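(* The function $\tau\mapsto\mathcal H_{\hat{\mathbb C},2}(e^{-2\pi\tau}S^1,S^1)$ is decreasing on $(0,\infty)$, tends to $+\infty$ as $\tau\to0$ and tends to $-\infty$ as $\tau\to\infty$. Consequently $$\inf_{(\gamma_1,\gamma_2)}\mathcal H_{\hat{\mathbb C},2}(\gamma_1,\gamma_2)=-\infty,$$ the infimum being over pairs of non-intersecting simple smooth loops in $\hat{\mathbb C}$, and the infimum is not attained.
   Context: $\hat{\mathbb C}$ is the Riemann sphere, $\mathbb D$ the open unit disk, $S^1=\partial\mathbb D$. Zeta-regularized determinants: For a compact surface $\Sigma$ with non-empty smooth boundary and metric $g$, $\det_\zeta\Delta_g=\exp(-\zeta'(0))$ where $\zeta(s)=\sum\lambda^{-s}$ (analytically continued) runs over the eigenvalues of the positive Laplace--Beltrami operator with Dirichlet boundary condition. For $\Sigma$ closed, $\det_\zeta\Delta_g:=\det'_\zeta\Delta_g/\mathrm{vol}_g(\Sigma)$, where $\det'_\zeta$ uses only the non-zero eigenvalues. One-loop Loewner potential: for a smooth simple loop $\gamma\subset\hat{\mathbb C}$ with complementary components $\Omega_1,\Omega_2$, $\mathcal H_{\hat{\mathbb C}}(\gamma)=\log\frac{\det_\zeta\Delta_{g}}{\det_\zeta\Delta_{g|_{\Omega_1}}\det_\zeta\Delta_{g|_{\Omega_2}}}$, $g$ any smooth conformal metric on $\hat{\mathbb C}$ (the value is independent of $g$). Normalized Brownian loop measure: The Brownian loop measure (Lawler--Werner) is the measure on unrooted loops induced by $\int_{\mathbb C}\int_0^\infty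 \frac1t\cdot\frac{1}{2\pi t}\,\mathbb P^{br}_{z,t}\,dt\,dA(z)$, with $\mathbb P^{br}_{z,t}$ the law of the planar Brownian bridge from $z$ to $z$ of duration $t$. $\Lambda_D(V_1,V_2)$ is the total mass of Brownian loops in $D$ intersecting both $V_1$ and $V_2$, and $\Lambda^*(V_1,V_2)=\lim_{R\to\infty}(\Lambda_{R\mathbb D}(V_1,V_2)-\log\log R)$ for disjoint non-polar closed sets (finite and Möbius invariant). Two-loop Loewner potential: $\mathcal H_{\hat{\mathbb C},2}(\gamma_1,\gamma_2)=\mathcal H_{\hat{\mathbb C}}(\gamma_1)+\mathcal H_{\hat{\mathbb C}}(\gamma_2)+\Lambda^*(\gamma_1,\gamma_2)$. *)

theory Defs
  imports
    "HOL-Complex_Analysis.Complex_Analysis"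
    "HOL-Probability.Probability"
    "HOL-Library.Function_Algebras"
begin

section \<open>The Riemann sphere\<close>

datatype rsphere = Pt complex | Infty

datatype chart = Affine | AtInfinity

text \<open>The two standard charts are \<open>z\<close> and \<open>w = 1/z\<close>. Below, \<open>param k\<close> is the inverse of the
  chart \<open>k\<close>, and \<open>coord k\<close> is the chart itself; the value of \<open>coord k\<close> outside
  \<open>range (param k)\<close> is a dummy.\<close>

fun param :: "chart \<Rightarrow> complex \<Rightarrow> rsphere" where
  "param Affine z = Pt z"
| "param AtInfinity w = (if w = 0 then Infty else Pt (1 / w))"

fun coord :: "chart \<Rightarrow> rsphere \<Rightarrow> complex" where
  "coord Affine (Pt z) = z"
| "coord Affine Infty = 0"
| "coord AtInfinity (Pt z) = 1 / z"
| "coord AtInfinity Infty = 0"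

instantiation rsphere :: topological_space
begin

definition open_rsphere :: "rsphere set \<Rightarrow> bool" where
  "open_rsphere U \<longleftrightarrow> (\<forall>k. open (param k -` U))"

instance
proof
  show "open (UNIV :: rsphere set)"
    by (simp add: open_rsphere_def)
next
  fix S T :: "rsphere set"
  assume "open S" "open T"
  then show "open (S \<inter> T)"
    by (simp add: open_rsphere_def vimage_Int open_Int)
next
  fix K :: "rsphere set set"
  assume "\<forall>S\<in>K. open S"
  then show "open (\<Union>K)"
    by (auto simp: open_rsphere_def vimage_Union)
qed

end


section \<open>Smooth functions, loops and conformal metrics\<close>

text \<open>Both predicates are meant for open \<open>S\<close>.\<close>

primrec C_k_on :: "nat \<Rightarrow> 'a::real_normed_vector set \<Rightarrow> ('a \<Rightarrow> 'b::real_normed_vector) \<Rightarrow> bool" where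
  "C_k_on 0 S f \<longleftrightarrow> continuous_on S f"
| "C_k_on (Suc k) S f \<longleftrightarrow> (\<forall>x\<in>S. f differentiable at x) \<and>
     (\<forall>v. C_k_on k S (\<lambda>x. frechet_derivative f (at x) v))"

definition smooth_on :: "'a::real_normed_vector set \<Rightarrow> ('a \<Rightarrow> 'b::real_normed_vector) \<Rightarrow> bool" where
  "smooth_on S f \<longleftrightarrow> (\<forall>k. C_k_on k S f)"

definition laplacian :: "(complex \<Rightarrow> real) \<Rightarrow> complex \<Rightarrow> real" where
  "laplacian f z =
     (\<Sum>b\<in>Basis. frechet_derivative (\<lambda>x. frechet_derivative f (at x) b) (at z) b)"

definition smooth_immersed_curve :: "(real \<Rightarrow> rsphere) \<Rightarrow> bool" where
  "smooth_immersed_curve c \<longleftrightarrow> continuous_on UNIV c \<and>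
     (\<forall>k. let S = c -` range (param k) in
        smooth_on S (coord k \<circ> c) \<and> (\<forall>t\<in>S. vector_derivative (coord k \<circ> c) (at t) \<noteq> 0))"

definition smooth_simple_loop :: "rsphere set \<Rightarrow> bool" where
  "smooth_simple_loop \<gamma> \<longleftrightarrow>
     (\<exists>c. smooth_immersed_curve c \<and> (\<forall>t. c (t + 1) = c t) \<and> inj_on c {0..<1} \<and> \<gamma> = range c)"

text \<open>A conformal metric is given by its densities in the two charts, the metric being
  \<open>\<rho> k z * |dz|\<^sup>2\<close> in chart \<open>k\<close>; the last condition is the transition rule under \<open>w = 1/z\<close>,
  where \<open>|dz|\<^sup>2 = |dw|\<^sup>2 / |w|\<^sup>4\<close>.\<close>

type_synonym density = "chart \<Rightarrow> complex \<Rightarrow> real"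

definition smooth_conformal_metric :: "density \<Rightarrow> bool" where
  "smooth_conformal_metric \<rho> \<longleftrightarrow>
     (\<forall>k. smooth_on UNIV (\<rho> k) \<and> (\<forall>z. \<rho> k z > 0)) \<and>
     (\<forall>w. w \<noteq> 0 \<longrightarrow> \<rho> AtInfinity w = \<rho> Affine (1 / w) / norm w ^ 4)"

text \<open>The point at infinity is a null set, so the affine chart computes the volume.\<close>

definition volume :: "density \<Rightarrow> real" where
  "volume \<rho> = (\<integral>z. \<rho> Affine z \<partial>lborel)"


section \<open>Zeta-regularized determinants\<close>

text \<open>Eigenfunctions of the positive Laplace--Beltrami operator on the open set \<open>\<Omega>\<close>. They are extended
  by zero off \<open>\<Omega>\<close>; continuity of this extension on the whole sphere expresses continuity up to
  the boundary together with the Dirichlet boundary condition. For \<open>\<Omega> = UNIV\<close> these are the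
  eigenfunctions on the closed sphere.\<close>

definition eigenspace :: "density \<Rightarrow> rsphere set \<Rightarrow> real \<Rightarrow> (rsphere \<Rightarrow> real) set" where
  "eigenspace \<rho> \<Omega> l = {u. continuous_on UNIV u \<and> (\<forall>p. p \<notin> \<Omega> \<longrightarrow> u p = 0) \<and>
     (\<forall>k. smooth_on (param k -` \<Omega>) (u \<circ> param k) \<and>
       (\<forall>z \<in> param k -` \<Omega>. - laplacian (u \<circ> param k) z / \<rho> k z = l * u (param k z)))}"

lemma vector_space_real_functions:
  "vector_space (\<lambda>(c::real) (u::'a \<Rightarrow> real) p. c * u p)"
  by unfold_locales (auto simp: fun_eq_iff algebra_simps)

definition multiplicity_of :: "density \<Rightarrow> rsphere set \<Rightarrow> real \<Rightarrow> nat" where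
  "multiplicity_of \<rho> \<Omega> l = vector_space.dim (\<lambda>(c::real) u p. c * u p) (eigenspace \<rho> \<Omega> l)"

text \<open>By Weyl's law in dimension two the Dirichlet series converges absolutely for \<open>Re s > 1\<close>.
  Only positive eigenvalues enter: all Dirichlet eigenvalues are positive, and on the closed sphere
  the eigenvalue zero is excluded. Multiplicity is zero off the spectrum.\<close>

definition spectral_zeta :: "density \<Rightarrow> rsphere set \<Rightarrow> (complex \<Rightarrow> complex) \<Rightarrow> bool" where
  "spectral_zeta \<rho> \<Omega> Z \<longleftrightarrow> Z meromorphic_on UNIV \<and> Z analytic_on {0} \<and>
     (\<forall>s. Re s > 1 \<longrightarrow>
       ((\<lambda>l. of_nat (multiplicity_of \<rho> \<Omega> l) * complex_of_real l powr (- s)) has_sum Z s) {0<..})"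

text \<open>\<open>Z\<close> is real on the real axis, so taking the real part only changes the type. The meromorphic
  continuation is unique up to its values at isolated points, and analyticity at 0 excludes
  a wrong value there.\<close>

definition zeta_det :: "density \<Rightarrow> rsphere set \<Rightarrow> real" where
  "zeta_det \<rho> \<Omega> = (THE d. \<exists>Z. spectral_zeta \<rho> \<Omega> Z \<and> d = exp (- Re (deriv Z 0)))"

definition zeta_det_sphere :: "density \<Rightarrow> real" where
  "zeta_det_sphere \<rho> = zeta_det \<rho> UNIV / volume \<rho>"


section \<open>The one-loop potential\<close>

text \<open>By the Jordan curve theorem the product has exactly two factors. The \<open>THE\<close> picks the common
  value for all smooth conformal metrics.\<close>

definition loop_potential_wrt :: "density \<Rightarrow> rsphere set \<Rightarrow> real" where
  "loop_potential_wrt \<rho> \<gamma> =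
     ln (zeta_det_sphere \<rho> / (\<Prod>\<Omega>\<in>components (- \<gamma>). zeta_det \<rho> \<Omega>))"

definition loop_potential :: "rsphere set \<Rightarrow> real" where
  "loop_potential \<gamma> = (THE v. \<forall>\<rho>. smooth_conformal_metric \<rho> \<longrightarrow> loop_potential_wrt \<rho> \<gamma> = v)"


section \<open>The Brownian loop measure\<close>

definition path_space :: "real \<Rightarrow> (real \<Rightarrow> complex) measure" where
  "path_space t = restrict_space (\<Pi>\<^sub>M s\<in>{0..t}. borel) {\<omega>. continuous_on {0..t} \<omega>}"

text \<open>The law of the planar Brownian bridge from \<open>z\<close> to \<open>z\<close> of duration \<open>t\<close>: the continuous Gaussian process
  with mean \<open>z\<close> whose real and imaginary parts are independent with covariance
  \<open>min s r - s * r / t\<close>. The Gaussian finite-dimensional distributions are given by their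
  characteristic functions, which also covers the degenerate times 0 and \<open>t\<close>.\<close>

definition is_brownian_bridge :: "complex \<Rightarrow> real \<Rightarrow> (real \<Rightarrow> complex) measure \<Rightarrow> bool" where
  "is_brownian_bridge z t M \<longleftrightarrow> prob_space M \<and> sets M = sets (path_space t) \<and>
     (\<forall>S a. finite S \<and> S \<subseteq> {0..t} \<longrightarrow>
       (CLINT \<omega>|M. iexp (\<Sum>s\<in>S. a s \<bullet> (\<omega> s - z))) =
       complex_of_real (exp (- (\<Sum>s\<in>S. \<Sum>r\<in>S. (a s \<bullet> a r) * (min s r - s * r / t)) / 2)))"

definition brownian_bridge :: "complex \<Rightarrow> real \<Rightarrow> (real \<Rightarrow> complex) measure" where
  "brownian_bridge z t = (THE M. is_brownian_bridge z t M)"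

text \<open>Total mass of the loops in \<open>D\<close> that intersect \<open>V\<^sub>1\<close> and \<open>V\<^sub>2\<close>. These conditions do not depend on
  the root, so the mass of the set of unrooted loops is that of its preimage among rooted loops.\<close>

definition loop_mass :: "complex set \<Rightarrow> rsphere set \<Rightarrow> rsphere set \<Rightarrow> ennreal" where
  "loop_mass D V\<^sub>1 V\<^sub>2 = (\<integral>\<^sup>+z. (\<integral>\<^sup>+t\<in>{0<..}.
     ennreal (1 / t * (1 / (2 * pi * t))) *
     emeasure (brownian_bridge z t)
       {\<omega> \<in> space (path_space t). \<omega> ` {0..t} \<subseteq> D \<and>
          Pt ` \<omega> ` {0..t} \<inter> V\<^sub>1 \<noteq> {} \<and> Pt ` \<omega> ` {0..t} \<inter> V\<^sub>2 \<noteq> {}} \<partial>lborel) \<partial>lborel)"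

text \<open>The limit is taken in the extended reals, so finiteness is not built in.\<close>

definition normalized_loop_mass :: "rsphere set \<Rightarrow> rsphere set \<Rightarrow> ereal" where
  "normalized_loop_mass V\<^sub>1 V\<^sub>2 =
     Lim at_top (\<lambda>R::real. enn2ereal (loop_mass (ball 0 R) V\<^sub>1 V\<^sub>2) - ereal (ln (ln R)))"


section \<open>The two-loop potential\<close>

definition two_loop_potential :: "rsphere set \<Rightarrow> rsphere set \<Rightarrow> ereal" where
  "two_loop_potential \<gamma>\<^sub>1 \<gamma>\<^sub>2 =
     ereal (loop_potential \<gamma>\<^sub>1) + ereal (loop_potential \<gamma>\<^sub>2) + normalized_loop_mass \<gamma>\<^sub>1 \<gamma>\<^sub>2"

definition disjoint_loop_pairs :: "(rsphere set \<times> rsphere set) set" where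
  "disjoint_loop_pairs =
     {(\<gamma>\<^sub>1, \<gamma>\<^sub>2). smooth_simple_loop \<gamma>\<^sub>1 \<and> smooth_simple_loop \<gamma>\<^sub>2 \<and> \<gamma>\<^sub>1 \<inter> \<gamma>\<^sub>2 = {}}"

definition circle :: "real \<Rightarrow> rsphere set" where
  "circle r = Pt ` sphere 0 r"

definition concentric_potential :: "real \<Rightarrow> ereal" where
  "concentric_potential \<tau> = two_loop_potential (circle (exp (- 2 * pi * \<tau>))) (circle 1)"

end

theory Submission
  imports Defs "HOL-Real_Asymp.Real_Asymp"
begin

text \<open>By scaling, all circles have the same one-loop potential, so only the normalized mass \<open>m(r)\<close> of the loops that
  hit the circles of radii \<open>r < 1\<close> and 1 matters.

  Realizing the Brownian bridge by Levy's series turns the loop measure into a product measure on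
  rooted loops, invariant under translations and scaling. Its key property is that the loops
  rooted far away that hit the unit disk and stay in the disk of radius \<open>R\<close> have mass \<open>ln (ln R) + const + o(1)\<close>:
  the Markov property on a fine time grid expresses the integral of \<open>t exp (- l t)\<close> (with \<open>t\<close> the duration)
  over the loops hitting the disk through killed Green functions, which gives \<open>1 / (2 l L)\<close> up to a factor
  \<open>1 + O(1 / L)\<close>, where \<open>L = ln (1 / sqrt l)\<close>; then integrate in \<open>l\<close>. Up to finite mass, the same loops hit
  any two disjoint closed sets, one of them bounded, that both disconnect the plane. By the Jordan curve theorem,
  the potential of two disjoint smooth loops is therefore finite.

  For concentric circles let \<open>k s R\<close> be the mass of the loops in the disk of radius \<open>R\<close> that hit the circles of radii 1
  and \<open>s > 1\<close>. Such a loop either hits the circle of radius \<open>x\<close>, where \<open>s < x < R\<close>, or stays inside it; with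
  scaling this gives \<open>m(r) = const - k s (1 / r)\<close> for \<open>s < 1 / r\<close>. Hence \<open>m\<close> is strictly increasing and tends to
  \<open>- \<infinity>\<close> at 0. It tends to \<open>\<infinity>\<close> at 1 because the small loops crossing a line have infinite mass.\<close>

section \<open>Joint characteristic functions\<close>

text \<open>The order of growth alone would not give a limit; hence the relative precision
  \<open>O(1 / L)\<close>. With \<open>l = 1 / r\<^sup>2\<close> the error becomes
  \<open>O(1 / (r (ln r)\<^sup>2))\<close>, integrable at infinity, against the main term
  \<open>1 / (r ln r)\<close>. The factor \<open>t\<close> turns the weight
  \<open>1 / (2 pi t\<^sup>2)\<close> of a loop into the heat kernel on the diagonal, so that loops
  become paths from \<open>z\<close> to \<open>z\<close>; the integration in \<open>l\<close> takes
  it away again. The time grid replaces hitting times: the Markov property is needed at one fixed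
  time only, and induction on the number of grid steps is a discrete maximum principle. From above,
  the hitting Green function is compared with the superharmonic potential of the disk, from below
  with a Riemann sum of that potential obeying the same recursion; the constants do not depend on
  the grid. Roots stay in \<open>|z| >= 2\<close> because small loops rooted in the disk have
  infinite mass. The difference between the cut-off \<open>exp (- l t)\<close> and the one at radius
  \<open>R\<close> is \<open>o(1)\<close>, by a fourth moment of the size of a unit bridge.\<close>

text \<open>Weights between 1 and 3 can be normalized to probability densities. The case
  \<open>a = 0\<close> shows that both have the same total mass \<open>c\<close>, so the reweighted
  laws of \<open>X\<close> and \<open>Y\<close> have equal characteristic functions and Levy's
  uniqueness theorem applies.\<close>

lemma weighted_char_unique_pos:
  fixes X :: "'a \<Rightarrow> real" and Y :: "'b \<Rightarrow> real" and w :: "'a \<Rightarrow> real" and v :: "'b \<Rightarrow> real"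
  assumes "prob_space M" "prob_space N"
    and [measurable]: "X \<in> borel_measurable M" "Y \<in> borel_measurable N"
      "w \<in> borel_measurable M" "v \<in> borel_measurable N" "A \<in> sets borel"
    and w: "\<And>x. 1 \<le> w x \<and> w x \<le> 3" and v: "\<And>x. 1 \<le> v x \<and> v x \<le> 3"
    and eq: "\<And>a. (CLINT x|M. w x * iexp (a * X x)) = (CLINT x|N. v x * iexp (a * Y x))"
  shows "(LINT x|M. w x * indicator A (X x)) = (LINT x|N. v x * indicator A (Y x))"
proof -
  interpret M: prob_space M by fact
  interpret N: prob_space N by fact
  have iw: "integrable M w"
    by (rule M.integrable_const_bound[where B=3]) (use w in \<open>auto intro!: AE_I2 simp: abs_le_iff intro: order_trans\<close>, smt (verit) w)
  have iv: "integrable N v"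
    by (rule N.integrable_const_bound[where B=3]) (use v in \<open>auto intro!: AE_I2 simp: abs_le_iff intro: order_trans\<close>, smt (verit) v)
  define c where "c = (LINT x|M. w x)"
  have "complex_of_real c = (CLINT x|N. v x)"
    using eq[of 0] by (simp add: c_def)
  hence c': "c = (LINT x|N. v x)" by (metis integral_complex_of_real of_real_eq_iff)
  have "(LINT x|M. 1) \<le> c" unfolding c_def by (rule integral_mono) (use iw w in auto)
  hence c1: "c \<ge> 1" by (simp add: M.prob_space)
  define M' where "M' = density M (\<lambda>x. ennreal (w x / c))"
  define N' where "N' = density N (\<lambda>x. ennreal (v x / c))"
  have w0: "0 \<le> w x" for x using w[of x] by linarith
  have v0: "0 \<le> v x" for x using v[of x] by linarith
  have pM: "prob_space M'"
  proof
    have "emeasure M' (space M') = (\<integral>\<^sup>+x. ennreal (w x / c) \<partial>M)"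
      by (auto simp: M'_def emeasure_density cong: nn_integral_cong)
    also have "\<dots> = ennreal (LINT x|M. w x / c)"
      by (rule nn_integral_eq_integral) (use iw w0 c1 in auto)
    also have "\<dots> = 1" using c1 by (simp add: c_def[symmetric])
    finally show "emeasure M' (space M') = 1" .
  qed
  have pN: "prob_space N'"
  proof
    have "emeasure N' (space N') = (\<integral>\<^sup>+x. ennreal (v x / c) \<partial>N)"
      by (auto simp: N'_def emeasure_density cong: nn_integral_cong)
    also have "\<dots> = ennreal (LINT x|N. v x / c)"
      by (rule nn_integral_eq_integral) (use iv v0 c1 in auto)
    also have "\<dots> = 1" using c1 by (simp add: c'[symmetric])
    finally show "emeasure N' (space N') = 1" .
  qed
  have [measurable]: "X \<in> borel_measurable M'" "Y \<in> borel_measurable N'"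
    by (simp_all add: M'_def N'_def)
  define D1 where "D1 = distr M' borel X"
  define D2 where "D2 = distr N' borel Y"
  have r1: "real_distribution D1" unfolding D1_def
    by (rule prob_space.real_distribution_distr[OF pM]) simp
  have r2: "real_distribution D2" unfolding D2_def
    by (rule prob_space.real_distribution_distr[OF pN]) simp
  have ch1: "char D1 a = (CLINT x|M. w x * iexp (a * X x)) / c" for a
  proof -
    have "char D1 a = (CLINT x|M'. iexp (a * X x))"
      unfolding char_def D1_def by (subst integral_distr) auto
    also have "\<dots> = (CLINT x|M. (w x / c) *\<^sub>R iexp (a * X x))"
      unfolding M'_def by (subst integral_density) (use w0 c1 in auto)
    also have "\<dots> = (CLINT x|M. (w x * iexp (a * X x)) / c)"
      by (rule Bochner_Integration.integral_cong) (auto simp: scaleR_conv_of_real)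
    finally show ?thesis by simp
  qed
  have ch2: "char D2 a = (CLINT x|N. v x * iexp (a * Y x)) / c" for a
  proof -
    have "char D2 a = (CLINT x|N'. iexp (a * Y x))"
      unfolding char_def D2_def by (subst integral_distr) auto
    also have "\<dots> = (CLINT x|N. (v x / c) *\<^sub>R iexp (a * Y x))"
      unfolding N'_def by (subst integral_density) (use v0 c1 in auto)
    also have "\<dots> = (CLINT x|N. (v x * iexp (a * Y x)) / c)"
      by (rule Bochner_Integration.integral_cong) (auto simp: scaleR_conv_of_real)
    finally show ?thesis by simp
  qed
  have "D1 = D2"
    by (rule Levy_uniqueness[OF r1 r2], rule ext) (simp only: ch1 ch2 eq)
  moreover have "measure D1 A = (LINT x|M. w x * indicator A (X x)) / c"
  proof -
    have "measure D1 A = (LINT x|D1. indicator A x)"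
      by (simp add: D1_def)
    also have "\<dots> = (LINT x|M'. indicator A (X x))"
      unfolding D1_def by (subst integral_distr) auto
    also have "\<dots> = (LINT x|M. (w x / c) *\<^sub>R indicator A (X x))"
      unfolding M'_def by (subst integral_density) (use w0 c1 in auto)
    finally show ?thesis by simp
  qed
  moreover have "measure D2 A = (LINT x|N. v x * indicator A (Y x)) / c"
  proof -
    have "measure D2 A = (LINT x|D2. indicator A x)"
      by (simp add: D2_def)
    also have "\<dots> = (LINT x|N'. indicator A (Y x))"
      unfolding D2_def by (subst integral_distr) auto
    also have "\<dots> = (LINT x|N. (v x / c) *\<^sub>R indicator A (Y x))"
      unfolding N'_def by (subst integral_density) (use v0 c1 in auto)
    finally show ?thesis by simp
  qed
  ultimately show ?thesis using c1 by simp
qed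

text \<open>A real weight in \<open>[-1, 1]\<close> becomes admissible for the positive version
  after adding 2; this is done for the real and the imaginary part of the complex weight. Taking
  these parts mixes \<open>W\<close> with \<open>cnj W\<close>, whose transform is the conjugate of
  that of \<open>W\<close> at \<open>- a\<close>.\<close>

lemma weighted_char_unique:
  fixes X :: "'a \<Rightarrow> real" and Y :: "'b \<Rightarrow> real" and W :: "'a \<Rightarrow> complex" and V :: "'b \<Rightarrow> complex"
  assumes pM: "prob_space M" and pN: "prob_space N"
    and [measurable]: "X \<in> borel_measurable M" "Y \<in> borel_measurable N"
      "W \<in> borel_measurable M" "V \<in> borel_measurable N" "A \<in> sets borel"
    and W: "\<And>x. norm (W x) \<le> 1" and V: "\<And>x. norm (V x) \<le> 1"
    and eq1: "\<And>a. (CLINT x|M. iexp (a * X x)) = (CLINT x|N. iexp (a * Y x))"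
    and eq: "\<And>a. (CLINT x|M. W x * iexp (a * X x)) = (CLINT x|N. V x * iexp (a * Y x))"
  shows "(CLINT x|M. W x * indicator A (X x)) = (CLINT x|N. V x * indicator A (Y x))"
proof -
  interpret M: prob_space M by fact
  interpret N: prob_space N by fact
  have bM: "integrable M f" if "f \<in> borel_measurable M" "\<And>x. norm (f x) \<le> 3" for f :: "'a \<Rightarrow> 'c::{banach,second_countable_topology}"
    by (rule M.integrable_const_bound[where B=3]) (use that in auto)
  have bN: "integrable N f" if "f \<in> borel_measurable N" "\<And>x. norm (f x) \<le> 3" for f :: "'b \<Rightarrow> 'c::{banach,second_countable_topology}"
    by (rule N.integrable_const_bound[where B=3]) (use that in auto)
  have WR: "\<bar>Re (W x)\<bar> \<le> 1" "\<bar>Im (W x)\<bar> \<le> 1" for x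
    using W[of x] abs_Re_le_cmod[of "W x"] abs_Im_le_cmod[of "W x"] by linarith+
  have VR: "\<bar>Re (V x)\<bar> \<le> 1" "\<bar>Im (V x)\<bar> \<le> 1" for x
    using V[of x] abs_Re_le_cmod[of "V x"] abs_Im_le_cmod[of "V x"] by linarith+
  have [measurable]: "cnj \<in> borel_measurable borel"
    by (intro borel_measurable_continuous_onI continuous_intros)
  have iM: "integrable M (\<lambda>x. W x * iexp (a * X x))" "integrable M (\<lambda>x. cnj (W x) * iexp (a * X x))"
     "integrable M (\<lambda>x. iexp (a * X x))" for a
    by (rule bM; use W in \<open>simp add: norm_mult order_trans[OF W]\<close>)+
  have iN: "integrable N (\<lambda>x. V x * iexp (a * Y x))" "integrable N (\<lambda>x. cnj (V x) * iexp (a * Y x))"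
     "integrable N (\<lambda>x. iexp (a * Y x))" for a
    by (rule bN; use V in \<open>simp add: norm_mult order_trans[OF V]\<close>)+
  have eqc: "(CLINT x|M. cnj (W x) * iexp (a * X x)) = (CLINT x|N. cnj (V x) * iexp (a * Y x))" for a
  proof -
    have "(CLINT x|M. cnj (W x) * iexp (a * X x)) = cnj (CLINT x|M. W x * iexp (- a * X x))"
      by (subst Bochner_Integration.integral_cnj[symmetric], rule Bochner_Integration.integral_cong) (auto simp: exp_cnj)
    also have "\<dots> = cnj (CLINT x|N. V x * iexp (- a * Y x))" by (simp only: eq)
    also have "\<dots> = (CLINT x|N. cnj (V x) * iexp (a * Y x))"
      by (subst Bochner_Integration.integral_cnj[symmetric], rule Bochner_Integration.integral_cong) (auto simp: exp_cnj)
    finally show ?thesis .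
  qed
  have *: "(LINT x|M. (2 + Re (W x)) * indicator A (X x)) = (LINT x|N. (2 + Re (V x)) * indicator A (Y x))"
  proof (rule weighted_char_unique_pos[OF pM pN])
    show "(CLINT x|M. complex_of_real (2 + Re (W x)) * iexp (a * X x)) = (CLINT x|N. complex_of_real (2 + Re (V x)) * iexp (a * Y x))" for a
    proof -
      have "(CLINT x|M. complex_of_real (2 + Re (W x)) * iexp (a * X x)) =
         (CLINT x|M. 2 * iexp (a * X x) + (1/2) * (W x * iexp (a * X x)) + (1/2) * (cnj (W x) * iexp (a * X x)))"
        by (rule Bochner_Integration.integral_cong)
           (auto simp: complex_eq_iff field_simps)
      also have "\<dots> = (CLINT x|N. 2 * iexp (a * Y x) + (1/2) * (V x * iexp (a * Y x)) + (1/2) * (cnj (V x) * iexp (a * Y x)))"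
        using iM[of a] iN[of a] eq[of a] eq1[of a] eqc[of a] by simp
      also have "\<dots> = (CLINT x|N. complex_of_real (2 + Re (V x)) * iexp (a * Y x))"
        by (rule Bochner_Integration.integral_cong)
           (auto simp: complex_eq_iff field_simps)
      finally show ?thesis .
    qed
  qed (use WR VR in \<open>auto simp: abs_le_iff intro: order_trans\<close>, (smt (verit) WR VR)+)
  have **: "(LINT x|M. (2 + Im (W x)) * indicator A (X x)) = (LINT x|N. (2 + Im (V x)) * indicator A (Y x))"
  proof (rule weighted_char_unique_pos[OF pM pN])
    show "(CLINT x|M. complex_of_real (2 + Im (W x)) * iexp (a * X x)) = (CLINT x|N. complex_of_real (2 + Im (V x)) * iexp (a * Y x))" for a
    proof -
      have "(CLINT x|M. complex_of_real (2 + Im (W x)) * iexp (a * X x)) =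
         (CLINT x|M. 2 * iexp (a * X x) + (-\<i>/2) * (W x * iexp (a * X x)) + (\<i>/2) * (cnj (W x) * iexp (a * X x)))"
        by (rule Bochner_Integration.integral_cong)
           (auto simp: complex_eq_iff field_simps)
      also have "\<dots> = (CLINT x|N. 2 * iexp (a * Y x) + (-\<i>/2) * (V x * iexp (a * Y x)) + (\<i>/2) * (cnj (V x) * iexp (a * Y x)))"
        using iM[of a] iN[of a] eq[of a] eq1[of a] eqc[of a] by simp
      also have "\<dots> = (CLINT x|N. complex_of_real (2 + Im (V x)) * iexp (a * Y x))"
        by (rule Bochner_Integration.integral_cong)
           (auto simp: complex_eq_iff field_simps)
      finally show ?thesis .
    qed
  qed (use WR VR in \<open>auto simp: abs_le_iff intro: order_trans\<close>, (smt (verit) WR VR)+)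
  have "(LINT x|M. (2 + 0 :: real) * indicator A (X x)) = (LINT x|N. (2 + 0) * indicator A (Y x))"
    by (rule weighted_char_unique_pos[OF pM pN])
       (use eq1 iM(3) iN(3) in auto)
  hence 1: "(LINT x|M. indicator A (X x)) = (LINT x|N. indicator A (Y x) :: real)" by simp
  have iA: "integrable M (\<lambda>x. indicator A (X x) :: real)" "integrable N (\<lambda>x. indicator A (Y x) :: real)"
    by (rule bM bN; auto simp: indicator_def)+
  have iWA: "integrable M (\<lambda>x. W x * indicator A (X x))"
    by (rule bM) (use W in \<open>auto simp: norm_mult indicator_def intro: order_trans[OF W]\<close>)
  have iVA: "integrable N (\<lambda>x. V x * indicator A (Y x))"
    by (rule bN) (use V in \<open>auto simp: norm_mult indicator_def intro: order_trans[OF V]\<close>)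
  have e: "Re (W x * indicator A (X x)) = (2 + Re (W x)) * indicator A (X x) - 2 * indicator A (X x)"
          "Im (W x * indicator A (X x)) = (2 + Im (W x)) * indicator A (X x) - 2 * indicator A (X x)" for x
    by (auto simp: indicator_def)
  have e': "Re (V x * indicator A (Y x)) = (2 + Re (V x)) * indicator A (Y x) - 2 * indicator A (Y x)"
          "Im (V x * indicator A (Y x)) = (2 + Im (V x)) * indicator A (Y x) - 2 * indicator A (Y x)" for x
    by (auto simp: indicator_def)
  have iR: "integrable M (\<lambda>x. (2 + Re (W x)) * indicator A (X x))" "integrable M (\<lambda>x. (2 + Im (W x)) * indicator A (X x))"
    by (rule bM; (use WR in \<open>auto simp: abs_mult indicator_def\<close>); smt (verit) WR)+
  have iR': "integrable N (\<lambda>x. (2 + Re (V x)) * indicator A (Y x))" "integrable N (\<lambda>x. (2 + Im (V x)) * indicator A (Y x))"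
    by (rule bN; (use VR in \<open>auto simp: abs_mult indicator_def\<close>); smt (verit) VR)+
  show ?thesis
    unfolding complex_eq_iff integral_Re[OF iWA, symmetric] integral_Im[OF iWA, symmetric]
       integral_Re[OF iVA, symmetric] integral_Im[OF iVA, symmetric] e e'
    using * ** 1 iA iR iR' by simp
qed

text \<open>Uniqueness in several dimensions from the one-dimensional theorem: exponentials are
  exchanged for indicators one coordinate at a time, while everything attached to the other
  coordinates serves as a complex weight of norm at most 1.\<close>

lemma joint_char_unique:
  fixes X :: "'i \<Rightarrow> 'a \<Rightarrow> real" and Y :: "'i \<Rightarrow> 'b \<Rightarrow> real"
  assumes pM: "prob_space M" and pN: "prob_space N" and fin: "finite I"
    and X[measurable]: "\<And>i. i \<in> I \<Longrightarrow> X i \<in> borel_measurable M"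
    and Y[measurable]: "\<And>i. i \<in> I \<Longrightarrow> Y i \<in> borel_measurable N"
    and eq: "\<And>a. (CLINT x|M. iexp (\<Sum>i\<in>I. a i * X i x)) = (CLINT x|N. iexp (\<Sum>i\<in>I. a i * Y i x))"
  shows "distr M (\<Pi>\<^sub>M i\<in>I. borel) (\<lambda>x. \<lambda>i\<in>I. X i x) = distr N (\<Pi>\<^sub>M i\<in>I. borel) (\<lambda>x. \<lambda>i\<in>I. Y i x)"
proof -
  interpret M: prob_space M by fact
  interpret N: prob_space N by fact
  \<comment> \<open>The hybrid statement of the induction: coordinates in \<open>J\<close> are
    already tested by sets, those in \<open>I - J\<close> still by exponentials. For
    \<open>J = {}\<close> it is the hypothesis, for \<open>J = I\<close> it is equality on
    boxes.\<close>
  have main: "(CLINT x|M. (\<Prod>j\<in>J. indicator (A j) (X j x)) * iexp (\<Sum>i\<in>I - J. a i * X i x)) =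
      (CLINT x|N. (\<Prod>j\<in>J. indicator (A j) (Y j x)) * iexp (\<Sum>i\<in>I - J. a i * Y i x))"
    if "J \<subseteq> I" "\<And>j. A j \<in> sets borel" for J A a
  proof -
    have "finite J" using that(1) fin finite_subset by blast
    from this that(1) show ?thesis
    proof (induction J arbitrary: a)
      case empty
      then show ?case using eq by simp
    next
      case (insert k J)
      have kI: "k \<in> I" using insert by auto
      note [measurable] = that(2)
      have mX[measurable]: "X j \<in> borel_measurable M" if "j \<in> I" for j using X that .
      have mY[measurable]: "Y j \<in> borel_measurable N" if "j \<in> I" for j using Y that .
      have *: "(CLINT x|M. ((\<Prod>j\<in>J. indicator (A j) (X j x)) * iexp (\<Sum>i\<in>I - insert k J. a i * X i x)) * indicator (A k) (X k x)) =
        (CLINT x|N. ((\<Prod>j\<in>J. indicator (A j) (Y j x)) * iexp (\<Sum>i\<in>I - insert k J. a i * Y i x)) * indicator (A k) (Y k x))"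
      proof (rule weighted_char_unique[OF pM pN])
        have s: "(\<Sum>i\<in>I. (if i = k then b else 0) * Z i) = b * Z k" for b and Z :: "'i \<Rightarrow> real"
          using kI fin by (subst sum.remove[of I k]) auto
        show "(CLINT x|M. iexp (b * X k x)) = (CLINT x|N. iexp (b * Y k x))" for b
          using eq[of "\<lambda>i. if i = k then b else 0"] by (simp only: s)
        show "(CLINT x|M. ((\<Prod>j\<in>J. indicator (A j) (X j x)) * iexp (\<Sum>i\<in>I - insert k J. a i * X i x)) * iexp (b * X k x)) =
          (CLINT x|N. ((\<Prod>j\<in>J. indicator (A j) (Y j x)) * iexp (\<Sum>i\<in>I - insert k J. a i * Y i x)) * iexp (b * Y k x))" for b
        proof -
          have eq2: "I - J = insert k (I - insert k J)" using kI insert by auto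
          have sm: "(\<Sum>i\<in>I - J. (a(k := b)) i * Z i) = b * Z k + (\<Sum>i\<in>I - insert k J. a i * Z i)" for Z :: "'i \<Rightarrow> real"
            unfolding eq2 using fin by (subst sum.insert) (auto intro!: sum.cong)
          have ex: "iexp (u + v) = iexp v * iexp u" for u v by (simp add: exp_add ring_distribs)
          have "J \<subseteq> I" using insert by auto
          from insert.IH[OF this, of "a(k := b)"] show ?thesis
            by (simp only: sm ex mult.assoc)
        qed
        have nI: "norm (indicator (A j) y :: complex) \<le> 1" for j y by (auto simp: indicator_def)
        show "norm ((\<Prod>j\<in>J. indicator (A j) (X j x)) * iexp (\<Sum>i\<in>I - insert k J. a i * X i x)) \<le> 1" for x
          by (simp add: norm_mult prod_norm[symmetric]) (rule prod_le_1, use nI in auto)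
        show "norm ((\<Prod>j\<in>J. indicator (A j) (Y j x)) * iexp (\<Sum>i\<in>I - insert k J. a i * Y i x)) \<le> 1" for x
          by (simp add: norm_mult prod_norm[symmetric]) (rule prod_le_1, use nI in auto)
        have "J \<subseteq> I" using insert by auto
        show "(\<lambda>x. (\<Prod>j\<in>J. indicator (A j) (X j x)) * iexp (\<Sum>i\<in>I - insert k J. a i * X i x)) \<in> borel_measurable M"
          using \<open>J \<subseteq> I\<close> by (intro borel_measurable_times borel_measurable_prod) (auto intro!: measurable_compose[OF mX borel_measurable_indicator] that)
        show "(\<lambda>x. (\<Prod>j\<in>J. indicator (A j) (Y j x)) * iexp (\<Sum>i\<in>I - insert k J. a i * Y i x)) \<in> borel_measurable N"
          using \<open>J \<subseteq> I\<close> by (intro borel_measurable_times borel_measurable_prod) (auto intro!: measurable_compose[OF mY borel_measurable_indicator] that)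
      qed (use kI X Y that in auto)
      have r: "(\<Prod>j\<in>insert k J. indicator (A j) (Z j)) * c = ((\<Prod>j\<in>J. indicator (A j) (Z j)) * c) * (indicator (A k) (Z k) :: complex)" for Z c
        using insert by simp
      show ?case unfolding r by (rule *)
    qed
  qed
  have meas: "(\<lambda>x. \<lambda>i\<in>I. X i x) \<in> measurable M (\<Pi>\<^sub>M i\<in>I. borel)" "(\<lambda>x. \<lambda>i\<in>I. Y i x) \<in> measurable N (\<Pi>\<^sub>M i\<in>I. borel)"
    by (auto intro!: measurable_restrict X Y)
  show ?thesis
  proof (rule measure_eqI_PiM_finite[OF fin])
    show "sets (distr M (\<Pi>\<^sub>M i\<in>I. borel) (\<lambda>x. \<lambda>i\<in>I. X i x)) = sets (\<Pi>\<^sub>M i\<in>I. borel)"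
         "sets (distr N (\<Pi>\<^sub>M i\<in>I. borel) (\<lambda>x. \<lambda>i\<in>I. Y i x)) = sets (\<Pi>\<^sub>M i\<in>I. borel)" by auto
    fix A :: "'i \<Rightarrow> real set" assume A: "\<And>i. i \<in> I \<Longrightarrow> A i \<in> sets borel"
    define A' where "A' i = (if i \<in> I then A i else {})" for i
    have A': "A' i \<in> sets borel" for i using A by (auto simp: A'_def)
    have PA: "Pi\<^sub>E I A = Pi\<^sub>E I A'" by (auto simp: A'_def PiE_iff)
    have sA: "Pi\<^sub>E I A' \<in> sets (\<Pi>\<^sub>M i\<in>I. borel)" using fin A' by (auto intro!: sets_PiM_I_finite)
    have 1: "emeasure (distr M (\<Pi>\<^sub>M i\<in>I. borel) (\<lambda>x. \<lambda>i\<in>I. X i x)) (Pi\<^sub>E I A') = ennreal (Re (CLINT x|M. (\<Prod>j\<in>I. indicator (A' j) (X j x))))"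
    proof -
      have pr: "(\<Prod>j\<in>I. indicator (A' j) (X j x) :: complex) = indicator {x\<in>space M. \<forall>i\<in>I. X i x \<in> A' i} x" if "x \<in> space M" for x
        using that fin by (auto simp: indicator_def prod_zero_iff)
      have S: "{x\<in>space M. \<forall>i\<in>I. X i x \<in> A' i} \<in> sets M"
        using fin X A' by measurable
      have "emeasure (distr M (\<Pi>\<^sub>M i\<in>I. borel) (\<lambda>x. \<lambda>i\<in>I. X i x)) (Pi\<^sub>E I A') = emeasure M {x\<in>space M. \<forall>i\<in>I. X i x \<in> A' i}"
        by (subst emeasure_distr[OF meas(1) sA]) (auto intro!: arg_cong2[where f=emeasure])
      also have "\<dots> = ennreal (LINT x|M. indicator {x\<in>space M. \<forall>i\<in>I. X i x \<in> A' i} x)"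
        using S by (simp add: M.emeasure_eq_measure)
      also have "(LINT x|M. indicator {x\<in>space M. \<forall>i\<in>I. X i x \<in> A' i} x) = Re (CLINT x|M. complex_of_real (indicator {x\<in>space M. \<forall>i\<in>I. X i x \<in> A' i} x))"
        unfolding integral_complex_of_real by simp
      also have "(CLINT x|M. complex_of_real (indicator {x\<in>space M. \<forall>i\<in>I. X i x \<in> A' i} x)) = (CLINT x|M. (\<Prod>j\<in>I. indicator (A' j) (X j x)))"
        by (rule Bochner_Integration.integral_cong[OF refl], simp only: pr, simp add: indicator_def)
      finally show ?thesis .
    qed
    have 2: "emeasure (distr N (\<Pi>\<^sub>M i\<in>I. borel) (\<lambda>x. \<lambda>i\<in>I. Y i x)) (Pi\<^sub>E I A') = ennreal (Re (CLINT x|N. (\<Prod>j\<in>I. indicator (A' j) (Y j x))))"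
    proof -
      have pr: "(\<Prod>j\<in>I. indicator (A' j) (Y j x) :: complex) = indicator {x\<in>space N. \<forall>i\<in>I. Y i x \<in> A' i} x" if "x \<in> space N" for x
        using that fin by (auto simp: indicator_def prod_zero_iff)
      have S: "{x\<in>space N. \<forall>i\<in>I. Y i x \<in> A' i} \<in> sets N"
        using fin Y A' by measurable
      have "emeasure (distr N (\<Pi>\<^sub>M i\<in>I. borel) (\<lambda>x. \<lambda>i\<in>I. Y i x)) (Pi\<^sub>E I A') = emeasure N {x\<in>space N. \<forall>i\<in>I. Y i x \<in> A' i}"
        by (subst emeasure_distr[OF meas(2) sA]) (auto intro!: arg_cong2[where f=emeasure])
      also have "\<dots> = ennreal (LINT x|N. indicator {x\<in>space N. \<forall>i\<in>I. Y i x \<in> A' i} x)"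
        using S by (simp add: N.emeasure_eq_measure)
      also have "(LINT x|N. indicator {x\<in>space N. \<forall>i\<in>I. Y i x \<in> A' i} x) = Re (CLINT x|N. complex_of_real (indicator {x\<in>space N. \<forall>i\<in>I. Y i x \<in> A' i} x))"
        unfolding integral_complex_of_real by simp
      also have "(CLINT x|N. complex_of_real (indicator {x\<in>space N. \<forall>i\<in>I. Y i x \<in> A' i} x)) = (CLINT x|N. (\<Prod>j\<in>I. indicator (A' j) (Y j x)))"
        by (rule Bochner_Integration.integral_cong[OF refl], simp only: pr, simp add: indicator_def)
      finally show ?thesis .
    qed
    show "emeasure (distr M (\<Pi>\<^sub>M i\<in>I. borel) (\<lambda>x. \<lambda>i\<in>I. X i x)) (Pi\<^sub>E I A) = emeasure (distr N (\<Pi>\<^sub>M i\<in>I. borel) (\<lambda>x. \<lambda>i\<in>I. Y i x)) (Pi\<^sub>E I A)"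
      unfolding PA 1 2 using main[of I A' "\<lambda>_. 0"] A' by simp
  next
    show "range (\<lambda>_::nat. Pi\<^sub>E I (\<lambda>_. UNIV)) \<subseteq> prod_algebra I (\<lambda>_. borel :: real measure)"
      using fin by (auto intro!: prod_algebraI_finite)
    show "(\<Union>i::nat. Pi\<^sub>E I (\<lambda>_. UNIV)) = space (\<Pi>\<^sub>M i\<in>I. borel :: real measure)"
      by (simp add: space_PiM)
    show "emeasure (distr M (\<Pi>\<^sub>M i\<in>I. borel) (\<lambda>x. \<lambda>i\<in>I. X i x)) (Pi\<^sub>E I (\<lambda>_. UNIV)) \<noteq> \<infinity>" for i :: nat
      using finite_measure.emeasure_finite[OF M.finite_measure_distr[OF meas(1)]] by simp
  qed
qed

text \<open>A complex coordinate is treated as two real ones indexed by \<open>bool\<close>, with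
  \<open>True\<close> for the real part; \<open>g\<close> reassembles them.\<close>

lemma joint_char_unique_complex:
  fixes X :: "'i \<Rightarrow> 'a \<Rightarrow> complex" and Y :: "'i \<Rightarrow> 'b \<Rightarrow> complex"
  assumes pM: "prob_space M" and pN: "prob_space N" and fin: "finite I"
    and X[measurable]: "\<And>i. i \<in> I \<Longrightarrow> X i \<in> borel_measurable M"
    and Y[measurable]: "\<And>i. i \<in> I \<Longrightarrow> Y i \<in> borel_measurable N"
    and eq: "\<And>a. (CLINT x|M. iexp (\<Sum>i\<in>I. a i \<bullet> X i x)) = (CLINT x|N. iexp (\<Sum>i\<in>I. a i \<bullet> Y i x))"
  shows "distr M (\<Pi>\<^sub>M i\<in>I. borel) (\<lambda>x. \<lambda>i\<in>I. X i x) = distr N (\<Pi>\<^sub>M i\<in>I. borel) (\<lambda>x. \<lambda>i\<in>I. Y i x)"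
proof -
  define p where "p = (\<lambda>(z::complex) b. if b then Re z else Im z)"
  have [measurable]: "(\<lambda>z. p z b) \<in> borel_measurable borel" for b by (cases b) (auto simp: p_def)
  let ?J = "I \<times> (UNIV::bool set)"
  define g where "g f = (\<lambda>i\<in>I. Complex (f (i, True)) (f (i, False)))" for f :: "'i \<times> bool \<Rightarrow> real"
  have g: "g \<in> measurable (\<Pi>\<^sub>M i\<in>?J. borel) (\<Pi>\<^sub>M i\<in>I. borel)"
    unfolding g_def Complex_eq by (intro measurable_restrict) measurable
  have s: "(\<Sum>i\<in>?J. a i * (case i of (i, b) \<Rightarrow> p (Z i) b)) = (\<Sum>i\<in>I. Complex (a (i, True)) (a (i, False)) \<bullet> Z i)" for a and Z :: "'i \<Rightarrow> complex"
    using fin by (simp add: sum.cartesian_product' UNIV_bool p_def inner_complex_def split_beta add.commute)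
  have *: "distr M (\<Pi>\<^sub>M i\<in>?J. borel) (\<lambda>x. \<lambda>i\<in>?J. (case i of (i, b) \<Rightarrow> p (X i x) b)) =
    distr N (\<Pi>\<^sub>M i\<in>?J. borel) (\<lambda>x. \<lambda>i\<in>?J. (case i of (i, b) \<Rightarrow> p (Y i x) b))"
    by (rule joint_char_unique[OF pM pN]) (use fin eq X Y in \<open>auto simp only: s, auto\<close>)
  have mX: "(\<lambda>x. \<lambda>i\<in>?J. (case i of (i, b) \<Rightarrow> p (X i x) b)) \<in> measurable M (\<Pi>\<^sub>M i\<in>?J. borel)"
    by (intro measurable_restrict) (auto split: prod.splits intro!: measurable_compose[OF X])
  have mY: "(\<lambda>x. \<lambda>i\<in>?J. (case i of (i, b) \<Rightarrow> p (Y i x) b)) \<in> measurable N (\<Pi>\<^sub>M i\<in>?J. borel)"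
    by (intro measurable_restrict) (auto split: prod.splits intro!: measurable_compose[OF Y])
  have r: "g (\<lambda>i\<in>?J. (case i of (i, b) \<Rightarrow> p (Z i) b)) = (\<lambda>i\<in>I. Z i)" for Z
    by (auto simp: g_def fun_eq_iff p_def)
  from arg_cong[OF *, of "\<lambda>M. distr M (\<Pi>\<^sub>M i\<in>I. borel) g"]
  show ?thesis
    unfolding distr_distr[OF g mX] distr_distr[OF g mY] o_def r .
qed

section \<open>The standard planar Brownian bridge\<close>

definition tent :: "real \<Rightarrow> real" where
  "tent x = max 0 (min x (1 - x))"

text \<open>Extended by 0 outside the unit square, so that one formula describes both halves of the
  bridge in \<open>bridge_cov_split\<close>.\<close>

definition bridge_cov :: "real \<Rightarrow> real \<Rightarrow> real" where
  "bridge_cov s r = (if 0 \<le> s \<and> s \<le> 1 \<and> 0 \<le> r \<and> r \<le> 1 then min s r - s * r else 0)"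

text \<open>The eighth root of 1/2 serves several exponents at once: \<open>qq ^ (4 * n)\<close> is
  the scale \<open>2 powr (- n / 2)\<close> of level \<open>n\<close> and also its weight in the
  energy, and \<open>qq ^ n\<close> is the decay of the resulting uniform bound of the
  level.\<close>

definition qq :: real where "qq = 2 powr (- 1 / 8)"

lemma qq: "0 < qq" "qq < 1" "qq ^ 8 = 1 / 2"
proof -
  show "0 < qq" by (simp add: qq_def)
  show "qq < 1" by (simp add: qq_def powr_less_one)
  have "qq ^ 8 = qq powr real 8" by (rule powr_realpow[symmetric]) (simp add: qq_def)
  also have "\<dots> = 2 powr (-1)" unfolding qq_def powr_powr by simp
  finally show "qq ^ 8 = 1 / 2" by (simp add: powr_minus_divide)
qed

definition schauder :: "nat \<Rightarrow> nat \<Rightarrow> real \<Rightarrow> real" where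
  "schauder n k s = qq ^ (4 * n) * tent (2 ^ n * s - real k)"

lemma qq8: "qq ^ (4 * n) * qq ^ (4 * n) = 1 / 2 ^ n"
proof -
  have "qq ^ (4 * n) * qq ^ (4 * n) = (qq ^ 8) ^ n" by (simp add: power_mult[symmetric] power_add[symmetric])
  thus ?thesis by (simp add: qq power_divide)
qed

lemma tent_nonneg: "0 \<le> tent x" by (simp add: tent_def)
lemma tent_le: "tent x \<le> 1" by (simp add: tent_def)

lemma tent_floor: "tent (x - real k) \<noteq> 0 \<Longrightarrow> int k = \<lfloor>x\<rfloor>"
  by (rule floor_unique[symmetric]) (auto simp: tent_def max_def min_def split: if_splits)

text \<open>At any point at most one integer translate of \<open>tent\<close> is non-zero, the one
  whose index is the floor of \<open>x\<close>.\<close>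

lemma sum_tent:
  "(\<Sum>k<m. f k * tent (x - real k)) = (if 0 \<le> \<lfloor>x\<rfloor> \<and> nat \<lfloor>x\<rfloor> < m then f (nat \<lfloor>x\<rfloor>) * tent (x - \<lfloor>x\<rfloor>) else (0::real))"
proof -
  have "(\<Sum>k<m. f k * tent (x - real k)) = (\<Sum>k<m. if k = nat \<lfloor>x\<rfloor> then (if 0 \<le> \<lfloor>x\<rfloor> then f k * tent (x - real k) else 0) else 0)"
  proof (rule sum.cong[OF refl])
    fix k
    show "f k * tent (x - real k) = (if k = nat \<lfloor>x\<rfloor> then (if 0 \<le> \<lfloor>x\<rfloor> then f k * tent (x - real k) else 0) else 0)"
    proof (cases "tent (x - real k) = 0")
      case False
      from tent_floor[OF this] show ?thesis by (metis nat_int of_nat_0_le_iff)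
    qed (simp only: mult_zero_right if_cancel)
  qed
  also have "\<dots> = (if 0 \<le> \<lfloor>x\<rfloor> \<and> nat \<lfloor>x\<rfloor> < m then f (nat \<lfloor>x\<rfloor>) * tent (x - real (nat \<lfloor>x\<rfloor>)) else 0)"
    by (simp add: sum.delta)
  finally show ?thesis by simp
qed

text \<open>Midpoint displacement: the value at 1/2 has variance 1/4 and enters with the
  interpolating function \<open>2 * tent\<close>, which yields \<open>tent x * tent y\<close>. Given
  this value, the two halves are independent bridges, shrunk by 2 in time and by 2 in
  variance.\<close>

lemma bridge_cov_split:
  "bridge_cov x y = tent x * tent y + (bridge_cov (2 * x) (2 * y) + bridge_cov (2 * x - 1) (2 * y - 1)) / 2"
proof -
  consider "x < 0 \<or> x > 1 \<or> y < 0 \<or> y > 1" | "0 \<le> x" "x \<le> 1/2" "0 \<le> y" "y \<le> 1/2"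
    | "1/2 \<le> x" "x \<le> 1" "1/2 \<le> y" "y \<le> 1" | "0 \<le> x" "x < 1/2" "1/2 < y" "y \<le> 1"
    | "0 \<le> y" "y < 1/2" "1/2 < x" "x \<le> 1" by linarith
  thus ?thesis
  proof cases
    case 1
    have "bridge_cov x y = 0" "bridge_cov (2 * x) (2 * y) = 0" "bridge_cov (2 * x - 1) (2 * y - 1) = 0"
      unfolding bridge_cov_def by (rule if_not_P, use 1 in linarith)+
    moreover have "tent x = 0 \<or> tent y = 0" using 1 by (auto simp: tent_def)
    ultimately show ?thesis by auto
  next
    case 2
    have t: "tent x = x" "tent y = y" using 2 by (auto simp: tent_def)
    have b: "bridge_cov (2 * x - 1) (2 * y - 1) = 0"
    proof (cases "x = 1/2 \<and> y = 1/2")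
      case False
      thus ?thesis unfolding bridge_cov_def by (intro if_not_P) (use 2 in linarith)
    qed (simp add: bridge_cov_def)
    have a: "bridge_cov x y = min x y - x * y" "bridge_cov (2 * x) (2 * y) = min (2 * x) (2 * y) - (2 * x) * (2 * y)"
      unfolding bridge_cov_def by (rule if_P, use 2 in linarith)+
    show ?thesis unfolding t a b by (simp add: min_def field_simps)
  next
    case 3
    have t: "tent x = 1 - x" "tent y = 1 - y" using 3 by (auto simp: tent_def)
    have b: "bridge_cov (2 * x) (2 * y) = 0"
    proof (cases "x = 1/2 \<and> y = 1/2")
      case False
      thus ?thesis unfolding bridge_cov_def by (intro if_not_P) (use 3 in linarith)
    qed (simp add: bridge_cov_def)
    have a: "bridge_cov x y = min x y - x * y" "bridge_cov (2 * x - 1) (2 * y - 1) = min (2 * x - 1) (2 * y - 1) - (2 * x - 1) * (2 * y - 1)"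
      unfolding bridge_cov_def by (rule if_P, use 3 in linarith)+
    show ?thesis unfolding t a b by (simp add: min_def field_simps)
  next
    case 4
    have t: "tent x = x" "tent y = 1 - y" using 4 by (auto simp: tent_def)
    have b: "bridge_cov (2 * x) (2 * y) = 0" "bridge_cov (2 * x - 1) (2 * y - 1) = 0"
      unfolding bridge_cov_def by (rule if_not_P, use 4 in linarith)+
    have a: "bridge_cov x y = min x y - x * y"
      unfolding bridge_cov_def by (rule if_P, use 4 in linarith)+
    show ?thesis unfolding t a b using 4 by (simp add: min_def algebra_simps)
  next
    case 5
    have t: "tent y = y" "tent x = 1 - x" using 5 by (auto simp: tent_def)
    have b: "bridge_cov (2 * x) (2 * y) = 0" "bridge_cov (2 * x - 1) (2 * y - 1) = 0"
      unfolding bridge_cov_def by (rule if_not_P, use 5 in linarith)+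
    have a: "bridge_cov x y = min x y - x * y"
      unfolding bridge_cov_def by (rule if_P, use 5 in linarith)+
    show ?thesis unfolding t a b using 5 by (simp add: min_def algebra_simps)
  qed
qed

lemma bridge_cov_bounds: "0 \<le> bridge_cov x y" "bridge_cov x y \<le> tent x"
proof -
  have "0 \<le> min x y - x * y" "min x y - x * y \<le> tent x" if "0 \<le> x" "x \<le> 1" "0 \<le> y" "y \<le> 1"
  proof -
    define p where "p = x * y"
    have "0 \<le> x * (1 - y)" "0 \<le> y * (1 - x)" "0 \<le> (1 - x) * (1 - y)" "0 \<le> p"
      unfolding p_def using that by (intro mult_nonneg_nonneg; simp)+
    hence "p \<le> x" "p \<le> y" "x + y \<le> 1 + p" "0 \<le> p" by (simp_all add: p_def algebra_simps)
    thus "0 \<le> min x y - x * y" "min x y - x * y \<le> tent x"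
      unfolding p_def[symmetric] using that by (auto simp: min_def max_def tent_def)
  qed
  thus "0 \<le> bridge_cov x y" "bridge_cov x y \<le> tent x"
    by (auto simp: bridge_cov_def tent_nonneg)
qed

lemma schauder_nonneg: "0 \<le> schauder n k s"
  using qq by (simp add: schauder_def tent_nonneg)

lemma sum_even_odd: "(\<Sum>k<2 * m. f k) = (\<Sum>k<m. f (2 * k) + f (Suc (2 * k)) :: real)"
  by (induction m) (auto simp: algebra_simps)

definition schauder_cov :: "nat \<Rightarrow> real \<Rightarrow> real \<Rightarrow> real" where
  "schauder_cov n s r = (\<Sum>k<2 ^ n. schauder n k s * schauder n k r)"

text \<open>The midpoint displacement is iterated \<open>N\<close> times; the remainder collects the
  bridges that are left on the \<open>2 ^ N\<close> dyadic intervals.\<close>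

lemma sum_schauder_cov:
  "bridge_cov s r = (\<Sum>n<N. schauder_cov n s r) + (\<Sum>k<2 ^ N. bridge_cov (2 ^ N * s - real k) (2 ^ N * r - real k)) / 2 ^ N"
proof (induction N)
  case 0 show ?case by simp
next
  case (Suc N)
  have "(\<Sum>k<2 ^ N. bridge_cov (2 ^ N * s - real k) (2 ^ N * r - real k)) / 2 ^ N =
    (\<Sum>k<2 ^ N. tent (2 ^ N * s - real k) * tent (2 ^ N * r - real k)) / 2 ^ N +
    (\<Sum>k<2 ^ N. (bridge_cov (2 * (2 ^ N * s - real k)) (2 * (2 ^ N * r - real k)) +
       bridge_cov (2 * (2 ^ N * s - real k) - 1) (2 * (2 ^ N * r - real k) - 1))) / 2 ^ Suc N"
    by (subst sum.cong[OF refl bridge_cov_split])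
       (simp add: sum.distrib sum_divide_distrib[symmetric] add_divide_distrib)
  also have "(\<Sum>k<2 ^ N. tent (2 ^ N * s - real k) * tent (2 ^ N * r - real k)) / 2 ^ N = schauder_cov N s r"
  proof -
    have "schauder_cov N s r = (\<Sum>k<2 ^ N. (qq ^ (4 * N) * qq ^ (4 * N)) * (tent (2 ^ N * s - real k) * tent (2 ^ N * r - real k)))"
      unfolding schauder_cov_def schauder_def by (intro sum.cong) (auto simp: ac_simps)
    thus ?thesis unfolding qq8 by (simp add: sum_distrib_left[symmetric] sum_divide_distrib)
  qed
  also have "(\<Sum>k<2 ^ N. (bridge_cov (2 * (2 ^ N * s - real k)) (2 * (2 ^ N * r - real k)) +
       bridge_cov (2 * (2 ^ N * s - real k) - 1) (2 * (2 ^ N * r - real k) - 1))) =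
      (\<Sum>k<2 ^ Suc N. bridge_cov (2 ^ Suc N * s - real k) (2 ^ Suc N * r - real k))"
    by (simp add: sum_even_odd algebra_simps)
  finally show ?case using Suc.IH by (simp add: algebra_simps)
qed

text \<open>The remainder is at most \<open>1 / 2 ^ N\<close>: \<open>bridge_cov\<close> is at most
  \<open>tent\<close>, and for given \<open>s\<close> only one dyadic interval contributes.\<close>

lemma schauder_cov_sums: "0 \<le> s \<Longrightarrow> s \<le> 1 \<Longrightarrow> 0 \<le> r \<Longrightarrow> r \<le> 1 \<Longrightarrow> (\<lambda>N. \<Sum>n<N. schauder_cov n s r) \<longlonglongrightarrow> min s r - s * r"
proof -
  assume a: "0 \<le> s" "s \<le> 1" "0 \<le> r" "r \<le> 1"
  have "(\<lambda>N. (\<Sum>k<2 ^ N. bridge_cov (2 ^ N * s - real k) (2 ^ N * r - real k)) / 2 ^ N) \<longlonglongrightarrow> 0"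
  proof (rule tendsto_sandwich)
    show "\<forall>\<^sub>F N in sequentially. 0 \<le> (\<Sum>k<2 ^ N. bridge_cov (2 ^ N * s - real k) (2 ^ N * r - real k)) / 2 ^ N"
      by (intro always_eventually allI divide_nonneg_nonneg sum_nonneg bridge_cov_bounds(1)) simp
    have "(\<Sum>k<2 ^ N. bridge_cov (2 ^ N * s - real k) (2 ^ N * r - real k)) \<le> 1" for N
    proof -
      have "(\<Sum>k<2 ^ N. bridge_cov (2 ^ N * s - real k) (2 ^ N * r - real k)) \<le> (\<Sum>k<2 ^ N. 1 * tent (2 ^ N * s - real k))"
        by (rule sum_mono) (simp add: bridge_cov_bounds)
      also have "\<dots> \<le> 1" unfolding sum_tent by (auto simp: tent_le)
      finally show ?thesis .
    qed
    thus "\<forall>\<^sub>F N in sequentially. (\<Sum>k<2 ^ N. bridge_cov (2 ^ N * s - real k) (2 ^ N * r - real k)) / 2 ^ N \<le> 1 / 2 ^ N"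
      by (intro always_eventually allI divide_right_mono) auto
    show "(\<lambda>N. 1 / 2 ^ N :: real) \<longlonglongrightarrow> 0"
      using LIMSEQ_power_zero[of "1/2::real"] by (simp add: power_divide)
  qed simp
  hence "(\<lambda>N. bridge_cov s r - (\<Sum>k<2 ^ N. bridge_cov (2 ^ N * s - real k) (2 ^ N * r - real k)) / 2 ^ N) \<longlonglongrightarrow> bridge_cov s r - 0"
    by (intro tendsto_intros)
  moreover have "bridge_cov s r - (\<Sum>k<2 ^ N. bridge_cov (2 ^ N * s - real k) (2 ^ N * r - real k)) / 2 ^ N = (\<Sum>n<N. schauder_cov n s r)" for N
    using sum_schauder_cov[of s r N] by (simp only: add_diff_cancel_right')
  ultimately show ?thesis using a by (simp add: bridge_cov_def)
qed

section \<open>The random series with Gaussian coefficients\<close>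

type_synonym gauss_index = "nat \<times> nat \<times> bool"

definition gauss :: "(gauss_index \<Rightarrow> real) measure" where
  "gauss = (\<Pi>\<^sub>M i\<in>UNIV. std_normal_distribution)"

lemma prob_space_std_normal: "prob_space std_normal_distribution"
  using real_dist_normal_dist by (simp add: real_distribution_def)

interpretation gauss: prob_space gauss
  unfolding gauss_def by (rule prob_space_PiM) (rule prob_space_std_normal)

lemma space_gauss [simp]: "space gauss = UNIV"
  by (simp add: gauss_def space_PiM)

lemma measurable_gauss_component [measurable]: "(\<lambda>\<omega>. \<omega> i) \<in> borel_measurable gauss"
proof -
  have "(\<lambda>\<omega>. \<omega> i) \<in> measurable gauss std_normal_distribution"
    unfolding gauss_def by (rule measurable_component_singleton) simp
  thus ?thesis by simp
qed

lemma distr_gauss_component: "distr gauss borel (\<lambda>\<omega>. \<omega> i) = std_normal_distribution"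
proof -
  have "distr gauss borel (\<lambda>\<omega>. \<omega> i) = distr gauss std_normal_distribution (\<lambda>\<omega>. \<omega> i)"
    by (rule distr_cong) auto
  also have "\<dots> = std_normal_distribution"
    unfolding gauss_def by (rule distr_PiM_component) (auto simp: prob_space_std_normal)
  finally show ?thesis .
qed

lemma indep_gauss: "finite J \<Longrightarrow> gauss.indep_vars (\<lambda>_. borel) (\<lambda>i \<omega>. \<omega> i) J"
proof (cases "J = {}")
  case True thus ?thesis by (simp add: gauss.indep_vars_def gauss.indep_sets_def)
next
  case False
  assume J: "finite J"
  interpret pp: product_prob_space "\<lambda>_::gauss_index. std_normal_distribution" UNIV
    by (intro product_prob_spaceI prob_space_std_normal)
  have s: "sets (\<Pi>\<^sub>M i\<in>J. borel) = sets (\<Pi>\<^sub>M i\<in>J. std_normal_distribution)"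
    by (rule sets_PiM_cong) auto
  have "distr gauss (\<Pi>\<^sub>M i\<in>J. borel) (\<lambda>x. \<lambda>i\<in>J. x i) = distr gauss (\<Pi>\<^sub>M i\<in>J. std_normal_distribution) (\<lambda>x. restrict x J)"
    by (rule distr_cong) (auto simp: s)
  also have "\<dots> = (\<Pi>\<^sub>M i\<in>J. std_normal_distribution)"
    unfolding gauss_def by (rule pp.distr_PiM_restrict_finite) (use J in auto)
  also have "\<dots> = (\<Pi>\<^sub>M i\<in>J. distr gauss borel (\<lambda>x. x i))" by (simp add: distr_gauss_component)
  finally show ?thesis
    by (subst gauss.indep_vars_iff_distr_eq_PiM[OF False]) auto
qed

lemma char_gauss_sum:
  assumes "finite J"
  shows "(CLINT \<omega>|gauss. iexp (\<Sum>i\<in>J. c i * \<omega> i)) = exp (- (\<Sum>i\<in>J. (c i)\<^sup>2) / 2)"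
proof -
  have ind: "gauss.indep_vars (\<lambda>_. borel) (\<lambda>i \<omega>. c i * \<omega> i) J"
    by (rule gauss.indep_vars_compose2[OF indep_gauss[OF assms]]) auto
  have "(CLINT \<omega>|gauss. iexp (\<Sum>i\<in>J. c i * \<omega> i)) = char (distr gauss borel (\<lambda>\<omega>. \<Sum>i\<in>J. c i * \<omega> i)) 1"
    unfolding char_def by (subst integral_distr) auto
  also have "\<dots> = (\<Prod>i\<in>J. char (distr gauss borel (\<lambda>\<omega>. c i * \<omega> i)) 1)"
    by (rule gauss.char_distr_sum[OF ind])
  also have "\<dots> = (\<Prod>i\<in>J. complex_of_real (exp (- (c i)\<^sup>2 / 2)))"
  proof (rule prod.cong[OF refl])
    fix i
    have "char (distr gauss borel (\<lambda>\<omega>. c i * \<omega> i)) 1 = (CLINT \<omega>|gauss. iexp (c i * \<omega> i))"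
      unfolding char_def by (subst integral_distr) auto
    also have "\<dots> = char (distr gauss borel (\<lambda>\<omega>. \<omega> i)) (c i)"
      unfolding char_def by (subst integral_distr) auto
    also have "\<dots> = exp (- (c i)\<^sup>2 / 2)" by (simp add: distr_gauss_component char_std_normal_distribution)
    finally show "char (distr gauss borel (\<lambda>\<omega>. c i * \<omega> i)) 1 = exp (- (c i)\<^sup>2 / 2)" .
  qed
  also have "\<dots> = complex_of_real (\<Prod>i\<in>J. exp (- (c i)\<^sup>2 / 2))" by simp
  also have "\<dots> = exp (- (\<Sum>i\<in>J. (c i)\<^sup>2) / 2)"
    unfolding exp_sum[OF assms, symmetric] by (simp add: sum_negf sum_divide_distrib)
  finally show ?thesis .
qed

definition gcoef :: "nat \<Rightarrow> nat \<Rightarrow> (gauss_index \<Rightarrow> real) \<Rightarrow> complex" where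
  "gcoef n k \<omega> = Complex (\<omega> (n, k, True)) (\<omega> (n, k, False))"

definition level_sum :: "nat \<Rightarrow> (gauss_index \<Rightarrow> real) \<Rightarrow> real" where
  "level_sum n \<omega> = (\<Sum>k<2 ^ n. norm (gcoef n k \<omega>) ^ 4) / 4 ^ n"

text \<open>Weighted so that level \<open>n\<close> has expectation of order
  \<open>qq ^ (4 * n)\<close>, while finiteness of the sum still forces geometric decay of the
  levels.\<close>

definition bridge_energy :: "(gauss_index \<Rightarrow> real) \<Rightarrow> ennreal" where
  "bridge_energy \<omega> = (\<Sum>n. ennreal (level_sum n \<omega> / qq ^ (4 * n)))"

definition bridge_level :: "nat \<Rightarrow> real \<Rightarrow> (gauss_index \<Rightarrow> real) \<Rightarrow> complex" where
  "bridge_level n s \<omega> = (\<Sum>k<2 ^ n. of_real (schauder n k s) * gcoef n k \<omega>)"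

text \<open>On the null set of infinite energy the path is set to 0, so that every path, not only
  almost every one, is continuous and bounded by \<open>bridge_bound\<close>.\<close>

definition bridge :: "real \<Rightarrow> (gauss_index \<Rightarrow> real) \<Rightarrow> complex" where
  "bridge s \<omega> = (if bridge_energy \<omega> < \<infinity> then (\<Sum>n. bridge_level n s \<omega>) else 0)"

definition bridge_bound :: "(gauss_index \<Rightarrow> real) \<Rightarrow> real" where
  "bridge_bound \<omega> = (if bridge_energy \<omega> < \<infinity> then root 4 (enn2real (bridge_energy \<omega>)) / (1 - qq) else 0)"

lemma measurable_gcoef [measurable]: "gcoef n k \<in> borel_measurable gauss"
  unfolding gcoef_def Complex_eq by measurable

lemma measurable_level_sum [measurable]: "level_sum n \<in> borel_measurable gauss"
  unfolding level_sum_def[abs_def] by measurable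

lemma measurable_bridge_energy [measurable]: "bridge_energy \<in> borel_measurable gauss"
  unfolding bridge_energy_def[abs_def] by measurable

lemma measurable_bridge_bound [measurable]: "bridge_bound \<in> borel_measurable gauss"
  unfolding bridge_bound_def[abs_def] by measurable

lemma measurable_tent [measurable]: "tent \<in> borel_measurable borel"
  unfolding tent_def[abs_def] by measurable

lemma continuous_tent: "continuous_on A tent"
  unfolding tent_def[abs_def] by (intro continuous_intros)

lemma measurable_bridge [measurable (raw)]:
  assumes [measurable]: "f \<in> borel_measurable M" "g \<in> measurable M gauss"
  shows "(\<lambda>x. bridge (f x) (g x)) \<in> borel_measurable M"
  unfolding bridge_def bridge_level_def schauder_def by measurable

lemma level_sum_nonneg: "0 \<le> level_sum n \<omega>"
  unfolding level_sum_def by (intro divide_nonneg_nonneg sum_nonneg) auto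

lemma nn_integral_gauss_moment4: "(\<integral>\<^sup>+\<omega>. ennreal (\<omega> i ^ 4) \<partial>gauss) = 3"
proof -
  have "(\<integral>\<^sup>+\<omega>. ennreal (\<omega> i ^ 4) \<partial>gauss) = (\<integral>\<^sup>+x. ennreal (x ^ 4) \<partial>distr gauss borel (\<lambda>\<omega>. \<omega> i))"
    by (subst nn_integral_distr) auto
  also have "\<dots> = (\<integral>\<^sup>+x. ennreal (x ^ (2 * 2)) \<partial>std_normal_distribution)" by (simp add: distr_gauss_component)
  also have "\<dots> = ennreal (LINT x|std_normal_distribution. x ^ (2 * 2))"
    by (rule nn_integral_eq_integral[OF integrable_std_normal_distribution_moment]) (auto simp: power_mult)
  also have "\<dots> = 3" unfolding std_normal_distribution_even_moments by (simp add: fact_numeral)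
  finally show ?thesis .
qed

text \<open>The 12 is \<open>2 * 3 + 2 * 3\<close>: convexity splits the fourth power of the
  modulus, and 3 is the fourth moment of a standard normal variable.\<close>

lemma gcoef_moment: "(\<integral>\<^sup>+\<omega>. ennreal (norm (gcoef n k \<omega>) ^ 4) \<partial>gauss) \<le> 12"
proof -
  have "norm (gcoef n k \<omega>) ^ 4 \<le> 2 * \<omega> (n, k, True) ^ 4 + 2 * \<omega> (n, k, False) ^ 4" for \<omega>
  proof -
    have "norm (gcoef n k \<omega>) ^ 4 = (norm (gcoef n k \<omega>) ^ 2) ^ 2" by simp
    also have "\<dots> = (\<omega> (n, k, True) ^ 2 + \<omega> (n, k, False) ^ 2) ^ 2" by (simp only: cmod_power2) (simp add: gcoef_def)
    also have "\<dots> \<le> 2 * (\<omega> (n, k, True) ^ 2) ^ 2 + 2 * (\<omega> (n, k, False) ^ 2) ^ 2"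
      using sum_squares_bound[of "\<omega> (n, k, True) ^ 2" "\<omega> (n, k, False) ^ 2"] by (simp add: power2_sum)
    finally show ?thesis by simp
  qed
  hence "(\<integral>\<^sup>+\<omega>. ennreal (norm (gcoef n k \<omega>) ^ 4) \<partial>gauss) \<le> (\<integral>\<^sup>+\<omega>. ennreal (2 * \<omega> (n, k, True) ^ 4 + 2 * \<omega> (n, k, False) ^ 4) \<partial>gauss)"
    by (intro nn_integral_mono ennreal_leI)
  also have "\<dots> = (\<integral>\<^sup>+\<omega>. 2 * ennreal (\<omega> (n, k, True) ^ 4) + 2 * ennreal (\<omega> (n, k, False) ^ 4) \<partial>gauss)"
    by (intro nn_integral_cong) (subst ennreal_plus, auto simp: ennreal_mult)
  also have "\<dots> = 12"
    by (subst nn_integral_add) (auto simp: nn_integral_cmult nn_integral_gauss_moment4)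
  finally show ?thesis .
qed

text \<open>A level sum has expectation at most \<open>12 / 2 ^ n\<close>, and division by
  \<open>qq ^ (4 * n)\<close>, which is \<open>2 powr (- n / 2)\<close>, leaves a geometric
  series.\<close>

lemma nn_integral_bridge_energy: "(\<integral>\<^sup>+\<omega>. bridge_energy \<omega> \<partial>gauss) < \<infinity>"
proof -
  have 1: "(\<integral>\<^sup>+\<omega>. ennreal (level_sum n \<omega> / qq ^ (4 * n)) \<partial>gauss) \<le> ennreal (12 * (qq ^ 4) ^ n)" for n
  proof -
    define c where "c = 1 / (4 ^ n * qq ^ (4 * n))"
    have c: "c \<ge> 0" using qq by (simp add: c_def)
    have cc: "c * 2 ^ n = (qq ^ 4) ^ n"
    proof -
      define a where "a = qq ^ (4 * n)"
      have "a * a * 2 ^ n = 1" by (simp add: qq8 a_def)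
      moreover have "a > 0" using qq by (simp add: a_def)
      moreover have "(4::real) ^ n = 2 ^ n * 2 ^ n" by (simp flip: power_mult_distrib)
      moreover have "(qq ^ 4) ^ n = a" by (simp add: a_def power_mult)
      ultimately show ?thesis unfolding c_def a_def[symmetric] by (simp add: field_simps)
    qed
    have "(\<integral>\<^sup>+\<omega>. ennreal (level_sum n \<omega> / qq ^ (4 * n)) \<partial>gauss) = (\<integral>\<^sup>+\<omega>. (\<Sum>k<2 ^ n. ennreal c * ennreal (norm (gcoef n k \<omega>) ^ 4)) \<partial>gauss)"
      by (intro nn_integral_cong) (simp add: level_sum_def c_def sum_divide_distrib ennreal_mult''[symmetric] sum_ennreal mult.commute qq less_imp_le)
    also have "\<dots> = (\<Sum>k<2 ^ n. ennreal c * (\<integral>\<^sup>+\<omega>. ennreal (norm (gcoef n k \<omega>) ^ 4) \<partial>gauss))"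
      by (simp add: nn_integral_sum nn_integral_cmult)
    also have "\<dots> \<le> (\<Sum>k<(2::nat) ^ n. ennreal c * 12)"
      by (intro sum_mono mult_left_mono gcoef_moment) auto
    also have "\<dots> = ennreal (12 * (c * 2 ^ n))"
      using c by (simp add: ennreal_mult ennreal_power[symmetric] ac_simps)
    finally show ?thesis by (simp add: cc)
  qed
  have q4: "0 < qq ^ 4" "qq ^ 4 < 1" using qq by (auto intro: power_less_one_iff[THEN iffD2])
  have "(\<integral>\<^sup>+\<omega>. bridge_energy \<omega> \<partial>gauss) = (\<Sum>n. \<integral>\<^sup>+\<omega>. ennreal (level_sum n \<omega> / qq ^ (4 * n)) \<partial>gauss)"
    unfolding bridge_energy_def by (rule nn_integral_suminf) measurable
  also have "\<dots> \<le> (\<Sum>n. ennreal (12 * (qq ^ 4) ^ n))"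
    by (rule suminf_le) (use 1 in auto)
  also have "\<dots> = ennreal (\<Sum>n. 12 * (qq ^ 4) ^ n)"
    by (rule suminf_ennreal2) (use q4 in \<open>auto intro!: summable_mult summable_geometric\<close>)
  finally show ?thesis by (auto simp: top_unique less_top[symmetric])
qed

lemma AE_bridge_energy: "AE \<omega> in gauss. bridge_energy \<omega> < \<infinity>"
  using nn_integral_PInf_AE[of bridge_energy gauss] nn_integral_bridge_energy by (auto simp: less_top)

text \<open>This moment makes the mass of short loops finite in \<open>small_loops\<close>. It is
  finite because \<open>bridge_bound\<close> is a multiple of the fourth root of the energy.\<close>

lemma nn_integral_bridge_bound: "(\<integral>\<^sup>+\<omega>. ennreal (bridge_bound \<omega> ^ 4) \<partial>gauss) < \<infinity>"
proof -
  have "ennreal (bridge_bound \<omega> ^ 4) \<le> bridge_energy \<omega> * ennreal (1 / (1 - qq) ^ 4)" for \<omega>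
  proof (cases "bridge_energy \<omega> < \<infinity>")
    case True
    hence "bridge_bound \<omega> ^ 4 = enn2real (bridge_energy \<omega>) * (1 / (1 - qq) ^ 4)"
      by (simp add: bridge_bound_def power_divide)
    moreover obtain E where "bridge_energy \<omega> = ennreal E" "E \<ge> 0" using True by (cases "bridge_energy \<omega>") auto
    ultimately show ?thesis by (simp add: ennreal_mult''[symmetric])
  qed (simp add: bridge_bound_def)
  hence "(\<integral>\<^sup>+\<omega>. ennreal (bridge_bound \<omega> ^ 4) \<partial>gauss) \<le> (\<integral>\<^sup>+\<omega>. bridge_energy \<omega> * ennreal (1 / (1 - qq) ^ 4) \<partial>gauss)"
    by (rule nn_integral_mono)
  also have "\<dots> = (\<integral>\<^sup>+\<omega>. bridge_energy \<omega> \<partial>gauss) * ennreal (1 / (1 - qq) ^ 4)"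
    by (rule nn_integral_multc) measurable
  also have "\<dots> < \<infinity>" using nn_integral_bridge_energy by (simp add: ennreal_mult_less_top)
  finally show ?thesis .
qed

text \<open>Only one tent of the level is active at \<open>s\<close>, so the value is at most the
  scale times one coefficient; summing over the whole level bounds that coefficient uniformly in
  \<open>s\<close>.\<close>

lemma norm_bridge_level_power: "norm (bridge_level n s \<omega>) ^ 4 \<le> level_sum n \<omega>"
proof -
  have "norm (bridge_level n s \<omega>) \<le> (\<Sum>k<2 ^ n. norm (of_real (schauder n k s) * gcoef n k \<omega>))"
    unfolding bridge_level_def by (rule norm_sum)
  also have "\<dots> = (\<Sum>k<2 ^ n. (qq ^ (4 * n) * norm (gcoef n k \<omega>)) * tent (2 ^ n * s - real k))"
    by (intro sum.cong refl) (simp only: norm_mult norm_of_real abs_of_nonneg[OF schauder_nonneg], simp add: schauder_def)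
  also have "\<dots> = (if 0 \<le> \<lfloor>2 ^ n * s\<rfloor> \<and> nat \<lfloor>2 ^ n * s\<rfloor> < 2 ^ n then
       qq ^ (4 * n) * norm (gcoef n (nat \<lfloor>2 ^ n * s\<rfloor>) \<omega>) * tent (2 ^ n * s - \<lfloor>2 ^ n * s\<rfloor>) else 0)"
    by (rule sum_tent)
  finally have *: "norm (bridge_level n s \<omega>) \<le> \<dots>" .
  show ?thesis
  proof (cases "0 \<le> \<lfloor>2 ^ n * s\<rfloor> \<and> nat \<lfloor>2 ^ n * s\<rfloor> < 2 ^ n")
    case True
    define k where "k = nat \<lfloor>2 ^ n * s\<rfloor>"
    have "norm (bridge_level n s \<omega>) \<le> qq ^ (4 * n) * norm (gcoef n k \<omega>) * tent (2 ^ n * s - \<lfloor>2 ^ n * s\<rfloor>)"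
      using * True by (simp add: k_def)
    also have "\<dots> \<le> qq ^ (4 * n) * norm (gcoef n k \<omega>) * 1"
      by (intro mult_left_mono tent_le) (use qq in auto)
    finally have "norm (bridge_level n s \<omega>) ^ 4 \<le> (qq ^ (4 * n) * norm (gcoef n k \<omega>)) ^ 4"
      by (intro power_mono) auto
    also have "\<dots> = norm (gcoef n k \<omega>) ^ 4 * (qq ^ (4 * n) * qq ^ (4 * n)) ^ 2"
      by (simp add: power_mult_distrib eval_nat_numeral)
    also have "\<dots> = norm (gcoef n k \<omega>) ^ 4 / 4 ^ n"
      unfolding qq8 by (simp add: power2_eq_square field_simps flip: power_mult_distrib)
    also have "\<dots> \<le> level_sum n \<omega>"
      unfolding level_sum_def by (intro divide_right_mono member_le_sum) (use True in \<open>auto simp: k_def\<close>)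
    finally show ?thesis .
  next
    case False
    with * have "norm (bridge_level n s \<omega>) = 0" by auto
    thus ?thesis using level_sum_nonneg by simp
  qed
qed

lemma norm_bridge_level:
  assumes "bridge_energy \<omega> < \<infinity>"
  shows "norm (bridge_level n s \<omega>) \<le> qq ^ n * root 4 (enn2real (bridge_energy \<omega>))"
proof -
  define E where "E = enn2real (bridge_energy \<omega>)"
  have E: "bridge_energy \<omega> = ennreal E" "E \<ge> 0" using assms by (auto simp: E_def)
  have "ennreal (level_sum n \<omega> / qq ^ (4 * n)) \<le> (\<Sum>n<Suc n. ennreal (level_sum n \<omega> / qq ^ (4 * n)))"
    by (rule member_le_sum) auto
  also have "\<dots> \<le> bridge_energy \<omega>"
    unfolding bridge_energy_def by (rule sum_le_suminf) auto
  finally have "level_sum n \<omega> / qq ^ (4 * n) \<le> E" using E by simp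
  hence "level_sum n \<omega> \<le> qq ^ (4 * n) * E" using qq by (simp add: field_simps)
  hence "norm (bridge_level n s \<omega>) ^ 4 \<le> (qq ^ n * root 4 E) ^ 4"
    using norm_bridge_level_power[of n s \<omega>] E by (simp add: power_mult_distrib power_mult[symmetric] mult.commute)
  hence "norm (bridge_level n s \<omega>) \<le> qq ^ n * root 4 E"
    by (subst (asm) power_mono_iff) (use E qq in auto)
  thus ?thesis by (simp add: E_def)
qed

lemma summable_bridge_level_bound: "summable (\<lambda>n. qq ^ n * root 4 (enn2real (bridge_energy \<omega>)))"
  using qq by (intro summable_mult2 summable_geometric) auto

lemma norm_bridge: "norm (bridge s \<omega>) \<le> bridge_bound \<omega>"
proof (cases "bridge_energy \<omega> < \<infinity>")
  case True
  have "norm (\<Sum>n. bridge_level n s \<omega>) \<le> (\<Sum>n. qq ^ n * root 4 (enn2real (bridge_energy \<omega>)))"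
    by (rule norm_suminf_le[OF norm_bridge_level[OF True] summable_bridge_level_bound])
  also have "\<dots> = bridge_bound \<omega>"
    using qq True by (subst suminf_mult2[symmetric]) (auto simp: suminf_geometric bridge_bound_def)
  finally show ?thesis using True by (simp add: bridge_def)
qed (simp add: bridge_def bridge_bound_def)

lemma continuous_bridge: "continuous_on A (\<lambda>s. bridge s \<omega>)"
proof (cases "bridge_energy \<omega> < \<infinity>")
  case True
  have "uniform_limit A (\<lambda>n s. \<Sum>i<n. bridge_level i s \<omega>) (\<lambda>s. \<Sum>i. bridge_level i s \<omega>) sequentially"
    by (rule Weierstrass_m_test[OF norm_bridge_level[OF True] summable_bridge_level_bound])
  hence "continuous_on A (\<lambda>s. \<Sum>i. bridge_level i s \<omega>)"
    by (rule uniform_limit_theorem[rotated])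
       (auto intro!: always_eventually continuous_intros continuous_on_compose2[OF continuous_tent] simp: bridge_level_def schauder_def)
  thus ?thesis using True by (simp add: bridge_def)
qed (simp add: bridge_def)

text \<open>Partial sums of the series are finite linear combinations of independent normal
  variables and have explicit Gaussian transforms; dominated convergence and
  \<open>schauder_cov_sums\<close> give the limit.\<close>

theorem char_bridge:
  assumes S: "finite S" "S \<subseteq> {0..1}"
  shows "(CLINT \<omega>|gauss. iexp (\<Sum>s\<in>S. a s \<bullet> bridge s \<omega>)) =
    exp (- (\<Sum>s\<in>S. \<Sum>r\<in>S. (a s \<bullet> a r) * (min s r - s * r)) / 2)"
proof -
  define I where "I N = (SIGMA n:{..<N}. {..<(2::nat) ^ n} \<times> (UNIV::bool set))" for N :: nat
  have sumI: "(\<Sum>i\<in>I N. g i) = (\<Sum>n<N. \<Sum>k<2 ^ n. g (n, k, True) + g (n, k, False))" for N and g :: "gauss_index \<Rightarrow> real"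
  proof -
    have "(\<Sum>p\<in>{..<2 ^ n} \<times> UNIV. g (n, p)) = (\<Sum>k<2 ^ n. g (n, k, True) + g (n, k, False))" for n
      unfolding sum.cartesian_product' by (simp add: UNIV_bool add.commute)
    moreover have "(\<Sum>n<N. \<Sum>p\<in>{..<2 ^ n} \<times> UNIV. g (n, p)) = (\<Sum>(n, p)\<in>I N. g (n, p))"
      unfolding I_def by (rule sum.Sigma) auto
    ultimately show ?thesis by simp
  qed
  have finI: "finite (I N)" for N by (auto simp: I_def)
  define c where "c = (\<lambda>(n, k, b). \<Sum>s\<in>S. (if b then Re (a s) else Im (a s)) * schauder n k s)"
  have partial: "(\<Sum>s\<in>S. a s \<bullet> (\<Sum>n<N. bridge_level n s \<omega>)) = (\<Sum>i\<in>I N. c i * \<omega> i)" for N \<omega>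
  proof -
    have "(\<Sum>i\<in>I N. c i * \<omega> i) = (\<Sum>n<N. \<Sum>k<2 ^ n. c (n, k, True) * \<omega> (n, k, True) + c (n, k, False) * \<omega> (n, k, False))"
      by (rule sumI)
    also have "\<dots> = (\<Sum>n<N. \<Sum>k<2 ^ n. \<Sum>s\<in>S. schauder n k s * (a s \<bullet> gcoef n k \<omega>))"
      by (intro sum.cong refl) (simp add: c_def sum_distrib_left sum_distrib_right sum.distrib[symmetric] inner_complex_def gcoef_def algebra_simps)
    also have "\<dots> = (\<Sum>s\<in>S. \<Sum>n<N. \<Sum>k<2 ^ n. schauder n k s * (a s \<bullet> gcoef n k \<omega>))"
    proof -
      have "(\<Sum>n<N. \<Sum>k<2 ^ n. \<Sum>s\<in>S. schauder n k s * (a s \<bullet> gcoef n k \<omega>)) = (\<Sum>n<N. \<Sum>s\<in>S. \<Sum>k<2 ^ n. schauder n k s * (a s \<bullet> gcoef n k \<omega>))"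
        by (rule sum.cong[OF refl sum.swap])
      also have "\<dots> = (\<Sum>s\<in>S. \<Sum>n<N. \<Sum>k<2 ^ n. schauder n k s * (a s \<bullet> gcoef n k \<omega>))"
        by (rule sum.swap)
      finally show ?thesis .
    qed
    also have "\<dots> = (\<Sum>s\<in>S. a s \<bullet> (\<Sum>n<N. bridge_level n s \<omega>))"
      by (simp add: bridge_level_def inner_sum_right scaleR_conv_of_real[symmetric])
    finally show ?thesis by simp
  qed
  have var: "(\<Sum>i\<in>I N. (c i)\<^sup>2) = (\<Sum>s\<in>S. \<Sum>r\<in>S. (a s \<bullet> a r) * (\<Sum>n<N. schauder_cov n s r))" for N
  proof -
    have "(\<Sum>i\<in>I N. (c i)\<^sup>2) = (\<Sum>n<N. \<Sum>k<2 ^ n. (c (n, k, True))\<^sup>2 + (c (n, k, False))\<^sup>2)"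
      by (rule sumI)
    also have "\<dots> = (\<Sum>n<N. \<Sum>k<2 ^ n. \<Sum>s\<in>S. \<Sum>r\<in>S. (a s \<bullet> a r) * (schauder n k s * schauder n k r))"
      by (intro sum.cong refl) (simp add: c_def power2_eq_square sum_product sum.distrib[symmetric] inner_complex_def algebra_simps)
    also have "\<dots> = (\<Sum>n<N. \<Sum>s\<in>S. \<Sum>r\<in>S. \<Sum>k<2 ^ n. (a s \<bullet> a r) * (schauder n k s * schauder n k r))"
    proof (rule sum.cong[OF refl])
      fix n
      have "(\<Sum>k<2 ^ n. \<Sum>s\<in>S. \<Sum>r\<in>S. (a s \<bullet> a r) * (schauder n k s * schauder n k r)) = (\<Sum>s\<in>S. \<Sum>k<2 ^ n. \<Sum>r\<in>S. (a s \<bullet> a r) * (schauder n k s * schauder n k r))"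
        by (rule sum.swap)
      also have "\<dots> = (\<Sum>s\<in>S. \<Sum>r\<in>S. \<Sum>k<2 ^ n. (a s \<bullet> a r) * (schauder n k s * schauder n k r))"
        by (rule sum.cong[OF refl sum.swap])
      finally show "(\<Sum>k<2 ^ n. \<Sum>s\<in>S. \<Sum>r\<in>S. (a s \<bullet> a r) * (schauder n k s * schauder n k r)) = \<dots>" .
    qed
    also have "\<dots> = (\<Sum>s\<in>S. \<Sum>r\<in>S. \<Sum>n<N. \<Sum>k<2 ^ n. (a s \<bullet> a r) * (schauder n k s * schauder n k r))"
    proof -
      have "(\<Sum>n<N. \<Sum>s\<in>S. \<Sum>r\<in>S. \<Sum>k<2 ^ n. (a s \<bullet> a r) * (schauder n k s * schauder n k r)) = (\<Sum>s\<in>S. \<Sum>n<N. \<Sum>r\<in>S. \<Sum>k<2 ^ n. (a s \<bullet> a r) * (schauder n k s * schauder n k r))"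
        by (rule sum.swap)
      also have "\<dots> = (\<Sum>s\<in>S. \<Sum>r\<in>S. \<Sum>n<N. \<Sum>k<2 ^ n. (a s \<bullet> a r) * (schauder n k s * schauder n k r))"
        by (rule sum.cong[OF refl sum.swap])
      finally show ?thesis .
    qed
    finally show ?thesis by (simp add: schauder_cov_def sum_distrib_left)
  qed
  have "(\<lambda>N. CLINT \<omega>|gauss. iexp (\<Sum>s\<in>S. a s \<bullet> (\<Sum>n<N. bridge_level n s \<omega>))) \<longlonglongrightarrow>
    (CLINT \<omega>|gauss. iexp (\<Sum>s\<in>S. a s \<bullet> bridge s \<omega>))"
  proof (rule integral_dominated_convergence[where w="\<lambda>_. 1"])
    show "AE \<omega> in gauss. (\<lambda>N. iexp (\<Sum>s\<in>S. a s \<bullet> (\<Sum>n<N. bridge_level n s \<omega>))) \<longlonglongrightarrow> iexp (\<Sum>s\<in>S. a s \<bullet> bridge s \<omega>)"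
      using AE_bridge_energy
    proof eventually_elim
      case (elim \<omega>)
      have "(\<lambda>N. \<Sum>n<N. bridge_level n s \<omega>) \<longlonglongrightarrow> bridge s \<omega>" for s
      proof -
        have "summable (\<lambda>n. bridge_level n s \<omega>)"
          by (rule summable_comparison_test'[OF summable_bridge_level_bound[of \<omega>], of 0]) (rule norm_bridge_level[OF elim])
        thus ?thesis using elim by (simp add: bridge_def summable_LIMSEQ)
      qed
      thus ?case by (intro tendsto_intros)
    qed
  qed (auto simp: bridge_level_def schauder_def)
  moreover have "(CLINT \<omega>|gauss. iexp (\<Sum>s\<in>S. a s \<bullet> (\<Sum>n<N. bridge_level n s \<omega>))) =
    exp (- (\<Sum>s\<in>S. \<Sum>r\<in>S. (a s \<bullet> a r) * (\<Sum>n<N. schauder_cov n s r)) / 2)" for N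
    unfolding partial char_gauss_sum[OF finI] var ..
  moreover have "(\<lambda>N. complex_of_real (exp (- (\<Sum>s\<in>S. \<Sum>r\<in>S. (a s \<bullet> a r) * (\<Sum>n<N. schauder_cov n s r)) / 2))) \<longlonglongrightarrow>
     exp (- (\<Sum>s\<in>S. \<Sum>r\<in>S. (a s \<bullet> a r) * (min s r - s * r)) / 2)"
    using S(2) by (intro tendsto_intros schauder_cov_sums) auto
  ultimately show ?thesis by (simp add: LIMSEQ_unique)
qed

text \<open>Every Schauder function of the series vanishes at both ends, so each sample closes up
  exactly and not only almost surely.\<close>

lemma bridge_0 [simp]: "bridge 0 \<omega> = 0" and bridge_1 [simp]: "bridge 1 \<omega> = 0"
proof -
  have "schauder n k 0 = 0" "k < 2 ^ n \<Longrightarrow> schauder n k 1 = 0" for n k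
  proof -
    show "schauder n k 0 = 0" by (simp add: schauder_def tent_def)
    assume "k < 2 ^ n"
    hence "real k + 1 \<le> 2 ^ n" by (metis Suc_eq_plus1 Suc_leI of_nat_1 of_nat_add of_nat_le_iff of_nat_numeral of_nat_power)
    thus "schauder n k 1 = 0" by (simp add: schauder_def tent_def)
  qed
  thus "bridge 0 \<omega> = 0" "bridge 1 \<omega> = 0" by (auto simp: bridge_def bridge_level_def)
qed

section \<open>The Brownian bridge of the loop measure\<close>

lemma measurable_path_space_eval [measurable (raw)]:
  "s \<in> {0..t} \<Longrightarrow> (\<lambda>\<omega>. \<omega> s) \<in> borel_measurable (path_space t)"
  unfolding path_space_def by (rule measurable_restrict_space1) measurable

lemma space_path_space: "\<omega> \<in> space (path_space t) \<Longrightarrow> continuous_on {0..t} \<omega>"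
  by (simp add: path_space_def space_restrict_space)

text \<open>Characteristic functions fix the finite-dimensional laws and thereby the image measure
  on the product space. This determines the measure, since the sigma-algebra of
  \<open>path_space\<close> is the trace of the product one; the set of continuous paths need not
  itself be measurable in the product.\<close>

lemma measure_path_space_eqI:
  assumes pM: "prob_space M" and pN: "prob_space N"
    and sM: "sets M = sets (path_space t)" and sN: "sets N = sets (path_space t)"
    and eq: "\<And>S a. finite S \<Longrightarrow> S \<subseteq> {0..t} \<Longrightarrow>
      (CLINT \<omega>|M. iexp (\<Sum>s\<in>S. a s \<bullet> \<omega> s)) = (CLINT \<omega>|N. iexp (\<Sum>s\<in>S. a s \<bullet> \<omega> s))"
  shows "M = N"
proof -
  let ?P = "\<Pi>\<^sub>M s\<in>{0..t}. borel :: complex measure"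
  define C where "C = {\<omega> :: real \<Rightarrow> complex. continuous_on {0..t} \<omega>}"
  interpret M: prob_space M by fact
  interpret N: prob_space N by fact
  have spM: "space M = C \<inter> space ?P" and spN: "space N = C \<inter> space ?P"
    using sets_eq_imp_space_eq[OF sM] sets_eq_imp_space_eq[OF sN]
    by (auto simp: path_space_def space_restrict_space C_def)
  have id: "(\<lambda>\<omega>. \<omega>) \<in> measurable (path_space t) ?P"
    unfolding path_space_def by (rule measurable_restrict_space1) simp
  have idM: "(\<lambda>\<omega>. \<omega>) \<in> measurable M ?P" and idN: "(\<lambda>\<omega>. \<omega>) \<in> measurable N ?P"
    using id measurable_cong_sets[OF sM refl] measurable_cong_sets[OF sN refl] by blast+
  have ev: "(\<lambda>\<omega>. \<omega> s) \<in> borel_measurable M" "(\<lambda>\<omega>. \<omega> s) \<in> borel_measurable N" if "s \<in> {0..t}" for s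
    using measurable_path_space_eval[OF that] measurable_cong_sets[OF sM refl] measurable_cong_sets[OF sN refl] by blast+
  have "distr M ?P (\<lambda>\<omega>. \<omega>) = distr N ?P (\<lambda>\<omega>. \<omega>)"
  proof (rule measure_eqI_PiM_infinite)
    fix A :: "real \<Rightarrow> complex set" and J assume J: "finite J" "J \<subseteq> {0..t}" and A: "\<And>i. i \<in> J \<Longrightarrow> A i \<in> sets borel"
    have "distr M (\<Pi>\<^sub>M i\<in>J. borel) (\<lambda>x. \<lambda>i\<in>J. x i) = distr N (\<Pi>\<^sub>M i\<in>J. borel) (\<lambda>x. \<lambda>i\<in>J. x i)"
      by (rule joint_char_unique_complex[OF pM pN J(1)]) (use J ev eq in auto)
    hence *: "emeasure (distr M (\<Pi>\<^sub>M i\<in>J. borel) (\<lambda>x. \<lambda>i\<in>J. x i)) (Pi\<^sub>E J A) =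
       emeasure (distr N (\<Pi>\<^sub>M i\<in>J. borel) (\<lambda>x. \<lambda>i\<in>J. x i)) (Pi\<^sub>E J A)" by simp
    have S: "Pi\<^sub>E J A \<in> sets (\<Pi>\<^sub>M i\<in>J. borel)" using J A by (intro sets_PiM_I_finite) auto
    have m: "(\<lambda>x. \<lambda>i\<in>J. x i) \<in> measurable M (\<Pi>\<^sub>M i\<in>J. borel)" "(\<lambda>x. \<lambda>i\<in>J. x i) \<in> measurable N (\<Pi>\<^sub>M i\<in>J. borel)"
      using J ev by (auto intro!: measurable_restrict)
    have emb: "prod_emb {0..t} (\<lambda>_. borel) J (Pi\<^sub>E J A) \<in> sets ?P"
      using J A by (intro sets_PiM_I) auto
    have "emeasure (distr M ?P (\<lambda>\<omega>. \<omega>)) (prod_emb {0..t} (\<lambda>_. borel) J (Pi\<^sub>E J A)) =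
       emeasure (distr M (\<Pi>\<^sub>M i\<in>J. borel) (\<lambda>x. \<lambda>i\<in>J. x i)) (Pi\<^sub>E J A)"
      unfolding emeasure_distr[OF idM emb] emeasure_distr[OF m(1) S]
      by (rule arg_cong2[where f=emeasure]) (auto simp: prod_emb_def spM space_PiM restrict_def)
    moreover have "emeasure (distr N ?P (\<lambda>\<omega>. \<omega>)) (prod_emb {0..t} (\<lambda>_. borel) J (Pi\<^sub>E J A)) =
       emeasure (distr N (\<Pi>\<^sub>M i\<in>J. borel) (\<lambda>x. \<lambda>i\<in>J. x i)) (Pi\<^sub>E J A)"
      unfolding emeasure_distr[OF idN emb] emeasure_distr[OF m(2) S]
      by (rule arg_cong2[where f=emeasure]) (auto simp: prod_emb_def spN space_PiM restrict_def)
    ultimately show "emeasure (distr M ?P (\<lambda>\<omega>. \<omega>)) (prod_emb {0..t} (\<lambda>_. borel) J (Pi\<^sub>E J A)) =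
      emeasure (distr N ?P (\<lambda>\<omega>. \<omega>)) (prod_emb {0..t} (\<lambda>_. borel) J (Pi\<^sub>E J A))" using * by simp
  qed (auto intro!: M.finite_measure_distr idM)
  note D = this
  show "M = N"
  proof (rule measure_eqI)
    fix A assume "A \<in> sets M"
    hence "A \<in> sets (restrict_space ?P C)" by (simp add: sM path_space_def C_def)
    then obtain B where B: "B \<in> sets ?P" "A = C \<inter> B" by (auto simp: sets_restrict_space)
    have "emeasure M A = emeasure (distr M ?P (\<lambda>\<omega>. \<omega>)) B"
      unfolding emeasure_distr[OF idM B(1)] using sets.sets_into_space[OF B(1)]
      by (intro arg_cong2[where f=emeasure]) (auto simp: B spM)
    moreover have "emeasure N A = emeasure (distr N ?P (\<lambda>\<omega>. \<omega>)) B"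
      unfolding emeasure_distr[OF idN B(1)] using sets.sets_into_space[OF B(1)]
      by (intro arg_cong2[where f=emeasure]) (auto simp: B spN)
    ultimately show "emeasure M A = emeasure N A" by (simp add: D)
  qed (simp add: sM sN)
qed

text \<open>Brownian scaling of the unit bridge; the restriction to \<open>{0..t}\<close> makes the
  path a point of the product space underlying \<open>path_space t\<close>.\<close>

definition scaled_bridge :: "complex \<Rightarrow> real \<Rightarrow> (gauss_index \<Rightarrow> real) \<Rightarrow> real \<Rightarrow> complex" where
  "scaled_bridge z t \<omega> = (\<lambda>s\<in>{0..t}. z + of_real (sqrt t) * bridge (s / t) \<omega>)"

lemma measurable_scaled_bridge: "0 < t \<Longrightarrow> scaled_bridge z t \<in> measurable gauss (path_space t)"
proof -
  assume t: "0 < t"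
  have "continuous_on {0..t} (scaled_bridge z t \<omega>)" for \<omega>
  proof -
    have "continuous_on {0..t} (\<lambda>s. z + of_real (sqrt t) * bridge (s / t) \<omega>)"
      by (intro continuous_intros continuous_on_compose2[OF continuous_bridge[of UNIV]]) (use t in auto)
    thus ?thesis by (rule continuous_on_eq) (simp add: scaled_bridge_def)
  qed
  moreover have "scaled_bridge z t \<in> measurable gauss (\<Pi>\<^sub>M s\<in>{0..t}. borel)"
    unfolding scaled_bridge_def[abs_def] by (intro measurable_restrict) measurable
  ultimately show ?thesis
    unfolding path_space_def by (intro measurable_restrict_space2) auto
qed

text \<open>The series has the transform required by \<open>is_brownian_bridge\<close>, and every
  other solution agrees with it by \<open>measure_path_space_eqI\<close>; this evaluates the
  \<open>THE\<close>.\<close>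

theorem brownian_bridge_eq:
  assumes t: "0 < t"
  shows "brownian_bridge z t = distr gauss (path_space t) (scaled_bridge z t)"
  unfolding brownian_bridge_def
proof (rule the_equality)
  let ?M = "distr gauss (path_space t) (scaled_bridge z t)"
  note m = measurable_scaled_bridge[OF t]
  show "is_brownian_bridge z t ?M"
    unfolding is_brownian_bridge_def
  proof (intro conjI allI impI)
    show "prob_space ?M" by (rule gauss.prob_space_distr[OF m])
    show "sets ?M = sets (path_space t)" by simp
    fix S and a :: "real \<Rightarrow> complex" assume S: "finite S \<and> S \<subseteq> {0..t}"
    let ?S = "(\<lambda>s. s / t) ` S" and ?a = "\<lambda>r. sqrt t *\<^sub>R a (r * t)"
    have inj: "inj_on (\<lambda>s. s / t) S" using t by (auto simp: inj_on_def)
    have "(CLINT \<omega>|?M. iexp (\<Sum>s\<in>S. a s \<bullet> (\<omega> s - z))) = (CLINT \<omega>|gauss. iexp (\<Sum>s\<in>S. a s \<bullet> (scaled_bridge z t \<omega> s - z)))"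
    proof (rule integral_distr[OF m])
      have "(\<lambda>\<omega>. \<Sum>s\<in>S. a s \<bullet> (\<omega> s - z)) \<in> borel_measurable (path_space t)"
        using S by (intro borel_measurable_sum borel_measurable_inner borel_measurable_diff measurable_path_space_eval) auto
      thus "(\<lambda>\<omega>. iexp (\<Sum>s\<in>S. a s \<bullet> (\<omega> s - z))) \<in> borel_measurable (path_space t)" by measurable
    qed
    also have "\<dots> = (CLINT \<omega>|gauss. iexp (\<Sum>r\<in>?S. ?a r \<bullet> bridge r \<omega>))"
      using S t by (intro Bochner_Integration.integral_cong refl arg_cong[where f="\<lambda>x. iexp x"])
        (subst sum.reindex[OF inj], auto simp: scaled_bridge_def scaleR_conv_of_real[symmetric] intro!: sum.cong)
    also have "\<dots> = exp (- (\<Sum>s\<in>?S. \<Sum>r\<in>?S. (?a s \<bullet> ?a r) * (min s r - s * r)) / 2)"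
      using S t by (intro char_bridge) auto
    also have "(\<Sum>s\<in>?S. \<Sum>r\<in>?S. (?a s \<bullet> ?a r) * (min s r - s * r)) =
       (\<Sum>s\<in>S. \<Sum>r\<in>S. (a s \<bullet> a r) * (min s r - s * r / t))"
    proof -
      have "(?a (s / t) \<bullet> ?a (r / t)) * (min (s / t) (r / t) - s / t * (r / t)) = (a s \<bullet> a r) * (min s r - s * r / t)" for s r
      proof -
        have "min (s / t) (r / t) = min s r / t" using t by (simp add: min_def divide_right_mono divide_le_cancel)
        hence "min (s / t) (r / t) - s / t * (r / t) = (min s r - s * r / t) / t" by (simp add: diff_divide_distrib)
        moreover have "?a (s / t) \<bullet> ?a (r / t) = t * (a s \<bullet> a r)" using t by (simp flip: mult.assoc)
        ultimately show ?thesis using t by (simp add: mult.assoc[symmetric])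
      qed
      thus ?thesis by (simp only: sum.reindex[OF inj] o_def)
    qed
    finally show "(CLINT \<omega>|?M. iexp (\<Sum>s\<in>S. a s \<bullet> (\<omega> s - z))) =
       exp (- (\<Sum>s\<in>S. \<Sum>r\<in>S. (a s \<bullet> a r) * (min s r - s * r / t)) / 2)" .
  qed
  note ex = this
  fix M assume M: "is_brownian_bridge z t M"
  show "M = ?M"
  proof (rule measure_path_space_eqI)
    fix S and a :: "real \<Rightarrow> complex" assume S: "finite S" "S \<subseteq> {0..t}"
    \<comment> \<open>Recentring at \<open>z\<close> multiplies the transform by a constant phase,
      so the defining formula also fixes the transform of the path itself.\<close>
    have *: "(CLINT \<omega>|Q. iexp (\<Sum>s\<in>S. a s \<bullet> \<omega> s)) = iexp (\<Sum>s\<in>S. a s \<bullet> z) * (CLINT \<omega>|Q. iexp (\<Sum>s\<in>S. a s \<bullet> (\<omega> s - z)))" for Q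
    proof -
      have "(CLINT \<omega>|Q. iexp (\<Sum>s\<in>S. a s \<bullet> \<omega> s)) = (CLINT \<omega>|Q. iexp (\<Sum>s\<in>S. a s \<bullet> z) * iexp (\<Sum>s\<in>S. a s \<bullet> (\<omega> s - z)))"
        by (rule Bochner_Integration.integral_cong)
           (auto simp: exp_add[symmetric] sum.distrib[symmetric] inner_diff_right sum_subtractf ring_distribs)
      thus ?thesis by simp
    qed
    have A: "(CLINT \<omega>|Q. iexp (\<Sum>s\<in>S. a s \<bullet> (\<omega> s - z))) = exp (- (\<Sum>s\<in>S. \<Sum>r\<in>S. (a s \<bullet> a r) * (min s r - s * r / t)) / 2)"
      if "is_brownian_bridge z t Q" for Q
      using that S unfolding is_brownian_bridge_def by blast
    show "(CLINT \<omega>|M. iexp (\<Sum>s\<in>S. a s \<bullet> \<omega> s)) = (CLINT \<omega>|?M. iexp (\<Sum>s\<in>S. a s \<bullet> \<omega> s))"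
      by (simp only: *[of M] *[of ?M] A[OF M] A[OF ex])
  qed (use M ex in \<open>auto simp: is_brownian_bridge_def\<close>)
qed

text \<open>The grid time just below \<open>s\<close> is within one mesh of it, and continuity does
  the rest. The mesh is arbitrary below a threshold, since both \<open>1 / (n + 1)\<close> and
  \<open>1 / 2 ^ j\<close> occur as meshes.\<close>

lemma grid_near:
  fixes g :: "real \<Rightarrow> 'a::metric_space"
  assumes g: "continuous_on {0..t} g" and U: "open U" and s: "s \<in> {0..t}" "g s \<in> U"
  shows "\<exists>\<delta>>0. \<forall>\<epsilon>. 0 < \<epsilon> \<and> \<epsilon> < \<delta> \<longrightarrow> (\<exists>k::nat. real k * \<epsilon> \<le> t \<and> g (real k * \<epsilon>) \<in> U)"
proof -
  obtain e where e: "e > 0" "ball (g s) e \<subseteq> U" using U s by (meson openE)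
  obtain d where d: "d > 0" "\<And>r. r \<in> {0..t} \<Longrightarrow> dist r s < d \<Longrightarrow> dist (g r) (g s) < e"
    using g s e unfolding continuous_on_iff by metis
  have "\<exists>k::nat. real k * \<epsilon> \<le> t \<and> g (real k * \<epsilon>) \<in> U" if \<epsilon>: "0 < \<epsilon>" "\<epsilon> < d" for \<epsilon>
  proof -
    define k where "k = nat \<lfloor>s / \<epsilon>\<rfloor>"
    have "0 \<le> s / \<epsilon>" using s \<epsilon> by auto
    hence "real k \<le> s / \<epsilon>" "s / \<epsilon> < real k + 1" by (auto simp: k_def)
    hence k: "real k * \<epsilon> \<le> s" "s < real k * \<epsilon> + \<epsilon>" using \<epsilon> by (auto simp: field_simps)
    have "dist (g (real k * \<epsilon>)) (g s) < e"
      by (rule d(2)) (use k s \<epsilon> in \<open>auto simp: dist_real_def\<close>)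
    thus ?thesis using e k s by (intro exI[of _ k]) (auto simp: dist_commute)
  qed
  thus ?thesis using d(1) by blast
qed

text \<open>Reduces a condition on uncountably many times to countably many: coming close to
  \<open>F\<close> at rational times. The converse holds because the distance to \<open>F\<close>
  attains its minimum on the compact interval.\<close>

lemma hits_closed_iff:
  fixes g :: "real \<Rightarrow> 'a::metric_space"
  assumes g: "continuous_on {0..t} g" and t: "0 \<le> t" and F: "closed F" "F \<noteq> {}"
  shows "g ` {0..t} \<inter> F \<noteq> {} \<longleftrightarrow> (\<forall>m::nat. \<exists>n k::nat. real k / (real n + 1) \<le> t \<and> infdist (g (real k / (real n + 1))) F < 1 / (real m + 1))"
proof
  assume "g ` {0..t} \<inter> F \<noteq> {}"
  then obtain s where s: "s \<in> {0..t}" "g s \<in> F" by blast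
  show "\<forall>m::nat. \<exists>n k::nat. real k / (real n + 1) \<le> t \<and> infdist (g (real k / (real n + 1))) F < 1 / (real m + 1)"
  proof
    fix m :: nat
    define U where "U = {x. infdist x F < 1 / (real m + 1)}"
    have U: "open U" unfolding U_def by (intro open_Collect_less continuous_intros)
    have "g s \<in> U" using s by (simp add: U_def)
    from grid_near[OF g U s(1) this] obtain \<delta> where \<delta>: "\<delta> > 0"
      "\<And>\<epsilon>. 0 < \<epsilon> \<Longrightarrow> \<epsilon> < \<delta> \<Longrightarrow> (\<exists>k::nat. real k * \<epsilon> \<le> t \<and> g (real k * \<epsilon>) \<in> U)" by metis
    obtain n where "1 / real (Suc n) < \<delta>" using nat_approx_posE[OF \<delta>(1)] by blast
    hence "1 / (real n + 1) < \<delta>" by (simp add: add.commute)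
    with \<delta>(2)[of "1 / (real n + 1)"] show "\<exists>n k::nat. real k / (real n + 1) \<le> t \<and> infdist (g (real k / (real n + 1))) F < 1 / (real m + 1)"
      by (auto simp: U_def intro!: exI[of _ n])
  qed
next
  assume *: "\<forall>m::nat. \<exists>n k::nat. real k / (real n + 1) \<le> t \<and> infdist (g (real k / (real n + 1))) F < 1 / (real m + 1)"
  have "continuous_on {0..t} (\<lambda>s. infdist (g s) F)" by (intro continuous_intros g)
  then obtain s where s: "s \<in> {0..t}" "\<And>r. r \<in> {0..t} \<Longrightarrow> infdist (g s) F \<le> infdist (g r) F"
    using continuous_attains_inf[of "{0..t}" "\<lambda>s. infdist (g s) F"] t by auto
  have "infdist (g s) F < 1 / (real m + 1)" for m :: nat
  proof -
    from * obtain n k :: nat where nk: "real k / (real n + 1) \<le> t" "infdist (g (real k / (real n + 1))) F < 1 / (real m + 1)" by blast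
    have "infdist (g s) F \<le> infdist (g (real k / (real n + 1))) F"
      by (rule s(2)) (use nk in auto)
    thus ?thesis using nk by linarith
  qed
  note lt = this
  have "infdist (g s) F \<le> 0"
  proof (rule field_le_epsilon)
    fix e :: real assume "e > 0"
    then obtain m where "1 / real (Suc m) < e" using nat_approx_posE by blast
    with lt[of m] show "infdist (g s) F \<le> 0 + e" by (simp add: add.commute)
  qed
  hence "infdist (g s) F = 0" using infdist_nonneg[of "g s" F] by linarith
  hence "g s \<in> F" using F in_closed_iff_infdist_zero by blast
  thus "g ` {0..t} \<inter> F \<noteq> {}" using s(1) by blast
qed

lemma sets_hits_closed:
  fixes f :: "'a \<Rightarrow> real \<Rightarrow> complex"
  assumes f: "\<And>s. s \<in> {0..t} \<Longrightarrow> (\<lambda>x. f x s) \<in> borel_measurable M"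
    and c: "\<And>x. x \<in> space M \<Longrightarrow> continuous_on {0..t} (f x)" and t: "0 \<le> t" and F: "closed F"
  shows "{x \<in> space M. f x ` {0..t} \<inter> F \<noteq> {}} \<in> sets M"
proof (cases "F = {}")
  case False
  define A where "A k n m x \<longleftrightarrow> real k / (real n + 1) \<le> t \<and> infdist (f x (real k / (real n + 1))) F < 1 / (real m + 1)" for k n m :: nat and x
  have "{x \<in> space M. A k n m x} \<in> sets M" for k n m :: nat
  proof (cases "real k / (real n + 1) \<le> t")
    case True
    have "(\<lambda>x. infdist (f x (real k / (real n + 1))) F) \<in> borel_measurable M"
      by (rule measurable_compose[OF f borel_measurable_continuous_onI]) (use True in \<open>auto intro!: continuous_intros\<close>)
    hence "{x \<in> space M. infdist (f x (real k / (real n + 1))) F < 1 / (real m + 1)} \<in> sets M"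
      by (rule borel_measurable_less) simp
    thus ?thesis using True by (simp add: A_def)
  qed (simp add: A_def)
  hence "{x \<in> space M. \<forall>m. \<exists>n k. A k n m x} \<in> sets M"
    by (intro sets.sets_Collect_countable_All sets.sets_Collect_countable_Ex)
  moreover have "f x ` {0..t} \<inter> F \<noteq> {} \<longleftrightarrow> (\<forall>m. \<exists>n k. A k n m x)" if "x \<in> space M" for x
    unfolding A_def by (rule hits_closed_iff[OF c[OF that] t F False])
  hence "{x \<in> space M. f x ` {0..t} \<inter> F \<noteq> {}} = {x \<in> space M. \<forall>m. \<exists>n k. A k n m x}" by blast
  ultimately show ?thesis by simp
qed simp

section \<open>The Brownian loop measure in product form\<close>

type_synonym rooted_loop = "complex \<times> real \<times> (gauss_index \<Rightarrow> real)"

text \<open>Time is normalized to the unit interval, so that the duration enters only through the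
  factor \<open>sqrt\<close>.\<close>

definition loop_path :: "rooted_loop \<Rightarrow> real \<Rightarrow> complex" where
  "loop_path x s = fst x + of_real (sqrt (fst (snd x))) * bridge s (snd (snd x))"

definition trace :: "rooted_loop \<Rightarrow> complex set" where
  "trace x = loop_path x ` {0..1}"

text \<open>The two factors in the loop measure combined, and 0 for \<open>t <= 0\<close>, so that
  durations range over the whole real line in a plain product measure.\<close>

definition loop_weight :: "real \<Rightarrow> ennreal" where
  "loop_weight t = ennreal (if 0 < t then 1 / (2 * pi * t ^ 2) else 0)"

lemma measurable_loop_weight [measurable]: "loop_weight \<in> borel_measurable borel"
  unfolding loop_weight_def[abs_def] by measurable

definition loop_meas :: "rooted_loop measure" where
  "loop_meas = density (lborel \<Otimes>\<^sub>M (lborel \<Otimes>\<^sub>M gauss)) (\<lambda>x. loop_weight (fst (snd x)))"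

lemma space_loop_meas [simp]: "space loop_meas = UNIV"
  by (simp add: loop_meas_def space_pair_measure)

lemma sets_loop_meas [measurable_cong]: "sets loop_meas = sets (borel \<Otimes>\<^sub>M (borel \<Otimes>\<^sub>M gauss))"
  by (simp add: loop_meas_def cong: sets_pair_measure_cong)

lemma measurable_loop_path [measurable (raw)]:
  assumes [measurable]: "g \<in> measurable M (borel \<Otimes>\<^sub>M (borel \<Otimes>\<^sub>M gauss))" "h \<in> borel_measurable M"
  shows "(\<lambda>x. loop_path (g x) (h x)) \<in> borel_measurable M"
  unfolding loop_path_def by measurable

lemma continuous_loop_path: "continuous_on A (loop_path x)"
  unfolding loop_path_def[abs_def] by (intro continuous_intros continuous_bridge)

lemma compact_trace: "compact (trace x)"
  unfolding trace_def by (intro compact_continuous_image continuous_loop_path) auto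

lemma connected_trace: "connected (trace x)"
  unfolding trace_def by (intro connected_continuous_image continuous_loop_path) auto

lemma loop_path_0: "loop_path x 0 = fst x" by (simp add: loop_path_def)

lemma root_in_trace: "fst x \<in> trace x"
  unfolding trace_def by (rule image_eqI[of _ _ 0]) (auto simp: loop_path_0)

lemma sets_trace_hits: "closed F \<Longrightarrow> {x. trace x \<inter> F \<noteq> {}} \<in> sets loop_meas"
  using sets_hits_closed[of 1 loop_path loop_meas F] by (simp add: trace_def continuous_loop_path)

lemma pred_trace_hits [measurable]: "closed F \<Longrightarrow> Measurable.pred loop_meas (\<lambda>x. trace x \<inter> F \<noteq> {})"
  using sets_trace_hits by (simp add: pred_def)

text \<open>A continuous path that meets an open set meets it at some rational time, by
  \<open>grid_near\<close>.\<close>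

lemma pred_trace_hits_open [measurable]: "open U \<Longrightarrow> Measurable.pred loop_meas (\<lambda>x. trace x \<inter> U \<noteq> {})"
proof -
  assume U: "open U"
  show ?thesis
  proof (cases "U = UNIV")
    case True
    have "trace x \<inter> U \<noteq> {}" for x using root_in_trace[of x] True by auto
    thus ?thesis by simp
  next
    case False
    have eq: "trace x \<inter> U \<noteq> {} \<longleftrightarrow> (\<exists>n k::nat. real k / (real n + 1) \<le> 1 \<and> loop_path x (real k / (real n + 1)) \<in> U)" for x
    proof
      assume "trace x \<inter> U \<noteq> {}"
      then obtain s where s: "s \<in> {0..1}" "loop_path x s \<in> U" unfolding trace_def by blast
      from grid_near[OF continuous_loop_path U this] obtain \<delta> where \<delta>: "\<delta> > 0"
        "\<And>\<epsilon>. 0 < \<epsilon> \<Longrightarrow> \<epsilon> < \<delta> \<Longrightarrow> (\<exists>k::nat. real k * \<epsilon> \<le> 1 \<and> loop_path x (real k * \<epsilon>) \<in> U)" by metis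
      obtain n where "1 / real (Suc n) < \<delta>" using nat_approx_posE[OF \<delta>(1)] by blast
    hence "1 / (real n + 1) < \<delta>" by (simp add: add.commute)
      with \<delta>(2)[of "1 / (real n + 1)"] show "\<exists>n k::nat. real k / (real n + 1) \<le> 1 \<and> loop_path x (real k / (real n + 1)) \<in> U"
        by (auto intro!: exI[of _ n])
    next
      assume "\<exists>n k::nat. real k / (real n + 1) \<le> 1 \<and> loop_path x (real k / (real n + 1)) \<in> U"
      then obtain n k :: nat where "real k / (real n + 1) \<le> 1" "loop_path x (real k / (real n + 1)) \<in> U" by blast
      moreover have "0 \<le> real k / (real n + 1)" by simp
      ultimately have "loop_path x (real k / (real n + 1)) \<in> loop_path x ` {0..1} \<inter> U" by simp
      thus "trace x \<inter> U \<noteq> {}" unfolding trace_def by blast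
    qed
    have [measurable]: "U \<in> sets borel" using U by simp
    show ?thesis unfolding eq by measurable
  qed
qed

lemma trace_subset_iff: "trace x \<subseteq> D \<longleftrightarrow> \<not> (trace x \<inter> - D \<noteq> {})" by auto

lemma pred_trace_subset [measurable]: "open D \<Longrightarrow> Measurable.pred loop_meas (\<lambda>x. trace x \<subseteq> D)"
  unfolding trace_subset_iff by measurable (simp add: closed_Compl)

interpretation lborel_gauss: pair_sigma_finite "lborel :: real measure" gauss
  by (intro pair_sigma_finite.intro lborel.sigma_finite_measure_axioms gauss.sigma_finite_measure_axioms)

lemma nn_integral_loop_meas:
  assumes f [measurable]: "f \<in> borel_measurable loop_meas"
  shows "(\<integral>\<^sup>+x. f x \<partial>loop_meas) = (\<integral>\<^sup>+z. \<integral>\<^sup>+t. loop_weight t * (\<integral>\<^sup>+\<omega>. f (z, t, \<omega>) \<partial>gauss) \<partial>lborel \<partial>lborel)"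
proof -
  have m[measurable]: "f \<in> borel_measurable (borel \<Otimes>\<^sub>M (borel \<Otimes>\<^sub>M gauss))"
    using f by (simp cong: measurable_cong_sets add: sets_loop_meas)
  have "(\<integral>\<^sup>+x. f x \<partial>loop_meas) = (\<integral>\<^sup>+x. loop_weight (fst (snd x)) * f x \<partial>(lborel \<Otimes>\<^sub>M (lborel \<Otimes>\<^sub>M gauss)))"
    unfolding loop_meas_def by (rule nn_integral_density) measurable
  also have "\<dots> = (\<integral>\<^sup>+z. \<integral>\<^sup>+y. loop_weight (fst y) * f (z, y) \<partial>(lborel \<Otimes>\<^sub>M gauss) \<partial>lborel)"
    by (subst sigma_finite_measure.nn_integral_fst[OF lborel_gauss.sigma_finite_measure_axioms, symmetric]) simp_all
  also have "\<dots> = (\<integral>\<^sup>+z. \<integral>\<^sup>+t. \<integral>\<^sup>+\<omega>. loop_weight t * f (z, t, \<omega>) \<partial>gauss \<partial>lborel \<partial>lborel)"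
    by (intro nn_integral_cong, subst gauss.nn_integral_fst[symmetric]) auto
  also have "\<dots> = (\<integral>\<^sup>+z. \<integral>\<^sup>+t. loop_weight t * (\<integral>\<^sup>+\<omega>. f (z, t, \<omega>) \<partial>gauss) \<partial>lborel \<partial>lborel)"
    by (intro nn_integral_cong nn_integral_cmult) measurable
  finally show ?thesis .
qed

lemma emeasure_loop_meas:
  assumes [measurable]: "A \<in> sets loop_meas"
  shows "emeasure loop_meas A = (\<integral>\<^sup>+z. \<integral>\<^sup>+t. loop_weight t * emeasure gauss {\<omega>. (z, t, \<omega>) \<in> A} \<partial>lborel \<partial>lborel)"
proof -
  have [measurable]: "A \<in> sets (borel \<Otimes>\<^sub>M (borel \<Otimes>\<^sub>M gauss))" using assms by (simp add: sets_loop_meas)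
  have "emeasure loop_meas A = (\<integral>\<^sup>+x. indicator A x \<partial>loop_meas)" by simp
  also have "\<dots> = (\<integral>\<^sup>+z. \<integral>\<^sup>+t. loop_weight t * (\<integral>\<^sup>+\<omega>. indicator A (z, t, \<omega>) \<partial>gauss) \<partial>lborel \<partial>lborel)"
    by (rule nn_integral_loop_meas) measurable
  finally have 1: "emeasure loop_meas A = (\<integral>\<^sup>+z. \<integral>\<^sup>+t. loop_weight t * (\<integral>\<^sup>+\<omega>. indicator A (z, t, \<omega>) \<partial>gauss) \<partial>lborel \<partial>lborel)" .
  have 2: "(\<integral>\<^sup>+\<omega>. indicator A (z, t, \<omega>) \<partial>gauss) = emeasure gauss {\<omega>. (z, t, \<omega>) \<in> A}" for z t
  proof -
    have "{\<omega> \<in> space gauss. (z, t, \<omega>) \<in> A} \<in> sets gauss" by measurable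
    hence [measurable]: "{\<omega>. (z, t, \<omega>) \<in> A} \<in> sets gauss" by simp
    have "(\<integral>\<^sup>+\<omega>. indicator A (z, t, \<omega>) \<partial>gauss) = (\<integral>\<^sup>+\<omega>. indicator {\<omega>. (z, t, \<omega>) \<in> A} \<omega> \<partial>gauss)"
      by (intro nn_integral_cong) (auto simp: indicator_def)
    thus ?thesis by simp
  qed
  show ?thesis unfolding 1 2 ..
qed

text \<open>By \<open>brownian_bridge_eq\<close> the law of the bridge is an image of
  \<open>gauss\<close>, under which events about the range of the path become events about
  \<open>trace\<close>. All later arguments work with \<open>loop_meas\<close>.\<close>

theorem loop_mass_eq:
  assumes D: "open D" and V: "closed (Pt -` V\<^sub>1)" "closed (Pt -` V\<^sub>2)"
  shows "loop_mass D V\<^sub>1 V\<^sub>2 = emeasure loop_meas {x. trace x \<subseteq> D \<and> trace x \<inter> Pt -` V\<^sub>1 \<noteq> {} \<and> trace x \<inter> Pt -` V\<^sub>2 \<noteq> {}}"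
proof -
  define A where "A = {x. trace x \<subseteq> D \<and> trace x \<inter> Pt -` V\<^sub>1 \<noteq> {} \<and> trace x \<inter> Pt -` V\<^sub>2 \<noteq> {}}"
  have [measurable]: "A \<in> sets loop_meas"
  proof -
    note [measurable] = pred_trace_subset[OF D] pred_trace_hits[OF V(1)] pred_trace_hits[OF V(2)]
    have "{x \<in> space loop_meas. trace x \<subseteq> D \<and> trace x \<inter> Pt -` V\<^sub>1 \<noteq> {} \<and> trace x \<inter> Pt -` V\<^sub>2 \<noteq> {}} \<in> sets loop_meas" by measurable
    thus ?thesis by (simp add: A_def)
  qed
  have *: "emeasure (brownian_bridge z t) {\<omega> \<in> space (path_space t). \<omega> ` {0..t} \<subseteq> D \<and>
          Pt ` \<omega> ` {0..t} \<inter> V\<^sub>1 \<noteq> {} \<and> Pt ` \<omega> ` {0..t} \<inter> V\<^sub>2 \<noteq> {}} = emeasure gauss {\<omega>. (z, t, \<omega>) \<in> A}" if t: "0 < t" for z t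
  proof -
    let ?E = "{\<omega> \<in> space (path_space t). \<omega> ` {0..t} \<subseteq> D \<and>
          Pt ` \<omega> ` {0..t} \<inter> V\<^sub>1 \<noteq> {} \<and> Pt ` \<omega> ` {0..t} \<inter> V\<^sub>2 \<noteq> {}}"
    have h: "{\<omega> \<in> space (path_space t). \<omega> ` {0..t} \<inter> F \<noteq> {}} \<in> sets (path_space t)" if "closed F" for F
      by (rule sets_hits_closed) (use t that space_path_space measurable_path_space_eval in auto)
    have "?E = {\<omega> \<in> space (path_space t). \<omega> ` {0..t} \<inter> Pt -` V\<^sub>1 \<noteq> {}} \<inter> {\<omega> \<in> space (path_space t). \<omega> ` {0..t} \<inter> Pt -` V\<^sub>2 \<noteq> {}}
       - {\<omega> \<in> space (path_space t). \<omega> ` {0..t} \<inter> (- D) \<noteq> {}}" by auto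
    also have "\<dots> \<in> sets (path_space t)"
      using D V by (intro sets.Diff sets.Int h) auto
    finally have E: "?E \<in> sets (path_space t)" .
    have im: "scaled_bridge z t \<omega> ` {0..t} = trace (z, t, \<omega>)" for \<omega>
    proof -
      have "scaled_bridge z t \<omega> ` {0..t} = loop_path (z, t, \<omega>) ` (\<lambda>s. s / t) ` {0..t}"
        unfolding image_image by (intro image_cong) (auto simp: scaled_bridge_def loop_path_def)
      also have "(\<lambda>s. s / t) ` {0..t} = {0..1}"
        using t by (auto simp: image_iff)
      finally show ?thesis by (simp add: trace_def)
    qed
    have sp: "scaled_bridge z t \<omega> \<in> space (path_space t)" for \<omega>
      using measurable_space[OF measurable_scaled_bridge[OF t]] by simp
    have "emeasure (brownian_bridge z t) ?E = emeasure gauss (scaled_bridge z t -` ?E \<inter> space gauss)"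
      unfolding brownian_bridge_eq[OF t] by (rule emeasure_distr[OF measurable_scaled_bridge[OF t] E])
    also have "scaled_bridge z t -` ?E \<inter> space gauss = {\<omega>. (z, t, \<omega>) \<in> A}"
    proof -
      have "Pt ` X \<inter> V = {} \<longleftrightarrow> X \<inter> Pt -` V = {}" for X V by blast
      thus ?thesis unfolding A_def using sp by (simp add: im vimage_def)
    qed
    finally show ?thesis .
  qed
  have "loop_mass D V\<^sub>1 V\<^sub>2 = (\<integral>\<^sup>+z. \<integral>\<^sup>+t. loop_weight t * emeasure gauss {\<omega>. (z, t, \<omega>) \<in> A} \<partial>lborel \<partial>lborel)"
    unfolding loop_mass_def
  proof (intro nn_integral_cong)
    fix z t
    show "ennreal (1 / t * (1 / (2 * pi * t))) * emeasure (brownian_bridge z t) {\<omega> \<in> space (path_space t). \<omega> ` {0..t} \<subseteq> D \<and>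
          Pt ` \<omega> ` {0..t} \<inter> V\<^sub>1 \<noteq> {} \<and> Pt ` \<omega> ` {0..t} \<inter> V\<^sub>2 \<noteq> {}} * indicator {0<..} t = loop_weight t * emeasure gauss {\<omega>. (z, t, \<omega>) \<in> A}"
    proof (cases "0 < t")
      case True
      have "loop_weight t = ennreal (1 / t * (1 / (2 * pi * t)))" using True by (simp add: loop_weight_def power2_eq_square ac_simps)
      with True show ?thesis unfolding *[OF True] by simp
    qed (simp add: loop_weight_def)
  qed
  also have "\<dots> = emeasure loop_meas A" by (rule emeasure_loop_meas[symmetric]) measurable
  finally show ?thesis by (simp add: A_def)
qed

lemma nn_integral_lborel_affine:
  fixes f :: "complex \<Rightarrow> ennreal"
  assumes [measurable]: "f \<in> borel_measurable borel" and c: "c > 0"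
  shows "(\<integral>\<^sup>+z. f z \<partial>lborel) = ennreal (c ^ 2) * (\<integral>\<^sup>+z. f (p + c *\<^sub>R z) \<partial>lborel)"
  by (subst lborel_affine[of c p]) (use c in \<open>auto simp: nn_integral_density nn_integral_distr nn_integral_cmult\<close>)

text \<open>The dilation acts on root and duration and keeps the Gaussian sample, so traces are
  mapped path by path and not only in law.\<close>

definition transform :: "complex \<Rightarrow> real \<Rightarrow> rooted_loop \<Rightarrow> rooted_loop" where
  "transform p c x = (p + c *\<^sub>R fst x, c ^ 2 * fst (snd x), snd (snd x))"

lemma measurable_transform [measurable]: "transform p c \<in> measurable loop_meas loop_meas"
  unfolding transform_def[abs_def] measurable_cong_sets[OF sets_loop_meas sets_loop_meas] by measurable

lemma trace_transform: "0 < c \<Longrightarrow> trace (transform p c x) = (\<lambda>z. p + c *\<^sub>R z) ` trace x"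
proof -
  assume c: "0 < c"
  have "loop_path (transform p c x) s = p + c *\<^sub>R loop_path x s" for s
    using c by (simp add: transform_def loop_path_def real_sqrt_mult scaleR_conv_of_real algebra_simps)
  thus ?thesis by (simp add: trace_def image_image)
qed

text \<open>The root contributes a Jacobian \<open>c ^ 2\<close>, the duration another
  \<open>c ^ 2\<close>, and together they cancel the factor \<open>1 / c ^ 4\<close> in
  \<open>loop_weight (c ^ 2 * t)\<close>.\<close>

lemma distr_transform:
  assumes c: "0 < c"
  shows "distr loop_meas loop_meas (transform p c) = loop_meas"
proof (rule measure_eqI)
  fix A assume "A \<in> sets (distr loop_meas loop_meas (transform p c))"
  hence A[measurable]: "A \<in> sets loop_meas" by simp
  have [measurable]: "A \<in> sets (borel \<Otimes>\<^sub>M (borel \<Otimes>\<^sub>M gauss))" using A by (simp add: sets_loop_meas)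
  let ?g = "\<lambda>z t. \<integral>\<^sup>+\<omega>. indicator A (z, t, \<omega>) \<partial>gauss"
  have P: "transform p c -` A \<in> sets loop_meas"
    using measurable_sets[OF measurable_transform[of p c] A] by simp
  have em: "emeasure loop_meas B = (\<integral>\<^sup>+z. \<integral>\<^sup>+t. loop_weight t * (\<integral>\<^sup>+\<omega>. indicator B (z, t, \<omega>) \<partial>gauss) \<partial>lborel \<partial>lborel)"
    if [measurable]: "B \<in> sets loop_meas" for B
    using nn_integral_loop_meas[of "indicator B"] by (simp)
  have "emeasure loop_meas A = (\<integral>\<^sup>+z. \<integral>\<^sup>+t. loop_weight t * ?g z t \<partial>lborel \<partial>lborel)"
    by (rule em) measurable
  also have "\<dots> = ennreal (c ^ 2) * (\<integral>\<^sup>+z. \<integral>\<^sup>+t. loop_weight t * ?g (p + c *\<^sub>R z) t \<partial>lborel \<partial>lborel)"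
    by (rule nn_integral_lborel_affine[OF _ c]) measurable
  also have "\<dots> = ennreal (c ^ 2) * (\<integral>\<^sup>+z. ennreal (c ^ 2) * (\<integral>\<^sup>+t. loop_weight (c ^ 2 * t) * ?g (p + c *\<^sub>R z) (c ^ 2 * t) \<partial>lborel) \<partial>lborel)"
  proof -
    have "(\<integral>\<^sup>+t. loop_weight t * ?g z t \<partial>lborel) = ennreal (c ^ 2) * (\<integral>\<^sup>+t. loop_weight (c ^ 2 * t) * ?g z (c ^ 2 * t) \<partial>lborel)" for z
      using nn_integral_real_affine[of "\<lambda>t. loop_weight t * ?g z t" "c ^ 2" 0] c by simp
    thus ?thesis by simp
  qed
  also have "\<dots> = (\<integral>\<^sup>+z. ennreal (c ^ 2) * (ennreal (c ^ 2) * (\<integral>\<^sup>+t. loop_weight (c ^ 2 * t) * ?g (p + c *\<^sub>R z) (c ^ 2 * t) \<partial>lborel)) \<partial>lborel)"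
    by (rule nn_integral_cmult[symmetric]) measurable
  also have "\<dots> = (\<integral>\<^sup>+z. \<integral>\<^sup>+t. (ennreal (c ^ 2) * ennreal (c ^ 2) * loop_weight (c ^ 2 * t)) * ?g (p + c *\<^sub>R z) (c ^ 2 * t) \<partial>lborel \<partial>lborel)"
  proof (rule nn_integral_cong)
    fix z
    have [measurable]: "(\<lambda>t. loop_weight (c ^ 2 * t) * ?g (p + c *\<^sub>R z) (c ^ 2 * t)) \<in> borel_measurable borel" by measurable
    show "ennreal (c ^ 2) * (ennreal (c ^ 2) * (\<integral>\<^sup>+t. loop_weight (c ^ 2 * t) * ?g (p + c *\<^sub>R z) (c ^ 2 * t) \<partial>lborel)) =
       (\<integral>\<^sup>+t. (ennreal (c ^ 2) * ennreal (c ^ 2) * loop_weight (c ^ 2 * t)) * ?g (p + c *\<^sub>R z) (c ^ 2 * t) \<partial>lborel)"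
      by (simp only: mult.assoc, subst nn_integral_cmult, simp, subst nn_integral_cmult) simp_all
  qed
  also have "\<dots> = (\<integral>\<^sup>+z. \<integral>\<^sup>+t. loop_weight t * ?g (p + c *\<^sub>R z) (c ^ 2 * t) \<partial>lborel \<partial>lborel)"
  proof -
    have "ennreal (c ^ 2) * ennreal (c ^ 2) * loop_weight (c ^ 2 * t) = loop_weight t" for t
      using c by (auto simp: loop_weight_def ennreal_mult[symmetric] zero_less_mult_iff power_mult_distrib)
    thus ?thesis by simp
  qed
  also have "\<dots> = emeasure loop_meas (transform p c -` A)"
    unfolding em[OF P] by (simp add: transform_def indicator_def)
  finally show "emeasure (distr loop_meas loop_meas (transform p c)) A = emeasure loop_meas A"
    by (simp add: emeasure_distr)
qed simp

lemma emeasure_transform: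
  assumes "0 < c" and [measurable]: "Measurable.pred loop_meas P"
  shows "emeasure loop_meas {x. P (transform p c x)} = emeasure loop_meas {x. P x}"
proof -
  have A: "{x. P x} \<in> sets loop_meas" using assms(2) by (simp add: pred_def)
  have "emeasure loop_meas {x. P x} = emeasure (distr loop_meas loop_meas (transform p c)) {x. P x}"
    by (simp add: distr_transform[OF assms(1)])
  also have "\<dots> = emeasure loop_meas (transform p c -` {x. P x} \<inter> space loop_meas)"
    by (rule emeasure_distr[OF measurable_transform A])
  finally show ?thesis by (simp add: vimage_def)
qed

declare measurable_gauss_component [measurable del]

section \<open>The planar heat kernel\<close>

definition heat :: "real \<Rightarrow> complex \<Rightarrow> real" where
  "heat t x = exp (- (norm x)\<^sup>2 / (2 * t)) / (2 * pi * t)"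

lemma measurable_heat [measurable (raw)]:
  assumes [measurable]: "f \<in> borel_measurable M" "g \<in> borel_measurable M"
  shows "(\<lambda>x. heat (f x) (g x)) \<in> borel_measurable M"
  unfolding heat_def by measurable

lemma measurable_Complex [measurable (raw)]:
  assumes [measurable]: "f \<in> borel_measurable M" "g \<in> borel_measurable M"
  shows "(\<lambda>x. Complex (f x) (g x)) \<in> borel_measurable M"
  unfolding Complex_eq by measurable

lemma heat_nonneg: "0 < t \<Longrightarrow> 0 \<le> heat t x" by (simp add: heat_def)

lemma distr_Complex: "distr (lborel \<Otimes>\<^sub>M lborel) borel (\<lambda>p. Complex (fst p) (snd p)) = lborel"
proof (rule lborel_eqI[symmetric])
  fix l u :: complex assume lu: "\<And>b. b \<in> Basis \<Longrightarrow> l \<bullet> b \<le> u \<bullet> b"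
  have le: "Re l \<le> Re u" "Im l \<le> Im u" using lu[of 1] lu[of \<i>] by (auto simp: Basis_complex_def)
  have "emeasure (distr (lborel \<Otimes>\<^sub>M lborel) borel (\<lambda>p. Complex (fst p) (snd p))) (box l u) =
     emeasure (lborel \<Otimes>\<^sub>M lborel) (box (Re l) (Re u) \<times> box (Im l) (Im u))"
    by (subst emeasure_distr) (auto simp: in_box_complex_iff space_pair_measure intro!: arg_cong2[where f=emeasure])
  also have "\<dots> = ennreal (Re u - Re l) * ennreal (Im u - Im l)"
    using le by (subst lborel.emeasure_pair_measure_Times) auto
  finally show "emeasure (distr (lborel \<Otimes>\<^sub>M lborel) borel (\<lambda>p. Complex (fst p) (snd p))) (box l u) = (\<Prod>b\<in>Basis. (u - l) \<bullet> b)"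
    using le by (simp add: Basis_complex_def ennreal_mult[symmetric])
qed simp

lemma nn_integral_complex:
  assumes [measurable]: "f \<in> borel_measurable borel"
  shows "(\<integral>\<^sup>+z. f z \<partial>lborel) = (\<integral>\<^sup>+x. \<integral>\<^sup>+y. f (Complex x y) \<partial>lborel \<partial>lborel)"
proof -
  have "(\<integral>\<^sup>+z. f z \<partial>lborel) = (\<integral>\<^sup>+p. f (Complex (fst p) (snd p)) \<partial>(lborel \<Otimes>\<^sub>M lborel))"
    by (subst distr_Complex[symmetric], subst nn_integral_distr) auto
  also have "\<dots> = (\<integral>\<^sup>+x. \<integral>\<^sup>+y. f (Complex x y) \<partial>lborel \<partial>lborel)"
    by (subst lborel.nn_integral_fst[symmetric]) auto
  finally show ?thesis .
qed

lemma heat_Complex: "0 < t \<Longrightarrow> heat t (Complex x y) = normal_density 0 (sqrt t) x * normal_density 0 (sqrt t) y"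
proof -
  assume t: "0 < t"
  have "sqrt (2 * pi * t) * sqrt (2 * pi * t) = 2 * pi * t" using t by simp
  moreover have "(norm (Complex x y))\<^sup>2 = x\<^sup>2 + y\<^sup>2" by (simp add: cmod_power2)
  hence "- (norm (Complex x y))\<^sup>2 / (2 * t) = - x\<^sup>2 / (2 * t) + - y\<^sup>2 / (2 * t)"
    using t by (simp add: field_simps)
  hence "exp (- (norm (Complex x y))\<^sup>2 / (2 * t)) = exp (- x\<^sup>2 / (2 * t)) * exp (- y\<^sup>2 / (2 * t))"
    by (simp only: exp_add)
  ultimately show ?thesis using t by (simp add: heat_def normal_density_def)
qed

lemma nn_integral_heat:
  assumes t: "0 < t"
  shows "(\<integral>\<^sup>+x. ennreal (heat t (x - p)) \<partial>lborel) = 1"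
proof -
  have n: "(\<integral>\<^sup>+x. ennreal (normal_density 0 (sqrt t) x) \<partial>lborel) = 1"
    using prob_space.emeasure_space_1[OF prob_space_normal_density[of "sqrt t" 0]] t by (simp add: emeasure_density)
  have "(\<integral>\<^sup>+x. ennreal (heat t x) \<partial>lborel) = (\<integral>\<^sup>+x. \<integral>\<^sup>+y. ennreal (normal_density 0 (sqrt t) x) * ennreal (normal_density 0 (sqrt t) y) \<partial>lborel \<partial>lborel)"
    by (subst nn_integral_complex) (auto simp: heat_Complex[OF t] ennreal_mult intro!: nn_integral_cong)
  also have "\<dots> = 1" by (simp add: nn_integral_cmult n)
  finally have 1: "(\<integral>\<^sup>+x. ennreal (heat t x) \<partial>lborel) = 1" .
  have "(\<integral>\<^sup>+x. ennreal (heat t (x - p)) \<partial>lborel) = (\<integral>\<^sup>+x. ennreal (heat t (p + 1 *\<^sub>R x - p)) \<partial>lborel)"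
    by (subst nn_integral_lborel_affine[of _ 1 p]) auto
  thus ?thesis by (simp add: 1)
qed

text \<open>Completing the square: at time \<open>s\<close>, a bridge from \<open>x\<close> to
  \<open>y\<close> of duration \<open>s + t\<close> is Gaussian about the interpolated point with
  variance \<open>s * t / (s + t)\<close>. Integration in \<open>w\<close> gives the semigroup
  property; the second factor is the law that appears in \<open>grid_prob_rec\<close>.\<close>

lemma heat_mult:
  assumes s: "0 < s" and t: "0 < t"
  shows "heat s (w - x) * heat t (y - w) = heat (s + t) (y - x) * heat (s * t / (s + t)) (w - (x + of_real (s / (s + t)) * (y - x)))"
proof -
  define p d c where "p = w - x" and "d = y - x" and "c = s / (s + t)"
  define P D I where "P = (norm p)\<^sup>2" and "D = (norm d)\<^sup>2" and "I = p \<bullet> d"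
  have e1: "(norm (y - w))\<^sup>2 = D - 2 * I + P"
    unfolding P_def D_def I_def p_def d_def power2_norm_eq_inner by (simp add: inner_diff inner_commute algebra_simps)
  have "w - (x + of_real c * (y - x)) = p - c *\<^sub>R d" by (simp add: p_def d_def scaleR_conv_of_real)
  moreover have "(norm (p - c *\<^sub>R d))\<^sup>2 = P - 2 * c * I + c\<^sup>2 * D"
    unfolding P_def D_def I_def power2_norm_eq_inner by (simp add: inner_diff inner_commute power2_eq_square algebra_simps)
  ultimately have e2: "(norm (w - (x + of_real c * (y - x))))\<^sup>2 = P - 2 * c * I + c\<^sup>2 * D" by simp
  have st: "s + t \<noteq> 0" "s * t \<noteq> 0" "s \<noteq> 0" "t \<noteq> 0" using s t by auto
  have "P / s + (D - 2 * I + P) / t = D / (s + t) + (P - 2 * c * I + c\<^sup>2 * D) * (s + t) / (s * t)"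
    unfolding c_def using st by (simp add: divide_simps power2_eq_square) (simp add: algebra_simps)
  hence "(- P / (2 * s)) + (- (D - 2 * I + P) / (2 * t)) = (- D / (2 * (s + t))) + (- (P - 2 * c * I + c\<^sup>2 * D) / (2 * (s * t / (s + t))))"
    using st by (simp add: divide_simps) (simp add: algebra_simps)
  hence ex: "exp (- P / (2 * s)) * exp (- (D - 2 * I + P) / (2 * t)) = exp (- D / (2 * (s + t))) * exp (- (P - 2 * c * I + c\<^sup>2 * D) / (2 * (s * t / (s + t))))"
    by (simp only: exp_add[symmetric])
  have "heat s (w - x) * heat t (y - w) = exp (- P / (2 * s)) * exp (- (D - 2 * I + P) / (2 * t)) / (2 * pi * s * (2 * pi * t))"
    unfolding heat_def e1 by (simp add: P_def p_def)
  also have "\<dots> = exp (- D / (2 * (s + t))) / (2 * pi * (s + t)) * (exp (- (P - 2 * c * I + c\<^sup>2 * D) / (2 * (s * t / (s + t)))) / (2 * pi * (s * t / (s + t))))"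
    unfolding ex using st by (simp add: divide_simps)
  also have "\<dots> = heat (s + t) (y - x) * heat (s * t / (s + t)) (w - (x + of_real c * (y - x)))"
    unfolding heat_def e2 by (simp add: D_def d_def)
  finally show ?thesis by (simp add: c_def)
qed

lemma chapman_kolmogorov:
  assumes s: "0 < s" and t: "0 < t"
  shows "(\<integral>\<^sup>+w. ennreal (heat s (w - x)) * ennreal (heat t (y - w)) \<partial>lborel) = ennreal (heat (s + t) (y - x))"
proof -
  have "(\<integral>\<^sup>+w. ennreal (heat s (w - x)) * ennreal (heat t (y - w)) \<partial>lborel) =
    (\<integral>\<^sup>+w. ennreal (heat (s + t) (y - x)) * ennreal (heat (s * t / (s + t)) (w - (x + of_real (s / (s + t)) * (y - x)))) \<partial>lborel)"
    using s t by (intro nn_integral_cong) (simp add: ennreal_mult[symmetric] heat_nonneg heat_mult)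
  also have "\<dots> = ennreal (heat (s + t) (y - x))"
    using s t by (subst nn_integral_cmult) (auto simp: nn_integral_heat)
  finally show ?thesis .
qed

lemma integral_pair_mult:
  fixes f :: "'a \<Rightarrow> complex" and g :: "'b \<Rightarrow> complex"
  assumes "prob_space M" "prob_space N"
    and [measurable]: "f \<in> borel_measurable M" "g \<in> borel_measurable N"
    and "\<And>x. norm (f x) \<le> 1" "\<And>x. norm (g x) \<le> 1"
  shows "(CLINT p|M \<Otimes>\<^sub>M N. f (fst p) * g (snd p)) = (CLINT x|M. f x) * (CLINT y|N. g y)"
proof -
  interpret M: prob_space M by fact
  interpret N: prob_space N by fact
  interpret P: pair_prob_space M N ..
  have "integrable (M \<Otimes>\<^sub>M N) (\<lambda>p. f (fst p) * g (snd p))"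
    by (rule P.integrable_const_bound[where B=1]) (use assms in \<open>auto simp: norm_mult intro!: mult_le_one\<close>)
  from P.integral_fst'[OF this] show ?thesis by simp
qed

text \<open>Centred planar normal law of variance \<open>v\<close> in each coordinate; for
  \<open>v = u * (1 - u)\<close> the law of the unit bridge at time \<open>u\<close>.\<close>

definition gauss2 :: "real \<Rightarrow> complex measure" where
  "gauss2 v = distr (std_normal_distribution \<Otimes>\<^sub>M std_normal_distribution) borel (\<lambda>p. of_real (sqrt v) * Complex (fst p) (snd p))"

lemma measurable_gauss2_fun: "(\<lambda>p. of_real (sqrt v) * Complex (fst p) (snd p)) \<in> borel_measurable (std_normal_distribution \<Otimes>\<^sub>M std_normal_distribution)"
  by measurable

lemma prob_space_gauss2: "prob_space (gauss2 v)"
proof -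
  interpret S: prob_space std_normal_distribution by (rule prob_space_std_normal)
  interpret P: pair_prob_space std_normal_distribution std_normal_distribution ..
  show ?thesis unfolding gauss2_def by (rule P.prob_space_distr[OF measurable_gauss2_fun])
qed

lemma sets_gauss2 [measurable_cong, simp]: "sets (gauss2 v) = sets borel" and space_gauss2 [simp]: "space (gauss2 v) = UNIV"
  by (auto simp: gauss2_def)

lemma char_gauss2:
  assumes v: "0 \<le> v"
  shows "(CLINT w|gauss2 v. iexp (a \<bullet> w)) = exp (- v * (norm a)\<^sup>2 / 2)"
proof -
  have "(CLINT w|gauss2 v. iexp (a \<bullet> w)) = (CLINT p|std_normal_distribution \<Otimes>\<^sub>M std_normal_distribution.
     iexp (a \<bullet> (of_real (sqrt v) * Complex (fst p) (snd p))))"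
    unfolding gauss2_def by (rule integral_distr[OF measurable_gauss2_fun]) measurable
  also have "\<dots> = (CLINT p|std_normal_distribution \<Otimes>\<^sub>M std_normal_distribution.
     iexp (Re a * sqrt v * fst p) * iexp (Im a * sqrt v * snd p))"
    by (intro Bochner_Integration.integral_cong refl) (simp add: exp_add[symmetric] inner_complex_def algebra_simps)
  also have "\<dots> = char std_normal_distribution (Re a * sqrt v) * char std_normal_distribution (Im a * sqrt v)"
    unfolding char_def by (rule integral_pair_mult[OF prob_space_std_normal prob_space_std_normal]) auto
  also have "\<dots> = exp (- v * (norm a)\<^sup>2 / 2)"
    using v unfolding char_std_normal_distribution of_real_mult[symmetric] exp_add[symmetric] cmod_power2
    by (simp add: power_mult_distrib field_simps)
  finally show ?thesis .
qed

lemma nn_integral_gauss2: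
  assumes v: "0 < v" and [measurable]: "f \<in> borel_measurable borel"
  shows "(\<integral>\<^sup>+w. f w \<partial>gauss2 v) = (\<integral>\<^sup>+w. ennreal (heat v w) * f w \<partial>lborel)"
proof -
  interpret S: prob_space std_normal_distribution by (rule prob_space_std_normal)
  have mm: "(\<lambda>p. f (of_real (sqrt v) * Complex (fst p) (snd p))) \<in> borel_measurable (std_normal_distribution \<Otimes>\<^sub>M std_normal_distribution)"
    by measurable
  have "(\<integral>\<^sup>+w. f w \<partial>gauss2 v) = (\<integral>\<^sup>+p. f (of_real (sqrt v) * Complex (fst p) (snd p)) \<partial>(std_normal_distribution \<Otimes>\<^sub>M std_normal_distribution))"
    unfolding gauss2_def by (rule nn_integral_distr[OF measurable_gauss2_fun]) simp
  also have "\<dots> = (\<integral>\<^sup>+x. \<integral>\<^sup>+y. f (of_real (sqrt v) * Complex x y) \<partial>std_normal_distribution \<partial>std_normal_distribution)"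
    by (subst S.nn_integral_fst[symmetric, OF mm]) simp
  also have "\<dots> = (\<integral>\<^sup>+x. ennreal (std_normal_density x) * (\<integral>\<^sup>+y. ennreal (std_normal_density y) * f (of_real (sqrt v) * Complex x y) \<partial>lborel) \<partial>lborel)"
    by (subst nn_integral_density, simp, measurable, intro nn_integral_cong arg_cong2[where f="(*)"] refl nn_integral_density) measurable
  also have "\<dots> = (\<integral>\<^sup>+x. \<integral>\<^sup>+y. ennreal (heat 1 (Complex x y)) * f (sqrt v *\<^sub>R Complex x y) \<partial>lborel \<partial>lborel)"
    by (intro nn_integral_cong) (simp add: nn_integral_cmult[symmetric] heat_Complex ennreal_mult mult.assoc scaleR_conv_of_real)
  also have "\<dots> = (\<integral>\<^sup>+w. ennreal (heat 1 w) * f (sqrt v *\<^sub>R w) \<partial>lborel)"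
    by (rule nn_integral_complex[symmetric]) measurable
  also have "\<dots> = (\<integral>\<^sup>+w. ennreal v * (ennreal (heat v (sqrt v *\<^sub>R w)) * f (sqrt v *\<^sub>R w)) \<partial>lborel)"
  proof -
    have "heat 1 w = v * heat v (sqrt v *\<^sub>R w)" for w
      using v by (simp add: heat_def power_mult_distrib)
    thus ?thesis using v by (simp add: ennreal_mult heat_nonneg mult.assoc)
  qed
  also have "\<dots> = ennreal v * (\<integral>\<^sup>+w. ennreal (heat v (sqrt v *\<^sub>R w)) * f (sqrt v *\<^sub>R w) \<partial>lborel)"
    by (rule nn_integral_cmult) measurable
  also have "\<dots> = (\<integral>\<^sup>+w. ennreal (heat v w) * f w \<partial>lborel)"
    using v nn_integral_lborel_affine[of "\<lambda>w. ennreal (heat v w) * f w" "sqrt v" 0] by simp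
  finally show ?thesis .
qed

section \<open>Hitting the unit disk on a time grid\<close>

text \<open>Here \<open>x + s (y - x) + sqrt t bridge s\<close> is the position at time \<open>s t\<close> of the Brownian bridge from \<open>x\<close> to \<open>y\<close>
  of duration \<open>t\<close>.\<close>

definition grid_hit :: "nat \<Rightarrow> real \<Rightarrow> complex \<Rightarrow> complex \<Rightarrow> real \<Rightarrow> (gauss_index \<Rightarrow> real) \<Rightarrow> bool" where
  "grid_hit n \<epsilon> x y t \<omega> \<longleftrightarrow> (\<exists>k\<in>{..n}. real k * \<epsilon> \<le> t \<and>
     x + of_real (real k * \<epsilon> / t) * (y - x) + of_real (sqrt t) * bridge (real k * \<epsilon> / t) \<omega> \<in> ball 0 1)"

definition grid_prob :: "nat \<Rightarrow> real \<Rightarrow> complex \<Rightarrow> complex \<Rightarrow> real \<Rightarrow> ennreal" where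
  "grid_prob n \<epsilon> x y t = emeasure gauss {\<omega>. grid_hit n \<epsilon> x y t \<omega>}"

lemma pred_grid_hit [measurable (raw)]:
  assumes [measurable]: "f \<in> borel_measurable M" "g \<in> borel_measurable M" "h \<in> borel_measurable M" "w \<in> measurable M gauss"
  shows "Measurable.pred M (\<lambda>x. grid_hit n \<epsilon> (f x) (g x) (h x) (w x))"
  unfolding grid_hit_def mem_ball_0 by measurable

lemma sets_grid_hit [measurable]: "{\<omega>. grid_hit n \<epsilon> x y t \<omega>} \<in> sets gauss"
proof -
  have "{\<omega> \<in> space gauss. grid_hit n \<epsilon> x y t \<omega>} \<in> sets gauss" by measurable
  thus ?thesis by simp
qed

lemma grid_prob_eq: "grid_prob n \<epsilon> x y t = (\<integral>\<^sup>+\<omega>. (if grid_hit n \<epsilon> x y t \<omega> then 1 else 0) \<partial>gauss)"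
proof -
  have "grid_prob n \<epsilon> x y t = (\<integral>\<^sup>+\<omega>. indicator {\<omega>. grid_hit n \<epsilon> x y t \<omega>} \<omega> \<partial>gauss)"
    by (simp add: grid_prob_def)
  thus ?thesis by (simp add: indicator_def of_bool_def)
qed

lemma measurable_grid_prob [measurable (raw)]:
  assumes [measurable]: "f \<in> borel_measurable M" "g \<in> borel_measurable M" "h \<in> borel_measurable M"
  shows "(\<lambda>x. grid_prob n \<epsilon> (f x) (g x) (h x)) \<in> borel_measurable M"
  unfolding grid_prob_eq by measurable

lemma grid_prob_in: "x \<in> ball 0 1 \<Longrightarrow> 0 < t \<Longrightarrow> grid_prob n \<epsilon> x y t = 1"
proof -
  assume x: "x \<in> ball 0 1" and t: "0 < t"
  have "grid_hit n \<epsilon> x y t \<omega>" for \<omega>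
    unfolding grid_hit_def by (rule bexI[of _ 0]) (use x t in auto)
  thus ?thesis using gauss.emeasure_space_1 by (simp add: grid_prob_def)
qed

text \<open>No positive grid time is available, and at time 0 the path is at
  \<open>x\<close>.\<close>

lemma grid_prob_out:
  assumes "x \<notin> ball 0 1" "0 < \<epsilon>" "t < \<epsilon> \<or> n = 0"
  shows "grid_prob n \<epsilon> x y t = 0"
proof -
  have "\<not> grid_hit n \<epsilon> x y t \<omega>" for \<omega>
  proof
    assume "grid_hit n \<epsilon> x y t \<omega>"
    then obtain k where k: "k \<le> n" "real k * \<epsilon> \<le> t"
      "x + of_real (real k * \<epsilon> / t) * (y - x) + of_real (sqrt t) * bridge (real k * \<epsilon> / t) \<omega> \<in> ball 0 1"
      unfolding grid_hit_def by auto
    show False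
    proof (cases "k = 0")
      case True with k(3) assms(1) show False by simp
    next
      case False
      hence "\<epsilon> \<le> real k * \<epsilon>" using assms(2) by simp
      with k assms False show False by auto
    qed
  qed
  thus ?thesis by (simp add: grid_prob_def)
qed

text \<open>Markov property of the bridge at the first grid time: given its position at time \<open>u\<close>, the rest of the
  bridge is a linear interpolation plus an independent rescaled bridge.\<close>

lemma bridge_markov:
  assumes u: "0 < u" "u < 1" and S: "finite S" "S \<subseteq> {u..1}"
  shows "distr gauss (\<Pi>\<^sub>M s\<in>S. borel) (\<lambda>\<omega>. \<lambda>s\<in>S. bridge s \<omega>) =
    distr (gauss2 (u * (1 - u)) \<Otimes>\<^sub>M gauss) (\<Pi>\<^sub>M s\<in>S. borel)
      (\<lambda>p. \<lambda>s\<in>S. of_real ((1 - s) / (1 - u)) * fst p + of_real (sqrt (1 - u)) * bridge ((s - u) / (1 - u)) (snd p))"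
proof (rule joint_char_unique_complex[OF gauss.prob_space_axioms _ S(1)])
  let ?v = "u * (1 - u)"
  have v: "0 \<le> ?v" using u by simp
  interpret G: prob_space "gauss2 ?v" by (rule prob_space_gauss2)
  interpret P: pair_prob_space "gauss2 ?v" gauss ..
  show "prob_space (gauss2 ?v \<Otimes>\<^sub>M gauss)" by (rule P.prob_space_axioms)
  show "bridge i \<in> borel_measurable gauss" for i by measurable
  show "(\<lambda>p. of_real ((1 - i) / (1 - u)) * fst p + of_real (sqrt (1 - u)) * bridge ((i - u) / (1 - u)) (snd p)) \<in> borel_measurable (gauss2 ?v \<Otimes>\<^sub>M gauss)" for i
    by measurable
  fix a :: "real \<Rightarrow> complex"
  define c where "c s = (1 - s) / (1 - u)" for s
  define \<phi> where "\<phi> s = (s - u) / (1 - u)" for s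
  define A where "A = (\<Sum>s\<in>S. c s *\<^sub>R a s)"
  let ?R = "\<phi> ` S" and ?a = "\<lambda>r. sqrt (1 - u) *\<^sub>R a (u + (1 - u) * r)"
  have inv: "u + (1 - u) * \<phi> s = s" for s using u by (simp add: \<phi>_def)
  have inj: "inj_on \<phi> S" by (metis inj_onI inv)
  have R: "finite ?R" "?R \<subseteq> {0..1}" using S u by (auto simp: \<phi>_def divide_simps)
  have "(CLINT p|gauss2 ?v \<Otimes>\<^sub>M gauss. iexp (\<Sum>s\<in>S. a s \<bullet> (of_real ((1 - s) / (1 - u)) * fst p + of_real (sqrt (1 - u)) * bridge ((s - u) / (1 - u)) (snd p)))) =
    (CLINT p|gauss2 ?v \<Otimes>\<^sub>M gauss. iexp (A \<bullet> fst p) * iexp (\<Sum>r\<in>?R. ?a r \<bullet> bridge r (snd p)))"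
  proof (intro Bochner_Integration.integral_cong refl)
    fix p :: "complex \<times> (gauss_index \<Rightarrow> real)"
    have "(\<Sum>r\<in>?R. ?a r \<bullet> bridge r (snd p)) = (\<Sum>s\<in>S. a s \<bullet> (of_real (sqrt (1 - u)) * bridge (\<phi> s) (snd p)))"
      unfolding sum.reindex[OF inj] o_def inv by (simp add: scaleR_conv_of_real[symmetric])
    moreover have "A \<bullet> fst p = (\<Sum>s\<in>S. a s \<bullet> (of_real (c s) * fst p))"
      unfolding A_def by (simp add: inner_sum_left scaleR_conv_of_real[symmetric])
    ultimately have "(\<Sum>s\<in>S. a s \<bullet> (of_real (c s) * fst p + of_real (sqrt (1 - u)) * bridge (\<phi> s) (snd p))) = A \<bullet> fst p + (\<Sum>r\<in>?R. ?a r \<bullet> bridge r (snd p))"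
      by (simp add: inner_add_right sum.distrib)
    thus "iexp (\<Sum>s\<in>S. a s \<bullet> (of_real ((1 - s) / (1 - u)) * fst p + of_real (sqrt (1 - u)) * bridge ((s - u) / (1 - u)) (snd p))) =
      iexp (A \<bullet> fst p) * iexp (\<Sum>r\<in>?R. ?a r \<bullet> bridge r (snd p))"
      unfolding c_def \<phi>_def by (simp only: exp_add[symmetric] of_real_add ring_distribs)
  qed
  also have "\<dots> = (CLINT w|gauss2 ?v. iexp (A \<bullet> w)) * (CLINT \<omega>|gauss. iexp (\<Sum>r\<in>?R. ?a r \<bullet> bridge r \<omega>))"
    by (rule integral_pair_mult[OF G.prob_space_axioms gauss.prob_space_axioms]) auto
  also have "\<dots> = complex_of_real (exp (- ?v * (norm A)\<^sup>2 / 2)) * exp (- (\<Sum>s\<in>?R. \<Sum>r\<in>?R. (?a s \<bullet> ?a r) * (min s r - s * r)) / 2)"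
    unfolding char_gauss2[OF v] char_bridge[OF R] ..
  also have "\<dots> = complex_of_real (exp (- (\<Sum>s\<in>S. \<Sum>r\<in>S. (a s \<bullet> a r) * (min s r - s * r)) / 2))"
  proof -
    have N: "(norm A)\<^sup>2 = (\<Sum>s\<in>S. \<Sum>r\<in>S. (c s * c r) * (a s \<bullet> a r))"
      unfolding A_def power2_norm_eq_inner by (simp add: inner_sum_left inner_sum_right sum_distrib_left inner_commute ac_simps)
    have Q: "(\<Sum>s\<in>?R. \<Sum>r\<in>?R. (?a s \<bullet> ?a r) * (min s r - s * r)) = (\<Sum>s\<in>S. \<Sum>r\<in>S. (1 - u) * (a s \<bullet> a r) * (min (\<phi> s) (\<phi> r) - \<phi> s * \<phi> r))"
      using u by (simp only: sum.reindex[OF inj] o_def inv inner_scaleR_left inner_scaleR_right) (simp add: mult.assoc[symmetric])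
    \<comment> \<open>The covariance carried by the position at time \<open>u\<close> and that of
      the independent rescaled bridge add up to the covariance of the bridge. \<open>key\<close> is
      the identity for \<open>s <= r\<close>; the other case follows by symmetry.\<close>
    have E: "?v * (c s * c r) + (1 - u) * (min (\<phi> s) (\<phi> r) - \<phi> s * \<phi> r) = min s r - s * r" for s r
    proof -
      define w where "w = 1 - u"
      have w: "w > 0" "u = 1 - w" using u by (auto simp: w_def)
      have key: "u * w * (((1 - s) / w) * ((1 - r) / w)) + w * ((s - u) / w - ((s - u) / w) * ((r - u) / w)) = s - s * r" for s r
        unfolding w(2) using w(1) by (simp add: divide_simps) (simp add: algebra_simps)
      show ?thesis
      proof (cases "s \<le> r")
        case True
        hence "min (\<phi> s) (\<phi> r) = \<phi> s" using w(1) by (simp add: \<phi>_def w_def divide_right_mono)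
        thus ?thesis using True key[of s r] by (simp add: c_def \<phi>_def w_def)
      next
        case False
        hence "min (\<phi> s) (\<phi> r) = \<phi> r" using w(1) by (simp add: \<phi>_def w_def divide_right_mono min.absorb2)
        thus ?thesis using False key[of r s] by (simp add: c_def \<phi>_def w_def mult.commute)
      qed
    qed
    have "?v * (norm A)\<^sup>2 + (\<Sum>s\<in>?R. \<Sum>r\<in>?R. (?a s \<bullet> ?a r) * (min s r - s * r)) = (\<Sum>s\<in>S. \<Sum>r\<in>S. (a s \<bullet> a r) * (min s r - s * r))"
      unfolding N Q sum_distrib_left sum.distrib[symmetric]
    proof (intro sum.cong refl)
      fix s r
      have "X * (V + (1 - u) * Y) = X * V + (1 - u) * X * Y" for X V Y :: real by (simp add: algebra_simps)
      thus "?v * (c s * c r * (a s \<bullet> a r)) + (1 - u) * (a s \<bullet> a r) * (min (\<phi> s) (\<phi> r) - \<phi> s * \<phi> r) = (a s \<bullet> a r) * (min s r - s * r)"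
        by (simp only: E[of s r, symmetric]) (simp only: mult.assoc mult.commute mult.left_commute)
    qed
    hence "- ?v * (norm A)\<^sup>2 / 2 + - (\<Sum>s\<in>?R. \<Sum>r\<in>?R. (?a s \<bullet> ?a r) * (min s r - s * r)) / 2 = - (\<Sum>s\<in>S. \<Sum>r\<in>S. (a s \<bullet> a r) * (min s r - s * r)) / 2"
      by (simp add: field_simps)
    thus ?thesis by (simp only: of_real_mult[symmetric] exp_add[symmetric])
  qed
  also have "\<dots> = (CLINT \<omega>|gauss. iexp (\<Sum>s\<in>S. a s \<bullet> bridge s \<omega>))"
    using S u by (intro char_bridge[symmetric]) auto
  finally show "(CLINT \<omega>|gauss. iexp (\<Sum>s\<in>S. a s \<bullet> bridge s \<omega>)) =
     (CLINT p|gauss2 ?v \<Otimes>\<^sub>M gauss. iexp (\<Sum>s\<in>S. a s \<bullet> (of_real ((1 - s) / (1 - u)) * fst p + of_real (sqrt (1 - u)) * bridge ((s - u) / (1 - u)) (snd p))))" ..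
qed

text \<open>Since the start lies outside the disk, time 0 does not count and the path can be split
  at time \<open>\<epsilon>\<close>. Multiplied by the heat kernel, the conditional law of the
  position at that time becomes a product of two heat kernels by \<open>heat_mult\<close>, so the
  formula can be iterated.\<close>

lemma grid_prob_rec:
  assumes \<epsilon>: "0 < \<epsilon>" "\<epsilon> < t" and x: "x \<notin> ball 0 1"
  shows "ennreal (heat t (y - x)) * grid_prob (Suc n) \<epsilon> x y t =
    (\<integral>\<^sup>+w. ennreal (heat \<epsilon> (w - x)) * (ennreal (heat (t - \<epsilon>) (y - w)) * grid_prob n \<epsilon> w y (t - \<epsilon>)) \<partial>lborel)"
proof -
  define u where "u = \<epsilon> / t"
  have t: "0 < t" and u: "0 < u" "u < 1" using \<epsilon> by (auto simp: u_def)
  define v where "v = u * (1 - u)"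
  have v: "0 < v" using u by (simp add: v_def)
  \<comment> \<open>Grid indices without 0; \<open>S\<close> contains their times as fractions of
    \<open>t\<close>, all at least \<open>u\<close>, where \<open>bridge_markov\<close> describes
    the bridge.\<close>
  define I where "I = {k\<in>{1..Suc n}. real k * \<epsilon> \<le> t}"
  define S where "S = (\<lambda>k. real k * \<epsilon> / t) ` I"
  have S: "finite S" "S \<subseteq> {u..1}" using \<epsilon> t by (auto simp: S_def I_def u_def divide_simps)
  define m where "m = x + of_real u * (y - x)"
  define E where "E = {f \<in> space (\<Pi>\<^sub>M s\<in>S. borel). \<exists>s\<in>S. norm (x + of_real s * (y - x) + of_real (sqrt t) * f s) < 1}"
  have E: "E \<in> sets (\<Pi>\<^sub>M s\<in>S. borel)"
    unfolding E_def using S(1) by measurable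
  define Y where "Y = (\<lambda>p. \<lambda>s\<in>S. of_real ((1 - s) / (1 - u)) * fst p + of_real (sqrt (1 - u)) * bridge ((s - u) / (1 - u)) (snd p))"
  have Y: "Y \<in> measurable (gauss2 v \<Otimes>\<^sub>M gauss) (\<Pi>\<^sub>M s\<in>S. borel)"
    unfolding Y_def by (intro measurable_restrict) measurable
  have X: "(\<lambda>\<omega>. \<lambda>s\<in>S. bridge s \<omega>) \<in> measurable gauss (\<Pi>\<^sub>M s\<in>S. borel)"
    by (intro measurable_restrict) measurable
  have hit1: "grid_hit (Suc n) \<epsilon> x y t \<omega> \<longleftrightarrow> (\<lambda>s\<in>S. bridge s \<omega>) \<in> E" for \<omega>
  proof -
    have "grid_hit (Suc n) \<epsilon> x y t \<omega> \<longleftrightarrow> (\<exists>k\<in>I. norm (x + of_real (real k * \<epsilon> / t) * (y - x) + of_real (sqrt t) * bridge (real k * \<epsilon> / t) \<omega>) < 1)"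
    proof
      assume "grid_hit (Suc n) \<epsilon> x y t \<omega>"
      then obtain k where k: "k \<le> Suc n" "real k * \<epsilon> \<le> t"
        "norm (x + of_real (real k * \<epsilon> / t) * (y - x) + of_real (sqrt t) * bridge (real k * \<epsilon> / t) \<omega>) < 1"
        unfolding grid_hit_def mem_ball_0 by auto
      have "k \<noteq> 0"
      proof
        assume "k = 0" with k(3) x show False by simp
      qed
      with k show "\<exists>k\<in>I. norm (x + of_real (real k * \<epsilon> / t) * (y - x) + of_real (sqrt t) * bridge (real k * \<epsilon> / t) \<omega>) < 1"
        by (intro bexI[of _ k]) (simp_all add: I_def)
    qed (auto simp: grid_hit_def I_def)
    also have "\<dots> \<longleftrightarrow> (\<exists>s\<in>S. norm (x + of_real s * (y - x) + of_real (sqrt t) * bridge s \<omega>) < 1)"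
      by (simp add: S_def)
    also have "\<dots> \<longleftrightarrow> (\<lambda>s\<in>S. bridge s \<omega>) \<in> E"
      by (auto simp: E_def space_PiM)
    finally show ?thesis .
  qed
  \<comment> \<open>Seen from the position after one step, index \<open>k\<close> becomes
    \<open>k - 1\<close> on a bridge of duration \<open>t - \<epsilon>\<close>.\<close>
  have hit2: "Y p \<in> E \<longleftrightarrow> grid_hit n \<epsilon> (m + sqrt t *\<^sub>R fst p) y (t - \<epsilon>) (snd p)" for p
  proof -
    let ?w = "m + sqrt t *\<^sub>R fst p"
    have bx: "(\<exists>s\<in>f ` A. P s) \<longleftrightarrow> (\<exists>k\<in>A. P (f k))" for f :: "nat \<Rightarrow> real" and A P by blast
    have "Y p \<in> E \<longleftrightarrow> (\<exists>s\<in>S. norm (x + of_real s * (y - x) + of_real (sqrt t) * (of_real ((1 - s) / (1 - u)) * fst p + of_real (sqrt (1 - u)) * bridge ((s - u) / (1 - u)) (snd p))) < 1)"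
      by (auto simp: E_def Y_def space_PiM)
    also have "\<dots> \<longleftrightarrow> (\<exists>k\<in>I. norm (?w + of_real (real (k - 1) * \<epsilon> / (t - \<epsilon>)) * (y - ?w) + of_real (sqrt (t - \<epsilon>)) * bridge (real (k - 1) * \<epsilon> / (t - \<epsilon>)) (snd p)) < 1)"
      unfolding S_def bx
    proof (rule bex_cong[OF refl])
      fix k assume k: "k \<in> I"
      define s \<phi> where "s = real k * \<epsilon> / t" and "\<phi> = real (k - 1) * \<epsilon> / (t - \<epsilon>)"
      have k1: "real (k - 1) = real k - 1" using k by (auto simp: I_def of_nat_diff)
      have "t - \<epsilon> \<noteq> 0" using \<epsilon> by simp
      have 1: "(s - u) / (1 - u) = \<phi>"
        unfolding s_def u_def \<phi>_def k1 using t \<open>t - \<epsilon> \<noteq> 0\<close> by (simp add: divide_simps) (simp add: algebra_simps)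
      have su: "s = u + (1 - u) * \<phi>" using 1 u by (simp add: divide_simps split: if_splits) (simp add: algebra_simps)
      have 2: "(1 - s) / (1 - u) = 1 - \<phi>" using u unfolding su by (simp add: divide_simps) (simp add: algebra_simps)
      have "t - \<epsilon> = t * (1 - u)" using t by (simp add: u_def field_simps)
      hence 3: "sqrt (t - \<epsilon>) = sqrt t * sqrt (1 - u)" by (simp add: real_sqrt_mult)
      have "x + of_real s * (y - x) + of_real (sqrt t) * (of_real (1 - \<phi>) * fst p + of_real (sqrt (1 - u)) * b) =
         ?w + of_real \<phi> * (y - ?w) + of_real (sqrt (t - \<epsilon>)) * b" for b
        unfolding 3 su m_def by (simp add: scaleR_conv_of_real algebra_simps)
      thus "(norm (x + of_real (real k * \<epsilon> / t) * (y - x) + of_real (sqrt t) * (of_real ((1 - real k * \<epsilon> / t) / (1 - u)) * fst p + of_real (sqrt (1 - u)) * bridge ((real k * \<epsilon> / t - u) / (1 - u)) (snd p))) < 1) =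
         (norm (?w + of_real (real (k - 1) * \<epsilon> / (t - \<epsilon>)) * (y - ?w) + of_real (sqrt (t - \<epsilon>)) * bridge (real (k - 1) * \<epsilon> / (t - \<epsilon>)) (snd p)) < 1)"
        unfolding s_def[symmetric] \<phi>_def[symmetric] 1 2 by simp
    qed
    also have "\<dots> \<longleftrightarrow> grid_hit n \<epsilon> ?w y (t - \<epsilon>) (snd p)"
      unfolding grid_hit_def mem_ball_0
    proof
      assume "\<exists>k\<in>I. norm (?w + of_real (real (k - 1) * \<epsilon> / (t - \<epsilon>)) * (y - ?w) + of_real (sqrt (t - \<epsilon>)) * bridge (real (k - 1) * \<epsilon> / (t - \<epsilon>)) (snd p)) < 1"
      then obtain k where k: "k \<in> I" "norm (?w + of_real (real (k - 1) * \<epsilon> / (t - \<epsilon>)) * (y - ?w) + of_real (sqrt (t - \<epsilon>)) * bridge (real (k - 1) * \<epsilon> / (t - \<epsilon>)) (snd p)) < 1" by blast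
      show "\<exists>k\<in>{..n}. real k * \<epsilon> \<le> t - \<epsilon> \<and> norm (?w + of_real (real k * \<epsilon> / (t - \<epsilon>)) * (y - ?w) + of_real (sqrt (t - \<epsilon>)) * bridge (real k * \<epsilon> / (t - \<epsilon>)) (snd p)) < 1"
        by (rule bexI[of _ "k - 1"]) (use k in \<open>auto simp: I_def of_nat_diff algebra_simps\<close>)
    next
      assume "\<exists>k\<in>{..n}. real k * \<epsilon> \<le> t - \<epsilon> \<and> norm (?w + of_real (real k * \<epsilon> / (t - \<epsilon>)) * (y - ?w) + of_real (sqrt (t - \<epsilon>)) * bridge (real k * \<epsilon> / (t - \<epsilon>)) (snd p)) < 1"
      then obtain k where k: "k \<le> n" "real k * \<epsilon> \<le> t - \<epsilon>" "norm (?w + of_real (real k * \<epsilon> / (t - \<epsilon>)) * (y - ?w) + of_real (sqrt (t - \<epsilon>)) * bridge (real k * \<epsilon> / (t - \<epsilon>)) (snd p)) < 1" by auto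
      show "\<exists>k\<in>I. norm (?w + of_real (real (k - 1) * \<epsilon> / (t - \<epsilon>)) * (y - ?w) + of_real (sqrt (t - \<epsilon>)) * bridge (real (k - 1) * \<epsilon> / (t - \<epsilon>)) (snd p)) < 1"
        by (rule bexI[of _ "Suc k"]) (use k in \<open>auto simp: I_def algebra_simps\<close>)
    qed
    finally show ?thesis .
  qed
  let ?g = "\<lambda>w. grid_prob n \<epsilon> w y (t - \<epsilon>)"
  have "grid_prob (Suc n) \<epsilon> x y t = emeasure (distr gauss (\<Pi>\<^sub>M s\<in>S. borel) (\<lambda>\<omega>. \<lambda>s\<in>S. bridge s \<omega>)) E"
    unfolding grid_prob_def emeasure_distr[OF X E] using hit1 by (intro arg_cong2[where f=emeasure]) auto
  also have "\<dots> = emeasure (distr (gauss2 v \<Otimes>\<^sub>M gauss) (\<Pi>\<^sub>M s\<in>S. borel) Y) E"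
    unfolding Y_def v_def by (simp only: bridge_markov[OF u S])
  also have "\<dots> = (\<integral>\<^sup>+p. indicator (Y -` E \<inter> space (gauss2 v \<Otimes>\<^sub>M gauss)) p \<partial>(gauss2 v \<Otimes>\<^sub>M gauss))"
    using measurable_sets[OF Y E] by (simp add: emeasure_distr[OF Y E])
  also have "\<dots> = (\<integral>\<^sup>+p. (if grid_hit n \<epsilon> (m + sqrt t *\<^sub>R fst p) y (t - \<epsilon>) (snd p) then 1 else 0) \<partial>(gauss2 v \<Otimes>\<^sub>M gauss))"
    using hit2 by (intro nn_integral_cong) (auto simp: indicator_def space_pair_measure)
  also have "\<dots> = (\<integral>\<^sup>+w. \<integral>\<^sup>+\<omega>. (if grid_hit n \<epsilon> (m + sqrt t *\<^sub>R w) y (t - \<epsilon>) \<omega> then 1 else 0) \<partial>gauss \<partial>gauss2 v)"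
    by (subst gauss.nn_integral_fst[symmetric]) auto
  also have "\<dots> = (\<integral>\<^sup>+w. ?g (m + sqrt t *\<^sub>R w) \<partial>gauss2 v)"
    unfolding grid_prob_eq ..
  also have "\<dots> = (\<integral>\<^sup>+w. ennreal (heat v w) * ?g (m + sqrt t *\<^sub>R w) \<partial>lborel)"
    by (rule nn_integral_gauss2[OF v]) measurable
  also have "\<dots> = (\<integral>\<^sup>+w. ennreal t * (ennreal (heat (t * v) (m + sqrt t *\<^sub>R w - m)) * ?g (m + sqrt t *\<^sub>R w)) \<partial>lborel)"
  proof -
    have "heat v w = t * heat (t * v) (sqrt t *\<^sub>R w)" for w
      using v t by (simp add: heat_def power_mult_distrib)
    thus ?thesis using v t by (simp add: ennreal_mult heat_nonneg mult.assoc)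
  qed
  also have "\<dots> = ennreal t * (\<integral>\<^sup>+w. ennreal (heat (t * v) (m + sqrt t *\<^sub>R w - m)) * ?g (m + sqrt t *\<^sub>R w) \<partial>lborel)"
    by (rule nn_integral_cmult) measurable
  also have "\<dots> = (\<integral>\<^sup>+w. ennreal (heat (t * v) (w - m)) * ?g w \<partial>lborel)"
    using t nn_integral_lborel_affine[of "\<lambda>w. ennreal (heat (t * v) (w - m)) * ?g w" "sqrt t" m] by simp
  finally have "ennreal (heat t (y - x)) * grid_prob (Suc n) \<epsilon> x y t =
     (\<integral>\<^sup>+w. ennreal (heat t (y - x)) * (ennreal (heat (t * v) (w - m)) * ?g w) \<partial>lborel)"
    by (simp add: nn_integral_cmult)
  also have "\<dots> = (\<integral>\<^sup>+w. ennreal (heat \<epsilon> (w - x)) * (ennreal (heat (t - \<epsilon>) (y - w)) * ?g w) \<partial>lborel)"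
  proof (rule nn_integral_cong)
    fix w
    \<comment> \<open>The variance after scaling by \<open>sqrt t\<close> is the one that
      \<open>heat_mult\<close> produces for the times \<open>\<epsilon>\<close> and
      \<open>t - \<epsilon>\<close>.\<close>
    have tv: "t * v = \<epsilon> * (t - \<epsilon>) / (\<epsilon> + (t - \<epsilon>))" using t by (simp add: v_def u_def field_simps)
    have "heat \<epsilon> (w - x) * heat (t - \<epsilon>) (y - w) = heat t (y - x) * heat (t * v) (w - m)"
      using heat_mult[of \<epsilon> "t - \<epsilon>" w x y] \<epsilon> unfolding tv m_def u_def by simp
    hence "ennreal (heat \<epsilon> (w - x)) * ennreal (heat (t - \<epsilon>) (y - w)) = ennreal (heat t (y - x)) * ennreal (heat (t * v) (w - m))"
      using \<epsilon> t v by (simp add: ennreal_mult[symmetric] heat_nonneg)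
    thus "ennreal (heat t (y - x)) * (ennreal (heat (t * v) (w - m)) * ?g w) = ennreal (heat \<epsilon> (w - x)) * (ennreal (heat (t - \<epsilon>) (y - w)) * ?g w)"
      by (simp add: mult.assoc[symmetric])
  qed
  finally show ?thesis .
qed

section \<open>Killed Green functions\<close>

definition expw :: "real \<Rightarrow> real \<Rightarrow> ennreal" where
  "expw l t = (if 0 < t then ennreal (exp (- l * t)) else 0)"

definition hk :: "real \<Rightarrow> complex \<Rightarrow> ennreal" where
  "hk t x = ennreal (heat t x)"

lemma sets_unit_ball [measurable]: "ball (0::complex) 1 \<in> sets borel"
  by simp

lemma measurable_expw [measurable (raw)]:
  assumes [measurable]: "f \<in> borel_measurable M"
  shows "(\<lambda>x. expw l (f x)) \<in> borel_measurable M"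
  unfolding expw_def by measurable

lemma measurable_hk [measurable (raw)]:
  assumes [measurable]: "f \<in> borel_measurable M" "g \<in> borel_measurable M"
  shows "(\<lambda>x. hk (f x) (g x)) \<in> borel_measurable M"
  unfolding hk_def by measurable

lemma expw_add: "0 < s \<Longrightarrow> expw l (e + s) = expw l s * ennreal (exp (- l * e))" if "0 \<le> e"
  using that by (auto simp: expw_def ennreal_mult[symmetric] exp_add[symmetric] algebra_simps)

text \<open>Resolvent kernel of planar Brownian motion killed at rate \<open>l\<close>.\<close>

definition green :: "real \<Rightarrow> complex \<Rightarrow> ennreal" where
  "green l z = (\<integral>\<^sup>+t. expw l t * hk t z \<partial>lborel)"

text \<open>The part of \<open>green l (y - x)\<close> carried by the paths that the grid sees in
  the disk.\<close>

definition hit_green :: "nat \<Rightarrow> real \<Rightarrow> real \<Rightarrow> complex \<Rightarrow> complex \<Rightarrow> ennreal" where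
  "hit_green n \<epsilon> l y x = (\<integral>\<^sup>+t. expw l t * (hk t (y - x) * grid_prob n \<epsilon> x y t) \<partial>lborel)"

definition disc_prob :: "real \<Rightarrow> complex \<Rightarrow> ennreal" where
  "disc_prob t x = (\<integral>\<^sup>+y. indicator (ball 0 1) y * hk t (y - x) \<partial>lborel)"

text \<open>Expected discounted time in the unit disk for Brownian motion started at
  \<open>x\<close>; it serves as comparison function for hitting the disk.\<close>

definition disc_pot :: "real \<Rightarrow> complex \<Rightarrow> ennreal" where
  "disc_pot l x = (\<integral>\<^sup>+t. expw l t * disc_prob t x \<partial>lborel)"

lemma measurable_green [measurable (raw)]:
  assumes [measurable]: "f \<in> borel_measurable M"
  shows "(\<lambda>x. green l (f x)) \<in> borel_measurable M"
  unfolding green_def by measurable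

lemma measurable_hit_green [measurable (raw)]:
  assumes [measurable]: "f \<in> borel_measurable M" "g \<in> borel_measurable M"
  shows "(\<lambda>x. hit_green n \<epsilon> l (f x) (g x)) \<in> borel_measurable M"
  unfolding hit_green_def by measurable

lemma measurable_disc_prob [measurable (raw)]:
  assumes [measurable]: "f \<in> borel_measurable M" "g \<in> borel_measurable M"
  shows "(\<lambda>x. disc_prob (f x) (g x)) \<in> borel_measurable M"
  unfolding disc_prob_def by measurable

lemma measurable_disc_pot [measurable (raw)]:
  assumes [measurable]: "f \<in> borel_measurable M"
  shows "(\<lambda>x. disc_pot l (f x)) \<in> borel_measurable M"
  unfolding disc_pot_def by measurable

lemma nn_integral_shift:
  assumes [measurable]: "f \<in> borel_measurable borel"
  shows "(\<integral>\<^sup>+t. f t \<partial>lborel) = (\<integral>\<^sup>+t. f (a + t) \<partial>(lborel :: real measure))"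
  using nn_integral_real_affine[of f 1 a] by simp

lemma hit_green_in: "x \<in> ball 0 1 \<Longrightarrow> hit_green n \<epsilon> l y x = green l (y - x)"
  unfolding hit_green_def green_def by (intro nn_integral_cong) (auto simp: grid_prob_in expw_def)

lemma hit_green_0: "x \<notin> ball 0 1 \<Longrightarrow> 0 < \<epsilon> \<Longrightarrow> hit_green 0 \<epsilon> l y x = 0"
  unfolding hit_green_def by (simp add: grid_prob_out)

text \<open>\<open>grid_prob_rec\<close> integrated over the duration. Durations below
  \<open>\<epsilon>\<close> drop out by \<open>grid_prob_out\<close>.\<close>

lemma hit_green_Suc:
  assumes x: "x \<notin> ball 0 1" and \<epsilon>: "0 < \<epsilon>"
  shows "hit_green (Suc n) \<epsilon> l y x = ennreal (exp (- l * \<epsilon>)) * (\<integral>\<^sup>+w. hk \<epsilon> (w - x) * hit_green n \<epsilon> l y w \<partial>lborel)"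
proof -
  have "hit_green (Suc n) \<epsilon> l y x = (\<integral>\<^sup>+s. expw l (\<epsilon> + s) * (hk (\<epsilon> + s) (y - x) * grid_prob (Suc n) \<epsilon> x y (\<epsilon> + s)) \<partial>lborel)"
    unfolding hit_green_def by (rule nn_integral_shift) measurable
  also have "\<dots> = (\<integral>\<^sup>+s. ennreal (exp (- l * \<epsilon>)) * (\<integral>\<^sup>+w. expw l s * (hk \<epsilon> (w - x) * (hk s (y - w) * grid_prob n \<epsilon> w y s)) \<partial>lborel) \<partial>lborel)"
  proof (rule nn_integral_cong_AE)
    show "AE s in lborel. expw l (\<epsilon> + s) * (hk (\<epsilon> + s) (y - x) * grid_prob (Suc n) \<epsilon> x y (\<epsilon> + s)) = ennreal (exp (- l * \<epsilon>)) * (\<integral>\<^sup>+w. expw l s * (hk \<epsilon> (w - x) * (hk s (y - w) * grid_prob n \<epsilon> w y s)) \<partial>lborel)"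
      using AE_lborel_singleton[of "0::real"]
    proof eventually_elim
      case (elim s)
      show ?case
      proof (cases "0 < s")
        case True
        have "hk (\<epsilon> + s) (y - x) * grid_prob (Suc n) \<epsilon> x y (\<epsilon> + s) = (\<integral>\<^sup>+w. hk \<epsilon> (w - x) * (hk s (y - w) * grid_prob n \<epsilon> w y s) \<partial>lborel)"
          unfolding hk_def using grid_prob_rec[OF \<epsilon> _ x, of "\<epsilon> + s" y n] True by simp
        thus ?thesis using True \<epsilon> by (simp add: expw_add nn_integral_cmult ac_simps)
      next
        case False
        with elim have "s < 0" by simp
        hence "grid_prob (Suc n) \<epsilon> x y (\<epsilon> + s) = 0" by (intro grid_prob_out x \<epsilon>) simp
        thus ?thesis using \<open>s < 0\<close> by (simp add: expw_def)
      qed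
    qed
  qed
  also have "\<dots> = ennreal (exp (- l * \<epsilon>)) * (\<integral>\<^sup>+s. \<integral>\<^sup>+w. expw l s * (hk \<epsilon> (w - x) * (hk s (y - w) * grid_prob n \<epsilon> w y s)) \<partial>lborel \<partial>lborel)"
    by (rule nn_integral_cmult) measurable
  also have "(\<integral>\<^sup>+s. \<integral>\<^sup>+w. expw l s * (hk \<epsilon> (w - x) * (hk s (y - w) * grid_prob n \<epsilon> w y s)) \<partial>lborel \<partial>lborel) =
     (\<integral>\<^sup>+w. \<integral>\<^sup>+s. expw l s * (hk \<epsilon> (w - x) * (hk s (y - w) * grid_prob n \<epsilon> w y s)) \<partial>lborel \<partial>lborel)"
    by (rule lborel_pair.Fubini') measurable
  also have "\<dots> = (\<integral>\<^sup>+w. hk \<epsilon> (w - x) * hit_green n \<epsilon> l y w \<partial>lborel)"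
    unfolding hit_green_def by (subst nn_integral_cmult[symmetric]) (auto simp: ac_simps intro!: nn_integral_cong)
  finally show ?thesis .
qed

lemma disc_prob_step:
  assumes \<epsilon>: "0 < \<epsilon>" and t: "0 < t"
  shows "(\<integral>\<^sup>+w. hk \<epsilon> (w - x) * disc_prob t w \<partial>lborel) = disc_prob (\<epsilon> + t) x"
proof -
  have "(\<integral>\<^sup>+w. hk \<epsilon> (w - x) * disc_prob t w \<partial>lborel) = (\<integral>\<^sup>+w. \<integral>\<^sup>+y. hk \<epsilon> (w - x) * (indicator (ball 0 1) y * hk t (y - w)) \<partial>lborel \<partial>lborel)"
    unfolding disc_prob_def by (intro nn_integral_cong nn_integral_cmult[symmetric]) measurable
  also have "\<dots> = (\<integral>\<^sup>+y. \<integral>\<^sup>+w. hk \<epsilon> (w - x) * (indicator (ball 0 1) y * hk t (y - w)) \<partial>lborel \<partial>lborel)"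
    by (rule lborel_pair.Fubini') measurable
  also have "\<dots> = (\<integral>\<^sup>+y. indicator (ball 0 1) y * (\<integral>\<^sup>+w. hk \<epsilon> (w - x) * hk t (y - w) \<partial>lborel) \<partial>lborel)"
    by (subst nn_integral_cmult[symmetric]) (auto simp: ac_simps intro!: nn_integral_cong)
  also have "\<dots> = disc_prob (\<epsilon> + t) x"
    unfolding disc_prob_def hk_def chapman_kolmogorov[OF assms] ..
  finally show ?thesis .
qed

lemma disc_prob_first: "(\<integral>\<^sup>+w. hk \<epsilon> (w - x) * indicator (ball 0 1) w \<partial>lborel) = disc_prob \<epsilon> x"
  unfolding disc_prob_def by (simp add: mult.commute)

text \<open>A heat step taken first loses exactly the discounted time spent in the disk before
  \<open>\<epsilon>\<close>.\<close>

lemma disc_pot_superharmonic: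
  assumes \<epsilon>: "0 < \<epsilon>"
  shows "ennreal (exp (- l * \<epsilon>)) * (\<integral>\<^sup>+w. hk \<epsilon> (w - x) * disc_pot l w \<partial>lborel) \<le> disc_pot l x"
proof -
  have "(\<integral>\<^sup>+w. hk \<epsilon> (w - x) * disc_pot l w \<partial>lborel) = (\<integral>\<^sup>+w. \<integral>\<^sup>+t. hk \<epsilon> (w - x) * (expw l t * disc_prob t w) \<partial>lborel \<partial>lborel)"
    unfolding disc_pot_def by (intro nn_integral_cong nn_integral_cmult[symmetric]) measurable
  also have "\<dots> = (\<integral>\<^sup>+t. \<integral>\<^sup>+w. hk \<epsilon> (w - x) * (expw l t * disc_prob t w) \<partial>lborel \<partial>lborel)"
    by (rule lborel_pair.Fubini') measurable
  also have "\<dots> = (\<integral>\<^sup>+t. expw l t * disc_prob (\<epsilon> + t) x \<partial>lborel)"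
  proof (rule nn_integral_cong)
    fix t
    have "(\<integral>\<^sup>+w. hk \<epsilon> (w - x) * (expw l t * disc_prob t w) \<partial>lborel) = expw l t * (\<integral>\<^sup>+w. hk \<epsilon> (w - x) * disc_prob t w \<partial>lborel)"
      by (subst nn_integral_cmult[symmetric]) (auto simp: ac_simps)
    thus "(\<integral>\<^sup>+w. hk \<epsilon> (w - x) * (expw l t * disc_prob t w) \<partial>lborel) = expw l t * disc_prob (\<epsilon> + t) x"
      by (cases "0 < t") (simp_all add: disc_prob_step[OF \<epsilon>] expw_def)
  qed
  finally have "ennreal (exp (- l * \<epsilon>)) * (\<integral>\<^sup>+w. hk \<epsilon> (w - x) * disc_pot l w \<partial>lborel) =
      (\<integral>\<^sup>+t. ennreal (exp (- l * \<epsilon>)) * (expw l t * disc_prob (\<epsilon> + t) x) \<partial>lborel)"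
    by (simp add: nn_integral_cmult)
  also have "\<dots> \<le> (\<integral>\<^sup>+t. expw l (\<epsilon> + t) * disc_prob (\<epsilon> + t) x \<partial>lborel)"
  proof (rule nn_integral_mono)
    fix t
    show "ennreal (exp (- l * \<epsilon>)) * (expw l t * disc_prob (\<epsilon> + t) x) \<le> expw l (\<epsilon> + t) * disc_prob (\<epsilon> + t) x"
      using \<epsilon> by (cases "0 < t") (simp_all add: expw_add ac_simps, simp add: expw_def)
  qed
  also have "\<dots> = disc_pot l x"
    unfolding disc_pot_def by (rule nn_integral_shift[symmetric]) measurable
  finally show ?thesis .
qed

text \<open>Discrete maximum principle: inside the disk only the constants are compared; outside,
  \<open>hit_green\<close> is a discounted average of its predecessor, while \<open>disc_pot\<close>
  dominates its own discounted average. The bound is the same for every grid.\<close>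

lemma hit_green_upper:
  assumes \<epsilon>: "0 < \<epsilon>" and m: "\<And>x. x \<in> ball 0 1 \<Longrightarrow> m \<le> disc_pot l x" and C: "\<And>x. x \<in> ball 0 1 \<Longrightarrow> green l (y - x) \<le> C"
  shows "m * hit_green n \<epsilon> l y x \<le> C * disc_pot l x"
proof (induction n arbitrary: x)
  have inn: "m * hit_green n \<epsilon> l y x \<le> C * disc_pot l x" if "x \<in> ball 0 1" for n x
    using mult_mono[OF m[OF that] C[OF that]] by (simp add: hit_green_in[OF that] mult.commute)
  {
    case 0 show ?case using inn[of x] hit_green_0[of x \<epsilon> l y] \<epsilon> by (cases "x \<in> ball 0 1") auto
  next
    case (Suc n)
    show ?case
    proof (cases "x \<in> ball 0 1")
      case True thus ?thesis by (rule inn)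
    next
      case False
      have "m * hit_green (Suc n) \<epsilon> l y x = ennreal (exp (- l * \<epsilon>)) * (\<integral>\<^sup>+w. hk \<epsilon> (w - x) * (m * hit_green n \<epsilon> l y w) \<partial>lborel)"
        unfolding hit_green_Suc[OF False \<epsilon>]
        by (subst mult.left_commute, subst nn_integral_cmult[symmetric]) (auto simp: ac_simps)
      also have "\<dots> \<le> ennreal (exp (- l * \<epsilon>)) * (\<integral>\<^sup>+w. hk \<epsilon> (w - x) * (C * disc_pot l w) \<partial>lborel)"
        by (intro mult_left_mono nn_integral_mono Suc.IH) auto
      also have "\<dots> = C * (ennreal (exp (- l * \<epsilon>)) * (\<integral>\<^sup>+w. hk \<epsilon> (w - x) * disc_pot l w \<partial>lborel))"
        by (subst mult.left_commute, subst (2) nn_integral_cmult[symmetric]) (auto simp: ac_simps)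
      also have "\<dots> \<le> C * disc_pot l x"
        by (intro mult_left_mono disc_pot_superharmonic \<epsilon>) auto
      finally show ?thesis .
    qed
  }
qed

text \<open>A Riemann sum of mesh \<open>\<epsilon>\<close> for \<open>disc_pot\<close>. Outside the
  disk it satisfies the recursion of \<open>hit_green_Suc\<close> with equality, where
  \<open>disc_pot\<close> has only an inequality, in the direction that serves the upper
  bound.\<close>

primrec disc_sum :: "nat \<Rightarrow> real \<Rightarrow> real \<Rightarrow> complex \<Rightarrow> ennreal" where
  "disc_sum 0 \<epsilon> l x = ennreal \<epsilon> * indicator (ball 0 1) x"
| "disc_sum (Suc n) \<epsilon> l x = ennreal \<epsilon> * indicator (ball 0 1) x + ennreal (exp (- l * \<epsilon>)) * (\<integral>\<^sup>+w. hk \<epsilon> (w - x) * disc_sum n \<epsilon> l w \<partial>lborel)"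

lemma measurable_disc_sum [measurable]: "disc_sum n \<epsilon> l \<in> borel_measurable borel"
proof (induction n)
  case (Suc n)
  note [measurable] = Suc
  show ?case unfolding disc_sum.simps by measurable
qed simp

lemma disc_sum_eq:
  assumes \<epsilon>: "0 < \<epsilon>"
  shows "disc_sum n \<epsilon> l x = ennreal \<epsilon> * indicator (ball 0 1) x + (\<Sum>k<n. ennreal \<epsilon> * (expw l (real (Suc k) * \<epsilon>) * disc_prob (real (Suc k) * \<epsilon>) x))"
proof (induction n arbitrary: x)
  case 0 show ?case by simp
next
  case (Suc n)
  let ?e = "ennreal (exp (- l * \<epsilon>))"
  have "(\<integral>\<^sup>+w. hk \<epsilon> (w - x) * disc_sum n \<epsilon> l w \<partial>lborel) =
    (\<integral>\<^sup>+w. ennreal \<epsilon> * (hk \<epsilon> (w - x) * indicator (ball 0 1) w) + (\<Sum>k<n. ennreal \<epsilon> * expw l (real (Suc k) * \<epsilon>) * (hk \<epsilon> (w - x) * disc_prob (real (Suc k) * \<epsilon>) w)) \<partial>lborel)"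
    unfolding Suc.IH by (intro nn_integral_cong) (simp add: distrib_left sum_distrib_left ac_simps)
  also have "\<dots> = ennreal \<epsilon> * disc_prob \<epsilon> x + (\<Sum>k<n. ennreal \<epsilon> * expw l (real (Suc k) * \<epsilon>) * disc_prob (\<epsilon> + real (Suc k) * \<epsilon>) x)"
    using \<epsilon> by (subst nn_integral_add) (simp_all add: nn_integral_sum nn_integral_cmult disc_prob_first disc_prob_step add_pos_nonneg)
  finally have *: "?e * (\<integral>\<^sup>+w. hk \<epsilon> (w - x) * disc_sum n \<epsilon> l w \<partial>lborel) =
     ennreal \<epsilon> * (?e * disc_prob \<epsilon> x) + (\<Sum>k<n. ennreal \<epsilon> * (?e * expw l (real (Suc k) * \<epsilon>) * disc_prob (\<epsilon> + real (Suc k) * \<epsilon>) x))"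
    by (simp add: distrib_left sum_distrib_left ac_simps)
  have e: "?e * expw l (real (Suc k) * \<epsilon>) = expw l (real (Suc (Suc k)) * \<epsilon>)" for k
  proof -
    have "real (Suc (Suc k)) * \<epsilon> = \<epsilon> + real (Suc k) * \<epsilon>" by (simp add: algebra_simps)
    moreover have "0 < real (Suc k) * \<epsilon>" using \<epsilon> by simp
    ultimately show ?thesis using \<epsilon> expw_add[of \<epsilon> "real (Suc k) * \<epsilon>" l] by (simp only: mult.commute less_imp_le)
  qed
  have e0: "expw l (real (Suc 0) * \<epsilon>) = ?e" using \<epsilon> by (simp add: expw_def)
  have d: "\<epsilon> + real (Suc k) * \<epsilon> = real (Suc (Suc k)) * \<epsilon>" for k by (simp add: algebra_simps)
  have "disc_sum (Suc n) \<epsilon> l x = ennreal \<epsilon> * indicator (ball 0 1) x + (ennreal \<epsilon> * (expw l (real (Suc 0) * \<epsilon>) * disc_prob (real (Suc 0) * \<epsilon>) x)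
      + (\<Sum>k<n. ennreal \<epsilon> * (expw l (real (Suc (Suc k)) * \<epsilon>) * disc_prob (real (Suc (Suc k)) * \<epsilon>) x)))"
    unfolding disc_sum.simps * e d e0 by simp
  thus ?case by (simp only: sum.lessThan_Suc_shift)
qed

text \<open>The opposite comparison: in the disk \<open>M\<close> absorbs \<open>disc_sum\<close>,
  and outside both sides obey the same recursion.\<close>

lemma hit_green_lower:
  assumes \<epsilon>: "0 < \<epsilon>" and M: "\<And>n x. disc_sum n \<epsilon> l x \<le> M" and C: "\<And>x. x \<in> ball 0 1 \<Longrightarrow> C \<le> green l (y - x)"
  shows "C * disc_sum n \<epsilon> l x \<le> M * hit_green n \<epsilon> l y x"
proof (induction n arbitrary: x)
  have inn: "C * disc_sum n \<epsilon> l x \<le> M * hit_green n \<epsilon> l y x" if "x \<in> ball 0 1" for n x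
    using mult_mono[OF C[OF that] M[of n x]] by (simp add: hit_green_in[OF that] mult.commute)
  {
    case 0 show ?case using inn[of x 0] by (cases "x \<in> ball 0 1") auto
  next
    case (Suc n)
    show ?case
    proof (cases "x \<in> ball 0 1")
      case True thus ?thesis by (rule inn)
    next
      case False
      have "C * disc_sum (Suc n) \<epsilon> l x = ennreal (exp (- l * \<epsilon>)) * (\<integral>\<^sup>+w. hk \<epsilon> (w - x) * (C * disc_sum n \<epsilon> l w) \<partial>lborel)"
        using False
        by (simp, subst mult.left_commute, subst nn_integral_cmult[symmetric]) (auto simp: ac_simps)
      also have "\<dots> \<le> ennreal (exp (- l * \<epsilon>)) * (\<integral>\<^sup>+w. hk \<epsilon> (w - x) * (M * hit_green n \<epsilon> l y w) \<partial>lborel)"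
        by (intro mult_left_mono nn_integral_mono Suc.IH) auto
      also have "\<dots> = M * (ennreal (exp (- l * \<epsilon>)) * (\<integral>\<^sup>+w. hk \<epsilon> (w - x) * hit_green n \<epsilon> l y w \<partial>lborel))"
        by (subst mult.left_commute, subst (2) nn_integral_cmult[symmetric]) (auto simp: ac_simps)
      finally show ?thesis unfolding hit_green_Suc[OF False \<epsilon>] .
    qed
  }
qed

section \<open>Laplace transform of the hitting mass\<close>

text \<open>The distance 2 excludes the small loops in and near the disk, whose mass is infinite,
  and keeps \<open>norm z - 1\<close> comparable with \<open>norm z + 1\<close>.\<close>

definition far_hit :: "rooted_loop set" where
  "far_hit = {x. 2 \<le> norm (fst x) \<and> trace x \<inter> ball 0 1 \<noteq> {}}"

text \<open>The duration as a factor cancels one power in \<open>loop_weight\<close> and leaves the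
  heat kernel on the diagonal, see \<open>loop_weight_expw\<close>.\<close>

definition hit_laplace :: "real \<Rightarrow> ennreal" where
  "hit_laplace l = (\<integral>\<^sup>+x. ennreal (fst (snd x) * exp (- l * fst (snd x))) * indicator far_hit x \<partial>loop_meas)"

abbreviation far :: "complex \<Rightarrow> ennreal" where
  "far \<equiv> indicator {z. 2 \<le> norm z}"

lemma sets_far_hit [measurable]: "far_hit \<in> sets loop_meas"
proof -
  note [measurable] = pred_trace_hits_open[of "ball 0 1"]
  have "{x \<in> space loop_meas. 2 \<le> norm (fst x) \<and> trace x \<inter> ball 0 1 \<noteq> {}} \<in> sets loop_meas" by measurable
  thus ?thesis by (simp add: far_hit_def)
qed

lemma hk_0: "0 < t \<Longrightarrow> hk t 0 = ennreal (1 / (2 * pi * t))"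
  by (simp add: hk_def heat_def)

lemma loop_weight_expw: "loop_weight t * ennreal (t * exp (- l * t)) = expw l t * hk t 0"
  by (cases "0 < t") (auto simp: loop_weight_def expw_def hk_0 ennreal_mult[symmetric] power2_eq_square)

lemma nn_integral_far:
  assumes Q: "Measurable.pred loop_meas Q"
  shows "(\<integral>\<^sup>+x. ennreal (fst (snd x) * exp (- l * fst (snd x))) * indicator {x. 2 \<le> norm (fst x) \<and> Q x} x \<partial>loop_meas) =
    (\<integral>\<^sup>+z. far z * (\<integral>\<^sup>+t. expw l t * (hk t 0 * emeasure gauss {\<omega>. Q (z, t, \<omega>)}) \<partial>lborel) \<partial>lborel)"
proof -
  have Q'[measurable]: "Measurable.pred (borel \<Otimes>\<^sub>M (borel \<Otimes>\<^sub>M gauss)) Q"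
    using Q measurable_cong_sets[OF sets_loop_meas refl] by blast
  have Qs: "{\<omega>. Q (z, t, \<omega>)} \<in> sets gauss" for z t
  proof -
    have "{\<omega> \<in> space gauss. Q (z, t, \<omega>)} \<in> sets gauss" by measurable
    thus ?thesis by simp
  qed
  have e: "emeasure gauss {\<omega>. Q (z, t, \<omega>)} = (\<integral>\<^sup>+\<omega>. (if Q (z, t, \<omega>) then 1 else 0) \<partial>gauss)" for z t
  proof -
    have "emeasure gauss {\<omega>. Q (z, t, \<omega>)} = (\<integral>\<^sup>+\<omega>. indicator {\<omega>. Q (z, t, \<omega>)} \<omega> \<partial>gauss)" using Qs by simp
    thus ?thesis by (simp add: indicator_def of_bool_def)
  qed
  have m[measurable]: "(\<lambda>x. ennreal (fst (snd x) * exp (- l * fst (snd x))) * indicator {x. 2 \<le> norm (fst x) \<and> Q x} x) \<in> borel_measurable loop_meas"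
    unfolding measurable_cong_sets[OF sets_loop_meas refl] by measurable
  have "(\<integral>\<^sup>+x. ennreal (fst (snd x) * exp (- l * fst (snd x))) * indicator {x. 2 \<le> norm (fst x) \<and> Q x} x \<partial>loop_meas) =
     (\<integral>\<^sup>+z. \<integral>\<^sup>+t. loop_weight t * (\<integral>\<^sup>+\<omega>. ennreal (t * exp (- l * t)) * (far z * (if Q (z, t, \<omega>) then 1 else 0)) \<partial>gauss) \<partial>lborel \<partial>lborel)"
    unfolding nn_integral_loop_meas[OF m]
    by (intro nn_integral_cong arg_cong2[where f="(*)"] refl) (auto simp: indicator_def)
  also have "\<dots> = (\<integral>\<^sup>+z. \<integral>\<^sup>+t. far z * (expw l t * (hk t 0 * emeasure gauss {\<omega>. Q (z, t, \<omega>)})) \<partial>lborel \<partial>lborel)"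
  proof (intro nn_integral_cong)
    fix z t
    let ?I = "\<integral>\<^sup>+\<omega>. (if Q (z, t, \<omega>) then 1 else 0) \<partial>gauss"
    have "(\<integral>\<^sup>+\<omega>. ennreal (t * exp (- l * t)) * (far z * (if Q (z, t, \<omega>) then 1 else 0)) \<partial>gauss) = ennreal (t * exp (- l * t)) * (\<integral>\<^sup>+\<omega>. far z * (if Q (z, t, \<omega>) then 1 else 0) \<partial>gauss)"
      by (rule nn_integral_cmult) measurable
    also have "(\<integral>\<^sup>+\<omega>. far z * (if Q (z, t, \<omega>) then 1 else 0) \<partial>gauss) = far z * ?I"
      by (rule nn_integral_cmult) measurable
    finally have "loop_weight t * (\<integral>\<^sup>+\<omega>. ennreal (t * exp (- l * t)) * (far z * (if Q (z, t, \<omega>) then 1 else 0)) \<partial>gauss) =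
      (loop_weight t * ennreal (t * exp (- l * t))) * (far z * ?I)" by (simp only: mult.assoc)
    also have "\<dots> = (expw l t * hk t 0) * (far z * ?I)" by (simp only: loop_weight_expw)
    also have "\<dots> = far z * (expw l t * (hk t 0 * ?I))" by (simp only: mult_ac)
    finally show "loop_weight t * (\<integral>\<^sup>+\<omega>. ennreal (t * exp (- l * t)) * (far z * (if Q (z, t, \<omega>) then 1 else 0)) \<partial>gauss) = far z * (expw l t * (hk t 0 * emeasure gauss {\<omega>. Q (z, t, \<omega>)}))"
      by (simp only: e)
  qed
  also have "\<dots> = (\<integral>\<^sup>+z. far z * (\<integral>\<^sup>+t. expw l t * (hk t 0 * emeasure gauss {\<omega>. Q (z, t, \<omega>)}) \<partial>lborel) \<partial>lborel)"
    unfolding e by (intro nn_integral_cong nn_integral_cmult) measurable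
  finally show ?thesis .
qed

definition far_grid :: "nat \<Rightarrow> real \<Rightarrow> rooted_loop set" where
  "far_grid n \<epsilon> = {x. 2 \<le> norm (fst x) \<and> grid_hit n \<epsilon> (fst x) (fst x) (fst (snd x)) (snd (snd x))}"

lemma pred_grid_hit_loop: "Measurable.pred loop_meas (\<lambda>x. grid_hit n \<epsilon> (fst x) (fst x) (fst (snd x)) (snd (snd x)))"
  unfolding measurable_cong_sets[OF sets_loop_meas refl] by measurable

lemma sets_far_grid [measurable]: "far_grid n \<epsilon> \<in> sets loop_meas"
proof -
  note [measurable] = pred_grid_hit_loop
  have "{x \<in> space loop_meas. 2 \<le> norm (fst x) \<and> grid_hit n \<epsilon> (fst x) (fst x) (fst (snd x)) (snd (snd x))} \<in> sets loop_meas" by measurable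
  thus ?thesis by (simp add: far_grid_def)
qed

lemma nn_integral_far_grid:
  "(\<integral>\<^sup>+x. ennreal (fst (snd x) * exp (- l * fst (snd x))) * indicator (far_grid n \<epsilon>) x \<partial>loop_meas) =
    (\<integral>\<^sup>+z. far z * hit_green n \<epsilon> l z z \<partial>lborel)"
  unfolding far_grid_def nn_integral_far[OF pred_grid_hit_loop] hit_green_def grid_prob_def by simp

lemma far_grid_subset: "0 < \<epsilon> \<Longrightarrow> 0 < fst (snd x) \<Longrightarrow> x \<in> far_grid n \<epsilon> \<Longrightarrow> x \<in> far_hit"
proof -
  assume \<epsilon>: "0 < \<epsilon>" and t: "0 < fst (snd x)" and "x \<in> far_grid n \<epsilon>"
  then obtain k where k: "2 \<le> norm (fst x)" "real k * \<epsilon> \<le> fst (snd x)"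
    "fst x + of_real (sqrt (fst (snd x))) * bridge (real k * \<epsilon> / fst (snd x)) (snd (snd x)) \<in> ball 0 1"
    by (auto simp: far_grid_def grid_hit_def)
  hence "loop_path x (real k * \<epsilon> / fst (snd x)) \<in> trace x \<inter> ball 0 1"
    using \<epsilon> t by (auto simp: trace_def loop_path_def)
  thus "x \<in> far_hit" using k(1) unfolding far_hit_def by blast
qed

text \<open>Mesh \<open>1 / 2 ^ j\<close> with \<open>4 ^ j\<close> steps reaches time
  \<open>2 ^ j\<close>, so that for a given loop both the fineness and the length of the grid
  eventually suffice.\<close>

lemma eventually_far_grid:
  assumes t: "0 < fst (snd x)" and x: "x \<in> far_hit"
  shows "\<forall>\<^sub>F j in sequentially. x \<in> far_grid (4 ^ j) (1 / 2 ^ j)"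
proof -
  obtain z t \<omega> where xx: "x = (z, t, \<omega>)" by (cases x) auto
  have t: "0 < t" using t xx by simp
  obtain s where s: "s \<in> {0..1}" "loop_path x s \<in> ball 0 1" using x unfolding far_hit_def trace_def by blast
  have c: "continuous_on {0..t} (\<lambda>r. loop_path x (r / t))"
    using t by (intro continuous_on_compose2[OF continuous_loop_path[of UNIV]] continuous_intros) auto
  have st: "s * t \<in> {0..t}" "loop_path x (s * t / t) \<in> ball 0 1" using s t by (auto simp: mult_le_cancel_right1)
  from grid_near[OF c open_ball st] obtain \<delta> where \<delta>: "\<delta> > 0"
    "\<And>\<epsilon>. 0 < \<epsilon> \<Longrightarrow> \<epsilon> < \<delta> \<Longrightarrow> (\<exists>k::nat. real k * \<epsilon> \<le> t \<and> loop_path x (real k * \<epsilon> / t) \<in> ball 0 1)" by metis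
  have "(\<lambda>j. (1 / 2 ^ j) :: real) \<longlonglongrightarrow> 0" using LIMSEQ_power_zero[of "1/2::real"] by (simp add: power_divide)
  hence "\<forall>\<^sub>F j in sequentially. (1 / 2 ^ j :: real) < \<delta>" using \<delta>(1) by (rule order_tendstoD)
  moreover have "filterlim (\<lambda>j. 2 ^ j :: real) at_top sequentially"
    by real_asymp
  hence "\<forall>\<^sub>F j in sequentially. t \<le> 2 ^ j" by (simp add: filterlim_at_top)
  ultimately show ?thesis
  proof eventually_elim
    case (elim j)
    obtain k :: nat where k: "real k * (1 / 2 ^ j) \<le> t" "loop_path x (real k * (1 / 2 ^ j) / t) \<in> ball 0 1"
      using \<delta>(2)[of "1 / 2 ^ j"] elim by auto
    have "real k \<le> t * 2 ^ j" using k(1) by (simp add: field_simps)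
    also have "\<dots> \<le> 2 ^ j * 2 ^ j" using elim by (intro mult_right_mono) auto
    also have "\<dots> = real (4 ^ j)" by (simp flip: power_mult_distrib)
    finally have "k \<le> 4 ^ j" by (simp only: of_nat_le_iff)
    thus ?case using k x xx unfolding far_grid_def grid_hit_def far_hit_def loop_path_def
      by (auto intro!: bexI[of _ k])
  qed
qed

lemma AE_loop_meas_pos: "AE x in loop_meas. 0 < fst (snd x)"
  unfolding loop_meas_def by (subst AE_density) (auto simp: loop_weight_def)

definition greenr :: "real \<Rightarrow> real \<Rightarrow> ennreal" where
  "greenr l r = green l (of_real r)"

lemma hk_mono: "norm x \<le> norm y \<Longrightarrow> 0 < t \<Longrightarrow> hk t y \<le> hk t x"
  unfolding hk_def heat_def by (intro ennreal_leI divide_right_mono) (auto intro!: divide_right_mono power_mono)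

lemma green_mono: "norm x \<le> norm y \<Longrightarrow> green l y \<le> green l x"
  unfolding green_def by (intro nn_integral_mono) (auto simp: expw_def intro!: mult_left_mono hk_mono)

lemma measurable_greenr [measurable (raw)]:
  assumes [measurable]: "f \<in> borel_measurable M"
  shows "(\<lambda>x. greenr l (f x)) \<in> borel_measurable M"
  unfolding greenr_def by measurable

lemma green_disc_bounds:
  assumes x: "x \<in> ball 0 1" and z: "2 \<le> norm z"
  shows "green l (z - x) \<le> greenr l (norm z - 1)" "greenr l (norm z + 1) \<le> green l (z - x)"
proof -
  have "norm z - 1 \<le> norm (z - x)" using x norm_triangle_ineq2[of z x] by simp
  thus "green l (z - x) \<le> greenr l (norm z - 1)"
    using z unfolding greenr_def by (intro green_mono) (simp add: norm_of_real del: of_real_diff of_real_1)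
  have "norm (z - x) \<le> norm z + 1" using x norm_triangle_ineq4[of z x] by simp
  thus "greenr l (norm z + 1) \<le> green l (z - x)"
    using z unfolding greenr_def by (intro green_mono) (simp add: norm_of_real del: of_real_add of_real_1)
qed

text \<open>Fatou along dyadic grids: every loop of \<open>far_hit\<close> is eventually seen by the
  grid, and \<open>hit_green_upper\<close> with \<open>x = y = z\<close> gives the same bound for
  all grids.\<close>

lemma hit_laplace_upper:
  assumes m: "0 < m" "\<And>x. x \<in> ball 0 1 \<Longrightarrow> ennreal m \<le> disc_pot l x"
  shows "hit_laplace l \<le> ennreal (1 / m) * (\<integral>\<^sup>+z. far z * (greenr l (norm z - 1) * disc_pot l z) \<partial>lborel)"
proof -
  define W where "W x = ennreal (fst (snd x) * exp (- l * fst (snd x)))" for x :: rooted_loop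
  have [measurable]: "W \<in> borel_measurable loop_meas"
    unfolding W_def measurable_cong_sets[OF sets_loop_meas refl] by measurable
  let ?G = "\<lambda>j. far_grid (4 ^ j) (1 / 2 ^ j)"
  have "hit_laplace l \<le> (\<integral>\<^sup>+x. liminf (\<lambda>j. W x * indicator (?G j) x) \<partial>loop_meas)"
    unfolding hit_laplace_def W_def[symmetric]
  proof (rule nn_integral_mono_AE)
    show "AE x in loop_meas. W x * indicator far_hit x \<le> liminf (\<lambda>j. W x * indicator (?G j) x)"
      using AE_loop_meas_pos
    proof eventually_elim
      case (elim x)
      show ?case
      proof (cases "x \<in> far_hit")
        case True
        have "\<forall>\<^sub>F j in sequentially. W x \<le> W x * indicator (?G j) x"
          using eventually_far_grid[OF elim True] by eventually_elim simp
        hence "W x \<le> liminf (\<lambda>j. W x * indicator (?G j) x)" by (rule Liminf_bounded)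
        thus ?thesis using True by simp
      qed simp
    qed
  qed
  also have "\<dots> \<le> liminf (\<lambda>j. \<integral>\<^sup>+x. W x * indicator (?G j) x \<partial>loop_meas)"
    by (rule nn_integral_liminf) measurable
  also have "\<dots> \<le> liminf (\<lambda>j::nat. ennreal (1 / m) * (\<integral>\<^sup>+z. far z * (greenr l (norm z - 1) * disc_pot l z) \<partial>lborel))"
  proof (intro Liminf_mono always_eventually allI)
    fix j
    have "(\<integral>\<^sup>+x. W x * indicator (?G j) x \<partial>loop_meas) = (\<integral>\<^sup>+z. far z * hit_green (4 ^ j) (1 / 2 ^ j) l z z \<partial>lborel)"
      unfolding W_def by (rule nn_integral_far_grid)
    also have "\<dots> \<le> (\<integral>\<^sup>+z. ennreal (1 / m) * (far z * (greenr l (norm z - 1) * disc_pot l z)) \<partial>lborel)"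
    proof (rule nn_integral_mono)
      fix z
      show "far z * hit_green (4 ^ j) (1 / 2 ^ j) l z z \<le> ennreal (1 / m) * (far z * (greenr l (norm z - 1) * disc_pot l z))"
      proof (cases "2 \<le> norm z")
        case True
        have "ennreal m * hit_green (4 ^ j) (1 / 2 ^ j) l z z \<le> greenr l (norm z - 1) * disc_pot l z"
          by (rule hit_green_upper) (use m green_disc_bounds(1) True in auto)
        hence "ennreal (1 / m) * (ennreal m * hit_green (4 ^ j) (1 / 2 ^ j) l z z) \<le> ennreal (1 / m) * (greenr l (norm z - 1) * disc_pot l z)"
          by (intro mult_left_mono) auto
        moreover have "ennreal (1 / m) * ennreal m = 1" using m by (simp add: ennreal_mult[symmetric])
        ultimately show ?thesis using True by (simp add: mult.assoc[symmetric])
      qed simp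
    qed
    also have "\<dots> = ennreal (1 / m) * (\<integral>\<^sup>+z. far z * (greenr l (norm z - 1) * disc_pot l z) \<partial>lborel)"
      by (rule nn_integral_cmult) measurable
    finally show "(\<integral>\<^sup>+x. W x * indicator (?G j) x \<partial>loop_meas) \<le> \<dots>" .
  qed
  also have "\<dots> = ennreal (1 / m) * (\<integral>\<^sup>+z. far z * (greenr l (norm z - 1) * disc_pot l z) \<partial>lborel)"
    by (rule Liminf_const) simp
  finally show ?thesis .
qed

lemma emeasure_unit_ball: "emeasure lborel (ball (0::complex) 1) = ennreal pi"
  by (simp add: emeasure_ball eval_unit_ball_vol)

lemma nn_integral_unit_ball: "integral\<^sup>N lborel (indicator (ball (0::complex) 1)) = ennreal pi"
  by (subst nn_integral_indicator) (simp_all add: emeasure_unit_ball)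

text \<open>The disk has area \<open>pi\<close>, and all its points lie within
  \<open>norm z + 1\<close> of \<open>z\<close>.\<close>

lemma disc_prob_lower:
  assumes t: "0 < t"
  shows "ennreal pi * hk t (of_real (norm z + 1)) \<le> disc_prob t z"
proof -
  have "ennreal pi * hk t (of_real (norm z + 1)) = (\<integral>\<^sup>+y. indicator (ball (0::complex) 1) y * hk t (of_real (norm z + 1)) \<partial>lborel)"
    by (subst nn_integral_multc, measurable) (simp add: nn_integral_unit_ball del: of_real_add)
  also have "\<dots> \<le> disc_prob t z"
    unfolding disc_prob_def
  proof (intro nn_integral_mono)
    fix y
    show "indicator (ball 0 1) y * hk t (of_real (norm z + 1)) \<le> indicator (ball 0 1) y * hk t (y - z)"
    proof (cases "y \<in> ball 0 1")
      case True
      have "norm (y - z) \<le> norm z + 1" using True norm_triangle_ineq4[of y z] by simp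
      hence "norm (y - z) \<le> norm (complex_of_real (norm z + 1))" by (simp only: norm_of_real)
      thus ?thesis using True t by (simp add: hk_mono del: of_real_add)
    qed simp
  qed
  finally show ?thesis .
qed

lemma greenr_disc_pot: "ennreal pi * greenr l (norm z + 1) \<le> disc_pot l z"
proof -
  have "ennreal pi * greenr l (norm z + 1) = (\<integral>\<^sup>+t. expw l t * (ennreal pi * hk t (of_real (norm z + 1))) \<partial>lborel)"
    unfolding greenr_def green_def by (subst nn_integral_cmult[symmetric]) (auto simp: ac_simps)
  also have "\<dots> \<le> disc_pot l z"
    unfolding disc_pot_def by (intro nn_integral_mono) (auto simp: expw_def simp del: of_real_add intro!: mult_left_mono disc_prob_lower)
  finally show ?thesis .
qed

text \<open>A grid never counts a loop outside \<open>far_hit\<close>, so each grid gives a lower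
  bound. It remains to pass from the Riemann sums \<open>disc_sum\<close> to an integral over the
  duration, by step functions that converge pointwise and by Fatou, once for the duration and once
  for the root.\<close>

lemma hit_laplace_lower:
  assumes M: "\<And>n \<epsilon> x. 0 < \<epsilon> \<Longrightarrow> \<epsilon> \<le> 1 \<Longrightarrow> disc_sum n \<epsilon> l x \<le> M" and fin: "\<And>z::complex. greenr l (norm z + 1) < \<infinity>"
  shows "(\<integral>\<^sup>+z. far z * (greenr l (norm z + 1) * (ennreal pi * greenr l (norm z + 1))) \<partial>lborel) \<le> M * hit_laplace l"
proof -
  define W where "W x = ennreal (fst (snd x) * exp (- l * fst (snd x)))" for x :: rooted_loop
  define e where "e j = (1 / 2 ^ j :: real)" for j :: nat
  define N where "N j = (4 ^ j :: nat)" for j :: nat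
  have e: "0 < e j" "e j \<le> 1" for j by (auto simp: e_def)
  define c where "c z = far z * greenr l (norm z + 1)" for z :: complex
  have [measurable]: "c \<in> borel_measurable borel" unfolding c_def by measurable
  \<comment> \<open>Multiplying a limit in \<open>ennreal\<close> by \<open>c z\<close> requires
    this factor to be finite; this is the purpose of \<open>fin\<close>.\<close>
  have cfin: "c z < top" for z using fin[of z] by (auto simp: c_def indicator_def ennreal_mult_less_top)
  define G where "G z t = expw l t * (ennreal pi * hk t (of_real (norm z + 1)))" for z :: complex and t :: real
  have [measurable]: "(\<lambda>x. G (f x) (g x)) \<in> borel_measurable Q" if [measurable]: "f \<in> borel_measurable Q" "g \<in> borel_measurable Q" for f g and Q :: "(complex \<times> real) measure"
    unfolding G_def by measurable
  have [measurable]: "(\<lambda>z. G z t) \<in> borel_measurable borel" "G z \<in> borel_measurable borel" for z t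
    unfolding G_def by measurable
  \<comment> \<open>Step function with the value of \<open>G z\<close> at the left end of each
    dyadic cell; the cell touching 0 is left out, which is harmless in the limit for fixed
    \<open>t > 0\<close>.\<close>
  define \<phi> where "\<phi> j z t = (\<Sum>k<N j. indicator {real (Suc k) * e j..<real (Suc k) * e j + e j} t * G z (real (Suc k) * e j))" for j and z :: complex and t :: real
  have [measurable]: "(\<lambda>x. \<phi> j (fst x) (snd x)) \<in> borel_measurable (borel \<Otimes>\<^sub>M borel)" for j
    unfolding \<phi>_def by measurable
  have [measurable]: "\<phi> j z \<in> borel_measurable borel" for j z
    unfolding \<phi>_def by measurable
  have step: "(\<integral>\<^sup>+z. \<integral>\<^sup>+t. c z * \<phi> j z t \<partial>lborel \<partial>lborel) \<le> M * hit_laplace l" for j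
  proof -
    have "(\<integral>\<^sup>+t. c z * \<phi> j z t \<partial>lborel) \<le> M * (far z * hit_green (N j) (e j) l z z)" for z
    proof -
      have "(\<integral>\<^sup>+t. \<phi> j z t \<partial>lborel) = (\<Sum>k<N j. ennreal (e j) * G z (real (Suc k) * e j))"
        unfolding \<phi>_def using e[of j] by (subst nn_integral_sum) (auto simp: nn_integral_multc intro!: sum.cong)
      also have "\<dots> \<le> (\<Sum>k<N j. ennreal (e j) * (expw l (real (Suc k) * e j) * disc_prob (real (Suc k) * e j) z))"
        unfolding G_def using e[of j] by (intro sum_mono mult_left_mono disc_prob_lower) auto
      also have "\<dots> \<le> disc_sum (N j) (e j) l z"
        unfolding disc_sum_eq[OF e(1)] by simp
      finally have 1: "(\<integral>\<^sup>+t. \<phi> j z t \<partial>lborel) \<le> disc_sum (N j) (e j) l z" .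
      show ?thesis
      proof (cases "2 \<le> norm z")
        case True
        have "(\<integral>\<^sup>+t. c z * \<phi> j z t \<partial>lborel) = greenr l (norm z + 1) * (\<integral>\<^sup>+t. \<phi> j z t \<partial>lborel)"
          using True by (simp add: c_def nn_integral_cmult)
        also have "\<dots> \<le> greenr l (norm z + 1) * disc_sum (N j) (e j) l z" using 1 by (intro mult_left_mono) auto
        also have "\<dots> \<le> M * hit_green (N j) (e j) l z z"
          by (rule hit_green_lower) (use e M green_disc_bounds(2) True in auto)
        finally show ?thesis using True by simp
      qed (simp add: c_def)
    qed
    hence "(\<integral>\<^sup>+z. \<integral>\<^sup>+t. c z * \<phi> j z t \<partial>lborel \<partial>lborel) \<le> (\<integral>\<^sup>+z. M * (far z * hit_green (N j) (e j) l z z) \<partial>lborel)"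
      by (rule nn_integral_mono)
    also have "\<dots> = M * (\<integral>\<^sup>+z. far z * hit_green (N j) (e j) l z z \<partial>lborel)"
      by (rule nn_integral_cmult) measurable
    also have "(\<integral>\<^sup>+z. far z * hit_green (N j) (e j) l z z \<partial>lborel) = (\<integral>\<^sup>+x. W x * indicator (far_grid (N j) (e j)) x \<partial>loop_meas)"
      unfolding W_def by (rule nn_integral_far_grid[symmetric])
    also have "\<dots> \<le> hit_laplace l"
      unfolding hit_laplace_def W_def[symmetric]
      by (rule nn_integral_mono_AE, use AE_loop_meas_pos in eventually_elim)
         (use far_grid_subset[OF e(1)] in \<open>auto simp: indicator_def\<close>)
    finally show ?thesis by (simp add: mult_left_mono)
  qed
  have lim: "(\<lambda>j. c z * \<phi> j z t) \<longlonglongrightarrow> c z * G z t" if t: "0 < t" for z t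
  proof (rule ennreal_tendsto_cmult[OF cfin])
    define k where "k j = nat \<lfloor>t * 2 ^ j\<rfloor>" for j
    have k: "real (k j) * e j \<le> t" "t < real (k j) * e j + e j" for j
    proof -
      have "0 \<le> t * 2 ^ j" using t by simp
      hence "real (k j) \<le> t * 2 ^ j" "t * 2 ^ j < real (k j) + 1" unfolding k_def by (simp_all)
      thus "real (k j) * e j \<le> t" "t < real (k j) * e j + e j" by (simp_all add: e_def field_simps)
    qed
    have e0: "e \<longlonglongrightarrow> 0" unfolding e_def using LIMSEQ_power_zero[of "1/2::real"] by (simp add: power_divide)
    have kt: "(\<lambda>j. real (k j) * e j) \<longlonglongrightarrow> t"
    proof (rule tendsto_sandwich[of "\<lambda>j. t - e j"])
      show "(\<lambda>j. t - e j) \<longlonglongrightarrow> t" using tendsto_diff[OF tendsto_const e0, of t] by simp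
      show "\<forall>\<^sub>F j in sequentially. t - e j \<le> real (k j) * e j" using k by (intro always_eventually allI) (smt (verit))
      show "\<forall>\<^sub>F j in sequentially. real (k j) * e j \<le> t" using k by (intro always_eventually allI)
    qed simp
    have "(\<lambda>j. G z (real (k j) * e j)) \<longlonglongrightarrow> G z t"
    proof -
      define g where "g s = exp (- l * s) * (pi * heat s (of_real (norm z + 1)))" for s
      have "isCont g t" unfolding g_def heat_def using t by (intro continuous_intros) auto
      hence "(\<lambda>j. ennreal (g (real (k j) * e j))) \<longlonglongrightarrow> ennreal (g t)"
        using kt by (intro tendsto_ennrealI) (rule isCont_tendsto_compose)
      moreover have "G z s = ennreal (g s)" if "0 < s" for s
        using that by (simp add: G_def g_def expw_def hk_def ennreal_mult heat_nonneg)
      moreover have "\<forall>\<^sub>F j in sequentially. 0 < real (k j) * e j" using order_tendstoD(1)[OF kt t] .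
      hence "\<forall>\<^sub>F j in sequentially. ennreal (g (real (k j) * e j)) = G z (real (k j) * e j)"
        by eventually_elim (use \<open>\<And>s. 0 < s \<Longrightarrow> G z s = ennreal (g s)\<close> in simp)
      ultimately show ?thesis using t by (auto intro: Lim_transform_eventually)
    qed
    moreover have "\<forall>\<^sub>F j in sequentially. G z (real (k j) * e j) = \<phi> j z t"
    proof -
      have "filterlim (\<lambda>j. 2 ^ j :: real) at_top sequentially"
        by real_asymp
      hence "\<forall>\<^sub>F j in sequentially. t \<le> 2 ^ j" by (simp add: filterlim_at_top)
      moreover have "\<forall>\<^sub>F j in sequentially. 0 < real (k j) * e j" using order_tendstoD(1)[OF kt t] .
      ultimately show ?thesis
      proof eventually_elim
        case (elim j)
        have k0: "0 < k j" using elim(2) e[of j] by (simp add: zero_less_mult_iff)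
        have "real (k j) \<le> t * 2 ^ j" using k(1)[of j] by (simp add: e_def field_simps)
        also have "\<dots> \<le> 2 ^ j * 2 ^ j" using elim by (intro mult_right_mono) auto
        also have "\<dots> = real (4 ^ j)" by (simp flip: power_mult_distrib)
        finally have kN: "k j \<le> N j" unfolding N_def by (simp only: of_nat_le_iff)
        have "\<phi> j z t = (\<Sum>i<N j. if i = k j - 1 then G z (real (k j) * e j) else 0)"
          unfolding \<phi>_def
        proof (rule sum.cong[OF refl])
          fix i assume "i \<in> {..<N j}"
          show "indicator {real (Suc i) * e j..<real (Suc i) * e j + e j} t * G z (real (Suc i) * e j) = (if i = k j - 1 then G z (real (k j) * e j) else 0)"
          proof (cases "i = k j - 1")
            case True
            hence "Suc i = k j" using k0 by simp
            thus ?thesis using k[of j] True by (simp del: of_nat_Suc)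
          next
            case False
            have "t \<notin> {real (Suc i) * e j..<real (Suc i) * e j + e j}"
            proof
              assume a: "t \<in> {real (Suc i) * e j..<real (Suc i) * e j + e j}"
              have "real (Suc i) * e j \<le> t" "t < real (Suc i) * e j + e j" using a by (simp_all only: atLeastLessThan_iff)
              hence "real (Suc i) * e j < (real (k j) + 1) * e j" "real (k j) * e j < (real (Suc i) + 1) * e j"
                unfolding distrib_right mult_1 using k[of j] by linarith+
              hence "real (Suc i) < real (k j) + 1" "real (k j) < real (Suc i) + 1" using e[of j] by (simp_all only: mult_less_cancel_right_pos)
              thus False using False by linarith
            qed
            thus ?thesis using False by simp
          qed
        qed
        also have "\<dots> = G z (real (k j) * e j)" using k0 kN by (simp add: sum.delta)
        finally show ?case ..
      qed
    qed
    ultimately show "(\<lambda>j. \<phi> j z t) \<longlonglongrightarrow> G z t" by (rule Lim_transform_eventually)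
  qed
  have "(\<integral>\<^sup>+z. far z * (greenr l (norm z + 1) * (ennreal pi * greenr l (norm z + 1))) \<partial>lborel) = (\<integral>\<^sup>+z. \<integral>\<^sup>+t. c z * G z t \<partial>lborel \<partial>lborel)"
  proof (rule nn_integral_cong)
    fix z
    have "(\<integral>\<^sup>+t. c z * G z t \<partial>lborel) = c z * (\<integral>\<^sup>+t. G z t \<partial>lborel)" by (rule nn_integral_cmult) simp
    also have "(\<integral>\<^sup>+t. G z t \<partial>lborel) = ennreal pi * greenr l (norm z + 1)"
      unfolding G_def greenr_def green_def by (subst nn_integral_cmult[symmetric]) (auto simp: ac_simps)
    finally show "far z * (greenr l (norm z + 1) * (ennreal pi * greenr l (norm z + 1))) = (\<integral>\<^sup>+t. c z * G z t \<partial>lborel)"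
      by (simp add: c_def mult.assoc)
  qed
  also have "\<dots> \<le> (\<integral>\<^sup>+z. \<integral>\<^sup>+t. liminf (\<lambda>j. c z * \<phi> j z t) \<partial>lborel \<partial>lborel)"
  proof (intro nn_integral_mono)
    fix z t
    show "c z * G z t \<le> liminf (\<lambda>j. c z * \<phi> j z t)"
    proof (cases "0 < t")
      case True
      thus ?thesis using lim_imp_Liminf[OF _ lim[OF True]] by simp
    qed (simp add: G_def expw_def)
  qed
  also have "\<dots> \<le> (\<integral>\<^sup>+z. liminf (\<lambda>j. \<integral>\<^sup>+t. c z * \<phi> j z t \<partial>lborel) \<partial>lborel)"
    by (intro nn_integral_mono nn_integral_liminf) measurable
  also have "\<dots> \<le> liminf (\<lambda>j. \<integral>\<^sup>+z. \<integral>\<^sup>+t. c z * \<phi> j z t \<partial>lborel \<partial>lborel)"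
    by (rule nn_integral_liminf) measurable
  also have "\<dots> \<le> liminf (\<lambda>j::nat. M * hit_laplace l)"
    by (intro Liminf_mono always_eventually allI step)
  also have "\<dots> = M * hit_laplace l" by (rule Liminf_const) simp
  finally show ?thesis .
qed

section \<open>Estimates for the killed Green functions\<close>

lemma disc_prob_le_1: "0 < t \<Longrightarrow> disc_prob t x \<le> 1"
proof -
  assume t: "0 < t"
  have "disc_prob t x \<le> (\<integral>\<^sup>+y. hk t (y - x) \<partial>lborel)"
    unfolding disc_prob_def by (intro nn_integral_mono) (auto simp: indicator_def)
  also have "\<dots> = 1" unfolding hk_def by (rule nn_integral_heat[OF t])
  finally show ?thesis .
qed

lemma disc_prob_le_const:
  assumes t: "0 < t" and c: "\<And>y. y \<in> ball 0 1 \<Longrightarrow> hk t (y - x) \<le> c"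
  shows "disc_prob t x \<le> ennreal pi * c"
proof -
  have "disc_prob t x \<le> (\<integral>\<^sup>+y. indicator (ball (0::complex) 1) y * c \<partial>lborel)"
    unfolding disc_prob_def by (intro nn_integral_mono) (use c in \<open>auto simp: indicator_def\<close>)
  also have "\<dots> = ennreal pi * c"
    by (subst nn_integral_multc, measurable) (simp add: nn_integral_unit_ball)
  finally show ?thesis .
qed

lemma hk_le: "0 < t \<Longrightarrow> hk t x \<le> ennreal (1 / (2 * pi * t))"
  unfolding hk_def heat_def by (intro ennreal_leI divide_right_mono) auto

lemma disc_prob_le: "0 < t \<Longrightarrow> disc_prob t x \<le> ennreal (1 / (2 * t))"
  using disc_prob_le_const[of t x "ennreal (1 / (2 * pi * t))"] hk_le[of t] by (simp add: ennreal_mult[symmetric])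

lemma disc_prob_ge:
  assumes t: "0 < t" and x: "norm x \<le> 1"
  shows "ennreal (exp (- 2 / t) / (2 * t)) \<le> disc_prob t x"
proof -
  have "(norm x + 1)\<^sup>2 \<le> 2\<^sup>2" using x by (intro power_mono) auto
  hence "- 2 / t \<le> - (norm x + 1)\<^sup>2 / (2 * t)" using t by (simp add: field_simps)
  hence "exp (- 2 / t) \<le> exp (- (norm x + 1)\<^sup>2 / (2 * t))" by simp
  hence "exp (- 2 / t) / (2 * t) \<le> pi * heat t (of_real (norm x + 1))"
    using t by (simp add: heat_def divide_right_mono del: of_real_add)
  hence "ennreal (exp (- 2 / t) / (2 * t)) \<le> ennreal pi * hk t (of_real (norm x + 1))"
    using t by (simp add: hk_def ennreal_mult[symmetric] heat_nonneg ennreal_leI del: of_real_add)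
  thus ?thesis using disc_prob_lower[OF t, of x] by (rule order_trans)
qed

lemma disc_pot_le_greenr: "2 \<le> norm z \<Longrightarrow> disc_pot l z \<le> ennreal pi * greenr l (norm z - 1)"
proof -
  assume z: "2 \<le> norm z"
  have "disc_prob t z \<le> ennreal pi * hk t (of_real (norm z - 1))" if "0 < t" for t
  proof (rule disc_prob_le_const[OF that], rule hk_mono[OF _ that])
    fix y :: complex assume "y \<in> ball 0 1"
    hence "norm z - 1 \<le> norm (y - z)" using norm_triangle_ineq2[of z y] by (simp add: norm_minus_commute)
    thus "norm (complex_of_real (norm z - 1)) \<le> norm (y - z)" using z by (simp only: norm_of_real)
  qed
  hence "disc_pot l z \<le> (\<integral>\<^sup>+t. expw l t * (ennreal pi * hk t (of_real (norm z - 1))) \<partial>lborel)"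
    unfolding disc_pot_def by (intro nn_integral_mono) (auto simp: expw_def simp del: of_real_diff intro!: mult_left_mono)
  also have "\<dots> = ennreal pi * greenr l (norm z - 1)"
    unfolding greenr_def green_def by (subst nn_integral_cmult[symmetric]) (auto simp: ac_simps)
  finally show ?thesis .
qed

lemma nn_integral_exp_tail:
  assumes l: "0 < l"
  shows "(\<integral>\<^sup>+t. ennreal (exp (- l * t)) * indicator {a..} t \<partial>lborel) = ennreal (exp (- l * a) / l)"
proof -
  have "(\<integral>\<^sup>+t. ennreal (exp (- l * t)) * indicator {a..} t \<partial>lborel) = ennreal (0 - (- exp (- l * a) / l))"
  proof (rule nn_integral_FTC_atLeast)
    show "((\<lambda>t. - exp (- l * t) / l) \<longlongrightarrow> 0) at_top" using l by real_asymp
    show "((\<lambda>t. - exp (- l * t) / l) has_real_derivative exp (- l * t)) (at t)" for t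
      using l by (auto intro!: derivative_eq_intros)
  qed auto
  thus ?thesis by simp
qed

lemma nn_integral_expw:
  assumes l: "0 < l"
  shows "(\<integral>\<^sup>+t. expw l t \<partial>lborel) = ennreal (1 / l)"
proof -
  have "(\<integral>\<^sup>+t. expw l t \<partial>lborel) = (\<integral>\<^sup>+t. ennreal (exp (- l * t)) * indicator {0..} t \<partial>lborel)"
    by (rule nn_integral_cong_AE, use AE_lborel_singleton[of "0::real"] in eventually_elim)
       (auto simp: expw_def indicator_def)
  thus ?thesis using nn_integral_exp_tail[OF l, of 0] by simp
qed

text \<open>For \<open>l = 1 / r\<^sup>2\<close> this is \<open>ln r\<close>.\<close>

definition hlog :: "real \<Rightarrow> real" where "hlog l = ln (1 / l) / 2"

lemma hlog_nonneg: "0 < l \<Longrightarrow> l \<le> 1 \<Longrightarrow> 0 \<le> hlog l"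
  by (simp add: hlog_def)

text \<open>A majorant of \<open>expw l t * disc_prob t x\<close> that decreases in
  \<open>t > 0\<close>, so that it controls Riemann sums as well as integrals.\<close>

definition expw_min :: "real \<Rightarrow> real \<Rightarrow> ennreal" where
  "expw_min l t = expw l t * ennreal (min 1 (1 / (2 * t)))"

lemma measurable_expw_min [measurable]: "expw_min l \<in> borel_measurable borel"
  unfolding expw_min_def[abs_def] by measurable

text \<open>Cut at 1 and \<open>1 / l\<close>: the majorants used on the three ranges integrate to
  1, \<open>hlog l\<close> and \<open>exp (- 1)\<close>.\<close>

lemma nn_integral_expw_min:
  assumes l: "0 < l" "l \<le> 1"
  shows "(\<integral>\<^sup>+t. expw_min l t \<partial>lborel) \<le> ennreal (hlog l + 2)"
proof -
  have l1: "1 \<le> 1 / l" using l by simp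
  have "expw_min l t \<le> indicator {0..1} t + (ennreal (1 / (2 * t)) * indicator {1..1/l} t + ennreal l * (ennreal (exp (- l * t)) * indicator {1/l..} t))" for t
  proof -
    consider "t \<le> 0" | "0 < t" "t \<le> 1" | "1 < t" "t \<le> 1 / l" | "1 / l < t" by linarith
    thus ?thesis
    proof cases
      case 1 thus ?thesis by (simp add: expw_min_def expw_def)
    next
      case 2
      have "exp (- l * t) * min 1 (1 / (2 * t)) \<le> 1 * 1" using 2 l by (intro mult_mono) auto
      hence "expw_min l t \<le> 1" using 2 by (simp add: expw_min_def expw_def ennreal_mult[symmetric])
      also have "1 \<le> indicator {0..1} t + (ennreal (1 / (2 * t)) * indicator {1..1/l} t + ennreal l * (ennreal (exp (- l * t)) * indicator {1/l..} t))"
        using 2 by (simp add: add_increasing2)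
      finally show ?thesis .
    next
      case 3
      have "exp (- l * t) * min 1 (1 / (2 * t)) \<le> 1 * (1 / (2 * t))" using 3 l by (intro mult_mono) auto
      hence "expw_min l t \<le> ennreal (1 / (2 * t))" using 3 by (simp add: expw_min_def expw_def ennreal_mult[symmetric] ennreal_leI)
      also have "\<dots> \<le> indicator {0..1} t + (ennreal (1 / (2 * t)) * indicator {1..1/l} t + ennreal l * (ennreal (exp (- l * t)) * indicator {1/l..} t))"
        using 3 by (simp add: add_increasing2)
      finally show ?thesis .
    next
      case 4
      have t: "0 < t" using 4 l by (smt (verit) divide_pos_pos)
      have "1 / (2 * t) \<le> l" using 4 t l by (simp add: field_simps)
      hence "min 1 (1 / (2 * t)) \<le> l" by linarith
      hence "exp (- l * t) * min 1 (1 / (2 * t)) \<le> exp (- l * t) * l" by (intro mult_left_mono) auto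
      hence "expw_min l t \<le> ennreal l * ennreal (exp (- l * t))" using t l by (simp add: expw_min_def expw_def ennreal_mult[symmetric] ennreal_leI mult.commute)
      also have "\<dots> \<le> indicator {0..1} t + (ennreal (1 / (2 * t)) * indicator {1..1/l} t + ennreal l * (ennreal (exp (- l * t)) * indicator {1/l..} t))"
        using 4 by (simp add: add_increasing add_increasing2)
      finally show ?thesis .
    qed
  qed
  hence "(\<integral>\<^sup>+t. expw_min l t \<partial>lborel) \<le> (\<integral>\<^sup>+t. indicator {0..1} t + (ennreal (1 / (2 * t)) * indicator {1..1/l} t + ennreal l * (ennreal (exp (- l * t)) * indicator {1/l..} t)) \<partial>lborel)"
    by (rule nn_integral_mono)
  also have "\<dots> = (\<integral>\<^sup>+t. indicator {0..1::real} t \<partial>lborel) + ((\<integral>\<^sup>+t. ennreal (1 / (2 * t)) * indicator {1..1/l} t \<partial>lborel) + ennreal l * (\<integral>\<^sup>+t. ennreal (exp (- l * t)) * indicator {1/l..} t \<partial>lborel))"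
    by (simp add: nn_integral_add nn_integral_cmult)
  also have "(\<integral>\<^sup>+t. indicator {0..1::real} t \<partial>lborel) = 1" by simp
  also have "(\<integral>\<^sup>+t. ennreal (1 / (2 * t)) * indicator {1..1/l} t \<partial>lborel) = ennreal (ln (1 / l) / 2 - ln 1 / 2)"
    by (rule nn_integral_FTC_Icc) (use l1 in \<open>auto intro!: derivative_eq_intros\<close>)
  also have "(\<integral>\<^sup>+t. ennreal (exp (- l * t)) * indicator {1/l..} t \<partial>lborel) = ennreal (exp (- 1) / l)"
    using nn_integral_exp_tail[OF l(1), of "1 / l"] l by simp
  also have "1 + (ennreal (ln (1 / l) / 2 - ln 1 / 2) + ennreal l * ennreal (exp (- 1) / l)) = ennreal (1 + (hlog l + exp (- 1)))"
    using l hlog_nonneg[OF l] by (simp add: ennreal_mult[symmetric] hlog_def ennreal_plus[symmetric] del: ennreal_plus flip: ennreal_1)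
  also have "\<dots> \<le> ennreal (hlog l + 2)" by (intro ennreal_leI) simp
  finally show ?thesis .
qed

lemma expw_disc_prob_le: "expw l t * disc_prob t x \<le> expw_min l t"
proof (cases "0 < t")
  case True
  have "disc_prob t x \<le> ennreal (min 1 (1 / (2 * t)))"
    using disc_prob_le_1[OF True] disc_prob_le[OF True] by (auto simp: min_def)
  thus ?thesis unfolding expw_min_def by (rule mult_left_mono) simp
qed (simp add: expw_def)

lemma disc_pot_le:
  assumes l: "0 < l" "l \<le> 1"
  shows "disc_pot l x \<le> ennreal (hlog l + 2)"
  unfolding disc_pot_def
  by (rule order_trans[OF nn_integral_mono[OF expw_disc_prob_le] nn_integral_expw_min[OF l]])

lemma expw_min_antimono:
  assumes "0 < s" "s \<le> t" "0 < l"
  shows "expw_min l t \<le> expw_min l s"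
proof -
  have "exp (- l * t) * min 1 (1 / (2 * t)) \<le> exp (- l * s) * min 1 (1 / (2 * s))"
    using assms by (intro mult_mono min.mono divide_left_mono) auto
  thus ?thesis using assms by (simp add: expw_min_def expw_def ennreal_mult[symmetric] ennreal_leI)
qed

text \<open>Each term is at most the integral of \<open>expw_min\<close> over the grid cell to its
  left, where this function is larger, and these cells are disjoint. The term at time 0 costs at
  most \<open>\<epsilon> <= 1\<close>, which turns the 2 into 3.\<close>

lemma disc_sum_le:
  assumes l: "0 < l" "l \<le> 1" and e: "0 < \<epsilon>" "\<epsilon> \<le> 1"
  shows "disc_sum n \<epsilon> l x \<le> ennreal (hlog l + 3)"
proof -
  have "(\<Sum>k<n. ennreal \<epsilon> * (expw l (real (Suc k) * \<epsilon>) * disc_prob (real (Suc k) * \<epsilon>) x)) \<le> (\<Sum>k<n. \<integral>\<^sup>+t. indicator {real k * \<epsilon><..<real k * \<epsilon> + \<epsilon>} t * expw_min l t \<partial>lborel)"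
  proof (rule sum_mono)
    fix k
    have "ennreal \<epsilon> * (expw l (real (Suc k) * \<epsilon>) * disc_prob (real (Suc k) * \<epsilon>) x) \<le> ennreal \<epsilon> * expw_min l (real (Suc k) * \<epsilon>)"
      by (intro mult_left_mono expw_disc_prob_le) simp
    also have "\<dots> = (\<integral>\<^sup>+t. indicator {real k * \<epsilon><..<real k * \<epsilon> + \<epsilon>} t * expw_min l (real (Suc k) * \<epsilon>) \<partial>lborel)"
      using e by (subst nn_integral_multc) auto
    also have "\<dots> \<le> (\<integral>\<^sup>+t. indicator {real k * \<epsilon><..<real k * \<epsilon> + \<epsilon>} t * expw_min l t \<partial>lborel)"
    proof (rule nn_integral_mono)
      fix t
      show "indicator {real k * \<epsilon><..<real k * \<epsilon> + \<epsilon>} t * expw_min l (real (Suc k) * \<epsilon>) \<le> indicator {real k * \<epsilon><..<real k * \<epsilon> + \<epsilon>} t * expw_min l t"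
      proof (cases "t \<in> {real k * \<epsilon><..<real k * \<epsilon> + \<epsilon>}")
        case True
        have "0 < t" using True e by (smt (verit) greaterThanLessThan_iff mult_nonneg_nonneg of_nat_0_le_iff)
        hence "expw_min l (real (Suc k) * \<epsilon>) \<le> expw_min l t"
          using True l by (intro expw_min_antimono) (auto simp: algebra_simps)
        thus ?thesis using True by simp
      qed simp
    qed
    finally show "ennreal \<epsilon> * (expw l (real (Suc k) * \<epsilon>) * disc_prob (real (Suc k) * \<epsilon>) x) \<le> \<dots>" .
  qed
  also have "\<dots> = (\<integral>\<^sup>+t. (\<Sum>k<n. indicator {real k * \<epsilon><..<real k * \<epsilon> + \<epsilon>} t) * expw_min l t \<partial>lborel)"
    unfolding sum_distrib_right by (rule nn_integral_sum[symmetric]) measurable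
  also have "\<dots> \<le> (\<integral>\<^sup>+t. 1 * expw_min l t \<partial>lborel)"
  proof (intro nn_integral_mono mult_right_mono)
    fix t
    have "disjoint_family_on (\<lambda>k. {real k * \<epsilon><..<real k * \<epsilon> + \<epsilon>}) {..<n}"
    unfolding disjoint_family_on_def
    proof (intro ballI impI)
      fix i j assume "i \<in> {..<n}" "j \<in> {..<n}" "i \<noteq> j"
      have *: "{real i * \<epsilon><..<real i * \<epsilon> + \<epsilon>} \<inter> {real j * \<epsilon><..<real j * \<epsilon> + \<epsilon>} = {}" if "i < j" for i j
      proof -
        have "real i + 1 \<le> real j" using that by linarith
        hence "(real i + 1) * \<epsilon> \<le> real j * \<epsilon>" using e by (intro mult_right_mono) auto
        thus ?thesis by (auto simp: algebra_simps)
      qed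
      show "{real i * \<epsilon><..<real i * \<epsilon> + \<epsilon>} \<inter> {real j * \<epsilon><..<real j * \<epsilon> + \<epsilon>} = {}"
        using *[of i j] *[of j i] \<open>i \<noteq> j\<close> by (cases "i < j") auto
    qed
    hence "(\<Sum>k<n. indicator {real k * \<epsilon><..<real k * \<epsilon> + \<epsilon>} t) = (indicator (\<Union>k<n. {real k * \<epsilon><..<real k * \<epsilon> + \<epsilon>}) t :: ennreal)"
      by (subst indicator_UN_disjoint) auto
    thus "(\<Sum>k<n. indicator {real k * \<epsilon><..<real k * \<epsilon> + \<epsilon>} t) \<le> (1::ennreal)" by (simp add: indicator_def)
  qed simp
  also have "\<dots> \<le> ennreal (hlog l + 2)" using nn_integral_expw_min[OF l] by simp
  finally have *: "(\<Sum>k<n. ennreal \<epsilon> * (expw l (real (Suc k) * \<epsilon>) * disc_prob (real (Suc k) * \<epsilon>) x)) \<le> ennreal (hlog l + 2)" .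
  have "disc_sum n \<epsilon> l x \<le> 1 + ennreal (hlog l + 2)"
    unfolding disc_sum_eq[OF e(1)] using e by (intro add_mono *) (auto simp: indicator_def)
  also have "\<dots> = ennreal (hlog l + 3)"
    using hlog_nonneg[OF l] by (simp add: ennreal_plus[symmetric] del: ennreal_plus flip: ennreal_1)
  finally show ?thesis .
qed

text \<open>Keeps only the durations in \<open>[2, 1 / l]\<close> and replaces both exponentials by
  \<open>1 - x <= exp (- x)\<close>. \<open>F\<close> is the antiderivative of the resulting
  \<open>f\<close>; the 3/2 absorbs what it contributes besides \<open>hlog l\<close> at the two
  ends.\<close>

lemma disc_pot_ge:
  assumes l: "0 < l" "l \<le> 1 / 9" and x: "norm x < 1"
  shows "ennreal (hlog l - 3 / 2) \<le> disc_pot l x"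
proof -
  define f where "f t = (1 - l * t) * (1 - 2 / t) / (2 * t)" for t
  define F where "F t = (ln t - l * t + 2 / t + 2 * l * ln t) / 2" for t
  have l2: "2 \<le> 1 / l" using l by (simp add: field_simps)
  have f0: "0 \<le> f t" if "2 \<le> t" "t \<le> 1 / l" for t
  proof -
    have "l * t \<le> 1" "2 / t \<le> 1" using that l by (simp_all add: field_simps)
    thus ?thesis using that unfolding f_def by (intro divide_nonneg_nonneg mult_nonneg_nonneg) auto
  qed
  define A where "A = ln (1 / l)"
  have ln2: "ln 2 \<le> (1::real)" using ln_le_minus_one[of 2] by simp
  have "ln 2 \<le> A" unfolding A_def using l2 l by (subst ln_le_cancel_iff) auto
  hence lA: "l * ln 2 \<le> l * A" using l by (intro mult_left_mono) auto
  have F: "F (1 / l) - F 2 = (A - 1 + 2 * l + 2 * (l * A)) / 2 - (ln 2 - 2 * l + 1 + 2 * (l * ln 2)) / 2"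
    using l unfolding F_def A_def by (simp add: algebra_simps)
  have "A / 2 - 3 / 2 \<le> (A - 1 + 2 * l + 2 * p) / 2 - (c - 2 * l + 1 + 2 * q) / 2" if "q \<le> p" "c \<le> 1" for p q c
    using that l by (simp add: field_simps)
  from this[OF lA ln2] have "hlog l - 3 / 2 \<le> F (1 / l) - F 2"
    unfolding F by (simp add: hlog_def A_def)
  hence "ennreal (hlog l - 3 / 2) \<le> ennreal (F (1 / l) - F 2)" by (rule ennreal_leI)
  also have "\<dots> = (\<integral>\<^sup>+t. ennreal (f t) * indicator {2..1/l} t \<partial>lborel)"
  proof (rule nn_integral_FTC_Icc[symmetric])
    show "(F has_real_derivative f t) (at t)" if t: "t \<in> {2..1/l}" for t
      unfolding F_def f_def using t l by (auto intro!: derivative_eq_intros simp: field_simps power2_eq_square)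
    show "0 \<le> f t" if "t \<in> {2..1/l}" for t using f0 that by simp
  qed (use l2 in \<open>auto simp: f_def[abs_def]\<close>)
  also have "\<dots> \<le> disc_pot l x"
    unfolding disc_pot_def
  proof (rule nn_integral_mono)
    fix t
    show "ennreal (f t) * indicator {2..1/l} t \<le> expw l t * disc_prob t x"
    proof (cases "t \<in> {2..1/l}")
      case True
      have t: "0 < t" "2 \<le> t" "t \<le> 1 / l" using True by auto
      have "f t \<le> exp (- l * t) * (exp (- 2 / t) / (2 * t))"
      proof -
        have "1 - l * t \<le> exp (- l * t)" "1 - 2 / t \<le> exp (- 2 / t)"
          using exp_ge_add_one_self[of "- l * t"] exp_ge_add_one_self[of "- 2 / t"] by auto
        hence "(1 - l * t) * (1 - 2 / t) \<le> exp (- l * t) * exp (- 2 / t)"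
          using t l by (intro mult_mono) (auto simp: field_simps)
        thus ?thesis using t by (simp add: f_def divide_right_mono)
      qed
      hence "ennreal (f t) \<le> expw l t * ennreal (exp (- 2 / t) / (2 * t))"
        using t by (simp add: expw_def ennreal_mult[symmetric] ennreal_leI)
      also have "\<dots> \<le> expw l t * disc_prob t x"
        using t x by (intro mult_left_mono disc_prob_ge) auto
      finally show ?thesis using True by simp
    qed simp
  qed
  finally show ?thesis .
qed

section \<open>Integrals of the disk potential and of its square\<close>

lemma hk_sym: "hk t (x - y) = hk t (y - x)"
  by (simp add: hk_def heat_def norm_minus_commute)

lemma nn_integral_disc_prob:
  assumes t: "0 < t" shows "(\<integral>\<^sup>+z. disc_prob t z \<partial>lborel) = ennreal pi"
proof -
  have "(\<integral>\<^sup>+z. disc_prob t z \<partial>lborel) = (\<integral>\<^sup>+y. \<integral>\<^sup>+z. indicator (ball 0 1) y * hk t (y - z) \<partial>lborel \<partial>lborel)"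
    unfolding disc_prob_def by (rule lborel_pair.Fubini') measurable
  also have "\<dots> = (\<integral>\<^sup>+y. indicator (ball (0::complex) 1) y \<partial>lborel)"
  proof (rule nn_integral_cong)
    fix y :: complex
    have "(\<integral>\<^sup>+z. indicator (ball 0 1) y * hk t (y - z) \<partial>lborel) = indicator (ball 0 1) y * (\<integral>\<^sup>+z. hk t (z - y) \<partial>lborel)"
      unfolding hk_sym[of t y] by (rule nn_integral_cmult) measurable
    thus "(\<integral>\<^sup>+z. indicator (ball 0 1) y * hk t (y - z) \<partial>lborel) = indicator (ball 0 1) y"
      unfolding hk_def nn_integral_heat[OF t] by simp
  qed
  finally show ?thesis by (simp only: nn_integral_unit_ball)
qed

lemma nn_integral_disc_pot:
  assumes l: "0 < l" shows "(\<integral>\<^sup>+z. disc_pot l z \<partial>lborel) = ennreal (pi / l)"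
proof -
  have "(\<integral>\<^sup>+z. disc_pot l z \<partial>lborel) = (\<integral>\<^sup>+t. \<integral>\<^sup>+z. expw l t * disc_prob t z \<partial>lborel \<partial>lborel)"
    unfolding disc_pot_def by (rule lborel_pair.Fubini') measurable
  also have "\<dots> = (\<integral>\<^sup>+t. expw l t * ennreal pi \<partial>lborel)"
  proof (rule nn_integral_cong)
    fix t
    have "(\<integral>\<^sup>+z. expw l t * disc_prob t z \<partial>lborel) = expw l t * (\<integral>\<^sup>+z. disc_prob t z \<partial>lborel)"
      by (rule nn_integral_cmult) measurable
    thus "(\<integral>\<^sup>+z. expw l t * disc_prob t z \<partial>lborel) = expw l t * ennreal pi"
      by (cases "0 < t") (simp_all add: nn_integral_disc_prob expw_def)
  qed
  also have "\<dots> = ennreal (1 / l) * ennreal pi"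
    by (subst nn_integral_multc) (use nn_integral_expw[OF l] in auto)
  finally show ?thesis using l by (simp add: ennreal_mult[symmetric])
qed

text \<open>Heat content of the disk: of the heat spread uniformly over it at time 0, the amount
  still there at time \<open>t\<close>.\<close>

definition disc_mass :: "real \<Rightarrow> ennreal" where
  "disc_mass t = (\<integral>\<^sup>+y. indicator (ball 0 1) y * disc_prob t y \<partial>lborel)"

lemma measurable_disc_mass [measurable]: "disc_mass \<in> borel_measurable borel"
  unfolding disc_mass_def by measurable

text \<open>By symmetry of the kernel the two motions from \<open>z\<close> join to one path of
  duration \<open>s + t\<close> between points of the disk.\<close>

lemma nn_integral_disc_prob_mult:
  assumes s: "0 < s" and t: "0 < t"
  shows "(\<integral>\<^sup>+z. disc_prob s z * disc_prob t z \<partial>lborel) = disc_mass (s + t)"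
proof -
  have "(\<integral>\<^sup>+z. disc_prob s z * disc_prob t z \<partial>lborel) = (\<integral>\<^sup>+z. \<integral>\<^sup>+y. (indicator (ball 0 1) y * hk s (y - z)) * disc_prob t z \<partial>lborel \<partial>lborel)"
    unfolding disc_prob_def[of s] by (intro nn_integral_cong nn_integral_multc[symmetric]) measurable
  also have "\<dots> = (\<integral>\<^sup>+y. \<integral>\<^sup>+z. (indicator (ball 0 1) y * hk s (y - z)) * disc_prob t z \<partial>lborel \<partial>lborel)"
    by (rule lborel_pair.Fubini') measurable
  also have "\<dots> = disc_mass (s + t)"
    unfolding disc_mass_def
  proof (rule nn_integral_cong)
    fix y
    have "(\<integral>\<^sup>+z. (indicator (ball 0 1) y * hk s (y - z)) * disc_prob t z \<partial>lborel) = indicator (ball 0 1) y * (\<integral>\<^sup>+z. hk s (z - y) * disc_prob t z \<partial>lborel)"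
      unfolding hk_sym[of s y] mult.assoc by (rule nn_integral_cmult) measurable
    thus "(\<integral>\<^sup>+z. (indicator (ball 0 1) y * hk s (y - z)) * disc_prob t z \<partial>lborel) = indicator (ball 0 1) y * disc_prob (s + t) y"
      by (simp only: disc_prob_step[OF s t])
  qed
  finally show ?thesis .
qed

text \<open>For a given sum \<open>t\<close> the first variable runs through an interval of length
  \<open>t\<close>.\<close>

lemma nn_integral_convolution_half_line:
  fixes F :: "real \<Rightarrow> ennreal"
  assumes [measurable]: "F \<in> borel_measurable borel"
  shows "(\<integral>\<^sup>+s. \<integral>\<^sup>+t. indicator {0<..} s * (indicator {0<..} t * F (s + t)) \<partial>lborel \<partial>lborel) = (\<integral>\<^sup>+t. ennreal t * F t \<partial>lborel)"
proof -
  have "(\<integral>\<^sup>+s. \<integral>\<^sup>+t. indicator {0<..} s * (indicator {0<..} t * F (s + t)) \<partial>lborel \<partial>lborel) =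
    (\<integral>\<^sup>+s. \<integral>\<^sup>+t. indicator {0<..} s * (indicator {0<..} (- s + t) * F t) \<partial>lborel \<partial>lborel)"
  proof (rule nn_integral_cong)
    fix s :: real
    have "(\<integral>\<^sup>+t. indicator {0<..} s * (indicator {0<..} t * F (s + t)) \<partial>lborel) = (\<integral>\<^sup>+t. indicator {0<..} s * (indicator {0<..} (- s + t) * F (s + (- s + t))) \<partial>lborel)"
      by (rule nn_integral_shift) measurable
    thus "(\<integral>\<^sup>+t. indicator {0<..} s * (indicator {0<..} t * F (s + t)) \<partial>lborel) = (\<integral>\<^sup>+t. indicator {0<..} s * (indicator {0<..} (- s + t) * F t) \<partial>lborel)" by simp
  qed
  also have "\<dots> = (\<integral>\<^sup>+t. \<integral>\<^sup>+s. indicator {0<..} s * (indicator {0<..} (- s + t) * F t) \<partial>lborel \<partial>lborel)"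
    by (rule lborel_pair.Fubini') measurable
  also have "\<dots> = (\<integral>\<^sup>+t. \<integral>\<^sup>+s. indicator {0<..<t} s * F t \<partial>lborel \<partial>lborel)"
    by (intro nn_integral_cong) (auto simp: indicator_def)
  also have "\<dots> = (\<integral>\<^sup>+t. ennreal t * F t \<partial>lborel)"
  proof (rule nn_integral_cong)
    fix t :: real
    have "(\<integral>\<^sup>+s. indicator {0<..<t} s * F t \<partial>lborel) = emeasure lborel {0<..<t} * F t"
      by (subst nn_integral_multc) auto
    thus "(\<integral>\<^sup>+s. indicator {0<..<t} s * F t \<partial>lborel) = ennreal t * F t"
      by (cases "0 \<le> t") (auto simp: ennreal_neg)
  qed
  finally show ?thesis .
qed

lemma nn_integral_disc_pot_square:
  "(\<integral>\<^sup>+z. disc_pot l z * disc_pot l z \<partial>lborel) = (\<integral>\<^sup>+t. ennreal t * (ennreal (exp (- l * t)) * disc_mass t) \<partial>lborel)"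
proof -
  have "(\<integral>\<^sup>+z. disc_pot l z * disc_pot l z \<partial>lborel) = (\<integral>\<^sup>+z. \<integral>\<^sup>+s. (expw l s * disc_prob s z) * disc_pot l z \<partial>lborel \<partial>lborel)"
    by (intro nn_integral_cong, subst (1) disc_pot_def, rule nn_integral_multc[symmetric]) measurable
  also have "\<dots> = (\<integral>\<^sup>+s. \<integral>\<^sup>+z. (expw l s * disc_prob s z) * disc_pot l z \<partial>lborel \<partial>lborel)"
    by (rule lborel_pair.Fubini') measurable
  also have "\<dots> = (\<integral>\<^sup>+s. \<integral>\<^sup>+z. \<integral>\<^sup>+t. (expw l s * disc_prob s z) * (expw l t * disc_prob t z) \<partial>lborel \<partial>lborel \<partial>lborel)"
    by (intro nn_integral_cong, subst disc_pot_def, rule nn_integral_cmult[symmetric]) measurable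
  also have "\<dots> = (\<integral>\<^sup>+s. \<integral>\<^sup>+t. \<integral>\<^sup>+z. (expw l s * disc_prob s z) * (expw l t * disc_prob t z) \<partial>lborel \<partial>lborel \<partial>lborel)"
    by (intro nn_integral_cong lborel_pair.Fubini') measurable
  also have "\<dots> = (\<integral>\<^sup>+s. \<integral>\<^sup>+t. indicator {0<..} s * (indicator {0<..} t * (ennreal (exp (- l * (s + t))) * disc_mass (s + t))) \<partial>lborel \<partial>lborel)"
  proof (intro nn_integral_cong)
    fix s t
    show "(\<integral>\<^sup>+z. (expw l s * disc_prob s z) * (expw l t * disc_prob t z) \<partial>lborel) = indicator {0<..} s * (indicator {0<..} t * (ennreal (exp (- l * (s + t))) * disc_mass (s + t)))"
    proof (cases "0 < s \<and> 0 < t")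
      case True
      have "(\<integral>\<^sup>+z. (expw l s * disc_prob s z) * (expw l t * disc_prob t z) \<partial>lborel) = (\<integral>\<^sup>+z. (expw l s * expw l t) * (disc_prob s z * disc_prob t z) \<partial>lborel)"
        by (intro nn_integral_cong) (simp only: mult_ac)
      also have "\<dots> = (expw l s * expw l t) * disc_mass (s + t)"
        by (subst nn_integral_cmult, measurable) (use True in \<open>simp only: nn_integral_disc_prob_mult\<close>)
      also have "expw l s * expw l t = ennreal (exp (- l * (s + t)))"
        using True by (simp add: expw_def ennreal_mult[symmetric] exp_add[symmetric] algebra_simps)
      finally show ?thesis using True by simp
    qed (auto simp: expw_def)
  qed
  also have "\<dots> = (\<integral>\<^sup>+t. ennreal t * (ennreal (exp (- l * t)) * disc_mass t) \<partial>lborel)"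
    by (rule nn_integral_convolution_half_line) measurable
  finally show ?thesis .
qed

lemma disc_mass_bounds:
  assumes t: "0 < t"
  shows "disc_mass t \<le> ennreal (pi / (2 * t))" "ennreal (pi * exp (- 2 / t) / (2 * t)) \<le> disc_mass t"
proof -
  have "disc_mass t \<le> (\<integral>\<^sup>+y. indicator (ball (0::complex) 1) y * ennreal (1 / (2 * t)) \<partial>lborel)"
    unfolding disc_mass_def using disc_prob_le[OF t] by (intro nn_integral_mono mult_left_mono) auto
  also have "\<dots> = ennreal (pi / (2 * t))"
    by (subst nn_integral_multc, measurable) (use t in \<open>simp add: nn_integral_unit_ball ennreal_mult[symmetric]\<close>)
  finally show "disc_mass t \<le> ennreal (pi / (2 * t))" .
  have "ennreal (pi * exp (- 2 / t) / (2 * t)) = (\<integral>\<^sup>+y. indicator (ball (0::complex) 1) y * ennreal (exp (- 2 / t) / (2 * t)) \<partial>lborel)"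
    by (subst nn_integral_multc, measurable) (use t in \<open>simp add: nn_integral_unit_ball ennreal_mult[symmetric]\<close>)
  also have "\<dots> \<le> disc_mass t"
    unfolding disc_mass_def using disc_prob_ge[OF t] by (intro nn_integral_mono) (auto simp: indicator_def)
  finally show "ennreal (pi * exp (- 2 / t) / (2 * t)) \<le> disc_mass t" .
qed

text \<open>In \<open>nn_integral_disc_pot_square\<close> the factor \<open>t * disc_mass t\<close>
  is at most \<open>pi / 2\<close>.\<close>

lemma disc_pot_square_le:
  assumes l: "0 < l"
  shows "(\<integral>\<^sup>+z. disc_pot l z * disc_pot l z \<partial>lborel) \<le> ennreal (pi / (2 * l))"
proof -
  have "(\<integral>\<^sup>+z. disc_pot l z * disc_pot l z \<partial>lborel) \<le> (\<integral>\<^sup>+t. expw l t * ennreal (pi / 2) \<partial>lborel)"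
    unfolding nn_integral_disc_pot_square
  proof (rule nn_integral_mono)
    fix t
    show "ennreal t * (ennreal (exp (- l * t)) * disc_mass t) \<le> expw l t * ennreal (pi / 2)"
    proof (cases "0 < t")
      case True
      have "ennreal t * (ennreal (exp (- l * t)) * disc_mass t) \<le> ennreal t * (ennreal (exp (- l * t)) * ennreal (pi / (2 * t)))"
        by (intro mult_left_mono disc_mass_bounds True) auto
      also have "\<dots> = expw l t * ennreal (pi / 2)" using True by (simp add: expw_def ennreal_mult[symmetric])
      finally show ?thesis .
    qed (simp add: expw_def ennreal_neg)
  qed
  also have "\<dots> = ennreal (1 / l) * ennreal (pi / 2)"
    by (subst nn_integral_multc) (use nn_integral_expw[OF l] in auto)
  also have "\<dots> = ennreal (pi / (2 * l))" using l by (simp add: ennreal_mult[symmetric] mult.commute)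
  finally show ?thesis .
qed

text \<open>Starting the integral at \<open>2 / sqrt l\<close> costs a factor
  \<open>1 - 2 * sqrt l\<close> in the exponential, and from there on \<open>t * disc_mass t\<close>
  is at least \<open>1 - sqrt l\<close> times \<open>pi / 2\<close>.\<close>

lemma disc_pot_square_ge:
  assumes l: "0 < l" "l \<le> 1 / 9"
  shows "ennreal (pi / 2 * (1 - 3 * sqrt l) / l) \<le> (\<integral>\<^sup>+z. disc_pot l z * disc_pot l z \<partial>lborel)"
proof -
  define \<eta> where "\<eta> = sqrt l"
  have "sqrt l \<le> sqrt ((1/3)\<^sup>2)" using l by (intro real_sqrt_le_mono) (simp add: power2_eq_square)
  hence \<eta>: "0 < \<eta>" "\<eta> \<le> 1 / 3" "\<eta> * \<eta> = l" using l by (auto simp: \<eta>_def)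
  have "(1 - 3 * \<eta>) \<le> (1 - \<eta>) * (1 - 2 * \<eta>)" using \<eta> by (simp add: algebra_simps)
  also have "\<dots> \<le> (1 - \<eta>) * exp (- l * (2 / \<eta>))"
  proof -
    have "l * (2 / \<eta>) = 2 * \<eta>" using \<eta> by (simp flip: \<eta>(3))
    thus ?thesis using \<eta> exp_ge_add_one_self[of "- 2 * \<eta>"] by (intro mult_left_mono) auto
  qed
  finally have "pi / 2 * (1 - 3 * \<eta>) / l \<le> pi / 2 * (1 - \<eta>) * (exp (- l * (2 / \<eta>)) / l)"
    using l by (simp add: divide_right_mono mult_left_mono mult.assoc)
  hence "ennreal (pi / 2 * (1 - 3 * \<eta>) / l) \<le> ennreal (pi / 2 * (1 - \<eta>)) * ennreal (exp (- l * (2 / \<eta>)) / l)"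
    using \<eta> l by (simp add: ennreal_mult[symmetric] ennreal_leI)
  also have "\<dots> = (\<integral>\<^sup>+t. ennreal (pi / 2 * (1 - \<eta>)) * (ennreal (exp (- l * t)) * indicator {2/\<eta>..} t) \<partial>lborel)"
    by (subst nn_integral_cmult) (use nn_integral_exp_tail[OF l(1), of "2 / \<eta>"] in auto)
  also have "\<dots> \<le> (\<integral>\<^sup>+z. disc_pot l z * disc_pot l z \<partial>lborel)"
    unfolding nn_integral_disc_pot_square
  proof (rule nn_integral_mono)
    fix t
    show "ennreal (pi / 2 * (1 - \<eta>)) * (ennreal (exp (- l * t)) * indicator {2/\<eta>..} t) \<le> ennreal t * (ennreal (exp (- l * t)) * disc_mass t)"
    proof (cases "2 / \<eta> \<le> t")
      case True
      have t: "0 < t" using True \<eta> by (smt (verit) divide_pos_pos)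
      have "2 / t \<le> \<eta>" using True t \<eta> by (simp add: field_simps)
      hence "1 - \<eta> \<le> exp (- 2 / t)" using exp_ge_add_one_self[of "- 2 / t"] by simp
      hence "pi / 2 * (1 - \<eta>) * exp (- l * t) \<le> pi / 2 * exp (- 2 / t) * exp (- l * t)"
        by (intro mult_right_mono mult_left_mono) auto
      also have "\<dots> = t * (exp (- l * t) * (pi * exp (- 2 / t) / (2 * t)))" using t by simp
      finally have "pi / 2 * (1 - \<eta>) * exp (- l * t) \<le> t * (exp (- l * t) * (pi * exp (- 2 / t) / (2 * t)))" .
      hence "ennreal (pi / 2 * (1 - \<eta>)) * ennreal (exp (- l * t)) \<le> ennreal t * (ennreal (exp (- l * t)) * ennreal (pi * exp (- 2 / t) / (2 * t)))"
        using t \<eta> by (simp add: ennreal_mult[symmetric] ennreal_leI)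
      also have "\<dots> \<le> ennreal t * (ennreal (exp (- l * t)) * disc_mass t)"
        by (intro mult_left_mono disc_mass_bounds t) auto
      finally show ?thesis using True by simp
    qed simp
  qed
  finally show ?thesis by (simp add: \<eta>_def)
qed

section \<open>Comparison of Green functions at nearby distances\<close>

text \<open>The antiderivative is \<open>exp (- c / t) / c\<close>; the integral is computed from
  \<open>1 / (n + 1)\<close> on and extended down to 0 by Fatou.\<close>

lemma nn_integral_exp_inverse:
  assumes c: "0 < c"
  shows "(\<integral>\<^sup>+t. ennreal (exp (- c / t) / t\<^sup>2) * indicator {0<..} t \<partial>lborel) \<le> ennreal (1 / c)"
proof -
  define f where "f t = exp (- c / t) / t\<^sup>2" for t
  have [measurable]: "f \<in> borel_measurable borel" unfolding f_def[abs_def] by measurable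
  have tail: "(\<integral>\<^sup>+t. ennreal (f t) * indicator {a..} t \<partial>lborel) \<le> ennreal (1 / c)" if a: "0 < a" for a
  proof -
    have "(\<integral>\<^sup>+t. ennreal (f t) * indicator {a..} t \<partial>lborel) = ennreal (1 / c - exp (- c / a) / c)"
    proof (rule nn_integral_FTC_atLeast)
      show "((\<lambda>t. exp (- c / t) / c) \<longlongrightarrow> 1 / c) at_top" using c by real_asymp (simp add: inverse_eq_divide)
      show "((\<lambda>t. exp (- c / t) / c) has_real_derivative f t) (at t)" if "a \<le> t" for t
        using c a that by (auto intro!: derivative_eq_intros simp: f_def power2_eq_square)
    qed (auto simp: f_def)
    also have "\<dots> \<le> ennreal (1 / c)" using c by (intro ennreal_leI) simp
    finally show ?thesis .
  qed
  have "(\<integral>\<^sup>+t. ennreal (f t) * indicator {0<..} t \<partial>lborel) \<le> (\<integral>\<^sup>+t. liminf (\<lambda>n. ennreal (f t) * indicator {1 / real (Suc n)..} t) \<partial>lborel)"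
  proof (rule nn_integral_mono)
    fix t
    show "ennreal (f t) * indicator {0<..} t \<le> liminf (\<lambda>n. ennreal (f t) * indicator {1 / real (Suc n)..} t)"
    proof (cases "0 < t")
      case True
      have "(\<lambda>n. 1 / real (Suc n)) \<longlonglongrightarrow> 0" by (rule LIMSEQ_Suc[OF lim_1_over_n])
      hence "\<forall>\<^sub>F n in sequentially. 1 / real (Suc n) < t" using True by (rule order_tendstoD)
      hence "\<forall>\<^sub>F n in sequentially. ennreal (f t) * indicator {0<..} t \<le> ennreal (f t) * indicator {1 / real (Suc n)..} t"
        by eventually_elim (use True in simp)
      thus ?thesis by (rule Liminf_bounded)
    qed simp
  qed
  also have "\<dots> \<le> liminf (\<lambda>n. \<integral>\<^sup>+t. ennreal (f t) * indicator {1 / real (Suc n)..} t \<partial>lborel)"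
    by (rule nn_integral_liminf) measurable
  also have "\<dots> \<le> liminf (\<lambda>n::nat. ennreal (1 / c))"
    by (intro Liminf_mono always_eventually allI tail) simp
  also have "\<dots> = ennreal (1 / c)" by (rule Liminf_const) simp
  finally show ?thesis by (simp add: f_def)
qed

text \<open>The exponents at distances \<open>r - 1\<close> and \<open>r + 1\<close> differ by
  \<open>2 * r / t\<close>, so \<open>1 - exp (- x) <= x\<close> bounds the difference of the
  kernels by \<open>r / pi * exp (- a\<^sup>2 / (2 * t)) / t\<^sup>2\<close>. Its integral is at
  most \<open>2 * r / (pi * a\<^sup>2)\<close>, and \<open>a >= r / 2\<close> gives the 8.\<close>

lemma greenr_diff:
  assumes l: "0 < l" and r: "2 \<le> r"
  shows "greenr l (r - 1) \<le> greenr l (r + 1) + ennreal (8 / (pi * r))"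
proof -
  define a where "a = r - 1"
  have a: "0 < a" "r / 2 \<le> a" using r by (auto simp: a_def)
  have "expw l t * hk t (of_real (r - 1)) \<le> expw l t * hk t (of_real (r + 1)) + ennreal (r / pi) * (ennreal (exp (- (a\<^sup>2 / 2) / t) / t\<^sup>2) * indicator {0<..} t)" for t
  proof (cases "0 < t")
    case True
    define A B where "A = a\<^sup>2 / (2 * t)" and "B = (r + 1)\<^sup>2 / (2 * t)"
    have BA: "B - A = 2 * r / t" using True by (simp add: A_def B_def a_def power2_eq_square field_simps)
    have "exp (- A) - exp (- B) = exp (- A) * (1 - exp (- (B - A)))" by (simp add: algebra_simps exp_add[symmetric])
    also have "\<dots> \<le> exp (- A) * (B - A)"
    proof (rule mult_left_mono)
      show "1 - exp (- (B - A)) \<le> B - A" using exp_ge_add_one_self[of "- (B - A)"] by linarith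
    qed simp
    finally have *: "exp (- A) \<le> exp (- B) + exp (- A) * (2 * r / t)" unfolding BA by simp
    have n: "norm (complex_of_real (r - 1)) = a" "norm (complex_of_real (r + 1)) = r + 1"
      unfolding norm_of_real using r by (simp_all add: a_def)
    have h: "heat t (of_real (r - 1)) = exp (- A) / (2 * pi * t)" "heat t (of_real (r + 1)) = exp (- B) / (2 * pi * t)"
      unfolding heat_def n by (simp_all add: A_def B_def)
    have "exp (- A) / (2 * pi * t) \<le> (exp (- B) + exp (- A) * (2 * r / t)) / (2 * pi * t)"
      using * True by (intro divide_right_mono) auto
    also have "\<dots> = exp (- B) / (2 * pi * t) + r / pi * (exp (- A) / t\<^sup>2)"
      using True by (simp add: add_divide_distrib power2_eq_square mult_ac)
    finally have "hk t (of_real (r - 1)) \<le> hk t (of_real (r + 1)) + ennreal (r / pi * (exp (- A) / t\<^sup>2))"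
    proof -
      assume le: "exp (- A) / (2 * pi * t) \<le> exp (- B) / (2 * pi * t) + r / pi * (exp (- A) / t\<^sup>2)"
      have "ennreal (exp (- B) / (2 * pi * t) + r / pi * (exp (- A) / t\<^sup>2)) = ennreal (exp (- B) / (2 * pi * t)) + ennreal (r / pi * (exp (- A) / t\<^sup>2))"
        by (rule ennreal_plus) (use True r in auto)
      with ennreal_leI[OF le] show ?thesis unfolding hk_def h by simp
    qed
    hence "expw l t * hk t (of_real (r - 1)) \<le> expw l t * (hk t (of_real (r + 1)) + ennreal (r / pi * (exp (- A) / t\<^sup>2)))"
      by (rule mult_left_mono) simp
    also have "\<dots> \<le> expw l t * hk t (of_real (r + 1)) + 1 * ennreal (r / pi * (exp (- A) / t\<^sup>2))"
      unfolding distrib_left using l True by (intro add_mono mult_right_mono) (auto simp: expw_def)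
    also have "1 * ennreal (r / pi * (exp (- A) / t\<^sup>2)) = ennreal (r / pi) * (ennreal (exp (- (a\<^sup>2 / 2) / t) / t\<^sup>2) * indicator {0<..} t)"
      using True r by (simp add: ennreal_mult[symmetric] A_def)
    finally show ?thesis .
  qed (simp add: expw_def)
  hence "greenr l (r - 1) \<le> (\<integral>\<^sup>+t. expw l t * hk t (of_real (r + 1)) + ennreal (r / pi) * (ennreal (exp (- (a\<^sup>2 / 2) / t) / t\<^sup>2) * indicator {0<..} t) \<partial>lborel)"
    unfolding greenr_def green_def by (intro nn_integral_mono)
  also have "\<dots> = greenr l (r + 1) + ennreal (r / pi) * (\<integral>\<^sup>+t. ennreal (exp (- (a\<^sup>2 / 2) / t) / t\<^sup>2) * indicator {0<..} t \<partial>lborel)"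
    unfolding greenr_def green_def by (subst nn_integral_add) (auto simp: nn_integral_cmult)
  also have "\<dots> \<le> greenr l (r + 1) + ennreal (r / pi) * ennreal (1 / (a\<^sup>2 / 2))"
    using a by (intro add_mono mult_left_mono nn_integral_exp_inverse) auto
  also have "\<dots> \<le> greenr l (r + 1) + ennreal (8 / (pi * r))"
  proof -
    have "(r / 2)\<^sup>2 \<le> a\<^sup>2" using a r by (intro power_mono) auto
    hence "r * 2 / a\<^sup>2 \<le> r * 2 / (r / 2)\<^sup>2" using r a by (intro divide_left_mono) auto
    also have "\<dots> = 8 / r" using r by (simp add: power2_eq_square)
    finally have "r / pi * (1 / (a\<^sup>2 / 2)) \<le> 8 / (pi * r)" using r by (simp add: field_simps)
    thus ?thesis using r a by (intro add_mono) (auto simp: ennreal_mult[symmetric] ennreal_leI)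
  qed
  finally show ?thesis .
qed

text \<open>The error of \<open>greenr_diff\<close> integrated against the potential. Beyond radius
  \<open>1 / \<eta>\<close> the weight is at most \<open>\<eta>\<close> and the potential has
  integral \<open>pi / l\<close>; below it the potential is at most logarithmic in
  \<open>1 / l\<close> and the area is \<open>pi / \<eta>\<^sup>2\<close>.\<close>

lemma far_weight_integral:
  assumes l: "0 < l" "l \<le> 1" and \<eta>: "0 < \<eta>"
  shows "(\<integral>\<^sup>+z. far z * (disc_pot l z * ennreal (1 / norm z)) \<partial>lborel) \<le> ennreal (pi * \<eta> / l + (hlog l + 2) / 2 * (pi / \<eta>\<^sup>2))"
proof -
  have [measurable]: "ball (0::complex) (1 / \<eta>) \<in> sets borel" by simp
  have "far z * (disc_pot l z * ennreal (1 / norm z)) \<le> ennreal \<eta> * disc_pot l z + ennreal ((hlog l + 2) / 2) * indicator (ball 0 (1 / \<eta>)) z" for z :: complex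
  proof (cases "2 \<le> norm z")
    case True
    show ?thesis
    proof (cases "norm z < 1 / \<eta>")
      case False
      moreover have nz: "0 < norm z" using True by linarith
      ultimately have "1 / norm z \<le> \<eta>" using \<eta> by (simp add: pos_divide_le_eq pos_less_divide_eq mult.commute)
      hence "disc_pot l z * ennreal (1 / norm z) \<le> disc_pot l z * ennreal \<eta>" by (intro mult_left_mono ennreal_leI) auto
      thus ?thesis using True by (simp add: mult.commute add_increasing2)
    next
      case z: True
      have "1 / norm z \<le> 1 / 2" using True by (intro divide_left_mono) auto
      hence "disc_pot l z * ennreal (1 / norm z) \<le> ennreal (hlog l + 2) * ennreal (1 / 2)"
        by (intro mult_mono disc_pot_le l ennreal_leI) auto
      also have "\<dots> = ennreal ((hlog l + 2) * (1 / 2))" by (rule ennreal_mult[symmetric]) (use hlog_nonneg[OF l] in auto)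
      also have "\<dots> = ennreal ((hlog l + 2) / 2)" by simp
      finally show ?thesis using True z by (simp add: add_increasing)
    qed
  qed simp
  hence "(\<integral>\<^sup>+z. far z * (disc_pot l z * ennreal (1 / norm z)) \<partial>lborel) \<le> (\<integral>\<^sup>+z. ennreal \<eta> * disc_pot l z + ennreal ((hlog l + 2) / 2) * indicator (ball 0 (1 / \<eta>)) z \<partial>lborel)"
    by (rule nn_integral_mono)
  also have "\<dots> = ennreal \<eta> * (\<integral>\<^sup>+z. disc_pot l z \<partial>lborel) + ennreal ((hlog l + 2) / 2) * emeasure lborel (ball (0::complex) (1 / \<eta>))"
    by (subst nn_integral_add) (auto simp: nn_integral_cmult)
  also have "\<dots> = ennreal (\<eta> * (pi / l)) + ennreal ((hlog l + 2) / 2 * (pi * (1 / \<eta>)\<^sup>2))"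
    using \<eta> l hlog_nonneg[OF l] by (simp add: nn_integral_disc_pot emeasure_ball eval_unit_ball_vol ennreal_mult[symmetric])
  also have "\<dots> = ennreal (pi * \<eta> / l + (hlog l + 2) / 2 * (pi / \<eta>\<^sup>2))"
    using \<eta> l hlog_nonneg[OF l] by (subst ennreal_plus[symmetric]) (auto simp: power_divide mult.commute)
  finally show ?thesis .
qed

lemma greenr_finite: "0 < l \<Longrightarrow> l \<le> 1 \<Longrightarrow> greenr l (norm (z::complex) + 1) < \<infinity>"
proof -
  assume l: "0 < l" "l \<le> 1"
  have "ennreal pi * greenr l (norm z + 1) \<le> ennreal (hlog l + 2)"
    by (rule order_trans[OF greenr_disc_pot disc_pot_le[OF l]])
  hence "ennreal pi * greenr l (norm z + 1) < \<infinity>" by (simp add: order_le_less_trans)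
  thus ?thesis by (auto simp: ennreal_mult_less_top ennreal_mult_eq_top_iff less_top)
qed

section \<open>Two-sided bounds for the Laplace transform\<close>

text \<open>In \<open>hit_laplace_upper\<close> the Green function at \<open>norm z - 1\<close> is
  replaced by \<open>disc_pot l z / pi\<close> up to the error of \<open>greenr_diff\<close>. The
  main term is then the integral of the squared potential, at most
  \<open>pi / (2 * l)\<close>.\<close>

lemma hit_laplace_le:
  assumes l: "0 < l" "l \<le> 1 / 9" "3 / 2 < hlog l" and J: "(\<integral>\<^sup>+z. far z * (disc_pot l z * ennreal (1 / norm z)) \<partial>lborel) \<le> ennreal J" and J0: "0 \<le> J"
  shows "hit_laplace l \<le> ennreal (1 / (hlog l - 3 / 2) * (1 / (2 * l) + 8 / pi * J))"
proof -
  have "hit_laplace l \<le> ennreal (1 / (hlog l - 3 / 2)) * (\<integral>\<^sup>+z. far z * (greenr l (norm z - 1) * disc_pot l z) \<partial>lborel)"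
    by (rule hit_laplace_upper) (use l disc_pot_ge in auto)
  also have "(\<integral>\<^sup>+z. far z * (greenr l (norm z - 1) * disc_pot l z) \<partial>lborel) \<le>
     (\<integral>\<^sup>+z. ennreal (1 / pi) * (disc_pot l z * disc_pot l z) + ennreal (8 / pi) * (far z * (disc_pot l z * ennreal (1 / norm z))) \<partial>lborel)"
  proof (rule nn_integral_mono)
    fix z :: complex
    show "far z * (greenr l (norm z - 1) * disc_pot l z) \<le> ennreal (1 / pi) * (disc_pot l z * disc_pot l z) + ennreal (8 / pi) * (far z * (disc_pot l z * ennreal (1 / norm z)))"
    proof (cases "2 \<le> norm z")
      case True
      have "greenr l (norm z + 1) = ennreal (1 / pi) * (ennreal pi * greenr l (norm z + 1))"
        by (simp add: mult.assoc[symmetric] ennreal_mult[symmetric])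
      also have "\<dots> \<le> ennreal (1 / pi) * disc_pot l z" by (intro mult_left_mono greenr_disc_pot) simp
      finally have "greenr l (norm z - 1) \<le> ennreal (1 / pi) * disc_pot l z + ennreal (8 / (pi * norm z))"
        using greenr_diff[OF l(1) True] by (meson add_right_mono order_trans)
      also have "ennreal (8 / (pi * norm z)) = ennreal (8 / pi) * ennreal (1 / norm z)" by (simp add: ennreal_mult[symmetric])
      finally have "greenr l (norm z - 1) * disc_pot l z \<le> (ennreal (1 / pi) * disc_pot l z + ennreal (8 / pi) * ennreal (1 / norm z)) * disc_pot l z"
        by (rule mult_right_mono) simp
      thus ?thesis using True by (simp add: distrib_left distrib_right mult_ac)
    qed simp
  qed
  also have "\<dots> = ennreal (1 / pi) * (\<integral>\<^sup>+z. disc_pot l z * disc_pot l z \<partial>lborel) + ennreal (8 / pi) * (\<integral>\<^sup>+z. far z * (disc_pot l z * ennreal (1 / norm z)) \<partial>lborel)"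
    by (subst nn_integral_add) (auto simp: nn_integral_cmult)
  also have "\<dots> \<le> ennreal (1 / pi) * ennreal (pi / (2 * l)) + ennreal (8 / pi) * ennreal J"
    by (intro add_mono mult_left_mono disc_pot_square_le l J) auto
  also have "\<dots> = ennreal (1 / (2 * l) + 8 / pi * J)"
    using l J0 by (simp add: ennreal_mult[symmetric] ennreal_plus[symmetric] del: ennreal_plus)
  finally have "hit_laplace l \<le> ennreal (1 / (hlog l - 3 / 2)) * ennreal (1 / (2 * l) + 8 / pi * J)"
    by (simp add: mult_left_mono)
  also have "\<dots> = ennreal (1 / (hlog l - 3 / 2) * (1 / (2 * l) + 8 / pi * J))"
    by (rule ennreal_mult[symmetric]) (use l J0 in auto)
  finally show ?thesis .
qed

text \<open>The same comparison read backwards: with \<open>u\<close> the potential and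
  \<open>g\<close> the Green function at \<open>norm z + 1\<close>, \<open>u <= pi g + d\<close> and
  \<open>pi g <= u\<close> give \<open>u u <= (pi g) (pi g) + 2 d u\<close>. The points with
  \<open>norm z < 2\<close>, which are not roots of \<open>far_hit\<close>, are covered by the bound
  for the potential and the area \<open>4 * pi\<close>.\<close>

lemma hit_laplace_ge:
  assumes l: "0 < l" "l \<le> 1 / 9" and J: "(\<integral>\<^sup>+z. far z * (disc_pot l z * ennreal (1 / norm z)) \<partial>lborel) \<le> ennreal J" and J0: "0 \<le> J"
  shows "ennreal (pi / 2 * (1 - 3 * sqrt l) / l) \<le> ennreal (pi * (hlog l + 3)) * hit_laplace l + ennreal (16 * J + 4 * pi * (hlog l + 2)\<^sup>2)"
proof -
  have l1: "l \<le> 1" using l by simp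
  have [measurable]: "ball (0::complex) 2 \<in> sets borel" by simp
  let ?g = "\<lambda>z. greenr l (norm z + 1)"
  have pw: "disc_pot l z * disc_pot l z \<le> ennreal pi * (far z * (?g z * (ennreal pi * ?g z))) +
     (ennreal 16 * (far z * (disc_pot l z * ennreal (1 / norm z))) + ennreal ((hlog l + 2)\<^sup>2) * indicator (ball 0 2) z)" for z :: complex
  proof (cases "2 \<le> norm z")
    case True
    define u where "u = disc_pot l z"
    define d where "d = ennreal (8 / norm z)"
    have "ennreal pi * ennreal (8 / (pi * norm z)) = d" using True by (simp add: ennreal_mult[symmetric] d_def)
    hence "u \<le> ennreal pi * ?g z + d"
    proof -
      assume d: "ennreal pi * ennreal (8 / (pi * norm z)) = d"
      have "ennreal pi * greenr l (norm z - 1) \<le> ennreal pi * (?g z + ennreal (8 / (pi * norm z)))"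
        by (intro mult_left_mono greenr_diff l True) simp
      from order_trans[OF disc_pot_le_greenr[OF True] this] show ?thesis
        by (simp add: distrib_left u_def d)
    qed
    hence "u * u \<le> (ennreal pi * ?g z + d) * u" by (rule mult_right_mono) simp
    also have "\<dots> = ennreal pi * ?g z * u + d * u" by (simp add: distrib_right)
    also have "ennreal pi * ?g z * u \<le> ennreal pi * ?g z * (ennreal pi * ?g z + d)"
      by (intro mult_left_mono) (use \<open>u \<le> ennreal pi * ?g z + d\<close> in auto)
    also have "\<dots> = ennreal pi * ?g z * (ennreal pi * ?g z) + d * (ennreal pi * ?g z)" by (simp add: distrib_left mult_ac)
    also have "\<dots> \<le> ennreal pi * ?g z * (ennreal pi * ?g z) + d * u"
      by (intro add_left_mono mult_left_mono) (use greenr_disc_pot in \<open>auto simp: u_def\<close>)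
    finally have "u * u \<le> ennreal pi * ?g z * (ennreal pi * ?g z) + (d * u + d * u)" by (simp add: add.assoc)
    moreover have "d * u + d * u = ennreal 16 * (u * ennreal (1 / norm z))"
    proof -
      have "d + d = ennreal (8 / norm z + 8 / norm z)" unfolding d_def by (rule ennreal_plus[symmetric]) auto
      also have "8 / norm z + 8 / norm z = 16 * (1 / norm z)" by simp
      also have "ennreal (16 * (1 / norm z)) = ennreal 16 * ennreal (1 / norm z)" by (rule ennreal_mult) auto
      finally have "d + d = ennreal 16 * ennreal (1 / norm z)" .
      thus ?thesis by (simp add: distrib_right[symmetric] mult_ac)
    qed
    ultimately show ?thesis using True by (simp add: u_def mult.assoc)
  next
    case False
    have "disc_pot l z * disc_pot l z \<le> ennreal (hlog l + 2) * ennreal (hlog l + 2)"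
      by (intro mult_mono disc_pot_le l1 l) auto
    also have "\<dots> = ennreal ((hlog l + 2)\<^sup>2)"
      unfolding power2_eq_square by (rule ennreal_mult[symmetric]) (use hlog_nonneg[OF l(1) l1] in auto)
    finally show ?thesis using False by simp
  qed
  have "ennreal (pi / 2 * (1 - 3 * sqrt l) / l) \<le> (\<integral>\<^sup>+z. disc_pot l z * disc_pot l z \<partial>lborel)"
    by (rule disc_pot_square_ge[OF l])
  also have "\<dots> \<le> (\<integral>\<^sup>+z. ennreal pi * (far z * (?g z * (ennreal pi * ?g z))) +
     (ennreal 16 * (far z * (disc_pot l z * ennreal (1 / norm z))) + ennreal ((hlog l + 2)\<^sup>2) * indicator (ball 0 2) z) \<partial>lborel)"
    by (rule nn_integral_mono) (rule pw)
  also have "\<dots> = ennreal pi * (\<integral>\<^sup>+z. far z * (?g z * (ennreal pi * ?g z)) \<partial>lborel) +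
     (ennreal 16 * (\<integral>\<^sup>+z. far z * (disc_pot l z * ennreal (1 / norm z)) \<partial>lborel) + ennreal ((hlog l + 2)\<^sup>2) * emeasure lborel (ball (0::complex) 2))"
    by (simp add: nn_integral_add nn_integral_cmult)
  also have "\<dots> \<le> ennreal pi * (ennreal (hlog l + 3) * hit_laplace l) + (ennreal 16 * ennreal J + ennreal ((hlog l + 2)\<^sup>2) * ennreal (4 * pi))"
  proof (intro add_mono mult_left_mono hit_laplace_lower J)
    show "disc_sum n \<epsilon> l x \<le> ennreal (hlog l + 3)" if "0 < \<epsilon>" "\<epsilon> \<le> 1" for n \<epsilon> x
      by (rule disc_sum_le[OF l(1) l1 that])
    show "greenr l (norm z + 1) < \<infinity>" for z :: complex by (rule greenr_finite[OF l(1) l1])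
    show "emeasure lborel (ball (0::complex) 2) \<le> ennreal (4 * pi)"
      by (simp add: emeasure_ball eval_unit_ball_vol mult.commute)
  qed auto
  also have "\<dots> = ennreal (pi * (hlog l + 3)) * hit_laplace l + ennreal (16 * J + 4 * pi * (hlog l + 2)\<^sup>2)"
  proof -
    have "ennreal 16 * ennreal J + ennreal ((hlog l + 2)\<^sup>2) * ennreal (4 * pi) = ennreal (16 * J + 4 * pi * (hlog l + 2)\<^sup>2)"
    proof -
      have "ennreal 16 * ennreal J = ennreal (16 * J)" by (rule ennreal_mult[symmetric]) (use J0 in auto)
      moreover have "ennreal ((hlog l + 2)\<^sup>2) * ennreal (4 * pi) = ennreal ((hlog l + 2)\<^sup>2 * (4 * pi))" by (rule ennreal_mult[symmetric]) auto
      moreover have "ennreal (16 * J + (hlog l + 2)\<^sup>2 * (4 * pi)) = ennreal (16 * J) + ennreal ((hlog l + 2)\<^sup>2 * (4 * pi))"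
        by (rule ennreal_plus) (use J0 in auto)
      ultimately show ?thesis by (simp only: mult.commute mult.left_commute)
    qed
    moreover have "ennreal pi * ennreal (hlog l + 3) = ennreal (pi * (hlog l + 3))"
      by (rule ennreal_mult[symmetric]) (use hlog_nonneg[OF l(1) l1] in auto)
    ultimately show ?thesis by (simp only: mult.assoc[symmetric])
  qed
  finally show ?thesis .
qed

definition hit_rate :: "real \<Rightarrow> real" where
  "hit_rate r = enn2real (hit_laplace (1 / r\<^sup>2))"

text \<open>The choice \<open>\<eta> = 1 / sqrt r\<close> in \<open>far_weight_integral\<close>
  makes both error terms smaller than \<open>r\<^sup>2\<close> by a power of \<open>r\<close>, up to
  logarithms. The threshold 9 ensures \<open>l <= 1 / 9\<close> and
  \<open>ln r > 3 / 2\<close>.\<close>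

lemma hit_rate_bounds:
  assumes r: "9 \<le> r"
  shows "hit_laplace (1 / r\<^sup>2) = ennreal (hit_rate r)"
    and "hit_rate r \<le> 1 / (ln r - 3 / 2) * (r\<^sup>2 / 2 + 8 * (r\<^sup>2 / sqrt r + (ln r + 2) / 2 * r))"
    and "(r\<^sup>2 / 2 * (1 - 3 / r) - (16 * (r\<^sup>2 / sqrt r + (ln r + 2) / 2 * r) + 4 * (ln r + 2)\<^sup>2)) / (ln r + 3) \<le> hit_rate r"
proof -
  define l where "l = 1 / r\<^sup>2"
  have r0: "0 < r" using r by simp
  have l0: "0 < l" using r by (simp add: l_def)
  have "9 * 9 \<le> r * r" using r by (intro mult_mono) auto
  hence l9: "l \<le> 1 / 9" unfolding l_def power2_eq_square by (intro divide_left_mono) auto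
  have h: "hlog l = ln r" using r0 by (simp add: hlog_def l_def ln_realpow)
  have "exp (3 / 2) \<le> (exp (1::real))\<^sup>2" by (simp add: exp_double[symmetric])
  also have "\<dots> < 3\<^sup>2" using e_less_272 by (intro power_strict_mono) auto
  finally have "exp (3 / 2) < r" using r by simp
  hence h32: "3 / 2 < hlog l" unfolding h using r0 by (metis exp_gt_zero ln_exp ln_less_cancel_iff)
  define J where "J = pi * (r\<^sup>2 / sqrt r + (ln r + 2) / 2 * r)"
  have J0: "0 \<le> J" using r h32 by (auto simp: J_def h intro!: mult_nonneg_nonneg add_nonneg_nonneg)
  have J: "(\<integral>\<^sup>+z. far z * (disc_pot l z * ennreal (1 / norm z)) \<partial>lborel) \<le> ennreal J"
  proof -
    have "pi * (1 / sqrt r) / l + (hlog l + 2) / 2 * (pi / (1 / sqrt r)\<^sup>2) = J"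
      unfolding J_def h using r0 by (simp add: l_def power_divide algebra_simps)
    thus ?thesis using far_weight_integral[OF l0, of "1 / sqrt r"] l9 r0 by simp
  qed
  have up: "hit_laplace l \<le> ennreal (1 / (ln r - 3 / 2) * (r\<^sup>2 / 2 + 8 * (r\<^sup>2 / sqrt r + (ln r + 2) / 2 * r)))"
    using hit_laplace_le[OF l0 l9 h32 J J0] unfolding h J_def using r0 by (simp add: l_def)
  hence "hit_laplace l < top" by (simp add: order_le_less_trans)
  thus eq: "hit_laplace (1 / r\<^sup>2) = ennreal (hit_rate r)" unfolding hit_rate_def l_def[symmetric] by simp
  have nn: "0 \<le> hit_rate r" by (simp add: hit_rate_def)
  have "0 \<le> 1 / (ln r - 3 / 2) * (r\<^sup>2 / 2 + 8 * (r\<^sup>2 / sqrt r + (ln r + 2) / 2 * r))"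
    using h32 r by (intro mult_nonneg_nonneg add_nonneg_nonneg divide_nonneg_nonneg) (auto simp: h)
  thus "hit_rate r \<le> 1 / (ln r - 3 / 2) * (r\<^sup>2 / 2 + 8 * (r\<^sup>2 / sqrt r + (ln r + 2) / 2 * r))"
    using up unfolding l_def eq by (simp add: ennreal_le_iff)
  define B where "B = 16 * J + 4 * pi * (ln r + 2)\<^sup>2"
  have "ennreal (pi / 2 * (1 - 3 * sqrt l) / l) \<le> ennreal (pi * (ln r + 3)) * ennreal (hit_rate r) + ennreal B"
    using hit_laplace_ge[OF l0 l9 J J0] unfolding eq[folded l_def] h B_def .
  also have "\<dots> = ennreal (pi * (ln r + 3) * hit_rate r + B)"
    using h32 nn J0 by (simp add: h B_def ennreal_mult[symmetric] ennreal_plus[symmetric] del: ennreal_plus)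
  finally have a: "pi / 2 * (1 - 3 * sqrt l) / l \<le> pi * (ln r + 3) * hit_rate r + B"
    by (subst (asm) ennreal_le_iff) (use h32 nn J0 in \<open>auto simp: h B_def\<close>)
  have b: "pi / 2 * (1 - 3 * sqrt l) / l = pi * (r\<^sup>2 / 2 * (1 - 3 / r))"
    using r0 by (simp add: l_def real_sqrt_divide)
  have c: "B = pi * (16 * (r\<^sup>2 / sqrt r + (ln r + 2) / 2 * r) + 4 * (ln r + 2)\<^sup>2)"
    by (simp add: B_def J_def algebra_simps)
  have "pi * (r\<^sup>2 / 2 * (1 - 3 / r)) \<le> pi * ((ln r + 3) * hit_rate r + (16 * (r\<^sup>2 / sqrt r + (ln r + 2) / 2 * r) + 4 * (ln r + 2)\<^sup>2))"
    using a unfolding b c mult.assoc[of pi "ln r + 3"] distrib_left[of pi "(ln r + 3) * hit_rate r"] .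
  hence "r\<^sup>2 / 2 * (1 - 3 / r) \<le> (ln r + 3) * hit_rate r + (16 * (r\<^sup>2 / sqrt r + (ln r + 2) / 2 * r) + 4 * (ln r + 2)\<^sup>2)"
    by (subst (asm) mult_le_cancel_left_pos) auto
  hence "r\<^sup>2 / 2 * (1 - 3 / r) - (16 * (r\<^sup>2 / sqrt r + (ln r + 2) / 2 * r) + 4 * (ln r + 2)\<^sup>2) \<le> hit_rate r * (ln r + 3)"
    unfolding diff_le_eq mult.commute[of "hit_rate r"] .
  thus "(r\<^sup>2 / 2 * (1 - 3 / r) - (16 * (r\<^sup>2 / sqrt r + (ln r + 2) / 2 * r) + 4 * (ln r + 2)\<^sup>2)) / (ln r + 3) \<le> hit_rate r"
    using h32 by (subst pos_divide_le_eq) (auto simp: h)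
qed

text \<open>The factor \<open>2 / r ^ 3\<close> is the Jacobian of the substitution
  \<open>l = 1 / r\<^sup>2\<close>. Upper and lower bound both expand to
  \<open>1 / (r * ln r)\<close> with an error that is integrable at infinity.\<close>

theorem hit_rate_asymptotics:
  obtains C R where "0 < C" "9 \<le> R" "\<And>r. R \<le> r \<Longrightarrow> \<bar>2 * hit_rate r / r ^ 3 - 1 / (r * ln r)\<bar> \<le> C / (r * (ln r)\<^sup>2)"
proof -
  define U where "U r = 2 * (1 / (ln r - 3 / 2) * (r\<^sup>2 / 2 + 8 * (r\<^sup>2 / sqrt r + (ln r + 2) / 2 * r))) / r ^ 3 - 1 / (r * ln r)" for r :: real
  define V where "V r = 2 * ((r\<^sup>2 / 2 * (1 - 3 / r) - (16 * (r\<^sup>2 / sqrt r + (ln r + 2) / 2 * r) + 4 * (ln r + 2)\<^sup>2)) / (ln r + 3)) / r ^ 3 - 1 / (r * ln r)" for r :: real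
  have "U \<in> O(\<lambda>r. 1 / (r * (ln r)\<^sup>2))" unfolding U_def by real_asymp
  then obtain c1 where c1: "c1 > 0" "\<forall>\<^sub>F r in at_top. norm (U r) \<le> c1 * norm (1 / (r * (ln r)\<^sup>2))"
    by (elim landau_o.bigE)
  have "V \<in> O(\<lambda>r. 1 / (r * (ln r)\<^sup>2))" unfolding V_def by real_asymp
  then obtain c2 where c2: "c2 > 0" "\<forall>\<^sub>F r in at_top. norm (V r) \<le> c2 * norm (1 / (r * (ln r)\<^sup>2))"
    by (elim landau_o.bigE)
  have "\<forall>\<^sub>F r in at_top. \<bar>2 * hit_rate r / r ^ 3 - 1 / (r * ln r)\<bar> \<le> (c1 + c2) / (r * (ln r)\<^sup>2)"
    using c1(2) c2(2) eventually_ge_at_top[of 9]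
  proof eventually_elim
    case (elim r)
    have w: "0 \<le> 1 / (r * (ln r)\<^sup>2)" using elim by simp
    have "2 * hit_rate r / r ^ 3 - 1 / (r * ln r) \<le> U r"
      unfolding U_def using elim hit_rate_bounds(2)[of r] by (intro diff_right_mono divide_right_mono mult_left_mono) auto
    moreover have "V r \<le> 2 * hit_rate r / r ^ 3 - 1 / (r * ln r)"
      unfolding V_def using elim hit_rate_bounds(3)[of r] by (intro diff_right_mono divide_right_mono mult_left_mono) auto
    moreover have "U r \<le> c1 * (1 / (r * (ln r)\<^sup>2))" "- (c2 * (1 / (r * (ln r)\<^sup>2))) \<le> V r"
      using elim w unfolding real_norm_def by (auto simp: abs_le_iff)
    moreover have "0 \<le> c1 * (1 / (r * (ln r)\<^sup>2))" "0 \<le> c2 * (1 / (r * (ln r)\<^sup>2))"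
      using w c1 c2 by (auto intro!: mult_nonneg_nonneg simp del: times_divide_eq_right)
    ultimately have "\<bar>2 * hit_rate r / r ^ 3 - 1 / (r * ln r)\<bar> \<le> (c1 + c2) * (1 / (r * (ln r)\<^sup>2))"
      unfolding distrib_right by linarith
    thus ?case by simp
  qed
  then obtain R where "\<And>r. R \<le> r \<Longrightarrow> \<bar>2 * hit_rate r / r ^ 3 - 1 / (r * ln r)\<bar> \<le> (c1 + c2) / (r * (ln r)\<^sup>2)"
    by (auto simp: eventually_at_top_linorder)
  thus ?thesis using c1 c2 by (intro that[of "c1 + c2" "max 9 R"]) auto
qed

section \<open>Growth of the mass of large loops\<close>

lemma sigma_finite_loop_meas: "sigma_finite_measure loop_meas"
proof -
  interpret B: pair_sigma_finite "lborel :: complex measure" "lborel \<Otimes>\<^sub>M gauss :: (real \<times> (gauss_index \<Rightarrow> real)) measure"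
    by (intro pair_sigma_finite.intro lborel.sigma_finite_measure_axioms lborel_gauss.sigma_finite_measure_axioms)
  show ?thesis
    unfolding loop_meas_def by (subst B.sigma_finite_iff_density_finite) (auto simp: loop_weight_def)
qed

interpretation loop_meas: sigma_finite_measure loop_meas
  by (rule sigma_finite_loop_meas)

interpretation complex_gauss: pair_sigma_finite "lborel :: complex measure" gauss
  by (intro pair_sigma_finite.intro lborel.sigma_finite_measure_axioms gauss.sigma_finite_measure_axioms)

section \<open>The size of a loop\<close>

abbreviation dur :: "rooted_loop \<Rightarrow> real" where "dur x \<equiv> fst (snd x)"

definition spread :: "rooted_loop \<Rightarrow> real" where
  "spread x = sqrt (dur x) * bridge_bound (snd (snd x))"

lemma measurable_fst_loop [measurable]: "(\<lambda>x. fst x) \<in> borel_measurable loop_meas"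
  and measurable_dur [measurable]: "(\<lambda>x. dur x) \<in> borel_measurable loop_meas"
  and measurable_spread [measurable]: "spread \<in> borel_measurable loop_meas"
  unfolding measurable_cong_sets[OF sets_loop_meas refl] spread_def[abs_def] by measurable

lemma trace_spread:
  assumes "z \<in> trace x" "0 < dur x" shows "norm (z - fst x) \<le> spread x"
proof -
  obtain s where "z = loop_path x s" using assms by (auto simp: trace_def)
  thus ?thesis using assms norm_bridge[of s "snd (snd x)"]
    by (auto simp: loop_path_def spread_def norm_mult intro!: mult_left_mono)
qed

definition bound_moment :: real where
  "bound_moment = enn2real (\<integral>\<^sup>+\<omega>. ennreal (bridge_bound \<omega> ^ 4) \<partial>gauss)"

lemma bound_moment: "(\<integral>\<^sup>+\<omega>. ennreal (bridge_bound \<omega> ^ 4) \<partial>gauss) = ennreal bound_moment" "0 \<le> bound_moment"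
  using nn_integral_bridge_bound by (simp_all add: bound_moment_def)

lemma bridge_bound_nonneg: "0 \<le> bridge_bound \<omega>"
  using norm_bridge[of 0 \<omega>] norm_ge_zero order_trans by blast

lemma emeasure_cball_complex: "0 \<le> r \<Longrightarrow> emeasure lborel (cball (0::complex) r) = ennreal (pi * r\<^sup>2)"
  by (simp add: emeasure_cball eval_unit_ball_vol)

text \<open>Integrating over the root first gives an area \<open>pi q\<^sup>2\<close>, and
  \<open>\<rho> <= q\<close> allows a further factor \<open>(q / \<rho>)\<^sup>2\<close>. The
  resulting \<open>q ^ 4\<close> contains \<open>t\<^sup>2\<close>, which cancels the singular
  weight \<open>1 / (2 pi t\<^sup>2)\<close>; this is where the fourth moment of the bridge
  enters.\<close>

lemma small_loops:
  assumes T: "0 < T" and \<rho>: "0 < \<rho>" and c: "0 \<le> c"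
  shows "emeasure loop_meas {x. 0 < dur x \<and> dur x < T \<and> norm (fst x) \<le> c * spread x \<and> \<rho> \<le> c * spread x} \<le> ennreal (c ^ 4 * bound_moment * T / (2 * \<rho>\<^sup>2))"
proof -
  define q where "q t \<omega> = c * (sqrt t * bridge_bound \<omega>)" for t \<omega>
  \<comment> \<open>The rule is given once for each product space through which the changes of the
    order of integration pass.\<close>
  have [measurable]: "(\<lambda>x. q (f x) (g x)) \<in> borel_measurable Q" if [measurable]: "f \<in> borel_measurable Q" "g \<in> measurable Q gauss" for f g and Q :: "(complex \<times> (gauss_index \<Rightarrow> real)) measure"
    unfolding q_def by measurable
  have [measurable]: "(\<lambda>x. q (f x) (g x)) \<in> borel_measurable Q" if [measurable]: "f \<in> borel_measurable Q" "g \<in> measurable Q gauss" for f g and Q :: "rooted_loop measure"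
    unfolding q_def by measurable
  have [measurable]: "(\<lambda>x. q (f x) (g x)) \<in> borel_measurable Q" if [measurable]: "f \<in> borel_measurable Q" "g \<in> measurable Q gauss" for f g and Q :: "((complex \<times> real) \<times> (gauss_index \<Rightarrow> real)) measure"
    unfolding q_def by measurable
  have [measurable]: "(\<lambda>x. q (f x) (g x)) \<in> borel_measurable Q" if [measurable]: "f \<in> borel_measurable Q" "g \<in> measurable Q gauss" for f g and Q :: "((real \<times> complex) \<times> (gauss_index \<Rightarrow> real)) measure"
    unfolding q_def by measurable
  have [measurable]: "(\<lambda>x. q (f x) (g x)) \<in> borel_measurable Q" if [measurable]: "f \<in> borel_measurable Q" "g \<in> measurable Q gauss" for f g and Q :: "(gauss_index \<Rightarrow> real) measure"
    unfolding q_def by measurable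
  let ?A = "{x. 0 < dur x \<and> dur x < T \<and> norm (fst x) \<le> c * spread x \<and> \<rho> \<le> c * spread x}"
  define f where "f z t \<omega> = (if 0 < t \<and> t < T \<and> norm z \<le> q t \<omega> \<and> \<rho> \<le> q t \<omega> then 1 else 0 :: ennreal)" for z :: complex and t :: real and \<omega>
  have "{x \<in> space loop_meas. 0 < dur x \<and> dur x < T \<and> norm (fst x) \<le> c * spread x \<and> \<rho> \<le> c * spread x} \<in> sets loop_meas" by measurable
  hence A: "?A \<in> sets loop_meas" by simp
  have "emeasure loop_meas ?A = (\<integral>\<^sup>+x. indicator ?A x \<partial>loop_meas)" using A by simp
  also have "\<dots> = (\<integral>\<^sup>+z. \<integral>\<^sup>+t. loop_weight t * (\<integral>\<^sup>+\<omega>. f z t \<omega> \<partial>gauss) \<partial>lborel \<partial>lborel)"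
    using A by (subst nn_integral_loop_meas, simp, intro nn_integral_cong arg_cong2[where f="(*)"] refl)
      (auto simp: f_def q_def spread_def indicator_def)
  also have "\<dots> = (\<integral>\<^sup>+t. \<integral>\<^sup>+z. loop_weight t * (\<integral>\<^sup>+\<omega>. f z t \<omega> \<partial>gauss) \<partial>lborel \<partial>lborel)"
    unfolding f_def by (rule lborel_pair.Fubini') measurable
  also have "\<dots> = (\<integral>\<^sup>+t. loop_weight t * (\<integral>\<^sup>+z. \<integral>\<^sup>+\<omega>. f z t \<omega> \<partial>gauss \<partial>lborel) \<partial>lborel)"
    unfolding f_def by (intro nn_integral_cong nn_integral_cmult) measurable
  also have "\<dots> = (\<integral>\<^sup>+t. loop_weight t * (\<integral>\<^sup>+\<omega>. \<integral>\<^sup>+z. f z t \<omega> \<partial>lborel \<partial>gauss) \<partial>lborel)"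
    unfolding f_def by (intro nn_integral_cong arg_cong2[where f="(*)"] refl complex_gauss.Fubini'[symmetric]) measurable
  also have "\<dots> \<le> (\<integral>\<^sup>+t. loop_weight t * (\<integral>\<^sup>+\<omega>. ennreal (pi * c ^ 4 * t\<^sup>2 / \<rho>\<^sup>2) * indicator {0<..<T} t * ennreal (bridge_bound \<omega> ^ 4) \<partial>gauss) \<partial>lborel)"
  proof (intro nn_integral_mono mult_left_mono)
    fix t \<omega>
    show "(\<integral>\<^sup>+z. f z t \<omega> \<partial>lborel) \<le> ennreal (pi * c ^ 4 * t\<^sup>2 / \<rho>\<^sup>2) * indicator {0<..<T} t * ennreal (bridge_bound \<omega> ^ 4)"
    proof (cases "0 < t \<and> t < T \<and> \<rho> \<le> q t \<omega>")
      case True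
      have q0: "0 \<le> q t \<omega>" using True \<rho> by linarith
      have "(\<integral>\<^sup>+z. f z t \<omega> \<partial>lborel) = (\<integral>\<^sup>+z. indicator (cball (0::complex) (q t \<omega>)) z \<partial>lborel)"
        using True by (intro nn_integral_cong) (auto simp: f_def indicator_def)
      also have "\<dots> = ennreal (pi * (q t \<omega>)\<^sup>2)" using q0 by (simp add: emeasure_cball_complex)
      also have "\<dots> \<le> ennreal (pi * c ^ 4 * t\<^sup>2 / \<rho>\<^sup>2 * bridge_bound \<omega> ^ 4)"
      proof (rule ennreal_leI)
        have "\<rho>\<^sup>2 \<le> (q t \<omega>)\<^sup>2" using True \<rho> by (intro power_mono) auto
        hence "(q t \<omega>)\<^sup>2 * \<rho>\<^sup>2 \<le> (q t \<omega>)\<^sup>2 * (q t \<omega>)\<^sup>2" by (intro mult_left_mono) auto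
        also have "\<dots> = c ^ 4 * t\<^sup>2 * bridge_bound \<omega> ^ 4"
        proof -
          have "sqrt t ^ 4 = t\<^sup>2" using True by (simp add: numeral_eq_Suc)
          moreover have "(q t \<omega>) ^ 4 = c ^ 4 * (sqrt t ^ 4 * bridge_bound \<omega> ^ 4)"
            by (simp only: q_def power_mult_distrib)
          moreover have "(q t \<omega>)\<^sup>2 * (q t \<omega>)\<^sup>2 = (q t \<omega>) ^ (2 + 2)" by (rule power_add[symmetric])
          ultimately show ?thesis by simp
        qed
        finally have "(q t \<omega>)\<^sup>2 \<le> c ^ 4 * t\<^sup>2 * bridge_bound \<omega> ^ 4 / \<rho>\<^sup>2" using \<rho> by (simp add: pos_le_divide_eq)
        hence "pi * (q t \<omega>)\<^sup>2 \<le> pi * (c ^ 4 * t\<^sup>2 * bridge_bound \<omega> ^ 4 / \<rho>\<^sup>2)" by (intro mult_left_mono) auto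
        thus "pi * (q t \<omega>)\<^sup>2 \<le> pi * c ^ 4 * t\<^sup>2 / \<rho>\<^sup>2 * bridge_bound \<omega> ^ 4" by (simp add: mult_ac)
      qed
      also have "\<dots> = ennreal (pi * c ^ 4 * t\<^sup>2 / \<rho>\<^sup>2) * ennreal (bridge_bound \<omega> ^ 4)"
        by (rule ennreal_mult'') (use bridge_bound_nonneg in auto)
      finally show ?thesis using True by simp
    next
      case False
      hence "f z t \<omega> = 0" for z by (auto simp: f_def)
      thus ?thesis by simp
    qed
  qed simp
  also have "\<dots> = (\<integral>\<^sup>+t. ennreal (c ^ 4 * bound_moment / (2 * \<rho>\<^sup>2)) * indicator {0<..<T} t \<partial>lborel)"
  proof (rule nn_integral_cong)
    fix t
    have "(\<integral>\<^sup>+\<omega>. ennreal (pi * c ^ 4 * t\<^sup>2 / \<rho>\<^sup>2) * indicator {0<..<T} t * ennreal (bridge_bound \<omega> ^ 4) \<partial>gauss) = ennreal (pi * c ^ 4 * t\<^sup>2 / \<rho>\<^sup>2) * indicator {0<..<T} t * ennreal bound_moment"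
      by (subst nn_integral_cmult) (auto simp: bound_moment(1))
    thus "loop_weight t * (\<integral>\<^sup>+\<omega>. ennreal (pi * c ^ 4 * t\<^sup>2 / \<rho>\<^sup>2) * indicator {0<..<T} t * ennreal (bridge_bound \<omega> ^ 4) \<partial>gauss) = ennreal (c ^ 4 * bound_moment / (2 * \<rho>\<^sup>2)) * indicator {0<..<T} t"
      using bound_moment(2) c \<rho> by (cases "t \<in> {0<..<T}") (auto simp: loop_weight_def ennreal_mult[symmetric] power2_eq_square field_simps)
  qed
  also have "\<dots> = ennreal (c ^ 4 * bound_moment / (2 * \<rho>\<^sup>2)) * ennreal T"
    using T by (subst nn_integral_cmult) auto
  also have "\<dots> = ennreal (c ^ 4 * bound_moment * T / (2 * \<rho>\<^sup>2))"
    using T \<rho> c bound_moment(2) by (simp add: ennreal_mult[symmetric])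
  finally show ?thesis .
qed

lemma long_loops:
  assumes T: "0 < T" and \<rho>: "0 < \<rho>"
  shows "emeasure loop_meas {x. norm (fst x) < \<rho> \<and> T \<le> dur x} \<le> ennreal (\<rho>\<^sup>2 / (2 * T))"
proof -
  let ?A = "{x. norm (fst x) < \<rho> \<and> T \<le> dur x} :: rooted_loop set"
  have "{x \<in> space loop_meas. norm (fst x) < \<rho> \<and> T \<le> dur x} \<in> sets loop_meas" by measurable
  hence A: "?A \<in> sets loop_meas" by simp
  have [measurable]: "ball (0::complex) \<rho> \<in> sets borel" by simp
  have "emeasure loop_meas ?A = (\<integral>\<^sup>+x. indicator ?A x \<partial>loop_meas)" using A by simp
  also have "\<dots> = (\<integral>\<^sup>+z. \<integral>\<^sup>+t. loop_weight t * (\<integral>\<^sup>+\<omega>. indicator ?A (z, t, \<omega>) \<partial>gauss) \<partial>lborel \<partial>lborel)"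
    using A by (subst nn_integral_loop_meas) auto
  also have "\<dots> = (\<integral>\<^sup>+z. \<integral>\<^sup>+t. indicator (ball (0::complex) \<rho>) z * (ennreal (1 / (2 * pi * t\<^sup>2)) * indicator {T..} t) \<partial>lborel \<partial>lborel)"
    using T gauss.emeasure_space_1 by (intro nn_integral_cong) (auto simp: indicator_def of_bool_def loop_weight_def)
  also have "\<dots> = (\<integral>\<^sup>+z. indicator (ball (0::complex) \<rho>) z * (\<integral>\<^sup>+t. ennreal (1 / (2 * pi * t\<^sup>2)) * indicator {T..} t \<partial>lborel) \<partial>lborel)"
    by (intro nn_integral_cong nn_integral_cmult) measurable
  also have "(\<integral>\<^sup>+t. ennreal (1 / (2 * pi * t\<^sup>2)) * indicator {T..} t \<partial>lborel) = ennreal (0 - (- 1 / (2 * pi * T)))"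
  proof (rule nn_integral_FTC_atLeast)
    show "((\<lambda>t. - 1 / (2 * pi * t)) \<longlongrightarrow> 0) at_top" by real_asymp
    show "((\<lambda>t. - 1 / (2 * pi * t)) has_real_derivative 1 / (2 * pi * t\<^sup>2)) (at t)" if "T \<le> t" for t
      using T that by (auto intro!: derivative_eq_intros simp: power2_eq_square)
  qed auto
  also have "(\<integral>\<^sup>+z. indicator (ball (0::complex) \<rho>) z * ennreal (0 - (- 1 / (2 * pi * T))) \<partial>lborel) = ennreal (pi * \<rho>\<^sup>2) * ennreal (1 / (2 * pi * T))"
    using \<rho> by (subst nn_integral_multc) (auto simp: emeasure_ball eval_unit_ball_vol)
  also have "\<dots> = ennreal (\<rho>\<^sup>2 / (2 * T))"
    using T \<rho> by (simp add: ennreal_mult[symmetric])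
  finally show ?thesis by simp
qed

text \<open>Durations of at least 1 are covered by \<open>long_loops\<close>. For the others
  \<open>c\<close> is chosen so that \<open>c * spread x\<close> dominates both the norm of the root
  and \<open>d\<close>, as \<open>small_loops\<close> demands.\<close>

lemma local_loops:
  assumes \<rho>: "0 < \<rho>" and d: "0 < d"
  shows "emeasure loop_meas {x. 0 < dur x \<and> norm (fst x) < \<rho> \<and> d \<le> spread x} < \<infinity>"
proof -
  define c where "c = max 1 (\<rho> / d)"
  have c: "1 \<le> c" "\<rho> / d \<le> c" by (auto simp: c_def)
  let ?S = "{x. 0 < dur x \<and> dur x < 1 \<and> norm (fst x) \<le> c * spread x \<and> d \<le> c * spread x}"
  let ?L = "{x. norm (fst x) < \<rho> \<and> 1 \<le> dur x} :: rooted_loop set"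
  have "{x \<in> space loop_meas. 0 < dur x \<and> dur x < 1 \<and> norm (fst x) \<le> c * spread x \<and> d \<le> c * spread x} \<in> sets loop_meas"
    "{x \<in> space loop_meas. norm (fst x) < \<rho> \<and> 1 \<le> dur x} \<in> sets loop_meas" by measurable
  hence [simp]: "?S \<in> sets loop_meas" "?L \<in> sets loop_meas" by simp_all
  have "{x. 0 < dur x \<and> norm (fst x) < \<rho> \<and> d \<le> spread x} \<subseteq> ?S \<union> ?L"
  proof
    fix x :: rooted_loop assume x: "x \<in> {x. 0 < dur x \<and> norm (fst x) < \<rho> \<and> d \<le> spread x}"
    have "\<rho> = \<rho> / d * d" using d by simp
    also have "\<dots> \<le> c * spread x" using x c d \<rho> by (intro mult_mono) auto
    finally have "\<rho> \<le> c * spread x" .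
    moreover have "d \<le> c * spread x" using x c d mult_mono[of 1 c d "spread x"] by auto
    ultimately show "x \<in> ?S \<union> ?L" using x by auto
  qed
  hence "emeasure loop_meas {x. 0 < dur x \<and> norm (fst x) < \<rho> \<and> d \<le> spread x} \<le> emeasure loop_meas (?S \<union> ?L)"
    by (rule emeasure_mono) auto
  also have "\<dots> \<le> emeasure loop_meas ?S + emeasure loop_meas ?L" by (rule emeasure_subadditive) auto
  also have "\<dots> \<le> ennreal (c ^ 4 * bound_moment * 1 / (2 * d\<^sup>2)) + ennreal (\<rho>\<^sup>2 / (2 * 1))"
    by (intro add_mono small_loops long_loops) (use c d \<rho> in auto)
  also have "\<dots> < \<infinity>" by simp
  finally show ?thesis .
qed

text \<open>A loop that reaches the disk has \<open>norm (fst x) - 1 <= spread x\<close>, and a root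
  of norm at least 2 is at most twice as large as \<open>norm (fst x) - 1\<close>.\<close>

lemma far_hit_spread: "x \<in> far_hit \<Longrightarrow> 0 < dur x \<Longrightarrow> norm (fst x) \<le> 2 * spread x \<and> 1 \<le> spread x"
proof -
  assume x: "x \<in> far_hit" and t: "0 < dur x"
  obtain z where z: "z \<in> trace x" "norm z < 1" using x by (auto simp: far_hit_def)
  have "norm (fst x) \<le> norm z + norm (z - fst x)" using norm_triangle_ineq4[of z "z - fst x"] by simp
  hence "norm (fst x) - 1 \<le> spread x" using trace_spread[OF z(1) t] z by linarith
  moreover have "2 \<le> norm (fst x)" using x by (simp add: far_hit_def)
  ultimately show ?thesis by linarith
qed

definition inside :: "real \<Rightarrow> rooted_loop set" where
  "inside R = {x. trace x \<subseteq> ball 0 R}"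

lemma sets_inside [measurable]: "inside R \<in> sets loop_meas"
proof -
  note [measurable] = pred_trace_subset[of "ball 0 R"]
  have "{x \<in> space loop_meas. trace x \<subseteq> ball 0 R} \<in> sets loop_meas" by measurable
  thus ?thesis by (simp add: inside_def)
qed

lemma inside_mono: "R \<le> R' \<Longrightarrow> inside R \<subseteq> inside R'"
  by (auto simp: inside_def)

lemma inside_exhausts: "\<exists>n::nat. x \<in> inside (real n)"
proof -
  from compact_imp_bounded[OF compact_trace[of x]] obtain B where "\<forall>z\<in>trace x. norm z \<le> B"
    by (auto simp: bounded_iff)
  moreover obtain n :: nat where "B < real n" using reals_Archimedean2 by blast
  ultimately show ?thesis by (intro exI[of _ n]) (force simp: inside_def)
qed

section \<open>The exponential cut-off of the duration\<close>

text \<open>A smooth substitute for staying in the disk of radius \<open>R\<close>, which a loop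
  does until durations of order \<open>R\<^sup>2\<close>. The derivative of this cut-off in
  \<open>R\<close> is a Laplace transform, see \<open>laplace_mass_diff\<close>.\<close>

definition laplace_mass :: "real \<Rightarrow> ennreal" where
  "laplace_mass R = (\<integral>\<^sup>+x. ennreal (exp (- dur x / R\<^sup>2)) * indicator far_hit x \<partial>loop_meas)"

text \<open>Loops of duration below 1 are covered by \<open>small_loops\<close>; for the others the
  extra factor \<open>dur x\<close> in \<open>hit_laplace\<close> is at least 1.\<close>

lemma laplace_mass_finite: "9 \<le> R \<Longrightarrow> laplace_mass R < \<infinity>"
proof -
  assume R: "9 \<le> R"
  let ?S = "{x. 0 < dur x \<and> dur x < 1 \<and> norm (fst x) \<le> 2 * spread x \<and> 1 \<le> 2 * spread x}"
  have "{x \<in> space loop_meas. 0 < dur x \<and> dur x < 1 \<and> norm (fst x) \<le> 2 * spread x \<and> 1 \<le> 2 * spread x} \<in> sets loop_meas" by measurable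
  hence S[measurable]: "?S \<in> sets loop_meas" by simp
  have "laplace_mass R \<le> (\<integral>\<^sup>+x. indicator ?S x + ennreal (dur x * exp (- (1 / R\<^sup>2) * dur x)) * indicator far_hit x \<partial>loop_meas)"
    unfolding laplace_mass_def
  proof (rule nn_integral_mono_AE, use AE_loop_meas_pos in eventually_elim)
    case (elim x)
    show ?case
    proof (cases "x \<in> far_hit")
      case True
      show ?thesis
      proof (cases "dur x < 1")
        case t: True
        have "x \<in> ?S" using far_hit_spread[OF True elim] elim t by auto
        moreover have "ennreal (exp (- dur x / R\<^sup>2)) \<le> 1" using elim by simp
        ultimately show ?thesis using True by (simp add: add_increasing2)
      next
        case False
        have "exp (- dur x / R\<^sup>2) \<le> dur x * exp (- (1 / R\<^sup>2) * dur x)" using False by simp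
        hence "ennreal (exp (- dur x / R\<^sup>2)) \<le> ennreal (dur x * exp (- (1 / R\<^sup>2) * dur x))" by (rule ennreal_leI)
        thus ?thesis using True by (simp add: add_increasing)
      qed
    qed simp
  qed
  also have "\<dots> = emeasure loop_meas ?S + hit_laplace (1 / R\<^sup>2)"
    unfolding hit_laplace_def by (subst nn_integral_add) auto
  also have "\<dots> \<le> ennreal (2 ^ 4 * bound_moment * 1 / (2 * 1\<^sup>2)) + ennreal (hit_rate R)"
    by (intro add_mono small_loops) (use hit_rate_bounds(1)[OF R] in auto)
  also have "\<dots> < \<infinity>" by simp
  finally show ?thesis .
qed

text \<open>The derivative of \<open>exp (- t / r\<^sup>2)\<close> in \<open>r\<close> is
  \<open>2 * t / r ^ 3\<close> times the same exponential: fundamental theorem for each loop, then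
  Fubini.\<close>

lemma laplace_mass_diff:
  assumes R: "0 < R" "R \<le> R'"
  shows "laplace_mass R' = laplace_mass R + (\<integral>\<^sup>+r. ennreal (2 / r ^ 3) * hit_laplace (1 / r\<^sup>2) * indicator {R..R'} r \<partial>lborel)"
proof -
  interpret P: pair_sigma_finite loop_meas "lborel :: real measure" ..
  have FTC: "ennreal (exp (- t / R'\<^sup>2)) = ennreal (exp (- t / R\<^sup>2)) + (\<integral>\<^sup>+r. ennreal (2 / r ^ 3 * (t * exp (- (1 / r\<^sup>2) * t))) * indicator {R..R'} r \<partial>lborel)" if t: "0 < t" for t
  proof -
    have mono: "exp (- t / R\<^sup>2) \<le> exp (- t / R'\<^sup>2)"
      using R t by (simp add: divide_left_mono power_mono)
    have "(\<integral>\<^sup>+r. ennreal (2 / r ^ 3 * (t * exp (- (1 / r\<^sup>2) * t))) * indicator {R..R'} r \<partial>lborel) = ennreal (exp (- t / R'\<^sup>2) - exp (- t / R\<^sup>2))"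
    proof (rule nn_integral_FTC_Icc)
      show "((\<lambda>r. exp (- t / r\<^sup>2)) has_real_derivative 2 / r ^ 3 * (t * exp (- (1 / r\<^sup>2) * t))) (at r)" if "r \<in> {R..R'}" for r
        using that R by (auto intro!: derivative_eq_intros simp: field_simps power2_eq_square power3_eq_cube)
      show "0 \<le> 2 / r ^ 3 * (t * exp (- (1 / r\<^sup>2) * t))" if "r \<in> {R..R'}" for r
        using that R t by auto
    qed (use R in auto)
    note I = this
    show ?thesis unfolding I using mono by (subst ennreal_plus[symmetric]) auto
  qed
  have "laplace_mass R' = (\<integral>\<^sup>+x. ennreal (exp (- dur x / R\<^sup>2)) * indicator far_hit x + (\<integral>\<^sup>+r. ennreal (2 / r ^ 3) * (ennreal (dur x * exp (- (1 / r\<^sup>2) * dur x)) * indicator far_hit x) * indicator {R..R'} r \<partial>lborel) \<partial>loop_meas)"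
    unfolding laplace_mass_def
  proof (rule nn_integral_cong_AE, use AE_loop_meas_pos in eventually_elim)
    case (elim x)
    have "ennreal (exp (- dur x / R'\<^sup>2)) * indicator far_hit x = (ennreal (exp (- dur x / R\<^sup>2)) + (\<integral>\<^sup>+r. ennreal (2 / r ^ 3 * (dur x * exp (- (1 / r\<^sup>2) * dur x))) * indicator {R..R'} r \<partial>lborel)) * indicator far_hit x"
      by (simp only: FTC[OF elim])
    also have "\<dots> = ennreal (exp (- dur x / R\<^sup>2)) * indicator far_hit x + (\<integral>\<^sup>+r. ennreal (2 / r ^ 3 * (dur x * exp (- (1 / r\<^sup>2) * dur x))) * indicator {R..R'} r * indicator far_hit x \<partial>lborel)"
      by (subst nn_integral_multc) (auto simp: distrib_right)
    also have "(\<integral>\<^sup>+r. ennreal (2 / r ^ 3 * (dur x * exp (- (1 / r\<^sup>2) * dur x))) * indicator {R..R'} r * indicator far_hit x \<partial>lborel) =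
       (\<integral>\<^sup>+r. ennreal (2 / r ^ 3) * (ennreal (dur x * exp (- (1 / r\<^sup>2) * dur x)) * indicator far_hit x) * indicator {R..R'} r \<partial>lborel)"
    proof (rule nn_integral_cong)
      fix r :: real
      show "ennreal (2 / r ^ 3 * (dur x * exp (- (1 / r\<^sup>2) * dur x))) * indicator {R..R'} r * indicator far_hit x = ennreal (2 / r ^ 3) * (ennreal (dur x * exp (- (1 / r\<^sup>2) * dur x)) * indicator far_hit x) * indicator {R..R'} r"
      proof (cases "r \<in> {R..R'}")
        case True
        have "ennreal (2 / r ^ 3 * (dur x * exp (- (1 / r\<^sup>2) * dur x))) = ennreal (2 / r ^ 3) * ennreal (dur x * exp (- (1 / r\<^sup>2) * dur x))"
          by (rule ennreal_mult) (use True R elim in auto)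
        thus ?thesis by (simp only: mult_ac)
      qed simp
    qed
    finally show ?case .
  qed
  also have "\<dots> = laplace_mass R + (\<integral>\<^sup>+x. \<integral>\<^sup>+r. ennreal (2 / r ^ 3) * (ennreal (dur x * exp (- (1 / r\<^sup>2) * dur x)) * indicator far_hit x) * indicator {R..R'} r \<partial>lborel \<partial>loop_meas)"
    unfolding laplace_mass_def by (rule nn_integral_add) measurable
  also have "(\<integral>\<^sup>+x. \<integral>\<^sup>+r. ennreal (2 / r ^ 3) * (ennreal (dur x * exp (- (1 / r\<^sup>2) * dur x)) * indicator far_hit x) * indicator {R..R'} r \<partial>lborel \<partial>loop_meas) =
     (\<integral>\<^sup>+r. \<integral>\<^sup>+x. ennreal (2 / r ^ 3) * (ennreal (dur x * exp (- (1 / r\<^sup>2) * dur x)) * indicator far_hit x) * indicator {R..R'} r \<partial>loop_meas \<partial>lborel)"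
    by (rule P.Fubini'[symmetric]) measurable
  also have "\<dots> = (\<integral>\<^sup>+r. ennreal (2 / r ^ 3) * hit_laplace (1 / r\<^sup>2) * indicator {R..R'} r \<partial>lborel)"
    unfolding hit_laplace_def
    by (intro nn_integral_cong) (subst nn_integral_multc, measurable, subst nn_integral_cmult, measurable)
  finally show ?thesis .
qed

definition laplace_real :: "real \<Rightarrow> real" where
  "laplace_real R = enn2real (laplace_mass R)"

lemma laplace_real: "9 \<le> R \<Longrightarrow> laplace_mass R = ennreal (laplace_real R)" "0 \<le> laplace_real R"
  using laplace_mass_finite[of R] by (simp_all add: laplace_real_def)

text \<open>Completeness gives convergence along \<open>R0 + n\<close>, and the same modulus carries
  the limit over to all real radii.\<close>

lemma tendsto_at_top_of_modulus:
  fixes g e :: "real \<Rightarrow> real"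
  assumes g: "\<And>R R'. R0 \<le> R \<Longrightarrow> R \<le> R' \<Longrightarrow> \<bar>g R' - g R\<bar> \<le> e R" and e: "(e \<longlongrightarrow> 0) at_top"
  obtains L where "(g \<longlongrightarrow> L) at_top"
proof -
  define X where "X n = g (R0 + real n)" for n :: nat
  have e': "(\<lambda>n. e (R0 + real n)) \<longlonglongrightarrow> 0"
    by (rule filterlim_compose[OF e]) real_asymp
  have "Cauchy X"
  proof (rule metric_CauchyI)
    fix \<delta> :: real assume "0 < \<delta>"
    then obtain N where N: "\<And>n. N \<le> n \<Longrightarrow> e (R0 + real n) < \<delta>"
      using order_tendstoD(2)[OF e'] by (auto simp: eventually_sequentially)
    have "dist (X m) (X n) < \<delta>" if "N \<le> n" "n \<le> m" for m n
      using g[of "R0 + real n" "R0 + real m"] N[OF that(1)] that by (simp add: X_def dist_real_def)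
    thus "\<exists>M. \<forall>m\<ge>M. \<forall>n\<ge>M. dist (X m) (X n) < \<delta>"
      by (intro exI[of _ N]) (metis dist_commute nle_le)
  qed
  then obtain L where L: "X \<longlonglongrightarrow> L" using Cauchy_convergent_iff convergent_def by blast
  have "\<bar>g R - L\<bar> \<le> e R" if "R0 \<le> R" for R
  proof (rule LIMSEQ_le_const2)
    show "(\<lambda>n. \<bar>g R - X n\<bar>) \<longlonglongrightarrow> \<bar>g R - L\<bar>" by (intro tendsto_intros L)
    show "\<exists>N. \<forall>n\<ge>N. \<bar>g R - X n\<bar> \<le> e R"
    proof (intro exI allI impI)
      fix n assume "nat \<lceil>R - R0\<rceil> \<le> n"
      hence "R \<le> R0 + real n" by linarith
      from g[OF that this] show "\<bar>g R - X n\<bar> \<le> e R" by (simp add: X_def abs_minus_commute)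
    qed
  qed
  hence "((\<lambda>R. g R - L) \<longlongrightarrow> 0) at_top"
    by (intro Lim_null_comparison[OF _ e]) (auto intro: eventually_at_top_linorderI)
  hence "(g \<longlongrightarrow> L) at_top" by (simp add: LIM_zero_iff)
  thus ?thesis by (rule that)
qed

text \<open>The error density \<open>C / (r * (ln r)\<^sup>2)\<close> integrates from
  \<open>R\<close> on to \<open>C / ln R\<close>, which is the modulus for the Cauchy criterion; the
  main density integrates to \<open>ln (ln R)\<close>.\<close>

lemma laplace_real_limit:
  obtains L where "((\<lambda>R. laplace_real R - ln (ln R)) \<longlongrightarrow> L) at_top"
proof -
  obtain C R1 where C: "0 < C" "9 \<le> R1" "\<And>r. R1 \<le> r \<Longrightarrow> \<bar>2 * hit_rate r / r ^ 3 - 1 / (r * ln r)\<bar> \<le> C / (r * (ln r)\<^sup>2)"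
    by (rule hit_rate_asymptotics) blast
  \<comment> \<open>Beyond \<open>exp C\<close> the lower density
    \<open>1 / (r * ln r) - C / (r * (ln r)\<^sup>2)\<close> is non-negative, as its integration in
    \<open>ennreal\<close> requires.\<close>
  define R0 where "R0 = max R1 (exp C)"
  have R0: "9 \<le> R0" "R1 \<le> R0" "exp C \<le> R0" using C by (auto simp: R0_def)
  have ln0: "1 < ln r" if "R0 \<le> r" for r
  proof -
    have "exp 1 < r" using e_less_272 R0 that by linarith
    hence "ln (exp 1) < ln r" using that R0 by (subst ln_less_cancel_iff) auto
    thus ?thesis by simp
  qed
  have bound: "\<bar>(laplace_real R' - ln (ln R')) - (laplace_real R - ln (ln R))\<bar> \<le> C / ln R" if R: "R0 \<le> R" "R \<le> R'" for R R'
  proof -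
    have R9: "9 \<le> R" "9 \<le> R'" using R R0 by auto
    define I where "I = (\<integral>\<^sup>+r. ennreal (2 / r ^ 3) * hit_laplace (1 / r\<^sup>2) * indicator {R..R'} r \<partial>lborel)"
    have eq: "ennreal (laplace_real R') = ennreal (laplace_real R) + I"
      using laplace_mass_diff[of R R'] R R9 laplace_real(1) by (simp add: I_def)
    have Ieq: "I = (\<integral>\<^sup>+r. ennreal (2 * hit_rate r / r ^ 3) * indicator {R..R'} r \<partial>lborel)"
      unfolding I_def
    proof (rule nn_integral_cong)
      fix r
      show "ennreal (2 / r ^ 3) * hit_laplace (1 / r\<^sup>2) * indicator {R..R'} r = ennreal (2 * hit_rate r / r ^ 3) * indicator {R..R'} r"
      proof (cases "r \<in> {R..R'}")
        case True
        have "ennreal (2 / r ^ 3 * hit_rate r) = ennreal (2 / r ^ 3) * ennreal (hit_rate r)"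
          by (rule ennreal_mult) (use True R9 in \<open>auto simp: hit_rate_def\<close>)
        thus ?thesis using True R9 hit_rate_bounds(1)[of r] by simp
      qed simp
    qed
    have up: "2 * hit_rate r / r ^ 3 \<le> 1 / (r * ln r) + C / (r * (ln r)\<^sup>2)"
      and lo: "1 / (r * ln r) - C / (r * (ln r)\<^sup>2) \<le> 2 * hit_rate r / r ^ 3" if "r \<in> {R..R'}" for r
      using C(3)[of r] that R R0 by (auto simp: abs_le_iff)
    have pos: "0 < r" "1 < ln r" "C \<le> ln r" "1 < r" if "r \<in> {R..R'}" for r
    proof -
      show "0 < r" "1 < ln r" "1 < r" using that R R0 ln0[of r] by auto
      have "exp C \<le> r" using that R R0 by auto
      thus "C \<le> ln r" using \<open>0 < r\<close> by (simp add: ln_ge_iff)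
    qed
    have d1: "((\<lambda>r. ln (ln r) - C / ln r) has_real_derivative 1 / (r * ln r) + C / (r * (ln r)\<^sup>2)) (at r)"
     and d2: "((\<lambda>r. ln (ln r) + C / ln r) has_real_derivative 1 / (r * ln r) - C / (r * (ln r)\<^sup>2)) (at r)" if "r \<in> {R..R'}" for r
      using pos[OF that] by (auto intro!: derivative_eq_intros simp: field_simps power2_eq_square)
    have RR: "R \<in> {R..R'}" "R' \<in> {R..R'}" using R by auto
    have nn: "0 \<le> 1 / (r * ln r) - C / (r * (ln r)\<^sup>2)" if "r \<in> {R..R'}" for r
    proof -
      have "C / (r * (ln r)\<^sup>2) \<le> ln r / (r * (ln r)\<^sup>2)" using pos[OF that] by (intro divide_right_mono) auto
      also have "\<dots> = 1 / (r * ln r)" using pos[OF that] by (simp add: power2_eq_square)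
      finally show ?thesis by simp
    qed
    have u: "I \<le> ennreal ((ln (ln R') - C / ln R') - (ln (ln R) - C / ln R))"
    proof -
      have "I \<le> (\<integral>\<^sup>+r. ennreal (1 / (r * ln r) + C / (r * (ln r)\<^sup>2)) * indicator {R..R'} r \<partial>lborel)"
        unfolding Ieq by (intro nn_integral_mono) (auto simp: indicator_def intro!: ennreal_leI up)
      also have "\<dots> = ennreal ((ln (ln R') - C / ln R') - (ln (ln R) - C / ln R))"
      proof (rule nn_integral_FTC_Icc)
        show "0 \<le> 1 / (r * ln r) + C / (r * (ln r)\<^sup>2)" if "r \<in> {R..R'}" for r
          using pos[OF that] C by (intro add_nonneg_nonneg divide_nonneg_nonneg mult_nonneg_nonneg) auto
      qed (use d1 R in auto)
      finally show ?thesis .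
    qed
    have l: "ennreal ((ln (ln R') + C / ln R') - (ln (ln R) + C / ln R)) \<le> I"
    proof -
      have "ennreal ((ln (ln R') + C / ln R') - (ln (ln R) + C / ln R)) = (\<integral>\<^sup>+r. ennreal (1 / (r * ln r) - C / (r * (ln r)\<^sup>2)) * indicator {R..R'} r \<partial>lborel)"
        by (rule nn_integral_FTC_Icc[symmetric]) (use d2 R nn in auto)
      also have "\<dots> \<le> I"
        unfolding Ieq by (intro nn_integral_mono) (auto simp: indicator_def intro!: ennreal_leI lo)
      finally show ?thesis .
    qed
    have "I < top" using u by (simp add: order_le_less_trans)
    then obtain i where i: "I = ennreal i" "0 \<le> i" by (cases I) auto
    have e: "laplace_real R' = laplace_real R + i"
      using eq laplace_real(2) i by (simp add: ennreal_plus[symmetric] del: ennreal_plus)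
    have "C / ln R' \<le> C / ln R" using C R pos[OF RR(1)] pos[OF RR(2)] by (intro divide_left_mono) auto
    moreover have "0 \<le> C / ln R'" using C pos[OF RR(2)] by simp
    moreover have "ln (ln R) \<le> ln (ln R')" using R pos[OF RR(1)] by simp
    moreover have "i \<le> (ln (ln R') - C / ln R') - (ln (ln R) - C / ln R)"
      using u calculation unfolding i(1) by (subst (asm) ennreal_le_iff) auto
    moreover have "(ln (ln R') + C / ln R') - (ln (ln R) + C / ln R) \<le> i"
      using l unfolding i(1) by (subst (asm) ennreal_le_iff) (use i in auto)
    ultimately show ?thesis unfolding e by linarith
  qed
  have "((\<lambda>R. C / ln R) \<longlongrightarrow> 0) at_top" by real_asymp
  from tendsto_at_top_of_modulus[OF bound this] show ?thesis using that by blast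
qed

section \<open>From the exponential cut-off to the sharp one\<close>

definition far_mass :: "real \<Rightarrow> real" where
  "far_mass R = measure loop_meas (far_hit \<inter> inside R)"

text \<open>First bound: a loop in the disk either lasts at least \<open>A * R\<^sup>2\<close>,
  which has mass at most \<open>1 / (2 * A)\<close>, or has \<open>X = dur x / R\<^sup>2\<close> at
  most \<open>A\<close>; then \<open>1 <= exp (- X) + X\<close>, and
  \<open>X <= exp A * (X * exp (- X))\<close> is controlled by \<open>hit_laplace\<close>. Second
  bound: a loop that leaves the disk is either short, and thus in \<open>small_loops\<close>, or
  satisfies \<open>1 <= dur x / (\<eta> * R\<^sup>2)\<close>.\<close>

lemma far_inside_bounds:
  assumes R: "9 \<le> R" and A: "0 < A" and \<eta>: "0 < \<eta>"
  shows "emeasure loop_meas (far_hit \<inter> inside R) \<le> laplace_mass R + ennreal (exp A * (hit_rate R / R\<^sup>2) + 1 / (2 * A))"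
    and "laplace_mass R \<le> emeasure loop_meas (far_hit \<inter> inside R) + ennreal (1 / \<eta> * (hit_rate R / R\<^sup>2) + 128 * bound_moment * \<eta>)"
proof -
  define W where "W x = ennreal (dur x * exp (- (1 / R\<^sup>2) * dur x)) * indicator far_hit x" for x :: rooted_loop
  have [measurable]: "W \<in> borel_measurable loop_meas" unfolding W_def by measurable
  have W: "(\<integral>\<^sup>+x. W x \<partial>loop_meas) = ennreal (hit_rate R)"
    using hit_rate_bounds(1)[OF R] by (simp add: hit_laplace_def W_def)
  have h0: "0 \<le> hit_rate R" by (simp add: hit_rate_def)
  let ?L = "{x. norm (fst x) < R \<and> A * R\<^sup>2 \<le> dur x} :: rooted_loop set"
  let ?S = "{x. 0 < dur x \<and> dur x < \<eta> * R\<^sup>2 \<and> norm (fst x) \<le> 4 * spread x \<and> R \<le> 4 * spread x}"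
  have "{x \<in> space loop_meas. norm (fst x) < R \<and> A * R\<^sup>2 \<le> dur x} \<in> sets loop_meas"
    "{x \<in> space loop_meas. 0 < dur x \<and> dur x < \<eta> * R\<^sup>2 \<and> norm (fst x) \<le> 4 * spread x \<and> R \<le> 4 * spread x} \<in> sets loop_meas" by measurable
  hence [measurable]: "?L \<in> sets loop_meas" "?S \<in> sets loop_meas" by simp_all
  define w where "w x = exp (- dur x / R\<^sup>2)" for x :: rooted_loop
  have [measurable]: "w \<in> borel_measurable loop_meas" unfolding w_def by measurable
  have lap: "laplace_mass R = (\<integral>\<^sup>+x. ennreal (w x) * indicator far_hit x \<partial>loop_meas)" by (simp add: laplace_mass_def w_def)
  have R2: "0 < R\<^sup>2" using R by simp
  have "emeasure loop_meas (far_hit \<inter> inside R) = (\<integral>\<^sup>+x. indicator (far_hit \<inter> inside R) x \<partial>loop_meas)" by simp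
  also have "\<dots> \<le> (\<integral>\<^sup>+x. ennreal (w x) * indicator far_hit x + (ennreal (exp A / R\<^sup>2) * W x + indicator ?L x) \<partial>loop_meas)"
  proof (rule nn_integral_mono_AE, use AE_loop_meas_pos in eventually_elim)
    case (elim x)
    show ?case
    proof (cases "x \<in> far_hit \<inter> inside R")
      case True
      show ?thesis
      proof (cases "A * R\<^sup>2 \<le> dur x")
        case t: True
        have "norm (fst x) < R" using True root_in_trace[of x] by (auto simp: inside_def)
        thus ?thesis using True t by (simp add: add_increasing)
      next
        case False
        define X where "X = dur x / R\<^sup>2"
        have X: "0 \<le> X" "X \<le> A" using False elim R2 by (simp_all add: X_def field_simps)
        have w: "w x = exp (- X)" by (simp add: w_def X_def)
        have "X = exp X * (X * exp (- X))" by (simp add: exp_minus)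
        also have "\<dots> \<le> exp A * (X * exp (- X))" using X by (intro mult_right_mono) auto
        finally have "1 \<le> exp (- X) + exp A * (X * exp (- X))" using exp_ge_add_one_self[of "- X"] by linarith
        also have "exp A * (X * exp (- X)) = exp A / R\<^sup>2 * (dur x * exp (- (1 / R\<^sup>2) * dur x))" by (simp add: X_def)
        finally have "ennreal 1 \<le> ennreal (w x + exp A / R\<^sup>2 * (dur x * exp (- (1 / R\<^sup>2) * dur x)))" unfolding w by (intro ennreal_leI) simp
        also have "\<dots> = ennreal (w x) + ennreal (exp A / R\<^sup>2) * ennreal (dur x * exp (- (1 / R\<^sup>2) * dur x))"
        proof -
          have "ennreal (exp A / R\<^sup>2 * (dur x * exp (- (1 / R\<^sup>2) * dur x))) = ennreal (exp A / R\<^sup>2) * ennreal (dur x * exp (- (1 / R\<^sup>2) * dur x))"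
            by (rule ennreal_mult) (use elim in auto)
          moreover have "ennreal (w x + exp A / R\<^sup>2 * (dur x * exp (- (1 / R\<^sup>2) * dur x))) = ennreal (w x) + ennreal (exp A / R\<^sup>2 * (dur x * exp (- (1 / R\<^sup>2) * dur x)))"
            by (rule ennreal_plus) (use elim in \<open>auto simp: w_def\<close>)
          ultimately show ?thesis by simp
        qed
        finally have e: "1 \<le> ennreal (w x) + ennreal (exp A / R\<^sup>2) * ennreal (dur x * exp (- (1 / R\<^sup>2) * dur x))" by simp
        have "1 + 0 \<le> ennreal (w x) + ennreal (exp A / R\<^sup>2) * ennreal (dur x * exp (- (1 / R\<^sup>2) * dur x)) + indicator ?L x"
          by (rule add_mono[OF e]) simp
        thus ?thesis using True by (simp add: W_def add.assoc)
      qed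
    qed simp
  qed
  also have "\<dots> = laplace_mass R + (ennreal (exp A / R\<^sup>2) * ennreal (hit_rate R) + emeasure loop_meas ?L)"
    unfolding lap by (simp add: nn_integral_add nn_integral_cmult W)
  also have "\<dots> \<le> laplace_mass R + (ennreal (exp A / R\<^sup>2) * ennreal (hit_rate R) + ennreal (R\<^sup>2 / (2 * (A * R\<^sup>2))))"
    by (intro add_mono order_refl long_loops) (use A R in auto)
  also have "ennreal (exp A / R\<^sup>2) * ennreal (hit_rate R) + ennreal (R\<^sup>2 / (2 * (A * R\<^sup>2))) = ennreal (exp A * (hit_rate R / R\<^sup>2) + 1 / (2 * A))"
    using A R2 h0 by (subst ennreal_plus) (auto simp: ennreal_mult[symmetric])
  finally show "emeasure loop_meas (far_hit \<inter> inside R) \<le> laplace_mass R + ennreal (exp A * (hit_rate R / R\<^sup>2) + 1 / (2 * A))" .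
  have "laplace_mass R \<le> (\<integral>\<^sup>+x. indicator (far_hit \<inter> inside R) x + (ennreal (1 / (\<eta> * R\<^sup>2)) * W x + indicator ?S x) \<partial>loop_meas)"
    unfolding lap
  proof (rule nn_integral_mono_AE, use AE_loop_meas_pos in eventually_elim)
    case (elim x)
    show ?case
    proof (cases "x \<in> far_hit")
      case far: True
      have w1: "ennreal (w x) \<le> 1" using elim by (simp add: w_def)
      show ?thesis
      proof (cases "x \<in> inside R")
        case True
        thus ?thesis using far w1 by (simp add: add_increasing2)
      next
        case out: False
        show ?thesis
        proof (cases "dur x < \<eta> * R\<^sup>2")
          case t: True
          obtain z where z: "z \<in> trace x" "R \<le> norm z" using out by (force simp: inside_def)
          have "norm z \<le> norm (fst x) + norm (z - fst x)" using norm_triangle_ineq[of "fst x" "z - fst x"] by simp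
          \<comment> \<open>A loop of \<open>far_hit\<close> has its root within
            \<open>2 * spread x\<close> of 0, so reaching radius \<open>R\<close> forces
            \<open>R <= 3 * spread x\<close>; the 4 in \<open>?S\<close> covers this.\<close>
          hence "R \<le> 2 * spread x + spread x" using z trace_spread[OF z(1) elim] far_hit_spread[OF far elim] by linarith
          hence "x \<in> ?S" using far_hit_spread[OF far elim] elim t by auto
          thus ?thesis using far out w1 by (simp add: add_increasing)
        next
          case False
          have "1 \<le> dur x / (\<eta> * R\<^sup>2)" using False \<eta> R2 by (simp add: field_simps)
          hence "w x * 1 \<le> w x * (dur x / (\<eta> * R\<^sup>2))" by (intro mult_left_mono) (auto simp: w_def)
          hence "ennreal (w x) \<le> ennreal (1 / (\<eta> * R\<^sup>2) * (dur x * exp (- (1 / R\<^sup>2) * dur x)))"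
            by (intro ennreal_leI) (simp add: w_def mult_ac)
          also have "\<dots> = ennreal (1 / (\<eta> * R\<^sup>2)) * ennreal (dur x * exp (- (1 / R\<^sup>2) * dur x))"
            by (rule ennreal_mult) (use elim \<eta> R2 in auto)
          finally show ?thesis using far out by (simp add: W_def add_increasing2)
        qed
      qed
    qed simp
  qed
  also have "\<dots> = emeasure loop_meas (far_hit \<inter> inside R) + (ennreal (1 / (\<eta> * R\<^sup>2)) * ennreal (hit_rate R) + emeasure loop_meas ?S)"
    by (simp add: nn_integral_add nn_integral_cmult W)
  also have "\<dots> \<le> emeasure loop_meas (far_hit \<inter> inside R) + (ennreal (1 / (\<eta> * R\<^sup>2)) * ennreal (hit_rate R) + ennreal (4 ^ 4 * bound_moment * (\<eta> * R\<^sup>2) / (2 * R\<^sup>2)))"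
    by (intro add_mono order_refl small_loops) (use \<eta> R in auto)
  also have "ennreal (1 / (\<eta> * R\<^sup>2)) * ennreal (hit_rate R) + ennreal (4 ^ 4 * bound_moment * (\<eta> * R\<^sup>2) / (2 * R\<^sup>2)) = ennreal (1 / \<eta> * (hit_rate R / R\<^sup>2) + 128 * bound_moment * \<eta>)"
    using \<eta> R2 h0 bound_moment(2) by (subst ennreal_plus) (auto simp: ennreal_mult[symmetric])
  finally show "laplace_mass R \<le> emeasure loop_meas (far_hit \<inter> inside R) + ennreal (1 / \<eta> * (hit_rate R / R\<^sup>2) + 128 * bound_moment * \<eta>)" .
qed

lemma far_inside_finite: "emeasure loop_meas (far_hit \<inter> inside R) < \<infinity>"
proof -
  have "emeasure loop_meas (far_hit \<inter> inside R) \<le> emeasure loop_meas (far_hit \<inter> inside (max 9 R))"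
    using inside_mono[of R "max 9 R"] by (intro emeasure_mono) auto
  also have "\<dots> \<le> laplace_mass (max 9 R) + ennreal (exp 1 * (hit_rate (max 9 R) / (max 9 R)\<^sup>2) + 1 / (2 * 1))"
    by (rule far_inside_bounds(1)[of "max 9 R" 1 1]) auto
  also have "\<dots> < \<infinity>" using laplace_mass_finite[of "max 9 R"] by simp
  finally show ?thesis .
qed

lemma hit_rate_small: "((\<lambda>R. hit_rate R / R\<^sup>2) \<longlongrightarrow> 0) at_top"
proof -
  obtain C R1 where C: "0 < C" "9 \<le> R1" "\<And>r. R1 \<le> r \<Longrightarrow> \<bar>2 * hit_rate r / r ^ 3 - 1 / (r * ln r)\<bar> \<le> C / (r * (ln r)\<^sup>2)"
    by (rule hit_rate_asymptotics) blast
  show ?thesis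
  proof (rule Lim_null_comparison)
    show "\<forall>\<^sub>F R in at_top. norm (hit_rate R / R\<^sup>2) \<le> (1 / ln R + C / (ln R)\<^sup>2) / 2"
    proof (rule eventually_at_top_linorderI[of R1])
      fix R assume R: "R1 \<le> R"
      have R0: "0 < R" using R C by simp
      have "2 * hit_rate R / R ^ 3 \<le> 1 / (R * ln R) + C / (R * (ln R)\<^sup>2)" using C(3)[OF R] by (simp add: abs_le_iff)
      hence "(2 * hit_rate R / R ^ 3) * (R / 2) \<le> (1 / (R * ln R) + C / (R * (ln R)\<^sup>2)) * (R / 2)"
        using R0 by (intro mult_right_mono) auto
      note a = this
      have b: "(2 * hit_rate R / R ^ 3) * (R / 2) = hit_rate R / R\<^sup>2" using R0 by (simp add: power2_eq_square power3_eq_cube)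
      have c: "(1 / (R * ln R) + C / (R * (ln R)\<^sup>2)) * (R / 2) = (1 / ln R + C / (ln R)\<^sup>2) / 2" using R0 by (simp add: distrib_right add_divide_distrib)
      have d: "0 \<le> hit_rate R / R\<^sup>2" by (simp add: hit_rate_def)
      show "norm (hit_rate R / R\<^sup>2) \<le> (1 / ln R + C / (ln R)\<^sup>2) / 2"
        using a unfolding b c real_norm_def abs_of_nonneg[OF d] .
    qed
    show "((\<lambda>R. (1 / ln R + C / (ln R)\<^sup>2) / 2) \<longlongrightarrow> 0) at_top" by real_asymp
  qed
qed

text \<open>\<open>A\<close> and \<open>\<eta>\<close> are fixed first and make the terms without
  \<open>hit_rate\<close> at most \<open>\<epsilon> / 2\<close>; the others vanish as
  \<open>R\<close> grows, by \<open>hit_rate_small\<close>.\<close>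

lemma far_mass_limit:
  obtains L where "((\<lambda>R. far_mass R - ln (ln R)) \<longlongrightarrow> L) at_top"
proof -
  obtain L where L: "((\<lambda>R. laplace_real R - ln (ln R)) \<longlongrightarrow> L) at_top" by (rule laplace_real_limit)
  have "((\<lambda>R. far_mass R - laplace_real R) \<longlongrightarrow> 0) at_top"
  proof (rule tendstoI)
    fix \<epsilon> :: real assume \<epsilon>: "0 < \<epsilon>"
    define A where "A = 1 / \<epsilon>"
    define \<eta> where "\<eta> = \<epsilon> / (2 * (128 * bound_moment + 1))"
    have A: "0 < A" and \<eta>: "0 < \<eta>" using \<epsilon> bound_moment(2) by (auto simp: A_def \<eta>_def)
    define K where "K = exp A + 1 / \<eta>"
    have K: "0 < K" using \<eta> by (auto simp: K_def add_pos_pos)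
    have \<eta>2: "128 * bound_moment * \<eta> < \<epsilon> / 2"
      using \<epsilon> bound_moment(2) by (simp add: \<eta>_def field_simps)
    have "\<forall>\<^sub>F R in at_top. hit_rate R / R\<^sup>2 < \<epsilon> / (2 * K)"
      using hit_rate_small K \<epsilon> by (intro order_tendstoD(2)) auto
    thus "\<forall>\<^sub>F R in at_top. dist (far_mass R - laplace_real R) 0 < \<epsilon>"
      using eventually_ge_at_top[of 9]
    proof eventually_elim
      case (elim R)
      have R: "9 \<le> R" using elim by simp
      define h where "h = hit_rate R / R\<^sup>2"
      have h: "0 \<le> h" "K * h < \<epsilon> / 2" using elim K by (simp_all add: h_def hit_rate_def field_simps)
      have "exp A \<le> K" "1 / \<eta> \<le> K" using \<eta> by (auto simp: K_def less_imp_le)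
      hence Kh: "exp A * h \<le> K * h" "1 / \<eta> * h \<le> K * h" using h by (auto intro: mult_right_mono simp del: times_divide_eq_left)
      have fm: "emeasure loop_meas (far_hit \<inter> inside R) = ennreal (far_mass R)" "0 \<le> far_mass R"
        unfolding far_mass_def using far_inside_finite[of R] by (auto intro!: emeasure_eq_ennreal_measure)
      have 1: "far_mass R \<le> laplace_real R + (exp A * h + 1 / (2 * A))"
        using far_inside_bounds(1)[OF R A \<eta>] fm laplace_real(1)[OF R] laplace_real(2)[of R] h A
        by (simp add: h_def[symmetric] ennreal_plus[symmetric] ennreal_le_iff del: ennreal_plus)
      have 2: "laplace_real R \<le> far_mass R + (1 / \<eta> * h + 128 * bound_moment * \<eta>)"
      proof -
        have "0 \<le> 1 / \<eta> * h + 128 * bound_moment * \<eta>" using h \<eta> bound_moment(2) by simp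
        thus ?thesis using far_inside_bounds(2)[OF R A \<eta>] fm laplace_real(1)[OF R]
          unfolding h_def[symmetric] by (simp add: ennreal_plus[symmetric] ennreal_le_iff del: ennreal_plus)
      qed
      have "1 / (2 * A) = \<epsilon> / 2" using \<epsilon> by (simp add: A_def)
      thus ?case using 1 2 Kh h \<eta>2 by (simp add: dist_real_def abs_less_iff)
    qed
  qed
  from tendsto_add[OF this L] have "((\<lambda>R. far_mass R - ln (ln R)) \<longlongrightarrow> L) at_top" by simp
  thus ?thesis by (rule that)
qed

section \<open>The normalized mass of loops hitting two disjoint sets\<close>

definition hit :: "complex set \<Rightarrow> rooted_loop set" where
  "hit F = {x. trace x \<inter> F \<noteq> {}}"

lemma hit_iff: "x \<in> hit F \<longleftrightarrow> (\<exists>z\<in>trace x. z \<in> F)"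
  by (auto simp: hit_def)

lemma sets_hit_closed: "closed F \<Longrightarrow> hit F \<in> sets loop_meas"
  unfolding hit_def by (rule sets_trace_hits)

lemma sets_hit_open: "open F \<Longrightarrow> hit F \<in> sets loop_meas"
  using pred_trace_hits_open[of F] by (simp add: pred_def hit_def)

lemma sets_hit_ball [measurable]: "hit (ball p r) \<in> sets loop_meas"
  and sets_hit_sphere [measurable]: "hit (sphere p r) \<in> sets loop_meas"
  by (simp_all add: sets_hit_closed sets_hit_open)

text \<open>A connected trace cannot meet two disjoint open sets and lie in their union.\<close>

lemma hit_between:
  assumes "x \<in> hit A" "x \<in> hit B" "open A" "open B" "A \<inter> B = {}"
  shows "x \<in> hit (- (A \<union> B))"
proof (rule ccontr)
  assume "x \<notin> hit (- (A \<union> B))"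
  hence "trace x \<subseteq> A \<union> B" by (auto simp: hit_iff)
  from connectedD[OF connected_trace assms(3,4) _ this] assms show False by (auto simp: hit_def)
qed

lemma emeasure_mono_pos:
  assumes "\<And>x. x \<in> A \<Longrightarrow> 0 < dur x \<Longrightarrow> x \<in> B" "B \<in> sets loop_meas"
  shows "emeasure loop_meas A \<le> emeasure loop_meas B"
  by (rule emeasure_mono_AE[OF _ assms(2)], use AE_loop_meas_pos in eventually_elim) (use assms(1) in auto)

lemma emeasure_vimage_transform:
  assumes "0 < c" "A \<in> sets loop_meas"
  shows "emeasure loop_meas (transform p c -` A) = emeasure loop_meas A"
  using emeasure_transform[OF assms(1), of "\<lambda>x. x \<in> A" p] assms(2) by (simp add: vimage_def)

lemma hit_transform: "0 < c \<Longrightarrow> transform p c x \<in> hit F \<longleftrightarrow> x \<in> hit ((\<lambda>z. p + c *\<^sub>R z) -` F)"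
  by (auto simp: hit_iff trace_transform)

lemma inside_transform: "0 < c \<Longrightarrow> transform 0 c x \<in> inside R \<longleftrightarrow> x \<in> inside (R / c)"
  by (auto simp: inside_def trace_transform field_simps subset_iff)

lemma inside_monoD: "x \<in> inside R \<Longrightarrow> R \<le> R' \<Longrightarrow> x \<in> inside R'"
  using inside_mono by blast

text \<open>Traces are compact, so the disks exhaust \<open>A\<close>.\<close>

lemma measure_inside_limit:
  assumes [measurable]: "A \<in> sets loop_meas" and fin: "emeasure loop_meas A < \<infinity>"
  shows "((\<lambda>R. measure loop_meas (A \<inter> inside R)) \<longlongrightarrow> measure loop_meas A) at_top"
proof (rule tendsto_at_topI_sequentially_real)
  have f: "A \<inter> inside R \<in> fmeasurable loop_meas" for R
    by (rule fmeasurableI2[of A]) (use fin in \<open>auto simp: fmeasurable_def\<close>)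
  show "mono (\<lambda>R. measure loop_meas (A \<inter> inside R))"
    by (intro monoI measure_mono_fmeasurable f) (use inside_mono in auto)
  have U: "(\<Union>n. A \<inter> inside (real n)) = A" using inside_exhausts by auto
  have "(\<lambda>n. measure loop_meas (A \<inter> inside (real n))) \<longlonglongrightarrow> measure loop_meas (\<Union>n. A \<inter> inside (real n))"
  proof (rule Lim_measure_incseq)
    show "incseq (\<lambda>n. A \<inter> inside (real n))" by (intro monoI Int_mono order_refl inside_mono) simp
    show "emeasure loop_meas (\<Union>n. A \<inter> inside (real n)) \<noteq> \<infinity>" unfolding U using fin by simp
  qed auto
  thus "(\<lambda>n. measure loop_meas (A \<inter> inside (real n))) \<longlonglongrightarrow> measure loop_meas A" by (simp only: U)
qed

text \<open>Families that differ by finite mass have the same growth up to a constant: each of the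
  two excesses is exhausted by the disks.\<close>

lemma inside_compare:
  assumes [measurable]: "F \<in> sets loop_meas" "G \<in> sets loop_meas"
    and FG: "emeasure loop_meas (F - G) < \<infinity>" and GF: "emeasure loop_meas (G - F) < \<infinity>"
    and G: "\<And>R. emeasure loop_meas (G \<inter> inside R) < \<infinity>"
  shows "emeasure loop_meas (F \<inter> inside R) < \<infinity>"
    and "((\<lambda>R. measure loop_meas (F \<inter> inside R) - measure loop_meas (G \<inter> inside R)) \<longlongrightarrow>
           measure loop_meas (F - G) - measure loop_meas (G - F)) at_top"
proof -
  have F: "emeasure loop_meas (F \<inter> inside R) < \<infinity>" for R
  proof -
    have "emeasure loop_meas (F \<inter> inside R) \<le> emeasure loop_meas (G \<inter> inside R \<union> (F - G))"
      by (rule emeasure_mono) auto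
    also have "\<dots> \<le> emeasure loop_meas (G \<inter> inside R) + emeasure loop_meas (F - G)"
      by (rule emeasure_subadditive) auto
    also have "\<dots> < \<infinity>" using G FG by simp
    finally show ?thesis .
  qed
  show "emeasure loop_meas (F \<inter> inside R) < \<infinity>" by (rule F)
  have fin: "emeasure loop_meas ((F - G) \<inter> inside R) \<noteq> \<infinity>" "emeasure loop_meas ((G - F) \<inter> inside R) \<noteq> \<infinity>" for R
  proof -
    have "emeasure loop_meas ((F - G) \<inter> inside R) \<le> emeasure loop_meas (F - G)"
      "emeasure loop_meas ((G - F) \<inter> inside R) \<le> emeasure loop_meas (G - F)" by (rule emeasure_mono; auto)+
    thus "emeasure loop_meas ((F - G) \<inter> inside R) \<noteq> \<infinity>" "emeasure loop_meas ((G - F) \<inter> inside R) \<noteq> \<infinity>"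
      using FG GF by (auto simp: top_unique)
  qed
  have eq: "measure loop_meas (F \<inter> inside R) - measure loop_meas (G \<inter> inside R) =
     measure loop_meas ((F - G) \<inter> inside R) - measure loop_meas ((G - F) \<inter> inside R)" for R
  proof -
    have "measure loop_meas (F \<inter> inside R \<union> (G - F) \<inter> inside R) = measure loop_meas (F \<inter> inside R) + measure loop_meas ((G - F) \<inter> inside R)"
      by (rule measure_Union) (use F[of R] fin[of R] in auto)
    moreover have "measure loop_meas (G \<inter> inside R \<union> (F - G) \<inter> inside R) = measure loop_meas (G \<inter> inside R) + measure loop_meas ((F - G) \<inter> inside R)"
      by (rule measure_Union) (use G[of R] fin[of R] in auto)
    moreover have "F \<inter> inside R \<union> (G - F) \<inter> inside R = G \<inter> inside R \<union> (F - G) \<inter> inside R" by auto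
    ultimately show ?thesis by simp
  qed
  show "((\<lambda>R. measure loop_meas (F \<inter> inside R) - measure loop_meas (G \<inter> inside R)) \<longlongrightarrow>
           measure loop_meas (F - G) - measure loop_meas (G - F)) at_top"
    unfolding eq by (intro tendsto_diff measure_inside_limit FG GF) measurable
qed

lemma far_compare_limit:
  assumes "F \<in> sets loop_meas" "emeasure loop_meas (F - far_hit) < \<infinity>" "emeasure loop_meas (far_hit - F) < \<infinity>"
  obtains L where "((\<lambda>R. measure loop_meas (F \<inter> inside R) - ln (ln R)) \<longlongrightarrow> L) at_top"
    "\<And>R. emeasure loop_meas (F \<inter> inside R) < \<infinity>"
proof -
  obtain L where L: "((\<lambda>R. far_mass R - ln (ln R)) \<longlongrightarrow> L) at_top" by (rule far_mass_limit)
  note c = inside_compare[OF assms(1) sets_far_hit assms(2,3) far_inside_finite]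
  from tendsto_add[OF c(2) L] have "((\<lambda>R. measure loop_meas (F \<inter> inside R) - ln (ln R)) \<longlongrightarrow> measure loop_meas (F - far_hit) - measure loop_meas (far_hit - F) + L) at_top"
    by (simp add: far_mass_def)
  thus ?thesis using c(1) by (rule that)
qed

definition far_hit_at :: "real \<Rightarrow> rooted_loop set" where
  "far_hit_at s = {x. 2 * s \<le> norm (fst x) \<and> x \<in> hit (ball 0 s)}"

lemma sets_far_hit_at [measurable]: "far_hit_at s \<in> sets loop_meas"
proof -
  have "{x \<in> space loop_meas. 2 * s \<le> norm (fst x) \<and> x \<in> hit (ball 0 s)} \<in> sets loop_meas" by measurable
  thus ?thesis by (simp add: far_hit_at_def)
qed

lemma far_hit_at_1: "far_hit_at 1 = far_hit"
  by (simp add: far_hit_at_def far_hit_def hit_def)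

text \<open>Dilation by \<open>1 / s\<close> maps one family onto the other. A larger
  \<open>s\<close> gives a smaller radius on the right, and this monotonicity is what
  \<open>miss_centre\<close> exploits.\<close>

lemma emeasure_far_hit_at:
  assumes s: "0 < s"
  shows "emeasure loop_meas (far_hit_at s \<inter> inside R) = emeasure loop_meas (far_hit \<inter> inside (R / s))"
proof -
  have "transform 0 (1 / s) -` (far_hit \<inter> inside (R / s)) = far_hit_at s \<inter> inside R"
  proof -
    have v: "(\<lambda>z. (0::complex) + (1 / s) *\<^sub>R z) -` ball 0 1 = ball 0 s" using s by auto
    have "x \<in> far_hit_at s \<longleftrightarrow> transform 0 (1 / s) x \<in> far_hit_at 1" for x
      unfolding far_hit_at_def mem_Collect_eq using s hit_transform[of "1 / s" 0 x "ball 0 1"] v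
      by (simp add: transform_def field_simps)
    thus ?thesis using s inside_transform[of "1 / s" _ "R / s"] by (intro set_eqI) (simp add: far_hit_at_1)
  qed
  moreover have "far_hit \<inter> inside (R / s) \<in> sets loop_meas" by measurable
  ultimately show ?thesis using emeasure_vimage_transform[of "1 / s" _ 0] s by (metis zero_less_divide_1_iff)
qed

lemma local_loops_sets [measurable]: "{x. 0 < dur x \<and> norm (fst x) < \<rho> \<and> d \<le> spread x} \<in> sets loop_meas"
proof -
  have "{x \<in> space loop_meas. 0 < dur x \<and> norm (fst x) < \<rho> \<and> d \<le> spread x} \<in> sets loop_meas" by measurable
  thus ?thesis by simp
qed

text \<open>Loops that come from far away and hit the larger disk mostly hit the smaller one as well: by
  scaling, both families have the same growth, so the difference stays bounded inside every disk.\<close>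

lemma miss_centre:
  assumes e: "0 < e" "e \<le> \<sigma>"
  shows "emeasure loop_meas (far_hit_at \<sigma> - hit (ball 0 e)) < \<infinity>"
proof -
  let ?N = "emeasure loop_meas"
  let ?A = "far_hit_at \<sigma> - hit (ball 0 e)"
  let ?B = "{x. 0 < dur x \<and> norm (fst x) < 2 * \<sigma> \<and> e \<le> spread x}"
  have B: "?N ?B < \<infinity>" using local_loops[of "2 * \<sigma>" e] e by simp
  have bound: "?N (?A \<inter> inside R) \<le> ?N ?B" if R: "0 < R" for R
  proof -
    have "?N (far_hit_at e \<inter> inside R) \<le> ?N (far_hit_at \<sigma> \<inter> hit (ball 0 e) \<inter> inside R \<union> ?B)"
    proof (rule emeasure_mono_pos)
      fix x assume x: "x \<in> far_hit_at e \<inter> inside R" and t: "0 < dur x"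
      obtain z where z: "z \<in> trace x" "norm z < e" using x by (auto simp: far_hit_at_def hit_iff)
      show "x \<in> far_hit_at \<sigma> \<inter> hit (ball 0 e) \<inter> inside R \<union> ?B"
      proof (cases "2 * \<sigma> \<le> norm (fst x)")
        case True
        thus ?thesis using x z e by (auto simp: far_hit_at_def hit_iff intro!: bexI[of _ z])
      next
        case False
        have "norm (fst x) \<le> norm z + norm (z - fst x)" using norm_triangle_ineq4[of z "z - fst x"] by simp
        hence "e \<le> spread x" using z x trace_spread[OF z(1) t] by (auto simp: far_hit_at_def)
        thus ?thesis using False t by simp
      qed
    qed measurable
    also have "\<dots> \<le> ?N (far_hit_at \<sigma> \<inter> hit (ball 0 e) \<inter> inside R) + ?N ?B"
      by (rule emeasure_subadditive) measurable
    finally have "?N (?A \<inter> inside R) + ?N (far_hit_at e \<inter> inside R) \<le>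
       ?N (?A \<inter> inside R) + (?N (far_hit_at \<sigma> \<inter> hit (ball 0 e) \<inter> inside R) + ?N ?B)" by (rule add_left_mono)
    also have "\<dots> = ?N (?A \<inter> inside R \<union> far_hit_at \<sigma> \<inter> hit (ball 0 e) \<inter> inside R) + ?N ?B"
      unfolding add.assoc[symmetric] by (subst plus_emeasure) auto
    also have "?A \<inter> inside R \<union> far_hit_at \<sigma> \<inter> hit (ball 0 e) \<inter> inside R = far_hit_at \<sigma> \<inter> inside R" by auto
    also have "?N (far_hit_at \<sigma> \<inter> inside R) \<le> ?N (far_hit_at e \<inter> inside R)"
    proof -
      have "far_hit \<inter> inside (R / \<sigma>) \<subseteq> far_hit \<inter> inside (R / e)" using e R by (intro Int_mono order_refl inside_mono frac_le) auto
      thus ?thesis using e by (simp add: emeasure_far_hit_at emeasure_mono)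
    qed
    finally have "?N (far_hit_at e \<inter> inside R) + ?N (?A \<inter> inside R) \<le> ?N (far_hit_at e \<inter> inside R) + ?N ?B"
      by (simp add: add.commute add_right_mono)
    \<comment> \<open>Finiteness permits cancelling this term in \<open>ennreal\<close>; what
      remains is a bound by the mass of \<open>?B\<close>, independent of \<open>R\<close>.\<close>
    moreover have "?N (far_hit_at e \<inter> inside R) \<noteq> \<infinity>" using e far_inside_finite by (simp add: emeasure_far_hit_at less_top[symmetric])
    ultimately show ?thesis by (simp add: ennreal_add_left_cancel_le)
  qed
  have U: "(\<Union>n. ?A \<inter> inside (real (Suc n))) = ?A"
  proof -
    have "\<exists>n. x \<in> inside (real (Suc n))" for x
      using inside_exhausts[of x] inside_mono[of "real n" "real (Suc n)" for n] by (meson subsetD of_nat_le_iff le_SucI order_refl)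
    thus ?thesis by auto
  qed
  have "?N ?A = ?N (\<Union>n. ?A \<inter> inside (real (Suc n)))" by (simp only: U)
  also have "\<dots> = (SUP n. ?N (?A \<inter> inside (real (Suc n))))"
    proof (rule SUP_emeasure_incseq[symmetric])
    show "incseq (\<lambda>n. ?A \<inter> inside (real (Suc n)))" by (intro monoI Int_mono order_refl inside_mono) simp
  qed auto
  also have "\<dots> \<le> ?N ?B" by (rule SUP_least) (rule bound, simp)
  finally show ?thesis using B by (rule le_less_trans)
qed

text \<open>\<open>miss_centre\<close> translated by \<open>p\<close>, with \<open>\<sigma>\<close>
  so large that the disk of radius \<open>\<sigma>\<close> about \<open>p\<close> contains the unit
  disk. Loops rooted closer to \<open>p\<close> than \<open>2 * \<sigma>\<close> have finite mass by
  \<open>local_loops\<close>.\<close>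

lemma miss_ball:
  assumes e: "0 < e"
  shows "emeasure loop_meas (far_hit - hit (ball p e)) < \<infinity>"
proof -
  let ?N = "emeasure loop_meas"
  define \<sigma> where "\<sigma> = max (1 + norm p) e"
  have \<sigma>: "1 + norm p \<le> \<sigma>" "e \<le> \<sigma>" "0 < \<sigma>" using e by (auto simp: \<sigma>_def)
  let ?A = "far_hit_at \<sigma> - hit (ball 0 e)"
  let ?B = "{x. 0 < dur x \<and> norm (fst x) < 2 * \<sigma> + norm p \<and> 1 \<le> spread x}"
  have m[measurable]: "transform (- p) 1 -` ?A \<in> sets loop_meas"
    using measurable_sets[OF measurable_transform, of ?A "- p" 1] by (simp)
  have "?N (far_hit - hit (ball p e)) \<le> ?N (transform (- p) 1 -` ?A \<union> ?B)"
  proof (rule emeasure_mono_pos)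
    fix x assume x: "x \<in> far_hit - hit (ball p e)" and t: "0 < dur x"
    show "x \<in> transform (- p) 1 -` ?A \<union> ?B"
    proof (cases "2 * \<sigma> \<le> norm (fst x - p)")
      case True
      obtain z where z: "z \<in> trace x" "norm z < 1" using x by (auto simp: far_hit_def)
      have "norm (z - p) < \<sigma>" using norm_triangle_ineq4[of z p] z \<sigma> by linarith
      hence "x \<in> hit ((\<lambda>z. - p + 1 *\<^sub>R z) -` ball 0 \<sigma>)" using z by (auto simp: hit_iff)
      moreover have "x \<notin> hit ((\<lambda>z. - p + 1 *\<^sub>R z) -` ball 0 e)"
      proof -
        have "(\<lambda>z. - p + 1 *\<^sub>R z) -` ball 0 e = ball p e" by (auto simp: dist_norm norm_minus_commute)
        thus ?thesis using x by simp
      qed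
      ultimately have "transform (- p) 1 x \<in> hit (ball 0 \<sigma>)" "transform (- p) 1 x \<notin> hit (ball 0 e)" by (simp_all add: hit_transform)
      thus ?thesis using True by (simp add: far_hit_at_def transform_def)
    next
      case False
      have "norm (fst x) \<le> norm (fst x - p) + norm p" using norm_triangle_ineq[of "fst x - p" p] by simp
      thus ?thesis using False far_hit_spread[of x] x t by auto
    qed
  qed measurable
  also have "\<dots> \<le> ?N (transform (- p) 1 -` ?A) + ?N ?B" by (rule emeasure_subadditive) measurable
  also have "?N (transform (- p) 1 -` ?A) = ?N ?A" by (rule emeasure_vimage_transform) auto
  also have "?N ?A + ?N ?B < \<infinity>" using miss_centre[OF e \<sigma>(2)] local_loops[of "2 * \<sigma> + norm p" 1] \<sigma> by (simp add: add_pos_nonneg)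
  finally show ?thesis .
qed

text \<open>A closed set whose complement splits into two non-empty open pieces is hit by almost all large loops:
  up to finite mass they visit a small disk in either piece, and the loops are connected.\<close>

definition separating :: "complex set \<Rightarrow> bool" where
  "separating V \<longleftrightarrow> (\<exists>A B. open A \<and> open B \<and> A \<inter> B = {} \<and> A \<noteq> {} \<and> B \<noteq> {} \<and> V = - (A \<union> B))"

lemma separating_closed: "separating V \<Longrightarrow> closed V"
  by (auto simp: separating_def intro!: closed_Compl open_Un)

lemma separating_missed:
  assumes "separating V"
  shows "emeasure loop_meas (far_hit - hit V) < \<infinity>"
proof -
  obtain A B where AB: "open A" "open B" "A \<inter> B = {}" "A \<noteq> {}" "B \<noteq> {}" and V: "V = - (A \<union> B)"
    using assms by (auto simp: separating_def)
  obtain a b where ab: "a \<in> A" "b \<in> B" using AB by auto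
  obtain d where d: "0 < d" "ball a d \<subseteq> A" using AB(1) ab(1) by (meson open_contains_ball)
  obtain e where e: "0 < e" "ball b e \<subseteq> B" using AB(2) ab(2) by (meson open_contains_ball)
  have "far_hit - hit V \<subseteq> (far_hit - hit (ball a d)) \<union> (far_hit - hit (ball b e))"
  proof (rule ccontr)
    assume "\<not> ?thesis"
    then obtain x where x: "x \<notin> hit V" "x \<in> hit (ball a d)" "x \<in> hit (ball b e)" by auto
    hence "x \<in> hit A" "x \<in> hit B" using d e by (auto simp: hit_iff)
    from hit_between[OF this AB(1-3)] x V show False by simp
  qed
  hence "emeasure loop_meas (far_hit - hit V) \<le> emeasure loop_meas ((far_hit - hit (ball a d)) \<union> (far_hit - hit (ball b e)))"
    by (rule emeasure_mono) measurable
  also have "\<dots> \<le> emeasure loop_meas (far_hit - hit (ball a d)) + emeasure loop_meas (far_hit - hit (ball b e))"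
    by (rule emeasure_subadditive) measurable
  also have "\<dots> < \<infinity>" using miss_ball d e by simp
  finally show ?thesis .
qed

text \<open>The pair is compared with \<open>far_hit\<close> in both directions. A loop that hits
  both sets but is not in \<open>far_hit\<close> either comes from far away and misses the unit
  disk, which is covered by \<open>miss_centre\<close>, or has a root in a bounded region and a
  spread of at least half the distance of the two sets; this distance is positive because
  \<open>V\<close> is compact.\<close>

lemma separating_pair_limit:
  assumes V: "separating V" and W: "separating W" and VW: "V \<inter> W = {}" and bd: "bounded V"
  obtains L where "((\<lambda>R. measure loop_meas (hit V \<inter> hit W \<inter> inside R) - ln (ln R)) \<longlongrightarrow> L) at_top"
    "\<And>R. emeasure loop_meas (hit V \<inter> hit W \<inter> inside R) < \<infinity>"
proof (rule far_compare_limit)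
  let ?N = "emeasure loop_meas"
  have [measurable]: "hit V \<in> sets loop_meas" "hit W \<in> sets loop_meas" using V W by (simp_all add: sets_hit_closed separating_closed)
  show "hit V \<inter> hit W \<in> sets loop_meas" by measurable
  have "far_hit - hit V \<inter> hit W = (far_hit - hit V) \<union> (far_hit - hit W)" by auto
  hence "?N (far_hit - hit V \<inter> hit W) \<le> ?N (far_hit - hit V) + ?N (far_hit - hit W)"
    by (simp only:) (rule emeasure_subadditive; measurable)
  also have "\<dots> < \<infinity>" using separating_missed V W by simp
  finally show "?N (far_hit - hit V \<inter> hit W) < \<infinity>" .
  have "compact V" using V bd by (simp add: compact_eq_bounded_closed separating_closed)
  then obtain d where d: "0 < d" "\<And>u v. u \<in> V \<Longrightarrow> v \<in> W \<Longrightarrow> d \<le> dist u v"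
    using separate_compact_closed[of V W] W VW by (metis separating_closed)
  obtain \<rho>' where \<rho>': "\<And>z. z \<in> V \<Longrightarrow> norm z \<le> \<rho>'" using bd by (auto simp: bounded_iff)
  define \<rho> where "\<rho> = max 1 (\<rho>' + 1)"
  have \<rho>: "1 \<le> \<rho>" "\<And>z. z \<in> V \<Longrightarrow> norm z < \<rho>" using \<rho>' by (force simp: \<rho>_def)+
  let ?B = "{x. 0 < dur x \<and> norm (fst x) < 2 * \<rho> \<and> d / 2 \<le> spread x}"
  have "?N (hit V \<inter> hit W - far_hit) \<le> ?N ((far_hit_at \<rho> - hit (ball 0 1)) \<union> ?B)"
  proof (rule emeasure_mono_pos)
    fix x assume x: "x \<in> hit V \<inter> hit W - far_hit" and t: "0 < dur x"
    obtain u v where uv: "u \<in> trace x" "u \<in> V" "v \<in> trace x" "v \<in> W" using x by (auto simp: hit_iff)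
    show "x \<in> (far_hit_at \<rho> - hit (ball 0 1)) \<union> ?B"
    proof (cases "2 * \<rho> \<le> norm (fst x)")
      case True
      hence "x \<notin> hit (ball 0 1)" using x \<rho> by (auto simp: far_hit_def hit_def)
      moreover have "x \<in> hit (ball 0 \<rho>)" using uv \<rho> by (auto simp: hit_iff)
      ultimately show ?thesis using True by (simp add: far_hit_at_def)
    next
      case False
      have "d \<le> norm ((u - fst x) - (v - fst x))" using d(2)[OF uv(2,4)] by (simp add: dist_norm)
      also have "\<dots> \<le> spread x + spread x" using norm_triangle_ineq4 trace_spread[OF uv(1) t] trace_spread[OF uv(3) t] by (meson add_mono order_trans)
      finally show ?thesis using False t by simp
    qed
  qed measurable
  also have "\<dots> \<le> ?N (far_hit_at \<rho> - hit (ball 0 1)) + ?N ?B" by (rule emeasure_subadditive) measurable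
  also have "\<dots> < \<infinity>" using miss_centre[of 1 \<rho>] local_loops[of "2 * \<rho>" "d / 2"] d \<rho> by simp
  finally show "?N (hit V \<inter> hit W - far_hit) < \<infinity>" .
qed (rule that)

text \<open>Finiteness in every disk lets the extended values be read as real measures before the
  limit is taken.\<close>

lemma normalized_loop_mass_eqI:
  assumes V: "closed (Pt -` V)" "closed (Pt -` W)"
    and fin: "\<And>R. emeasure loop_meas (hit (Pt -` V) \<inter> hit (Pt -` W) \<inter> inside R) < \<infinity>"
    and L: "((\<lambda>R. measure loop_meas (hit (Pt -` V) \<inter> hit (Pt -` W) \<inter> inside R) - ln (ln R)) \<longlongrightarrow> L) at_top"
  shows "normalized_loop_mass V W = ereal L"
proof -
  let ?F = "\<lambda>R. hit (Pt -` V) \<inter> hit (Pt -` W) \<inter> inside R"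
  have "enn2ereal (loop_mass (ball 0 R) V W) - ereal (ln (ln R)) = ereal (measure loop_meas (?F R) - ln (ln R))" for R
  proof -
    have "{x. trace x \<subseteq> ball 0 R \<and> trace x \<inter> Pt -` V \<noteq> {} \<and> trace x \<inter> Pt -` W \<noteq> {}} = ?F R"
      by (auto simp: hit_def inside_def)
    hence "loop_mass (ball 0 R) V W = ennreal (measure loop_meas (?F R))"
      using loop_mass_eq[OF open_ball V] fin[of R] by (simp add: emeasure_eq_ennreal_measure)
    thus ?thesis by (simp add: enn2ereal_ennreal)
  qed
  thus ?thesis unfolding normalized_loop_mass_def using L by (intro tendsto_Lim) auto
qed

section \<open>Loops hitting two concentric circles\<close>

definition crossing :: "real \<Rightarrow> real \<Rightarrow> rooted_loop set" where
  "crossing r s = hit (sphere 0 r) \<inter> hit (sphere 0 s)"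

lemma sets_crossing [measurable]: "crossing r s \<in> sets loop_meas"
  unfolding crossing_def by measurable

lemma separating_sphere:
  assumes "0 < r" shows "separating (sphere 0 r)"
  unfolding separating_def
proof (intro exI conjI)
  show "open (ball (0::complex) r)" "open (- cball (0::complex) r)" by auto
  show "ball (0::complex) r \<noteq> {}" using assms by simp
  have "complex_of_real (r + 1) \<in> - cball 0 r" using assms by (simp del: of_real_add)
  thus "- cball (0::complex) r \<noteq> {}" by blast
  show "sphere (0::complex) r = - (ball 0 r \<union> - cball 0 r)" by auto
qed auto

lemma hit_sphere_between:
  assumes "z \<in> trace x" "w \<in> trace x" "norm z \<le> r" "r \<le> norm w"
  shows "x \<in> hit (sphere 0 r)"
proof (cases "norm z = r \<or> norm w = r")
  case True
  thus ?thesis using assms by (auto simp: hit_iff)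
next
  case False
  hence "z \<in> ball 0 r" "w \<in> - cball 0 r" using assms by auto
  hence "x \<in> hit (ball 0 r)" "x \<in> hit (- cball 0 r)" using assms(1,2) unfolding hit_iff by blast+
  moreover have "open (- cball (0::complex) r)" "ball (0::complex) r \<inter> - cball 0 r = {}" by auto
  ultimately have "x \<in> hit (- (ball 0 r \<union> - cball 0 r))" by (intro hit_between) auto
  thus ?thesis by (auto simp: hit_iff)
qed

text \<open>By connectedness; the monotonicity of crossing masses in the radii rests on
  this.\<close>

lemma crossing_between:
  assumes "x \<in> crossing a b" "a \<le> r" "r \<le> b" shows "x \<in> hit (sphere 0 r)"
proof -
  obtain z w where "z \<in> trace x" "norm z = a" "w \<in> trace x" "norm w = b"
    using assms(1) by (auto simp: crossing_def hit_iff)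
  thus ?thesis using hit_sphere_between[of z x w r] assms by simp
qed

lemma crossing_limit:
  assumes "0 < r" "r < s"
  obtains L where "((\<lambda>R. measure loop_meas (crossing r s \<inter> inside R) - ln (ln R)) \<longlongrightarrow> L) at_top"
    "\<And>R. emeasure loop_meas (crossing r s \<inter> inside R) < \<infinity>"
proof (rule separating_pair_limit)
  show "separating (sphere 0 r)" "separating (sphere 0 s)" using assms by (simp_all add: separating_sphere)
  show "sphere (0::complex) r \<inter> sphere 0 s = {}" using assms by auto
  show "bounded (sphere (0::complex) r)" by simp
qed (rule that, simp_all only: crossing_def)

lemma crossing_fmeasurable:
  assumes "0 < r" "r < s"
  shows "crossing r s \<inter> inside R \<in> fmeasurable loop_meas"
proof -
  obtain L where "((\<lambda>R. measure loop_meas (crossing r s \<inter> inside R) - ln (ln R)) \<longlongrightarrow> L) at_top"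
    "\<And>R. emeasure loop_meas (crossing r s \<inter> inside R) < \<infinity>" by (rule crossing_limit[OF assms]) blast
  thus ?thesis by (intro fmeasurableI) auto
qed

lemma measure_crossing_scale:
  assumes c: "0 < c"
  shows "measure loop_meas (crossing (c * r) (c * s) \<inter> inside (c * R)) = measure loop_meas (crossing r s \<inter> inside R)"
proof -
  have v: "(*\<^sub>R) c -` sphere (0::complex) (c * r) = sphere 0 r" for r using c by auto
  have "transform 0 c -` (crossing (c * r) (c * s) \<inter> inside (c * R)) = crossing r s \<inter> inside R"
    using hit_transform[OF c, of 0] inside_transform[OF c] c by (intro set_eqI) (simp add: crossing_def v)
  moreover have "crossing (c * r) (c * s) \<inter> inside (c * R) \<in> sets loop_meas" by measurable
  ultimately have "emeasure loop_meas (crossing r s \<inter> inside R) = emeasure loop_meas (crossing (c * r) (c * s) \<inter> inside (c * R))"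
    using emeasure_vimage_transform[OF c] by metis
  thus ?thesis by (simp add: measure_def)
qed

text \<open>A loop from the inner circle either reaches the circle of radius \<open>x\<close>, and
  then crosses that of radius \<open>s\<close> on the way, or stays in the open disk of radius
  \<open>x\<close>. The two cases exclude each other.\<close>

lemma measure_crossing_add:
  assumes "0 < a" "a < s" "s < x" "x \<le> R"
  shows "measure loop_meas (crossing a s \<inter> inside R) =
    measure loop_meas (crossing a x \<inter> inside R) + measure loop_meas (crossing a s \<inter> inside x)"
proof -
  have "crossing a s \<inter> inside R = crossing a x \<inter> inside R \<union> crossing a s \<inter> inside x"
  proof (intro subset_antisym subsetI)
    fix y assume y: "y \<in> crossing a s \<inter> inside R"
    obtain z where z: "z \<in> trace y" "norm z = a" using y by (auto simp: crossing_def hit_iff)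
    show "y \<in> crossing a x \<inter> inside R \<union> crossing a s \<inter> inside x"
    proof (cases "y \<in> inside x")
      case False
      then obtain w where "w \<in> trace y" "x \<le> norm w" by (force simp: inside_def)
      hence "y \<in> hit (sphere 0 x)" using hit_sphere_between[of z y w x] z assms by simp
      thus ?thesis using y by (simp add: crossing_def)
    qed (use y in simp)
  next
    fix y assume "y \<in> crossing a x \<inter> inside R \<union> crossing a s \<inter> inside x"
    thus "y \<in> crossing a s \<inter> inside R" using crossing_between[of y a x s] inside_monoD[of y x R] assms
      by (auto simp: crossing_def)
  qed
  moreover have "crossing a x \<inter> inside R \<inter> (crossing a s \<inter> inside x) = {}"
  proof -
    have False if y: "y \<in> hit (sphere 0 x)" "y \<in> inside x" for y
    proof -
      obtain z where "z \<in> trace y" "norm z = x" using y(1) by (auto simp: hit_iff)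
      thus False using y(2) by (force simp: inside_def)
    qed
    thus ?thesis by (auto simp: crossing_def)
  qed
  ultimately show ?thesis
    using crossing_fmeasurable[of a x R] crossing_fmeasurable[of a s x] assms
    by (simp add: measure_Union fmeasurable_def less_top[symmetric])
qed

definition crossing_mass :: "real \<Rightarrow> real \<Rightarrow> real" where
  "crossing_mass s R = measure loop_meas (crossing 1 s \<inter> inside R)"

lemma crossing_mass_limit:
  assumes "1 < s"
  obtains \<kappa> where "((\<lambda>R. crossing_mass s R - ln (ln R)) \<longlongrightarrow> \<kappa>) at_top"
  using crossing_limit[of 1 s] assms unfolding crossing_mass_def by auto

lemma crossing_mass_at_top:
  assumes "1 < s" shows "filterlim (crossing_mass s) at_top at_top"
proof -
  obtain \<kappa> where \<kappa>: "((\<lambda>R. crossing_mass s R - ln (ln R)) \<longlongrightarrow> \<kappa>) at_top"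
    by (rule crossing_mass_limit[OF assms])
  have "filterlim (\<lambda>R::real. ln (ln R)) at_top at_top" by real_asymp
  from filterlim_tendsto_add_at_top[OF \<kappa> this] show ?thesis by simp
qed

text \<open>The increment does not involve \<open>s\<close>, which leaves it free to be rescaled in
  \<open>crossing_mass_strict\<close>.\<close>

lemma crossing_mass_diff:
  assumes "1 < s" "s < x" "x \<le> R"
  shows "crossing_mass s R - crossing_mass s x = measure loop_meas (crossing 1 x \<inter> inside R)"
  using measure_crossing_add[of 1 s x R] assms by (simp add: crossing_mass_def)

text \<open>By scaling, a vanishing increment would propagate to all larger radii, but the mass is unbounded.\<close>

lemma crossing_mass_strict:
  assumes s: "1 < s" "s < x" "x < x'"
  shows "crossing_mass s x < crossing_mass s x'"
proof (rule ccontr)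
  assume "\<not> ?thesis"
  hence zero: "measure loop_meas (crossing 1 x \<inter> inside x') = 0"
    using crossing_mass_diff[of s x x'] measure_nonneg[of loop_meas "crossing 1 x \<inter> inside x'"] s by linarith
  define q where "q = x' / x"
  have q: "1 < q" "x' = q * x" using s by (simp_all add: q_def)
  have const: "crossing_mass s (q ^ n * x) = crossing_mass s x" for n
  proof (induction n)
    case (Suc n)
    define a where "a = q ^ n"
    have a: "1 \<le> a" using q by (simp add: a_def)
    have sa: "s < a * x" "a * x \<le> a * x'" using s a mult_right_mono[of 1 a x] mult_left_mono[of x x' a] by linarith+
    have "crossing_mass s (a * x') - crossing_mass s (a * x) = measure loop_meas (crossing 1 (a * x) \<inter> inside (a * x'))"
      using s a sa by (intro crossing_mass_diff) auto
    also have "\<dots> = measure loop_meas (crossing (1 / a) x \<inter> inside x')"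
      using measure_crossing_scale[of a "1 / a" x x'] a by simp
    \<comment> \<open>A loop crossing from \<open>1 / a <= 1\<close> to \<open>x\<close> also
      crosses from 1, so the rescaled increment is at most the one assumed to vanish.\<close>
    also have "\<dots> \<le> measure loop_meas (crossing 1 x \<inter> inside x')"
    proof (rule measure_mono_fmeasurable)
      show "crossing (1 / a) x \<inter> inside x' \<subseteq> crossing 1 x \<inter> inside x'"
        using crossing_between[of _ "1 / a" x 1] a s by (auto simp: crossing_def)
    qed (use s crossing_fmeasurable in auto)
    finally have "crossing_mass s (a * x') \<le> crossing_mass s (a * x)" using zero by simp
    moreover have "crossing_mass s (a * x) \<le> crossing_mass s (a * x')"
      using crossing_mass_diff[of s "a * x" "a * x'"] s a sa measure_nonneg[of loop_meas "crossing 1 (a * x) \<inter> inside (a * x')"]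
      by linarith
    moreover have e: "q ^ Suc n * x = a * x'" by (simp add: a_def q(2))
    ultimately show ?case unfolding e using Suc.IH[folded a_def] by linarith
  qed simp
  have "0 < x" using s by simp
  have "filterlim (\<lambda>n. q ^ n * x) at_top sequentially"
    using q(1) \<open>0 < x\<close> by real_asymp
  from filterlim_compose[OF crossing_mass_at_top[OF s(1)] this]
  have "\<forall>\<^sub>F n in sequentially. crossing_mass s x < crossing_mass s (q ^ n * x)" by (simp add: filterlim_at_top_dense)
  thus False by (simp add: const)
qed

definition circle_mass :: "real \<Rightarrow> real" where
  "circle_mass r = Lim at_top (\<lambda>R. measure loop_meas (crossing r 1 \<inter> inside R) - ln (ln R))"

lemma circle_mass_limit:
  assumes "0 < r" "r < 1"
  shows "((\<lambda>R. measure loop_meas (crossing r 1 \<inter> inside R) - ln (ln R)) \<longlongrightarrow> circle_mass r) at_top"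
proof -
  obtain L where L: "((\<lambda>R. measure loop_meas (crossing r 1 \<inter> inside R) - ln (ln R)) \<longlongrightarrow> L) at_top"
    by (rule crossing_limit[OF assms])
  thus ?thesis unfolding circle_mass_def by (subst tendsto_Lim[OF _ L]) auto
qed

text \<open>Dilation by \<open>1 / r\<close> turns the radii \<open>r\<close> and 1 into 1 and
  \<open>1 / r\<close>, to which \<open>crossing_mass_diff\<close> applies. The outer radius becomes
  \<open>R / r\<close>, which changes \<open>ln (ln R)\<close> only by \<open>o(1)\<close>.\<close>

lemma circle_mass_eq:
  assumes s: "1 < s" "s < 1 / r" and r: "0 < r"
    and \<kappa>: "((\<lambda>R. crossing_mass s R - ln (ln R)) \<longlongrightarrow> \<kappa>) at_top"
  shows "circle_mass r = \<kappa> - crossing_mass s (1 / r)"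
  unfolding circle_mass_def
proof (rule tendsto_Lim)
  have "filterlim (\<lambda>R. R / r) at_top at_top" using r by real_asymp
  from filterlim_compose[OF \<kappa> this] have 1: "((\<lambda>R. crossing_mass s (R / r) - ln (ln (R / r))) \<longlongrightarrow> \<kappa>) at_top" .
  have 2: "((\<lambda>R. ln (ln (R / r)) - ln (ln R)) \<longlongrightarrow> 0) at_top" using r by real_asymp
  have "((\<lambda>R. crossing_mass s (R / r) - ln (ln R) - crossing_mass s (1 / r)) \<longlongrightarrow> \<kappa> - crossing_mass s (1 / r)) at_top"
    using tendsto_diff[OF tendsto_add[OF 1 2] tendsto_const[of "crossing_mass s (1 / r)"]] by simp
  thus "((\<lambda>R. measure loop_meas (crossing r 1 \<inter> inside R) - ln (ln R)) \<longlongrightarrow> \<kappa> - crossing_mass s (1 / r)) at_top"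
  proof (rule Lim_transform_eventually)
    show "\<forall>\<^sub>F R in at_top. crossing_mass s (R / r) - ln (ln R) - crossing_mass s (1 / r) =
        measure loop_meas (crossing r 1 \<inter> inside R) - ln (ln R)"
    proof (rule eventually_at_top_linorderI[of 1])
      fix R :: real assume R: "1 \<le> R"
      have "measure loop_meas (crossing r 1 \<inter> inside R) = measure loop_meas (crossing 1 (1 / r) \<inter> inside (R / r))"
        using measure_crossing_scale[of "1 / r" r 1 R] r by simp
      also have "\<dots> = crossing_mass s (R / r) - crossing_mass s (1 / r)"
        using crossing_mass_diff[of s "1 / r" "R / r"] s r R by (simp add: divide_right_mono)
      finally show "crossing_mass s (R / r) - ln (ln R) - crossing_mass s (1 / r) =
        measure loop_meas (crossing r 1 \<inter> inside R) - ln (ln R)" by simp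
    qed
  qed
qed simp

text \<open>With \<open>s\<close> between 1 and \<open>1 / r'\<close> the formula of
  \<open>circle_mass_eq\<close> holds at both radii with the same \<open>\<kappa>\<close>.\<close>

lemma circle_mass_strict:
  assumes "0 < r" "r < r'" "r' < 1"
  shows "circle_mass r < circle_mass r'"
proof -
  obtain s where s: "1 < s" "s < 1 / r'" using dense[of 1 "1 / r'"] assms by auto
  have rr: "1 / r' < 1 / r" using assms by (simp add: frac_less2)
  obtain \<kappa> where \<kappa>: "((\<lambda>R. crossing_mass s R - ln (ln R)) \<longlongrightarrow> \<kappa>) at_top"
    by (rule crossing_mass_limit[OF s(1)])
  show ?thesis
    using circle_mass_eq[OF s(1) _ _ \<kappa>, of r] circle_mass_eq[OF s(1) _ _ \<kappa>, of r'] crossing_mass_strict[OF s rr] s rr assms by simp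
qed

lemma circle_mass_at_0: "filterlim circle_mass at_bot (at_right 0)"
proof -
  obtain \<kappa> where \<kappa>: "((\<lambda>R. crossing_mass 2 R - ln (ln R)) \<longlongrightarrow> \<kappa>) at_top"
    by (rule crossing_mass_limit[of 2]) auto
  have "filterlim (\<lambda>r::real. 1 / r) at_top (at_right 0)" by real_asymp
  from filterlim_compose[OF crossing_mass_at_top[of 2] this]
  have "filterlim (\<lambda>r. - \<kappa> + crossing_mass 2 (1 / r)) at_top (at_right 0)"
    by (intro filterlim_tendsto_add_at_top[OF tendsto_const]) simp
  hence lim: "filterlim (\<lambda>r. - (- \<kappa> + crossing_mass 2 (1 / r))) at_bot (at_right 0)"
    by (simp only: filterlim_uminus_at_top)
  have eq: "\<forall>\<^sub>F r in at_right 0. - (- \<kappa> + crossing_mass 2 (1 / r)) = circle_mass r"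
    using circle_mass_eq[OF _ _ _ \<kappa>] by (auto simp: eventually_at_right_field field_simps intro!: exI[of _ "1/2"])
  from filterlim_cong[OF refl refl eq] lim show ?thesis by (rule iffD1)
qed

text \<open>Loops in the disk of radius \<open>c\<close> about 0 that hit both the half plane \<open>z \<bullet> e > 0\<close> and the disk of radius \<open>c\<close>
  tangent to it at 0. These families shrink to nothing as \<open>c\<close> tends to 0 but have equal mass by
  scaling, so their mass is either 0 or infinite.\<close>

definition cap_loops :: "complex \<Rightarrow> real \<Rightarrow> rooted_loop set" where
  "cap_loops e c = inside c \<inter> hit {z. 0 < z \<bullet> e} \<inter> hit {z. z \<bullet> e < - (norm z)\<^sup>2 / (2 * c)}"

lemma sets_cap_loops [measurable]: "cap_loops e c \<in> sets loop_meas"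
proof -
  have "open {z. 0 < z \<bullet> e}" "open {z. z \<bullet> e < - (norm z)\<^sup>2 / (2 * c)}"
    by (cases "c = 0"; auto intro!: open_Collect_less continuous_intros)+
  thus ?thesis unfolding cap_loops_def by (intro sets.Int sets_inside sets_hit_open)
qed

lemma cap_loops_mono:
  assumes c: "0 < c" "c \<le> c'" shows "cap_loops e c \<subseteq> cap_loops e c'"
proof -
  have "- (norm z)\<^sup>2 / (2 * c) \<le> - (norm z)\<^sup>2 / (2 * c')" for z :: complex using c by (simp add: frac_le)
  hence "x \<in> hit {z. z \<bullet> e < - (norm z)\<^sup>2 / (2 * c)} \<Longrightarrow> x \<in> hit {z. z \<bullet> e < - (norm z)\<^sup>2 / (2 * c')}" for x
    unfolding hit_iff mem_Collect_eq by (meson less_le_trans)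
  thus ?thesis using c inside_mono[of c c'] by (auto simp: cap_loops_def)
qed

lemma emeasure_cap_loops:
  assumes c: "0 < c" shows "emeasure loop_meas (cap_loops e c) = emeasure loop_meas (cap_loops e 1)"
proof -
  have "- (norm (c *\<^sub>R z))\<^sup>2 / (2 * c) = c * (- (norm z)\<^sup>2 / 2)" for z :: complex
    using c by (simp add: power_mult_distrib power2_eq_square)
  hence mem: "z \<in> (*\<^sub>R) c -` {z. z \<bullet> e < - (norm z)\<^sup>2 / (2 * c)} \<longleftrightarrow> c * (z \<bullet> e) < c * (- (norm z)\<^sup>2 / 2)" for z
    by (simp only: vimage_eq mem_Collect_eq inner_scaleR_left)
  have "(*\<^sub>R) c -` {z. z \<bullet> e < - (norm z)\<^sup>2 / (2 * c)} = {z. z \<bullet> e < - (norm z)\<^sup>2 / (2 * 1)}"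
    by (simp only: set_eq_iff mem mult_less_cancel_left_pos[OF c] mem_Collect_eq mult_1_right simp_thms)
  moreover have "(*\<^sub>R) c -` {z. 0 < z \<bullet> e} = {z. 0 < z \<bullet> e}" using c by (auto simp: zero_less_mult_iff)
  ultimately have "transform 0 c -` cap_loops e c = cap_loops e 1"
    using hit_transform[OF c, of 0] inside_transform[OF c] c by (intro set_eqI) (simp add: cap_loops_def)
  thus ?thesis using emeasure_vimage_transform[OF c sets_cap_loops, of 0 e c] by simp
qed

lemma cap_loops_dichotomy:
  assumes "emeasure loop_meas (cap_loops e 1) < \<infinity>"
  shows "emeasure loop_meas (cap_loops e 1) = 0"
proof -
  let ?C = "\<lambda>n::nat. cap_loops e (1 / real (Suc n))"
  have "(INF n. emeasure loop_meas (?C n)) = emeasure loop_meas (\<Inter>n. ?C n)"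
  proof (rule INF_emeasure_decseq)
    show "decseq ?C" by (intro antimonoI cap_loops_mono) (auto simp: frac_le)
    show "emeasure loop_meas (?C n) \<noteq> \<infinity>" for n using assms by (subst emeasure_cap_loops) auto
  qed auto
  also have "(\<Inter>n. ?C n) = {}"
  proof (rule ccontr)
    assume "(\<Inter>n. ?C n) \<noteq> {}"
    then obtain x where "x \<in> (\<Inter>n. ?C n)" by blast
    hence x: "x \<in> ?C n" for n by blast
    \<comment> \<open>A loop in all the families lies in arbitrarily small disks about 0, but it has
      a point in the open half plane, hence off 0.\<close>
    from x[of 0] obtain z where z: "z \<in> trace x" "0 < z \<bullet> e" by (auto simp: cap_loops_def hit_iff)
    hence "0 < norm z" by auto
    then obtain n where "1 / real (Suc n) < norm z" using reals_Archimedean[of "norm z"] by (auto simp: inverse_eq_divide)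
    thus False using x[of n] z by (force simp: cap_loops_def inside_def)
  qed
  finally show ?thesis by (subst (asm) emeasure_cap_loops) auto
qed

text \<open>If both families were null, so would be their dilates and their translates to rational
  levels. The tangent disks of growing radius exhaust the half plane behind the tangent line, so
  almost every loop would have constant real and constant imaginary part and be a point; yet loops
  that hit the circles of radii 1 and 2 have positive mass.\<close>

lemma cap_loops_infinite: "\<exists>e\<in>{1, \<i>}. emeasure loop_meas (cap_loops e 1) = \<infinity>"
proof (rule ccontr)
  assume none: "\<not> ?thesis"
  have null: "AE x in loop_meas. \<forall>z\<in>trace x. \<forall>w\<in>trace x. z \<bullet> e = w \<bullet> e" if e: "e \<in> {1, \<i>}" for e
  proof -
    have e1: "e \<bullet> e = 1" using e by auto
    have "emeasure loop_meas (cap_loops e 1) = 0" using none e by (intro cap_loops_dichotomy) (auto simp: less_top)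
    hence "cap_loops e (real (Suc n)) \<in> null_sets loop_meas" for n
      using emeasure_cap_loops[of "real (Suc n)" e] by (simp add: null_setsI)
    hence U: "(\<Union>n. cap_loops e (real (Suc n))) \<in> null_sets loop_meas" by auto
    have "transform (- (of_rat q *\<^sub>R e)) 1 -` (\<Union>n. cap_loops e (real (Suc n))) \<in> null_sets loop_meas" for q :: rat
    proof (rule null_setsI)
      show "emeasure loop_meas (transform (- (of_rat q *\<^sub>R e)) 1 -` (\<Union>n. cap_loops e (real (Suc n)))) = 0"
        using U by (subst emeasure_vimage_transform) (auto dest: null_setsD1)
      show "transform (- (of_rat q *\<^sub>R e)) 1 -` (\<Union>n. cap_loops e (real (Suc n))) \<in> sets loop_meas"
        using measurable_sets[OF measurable_transform null_setsD2[OF U]] by simp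
    qed
    hence "(\<Union>q::rat. transform (- (of_rat q *\<^sub>R e)) 1 -` (\<Union>n. cap_loops e (real (Suc n)))) \<in> null_sets loop_meas" by auto
    thus ?thesis
    proof (rule AE_I')
      show "{x \<in> space loop_meas. \<not> (\<forall>z\<in>trace x. \<forall>w\<in>trace x. z \<bullet> e = w \<bullet> e)} \<subseteq>
        (\<Union>q::rat. transform (- (of_rat q *\<^sub>R e)) 1 -` (\<Union>n. cap_loops e (real (Suc n))))"
      proof
        fix x assume "x \<in> {x \<in> space loop_meas. \<not> (\<forall>z\<in>trace x. \<forall>w\<in>trace x. z \<bullet> e = w \<bullet> e)}"
        then obtain z w where zw: "z \<in> trace x" "w \<in> trace x" "w \<bullet> e < z \<bullet> e" by (auto simp: neq_iff)
        obtain q :: rat where q: "w \<bullet> e < of_rat q" "of_rat q < z \<bullet> e" using of_rat_dense[OF zw(3)] by blast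
        define p where "p = of_rat q *\<^sub>R e"
        let ?y = "transform (- p) 1 x"
        have tr: "trace ?y = (\<lambda>u. u - p) ` trace x" by (simp add: trace_transform)
        have 1: "0 < (z - p) \<bullet> e" "(w - p) \<bullet> e < 0" using q e1 by (simp_all add: p_def inner_diff_left)
        obtain k where k: "?y \<in> inside (real k)" using inside_exhausts by blast
        \<comment> \<open>From this size on, the disk of that radius tangent to the line through
          \<open>p\<close> contains \<open>w\<close>.\<close>
        obtain m where m: "(norm (w - p))\<^sup>2 / (- ((w - p) \<bullet> e)) < real m" using reals_Archimedean2 by blast
        define n where "n = k + m"
        have "(norm (w - p))\<^sup>2 / (- ((w - p) \<bullet> e)) < 2 * real (Suc n)" using m by (simp add: n_def)
        hence "(norm (w - p))\<^sup>2 < 2 * real (Suc n) * (- ((w - p) \<bullet> e))" using 1 by (simp only: pos_divide_less_eq neg_0_less_iff_less)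
        hence "(w - p) \<bullet> e < - (norm (w - p))\<^sup>2 / (2 * real (Suc n))" by (simp add: field_simps)
        moreover have "?y \<in> inside (real (Suc n))" using k by (rule inside_monoD) (simp add: n_def)
        ultimately have "?y \<in> cap_loops e (real (Suc n))" using 1 zw by (auto simp: cap_loops_def hit_iff tr)
        thus "x \<in> (\<Union>q::rat. transform (- (of_rat q *\<^sub>R e)) 1 -` (\<Union>n. cap_loops e (real (Suc n))))"
          by (auto simp: p_def)
      qed
    qed
  qed
  have "AE x in loop_meas. x \<notin> crossing 1 2"
    using null[OF insertI1] null[OF insertI2[OF singletonI]]
  proof eventually_elim
    case (elim x)
    show ?case
    proof
      assume "x \<in> crossing 1 2"
      then obtain z w where zw: "z \<in> trace x" "w \<in> trace x" "norm z = 1" "norm w = 2"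
        by (auto simp: crossing_def hit_iff)
      have "z \<bullet> 1 = w \<bullet> 1" "z \<bullet> \<i> = w \<bullet> \<i>" using elim zw(1,2) by blast+
      hence "z = w" by (intro complex_eqI) (simp_all add: inner_complex_def)
      thus False using zw by simp
    qed
  qed
  hence "crossing 1 2 \<in> null_sets loop_meas" by (simp add: AE_iff_null_sets[OF sets_crossing])
  hence "emeasure loop_meas (crossing 1 2 \<inter> inside R) = 0" for R
    by (intro null_setsD1 null_set_Int2) auto
  hence "crossing_mass 2 R = 0" for R by (simp add: crossing_mass_def measure_def)
  moreover have "\<forall>\<^sub>F R in at_top. 0 < crossing_mass 2 R"
    using crossing_mass_at_top[of 2] by (simp add: filterlim_at_top_dense)
  ultimately show False by simp
qed

text \<open>Translated by \<open>e\<close>, the tangent disk of radius 1 becomes the unit disk and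
  the half plane lies beyond its tangent at \<open>e\<close>. So the cap loops, of infinite mass,
  run from strictly inside the unit circle to strictly outside, and radii increasing to 1 exhaust
  them.\<close>

lemma unbounded_near_circle:
  "\<exists>r. 1 / 2 \<le> r \<and> r < 1 \<and> B < measure loop_meas (crossing r 1 \<inter> inside 2)"
proof (rule ccontr)
  assume none: "\<not> ?thesis"
  define r where "r n = 1 - 1 / (real n + 2)" for n
  have r: "1 / 2 \<le> r n" "r n < 1" for n by (simp_all add: r_def field_simps)
  have r_mono: "r m \<le> r n" if "m \<le> n" for m n using that by (simp add: r_def frac_le)
  have le: "emeasure loop_meas (crossing (r n) 1 \<inter> inside 2) \<le> ennreal B" for n
  proof -
    have "0 < r n" using r(1)[of n] by simp
    hence "emeasure loop_meas (crossing (r n) 1 \<inter> inside 2) = ennreal (measure loop_meas (crossing (r n) 1 \<inter> inside 2))"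
      using crossing_fmeasurable[of "r n" 1 2] r(2) by (intro emeasure_eq_measure2) auto
    also have "\<dots> \<le> ennreal B" using none r by (intro ennreal_leI) (meson not_le)
    finally show ?thesis .
  qed
  have "emeasure loop_meas (\<Union>n. crossing (r n) 1 \<inter> inside 2) = (SUP n. emeasure loop_meas (crossing (r n) 1 \<inter> inside 2))"
  proof (rule SUP_emeasure_incseq[symmetric])
    show "incseq (\<lambda>n. crossing (r n) 1 \<inter> inside 2)"
    proof (intro monoI subsetI)
      fix m n :: nat and x assume "m \<le> n" "x \<in> crossing (r m) 1 \<inter> inside 2"
      thus "x \<in> crossing (r n) 1 \<inter> inside 2"
        using crossing_between[of x "r m" 1 "r n"] r_mono[of m n] r[of n] by (auto simp: crossing_def)
    qed
  qed auto
  also have "\<dots> \<le> ennreal B" by (intro SUP_least le)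
  finally have fin: "emeasure loop_meas (\<Union>n. crossing (r n) 1 \<inter> inside 2) < \<infinity>" by (rule le_less_trans) simp
  obtain e where e: "e \<in> {1, \<i>}" "emeasure loop_meas (cap_loops e 1) = \<infinity>" using cap_loops_infinite by blast
  have e1: "norm e = 1" "e \<bullet> e = 1" using e by auto
  have "transform (- e) 1 -` cap_loops e 1 \<subseteq> (\<Union>n. crossing (r n) 1 \<inter> inside 2)"
  proof
    fix x assume "x \<in> transform (- e) 1 -` cap_loops e 1"
    hence x: "transform (- e) 1 x \<in> cap_loops e 1" by simp
    have tr: "trace (transform (- e) 1 x) = (\<lambda>u. u - e) ` trace x" by (simp add: trace_transform)
    obtain z w where zw: "z \<in> trace x" "w \<in> trace x" "0 < (z - e) \<bullet> e" "(w - e) \<bullet> e < - (norm (w - e))\<^sup>2 / 2"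
      using x by (auto simp: cap_loops_def hit_iff tr)
    have "1 < z \<bullet> e" using zw e1 by (simp add: inner_diff_left)
    hence z: "1 < norm z" using Cauchy_Schwarz_ineq2[of z e] e1 by simp
    have "(norm w)\<^sup>2 = (norm (w - e))\<^sup>2 + 2 * ((w - e) \<bullet> e) + 1"
      using e1 by (simp add: power2_norm_eq_inner inner_diff_left inner_diff_right inner_commute)
    hence "(norm w)\<^sup>2 < 1\<^sup>2" using zw(4) by simp
    hence w: "norm w < 1" by (rule power2_less_imp_less) simp
    obtain n where "inverse (real (Suc n)) < 1 - norm w" using reals_Archimedean[of "1 - norm w"] w by auto
    moreover have "1 / (real n + 2) \<le> inverse (real (Suc n))" by (simp add: field_simps)
    ultimately have "norm w \<le> r n" by (simp add: r_def)
    hence "x \<in> crossing (r n) 1"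
      using hit_sphere_between[OF zw(2,1), of "r n"] hit_sphere_between[OF zw(2,1), of 1] z w r[of n] by (auto simp: crossing_def)
    moreover have "x \<in> inside 2"
      unfolding inside_def
    proof (intro CollectI subsetI)
      fix u assume "u \<in> trace x"
      hence "norm (u - e) < 1" using x by (auto simp: cap_loops_def inside_def tr)
      thus "u \<in> ball 0 2" using norm_triangle_ineq[of "u - e" e] e1 by simp
    qed
    ultimately show "x \<in> (\<Union>n. crossing (r n) 1 \<inter> inside 2)" by auto
  qed
  hence "emeasure loop_meas (transform (- e) 1 -` cap_loops e 1) \<le> emeasure loop_meas (\<Union>n. crossing (r n) 1 \<inter> inside 2)"
    by (rule emeasure_mono) measurable
  thus False using fin e by (subst (asm) emeasure_vimage_transform) (auto simp: top_unique)
qed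

text \<open>The loops gained inside the fixed disk of radius 2, when the inner circle moves from 1/2
  to \<open>r\<close>, are counted for every \<open>R >= 2\<close>, so their mass survives the
  limit.\<close>

lemma circle_mass_ge:
  assumes "1 / 2 \<le> r" "r < 1"
  shows "circle_mass (1 / 2) + (measure loop_meas (crossing r 1 \<inter> inside 2) - measure loop_meas (crossing (1 / 2) 1 \<inter> inside 2)) \<le> circle_mass r"
proof -
  have fm: "crossing r 1 \<inter> inside R \<in> fmeasurable loop_meas" "crossing (1 / 2) 1 \<inter> inside R \<in> fmeasurable loop_meas" for R
    using assms by (auto intro!: crossing_fmeasurable)
  have sub: "crossing (1 / 2) 1 \<subseteq> crossing r 1"
    using crossing_between[of _ "1 / 2" 1 r] assms by (auto simp: crossing_def)
  let ?D = "(crossing r 1 - crossing (1 / 2) 1) \<inter> inside 2"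
  have D: "?D \<in> fmeasurable loop_meas" by (rule fmeasurableI2[OF fm(1)[of 2]]) auto
  have "measure loop_meas (crossing r 1 \<inter> inside 2) = measure loop_meas (crossing (1 / 2) 1 \<inter> inside 2 \<union> ?D)"
    by (rule arg_cong[of _ _ "measure loop_meas"]) (use sub in auto)
  also have "\<dots> = measure loop_meas (crossing (1 / 2) 1 \<inter> inside 2) + measure loop_meas ?D"
    by (rule measure_Un_AE[OF _ fm(2) D]) auto
  finally have eq: "measure loop_meas (crossing r 1 \<inter> inside 2) - measure loop_meas (crossing (1 / 2) 1 \<inter> inside 2) = measure loop_meas ?D" by simp
  have le: "(measure loop_meas (crossing (1 / 2) 1 \<inter> inside R) - ln (ln R)) + measure loop_meas ?D \<le> measure loop_meas (crossing r 1 \<inter> inside R) - ln (ln R)" if R: "2 \<le> R" for R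
  proof -
    have "measure loop_meas (crossing (1 / 2) 1 \<inter> inside R) + measure loop_meas ?D = measure loop_meas (crossing (1 / 2) 1 \<inter> inside R \<union> ?D)"
      by (rule measure_Un_AE[OF _ fm(2) D, symmetric]) auto
    also have "\<dots> \<le> measure loop_meas (crossing r 1 \<inter> inside R)"
      by (rule measure_mono_fmeasurable[OF _ _ fm(1)]) (use sub inside_mono[OF R] in auto)
    finally show ?thesis by simp
  qed
  show ?thesis unfolding eq
  proof (rule tendsto_le)
    show "((\<lambda>R. measure loop_meas (crossing r 1 \<inter> inside R) - ln (ln R)) \<longlongrightarrow> circle_mass r) at_top"
      using assms by (intro circle_mass_limit) auto
    show "((\<lambda>R. (measure loop_meas (crossing (1 / 2) 1 \<inter> inside R) - ln (ln R)) + measure loop_meas ?D) \<longlongrightarrow> circle_mass (1 / 2) + measure loop_meas ?D) at_top"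
      by (intro tendsto_add tendsto_const circle_mass_limit) auto
    show "\<forall>\<^sub>F R in at_top. (measure loop_meas (crossing (1 / 2) 1 \<inter> inside R) - ln (ln R)) + measure loop_meas ?D \<le> measure loop_meas (crossing r 1 \<inter> inside R) - ln (ln R)"
      by (rule eventually_at_top_linorderI[of 2]) (rule le)
  qed simp
qed

lemma circle_mass_at_1: "filterlim circle_mass at_top (at_left 1)"
  unfolding filterlim_at_top
proof
  fix Z
  obtain r where r: "1 / 2 \<le> r" "r < 1"
    "Z - circle_mass (1 / 2) + measure loop_meas (crossing (1 / 2) 1 \<inter> inside 2) < measure loop_meas (crossing r 1 \<inter> inside 2)"
    using unbounded_near_circle by blast
  hence Z: "Z \<le> circle_mass r" using circle_mass_ge[of r] by simp
  have "Z \<le> circle_mass s" if "r < s" "s < 1" for s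
    using circle_mass_strict[of r s] that r Z by simp
  thus "\<forall>\<^sub>F s in at_left 1. Z \<le> circle_mass s"
    using r(2) by (auto simp: eventually_at_left[of 0 1] intro!: exI[of _ r])
qed

lemma normalized_loop_mass_circles:
  assumes "0 < r" "r < 1"
  shows "normalized_loop_mass (circle r) (circle 1) = ereal (circle_mass r)"
proof (rule normalized_loop_mass_eqI)
  have [simp]: "Pt -` circle s = sphere 0 s" for s by (auto simp: circle_def)
  show "closed (Pt -` circle r)" "closed (Pt -` circle 1)" by simp_all
  have c: "hit (Pt -` circle r) \<inter> hit (Pt -` circle 1) = crossing r 1" by (simp add: crossing_def)
  show "emeasure loop_meas (hit (Pt -` circle r) \<inter> hit (Pt -` circle 1) \<inter> inside R) < \<infinity>" for R
    unfolding c using crossing_fmeasurable[OF assms, of R] by (simp add: fmeasurable_def)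
  show "((\<lambda>R. measure loop_meas (hit (Pt -` circle r) \<inter> hit (Pt -` circle 1) \<inter> inside R) - ln (ln R)) \<longlongrightarrow> circle_mass r) at_top"
    unfolding c by (rule circle_mass_limit[OF assms])
qed

section \<open>Smooth simple loops\<close>

lemma open_range_param: "open (range (param k))"
proof -
  have "param k' -` range (param k) \<in> {UNIV, - {0}}" for k'
  proof (cases "k = k'")
    case True
    thus ?thesis by auto
  next
    case False
    have "param k' -` range (param k) = - {0}"
    proof (intro subset_antisym subsetI)
      fix z assume "z \<in> param k' -` range (param k)"
      thus "z \<in> - {0}" using False by (cases k; cases k') (auto split: if_splits)
    next
      fix z :: complex assume z: "z \<in> - {0}"
      hence "param k' z = param k (1 / z)" using False by (cases k; cases k') auto
      thus "z \<in> param k' -` range (param k)" by auto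
    qed
    thus ?thesis by simp
  qed
  hence "open (param k' -` range (param k))" for k' by (metis insertE singletonD open_UNIV open_Compl closed_singleton)
  thus ?thesis by (simp add: open_rsphere_def)
qed

lemma smooth_on_imp_continuous_on: "smooth_on S f \<Longrightarrow> continuous_on S f"
  by (auto simp: smooth_on_def dest: spec[of _ 0])

lemma smooth_on_imp_differentiable_on: "smooth_on S f \<Longrightarrow> f differentiable_on S"
  unfolding smooth_on_def differentiable_on_def
  by (drule spec[of _ "Suc 0"]) (auto intro: differentiable_at_withinI)

locale smooth_loop =
  fixes c :: "real \<Rightarrow> rsphere"
  assumes immersed: "smooth_immersed_curve c"
    and periodic: "c (t + 1) = c t"
    and inj: "inj_on c {0..<1}"
begin

lemma continuous: "continuous_on UNIV c"
  using immersed by (simp add: smooth_immersed_curve_def)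

lemma smooth_chart: "smooth_on (c -` range (param k)) (coord k \<circ> c)"
  using immersed by (simp add: smooth_immersed_curve_def Let_def)

lemma open_chart: "open (c -` range (param k))"
  using continuous open_range_param[of k] by (simp add: continuous_on_open_vimage)

lemma periodic_nat: "c (t + real n) = c t"
proof (induction n)
  case (Suc n)
  have "c (t + real (Suc n)) = c ((t + real n) + 1)" by (rule arg_cong[of _ _ c]) simp
  thus ?case using Suc periodic by simp
qed simp

lemma periodic_frac: "c (frac t) = c t"
proof (cases "0 \<le> \<lfloor>t\<rfloor>")
  case True
  have "c (frac t + real (nat \<lfloor>t\<rfloor>)) = c (frac t)" by (rule periodic_nat)
  thus ?thesis using True by (simp add: frac_def)
next
  case False
  have "c (t + real (nat (- \<lfloor>t\<rfloor>))) = c t" by (rule periodic_nat)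
  thus ?thesis using False by (simp add: frac_def)
qed

lemma range_unit: "range c = c ` {0..1}"
proof (intro subset_antisym subsetI)
  fix x assume "x \<in> range c"
  then obtain t where "x = c (frac t)" using periodic_frac by auto
  thus "x \<in> c ` {0..1}" using frac_ge_0[of t] frac_lt_1[of t] by (intro image_eqI[of _ _ "frac t"]) auto
qed auto

text \<open>A differentiable image of a subset of the line in the plane is a null set; this provides
  the centre of the inversion in \<open>separating_range\<close>.\<close>

lemma negligible_range: "negligible (Pt -` range c)"
proof -
  have "Pt -` range c = (coord Affine \<circ> c) ` (c -` range (param Affine))"
  proof (intro subset_antisym subsetI)
    fix z assume "z \<in> Pt -` range c"
    then obtain t where "c t = Pt z" by (metis vimageE imageE)
    thus "z \<in> (coord Affine \<circ> c) ` (c -` range (param Affine))" by (intro image_eqI[of _ _ t]) auto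
  next
    fix z assume "z \<in> (coord Affine \<circ> c) ` (c -` range (param Affine))"
    then obtain t u where "z = coord Affine (c t)" "c t = Pt u" by auto
    thus "z \<in> Pt -` range c" by (metis coord.simps(1) rangeI vimageI2)
  qed
  thus ?thesis using smooth_chart[of Affine]
    by (simp only:) (rule negligible_differentiable_image_lowdim, auto intro: smooth_on_imp_differentiable_on)
qed

lemma bounded_range:
  assumes "Infty \<notin> range c" shows "bounded (Pt -` range c)"
proof -
  have all: "c -` range (param Affine) = UNIV"
  proof -
    have "c t \<in> range Pt" for t using assms by (cases "c t") (auto, metis rangeI)
    thus ?thesis by auto
  qed
  have "Pt -` range c \<subseteq> (coord Affine \<circ> c) ` {0..1}"
  proof
    fix z assume "z \<in> Pt -` range c"
    then obtain t where "t \<in> {0..1}" "Pt z = c t" using range_unit by auto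
    thus "z \<in> (coord Affine \<circ> c) ` {0..1}" by (intro image_eqI[of _ _ t]) (auto, metis coord.simps(1))
  qed
  moreover have "compact ((coord Affine \<circ> c) ` {0..1})"
    using smooth_chart[of Affine] unfolding all
    by (intro compact_continuous_image compact_Icc) (meson smooth_on_imp_continuous_on continuous_on_subset subset_UNIV)
  ultimately show ?thesis by (meson bounded_subset compact_imp_bounded)
qed

text \<open>An inversion about a point off the loop turns it into a Jordan curve in the plane.\<close>

lemma separating_range: "separating (Pt -` range c)"
proof -
  obtain p where p: "Pt p \<notin> range c"
  proof -
    have "Pt -` range c \<noteq> UNIV" using negligible_range non_negligible_UNIV by metis
    thus ?thesis using that by blast
  qed
  \<comment> \<open>Inversion about \<open>p\<close>, with infinity sent to 0. At
    \<open>Pt p\<close> itself the formula has the default value \<open>1 / 0 = 0\<close>, so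
    injectivity is claimed away from this point only.\<close>
  define \<phi> where "\<phi> q = (case q of Pt z \<Rightarrow> 1 / (z - p) | Infty \<Rightarrow> 0)" for q
  define g where "g = \<phi> \<circ> c"
  have \<phi>_inj: "q = q'" if "\<phi> q = \<phi> q'" "q \<noteq> Pt p" "q' \<noteq> Pt p" for q q'
    using that by (cases q; cases q') (auto simp: \<phi>_def)
  have "continuous_on (c -` range (param Affine)) g"
  proof -
    have g: "coord Affine (c t) \<noteq> p \<and> g t = 1 / (coord Affine (c t) - p)" if t: "t \<in> c -` range (param Affine)" for t
    proof -
      obtain z where z: "c t = Pt z" using t by auto
      moreover have "z \<noteq> p" using p z by (metis rangeI)
      ultimately show ?thesis by (simp add: g_def \<phi>_def)
    qed
    have "continuous_on (c -` range (param Affine)) (\<lambda>t. coord Affine (c t))"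
      using smooth_on_imp_continuous_on[OF smooth_chart[of Affine]] by (simp add: o_def)
    hence "continuous_on (c -` range (param Affine)) (\<lambda>t. 1 / (coord Affine (c t) - p))"
      using g by (intro continuous_on_divide continuous_on_diff continuous_on_const) auto
    thus ?thesis by (rule continuous_on_eq) (use g in auto)
  qed
  moreover have "continuous_on (c -` range (param AtInfinity)) g"
  proof -
    \<comment> \<open>In the coordinate \<open>w = 1 / z\<close> the inversion reads
      \<open>w / (1 - p w)\<close>, which is continuous across \<open>w = 0\<close>.\<close>
    have g: "1 - p * coord AtInfinity (c t) \<noteq> 0 \<and> g t = coord AtInfinity (c t) / (1 - p * coord AtInfinity (c t))" if t: "t \<in> c -` range (param AtInfinity)" for t
    proof (cases "c t")
      case (Pt z)
      have "z \<noteq> p" using p Pt by (metis rangeI)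
      moreover have "z \<noteq> 0" using t Pt by (auto split: if_splits)
      ultimately show ?thesis using Pt by (simp add: g_def \<phi>_def field_simps)
    qed (simp add: g_def \<phi>_def)
    have "continuous_on (c -` range (param AtInfinity)) (\<lambda>t. coord AtInfinity (c t))"
      using smooth_on_imp_continuous_on[OF smooth_chart[of AtInfinity]] by (simp add: o_def)
    hence "continuous_on (c -` range (param AtInfinity)) (\<lambda>t. coord AtInfinity (c t) / (1 - p * coord AtInfinity (c t)))"
      using g by (intro continuous_on_divide continuous_on_diff continuous_on_mult continuous_on_const) auto
    thus ?thesis by (rule continuous_on_eq) (use g in auto)
  qed
  ultimately have "continuous_on (c -` range (param Affine) \<union> c -` range (param AtInfinity)) g"
    by (intro continuous_on_open_Un open_chart)
  moreover have "c -` range (param Affine) \<union> c -` range (param AtInfinity) = UNIV"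
  proof -
    have "q \<in> range (param Affine) \<union> range (param AtInfinity)" for q
    proof (cases q)
      case Infty
      hence "q = param AtInfinity 0" by simp
      thus ?thesis by blast
    qed auto
    thus ?thesis by blast
  qed
  ultimately have cont: "continuous_on UNIV g" by simp
  have off: "c t \<noteq> Pt p" for t using p by (metis rangeI)
  have simple: "simple_path g"
    unfolding simple_path_def loop_free_def
  proof (intro conjI ballI impI)
    show "path g" unfolding path_def using cont continuous_on_subset by blast
    fix s t :: real assume st: "s \<in> {0..1}" "t \<in> {0..1}" and "g s = g t"
    hence ct: "c s = c t" using \<phi>_inj off by (simp add: g_def)
    have c1: "c 1 = c 0" using periodic[of 0] by simp
    show "s = t \<or> s = 0 \<and> t = 1 \<or> s = 1 \<and> t = 0"
      using st ct c1 inj_onD[OF inj, of s t] inj_onD[OF inj, of s 0] inj_onD[OF inj, of 0 t] by (cases "s = 1"; cases "t = 1") auto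
  qed
  have closed_path: "pathfinish g = pathstart g" using periodic[of 0] by (simp add: pathfinish_def pathstart_def g_def)
  let ?P = "path_image g"
  have P: "?P = \<phi> ` range c" by (simp add: path_image_def g_def range_unit image_image)
  note J = Jordan_inside_outside[OF simple closed_path]
  have mem: "z \<in> Pt -` range c \<longleftrightarrow> 1 / (z - p) \<in> ?P" if "z \<noteq> p" for z
  proof
    assume "1 / (z - p) \<in> ?P"
    then obtain t where "\<phi> (Pt z) = \<phi> (c t)" by (auto simp: P \<phi>_def)
    hence "Pt z = c t" using \<phi>_inj off that by auto
    thus "z \<in> Pt -` range c" by simp
  next
    assume "z \<in> Pt -` range c"
    moreover have "1 / (z - p) = \<phi> (Pt z)" by (simp add: \<phi>_def)
    ultimately show "1 / (z - p) \<in> ?P" unfolding P by blast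
  qed
  have pre: "open {z. z \<noteq> p \<and> 1 / (z - p) \<in> U}" if "open U" for U
  proof -
    have "open (- {p} \<inter> (\<lambda>z. 1 / (z - p)) -` U)"
      using that by (intro continuous_open_preimage) (auto intro!: continuous_intros)
    moreover have "- {p} \<inter> (\<lambda>z. 1 / (z - p)) -` U = {z. z \<noteq> p \<and> 1 / (z - p) \<in> U}" by auto
    ultimately show ?thesis by simp
  qed
  define A where "A = {z. z \<noteq> p \<and> 1 / (z - p) \<in> Path_Connected.inside ?P}"
  \<comment> \<open>\<open>p\<close> is the preimage of infinity and belongs to the unbounded
    side.\<close>
  define B where "B = {z. z \<noteq> p \<and> 1 / (z - p) \<in> outside ?P} \<union> {p}"
  show ?thesis unfolding separating_def
  proof (intro exI conjI)
    show "open A" unfolding A_def using J by (intro pre) auto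
    have "bounded (- outside ?P)"
    proof -
      have "- outside ?P = Path_Connected.inside ?P \<union> ?P" using J by blast
      moreover have "bounded ?P" using simple by (simp add: bounded_simple_path_image)
      ultimately show ?thesis using J by simp
    qed
    then obtain K where K: "\<And>w. w \<notin> outside ?P \<Longrightarrow> norm w \<le> K" by (auto simp: bounded_iff)
    \<comment> \<open>Points within \<open>d\<close> of \<open>p\<close> have images of norm above
      \<open>|K| + 1\<close>, all of them outside the curve; hence \<open>B\<close> is open at
      \<open>p\<close>.\<close>
    define d where "d = 1 / (\<bar>K\<bar> + 1)"
    have d: "0 < d" by (simp add: d_def add_nonneg_pos)
    have "B = {z. z \<noteq> p \<and> 1 / (z - p) \<in> outside ?P} \<union> ball p d"
    proof -
      have "1 / (z - p) \<in> outside ?P" if "z \<in> ball p d" "z \<noteq> p" for z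
      proof (rule ccontr)
        assume "1 / (z - p) \<notin> outside ?P"
        from K[OF this] have "1 / norm (z - p) \<le> K" by (simp add: norm_divide)
        moreover have "norm (z - p) < d" "0 < norm (z - p)" using that by (auto simp: dist_norm norm_minus_commute)
        hence "1 / d < 1 / norm (z - p)" by (intro divide_strict_left_mono) (auto simp: d)
        ultimately show False by (simp add: d_def)
      qed
      thus ?thesis using d unfolding B_def by auto
    qed
    thus "open B" using J pre[of "outside ?P"] by (simp add: open_Un)
    have "Path_Connected.inside ?P \<inter> outside ?P = {}" by (rule inside_Int_outside)
    thus "A \<inter> B = {}" unfolding A_def B_def by blast
    show "B \<noteq> {}" by (simp add: B_def)
    \<comment> \<open>The point 0 is the image of infinity and has no preimage in the plane; the
      inside is open and therefore contains another point.\<close>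
    have "Path_Connected.inside ?P \<noteq> {0}" using J not_open_singleton[of "0::complex"] by metis
    then obtain w where w: "w \<in> Path_Connected.inside ?P" "w \<noteq> 0" using J by blast
    hence "p + 1 / w \<in> A" by (simp add: A_def)
    thus "A \<noteq> {}" by blast
    have "z \<in> Pt -` range c \<longleftrightarrow> z \<notin> A \<union> B" for z
    proof (cases "z = p")
      case True
      thus ?thesis using p by (auto simp: B_def)
    next
      case False
      have "Path_Connected.inside ?P \<union> outside ?P = - ?P" using J by blast
      thus ?thesis using mem[OF False] False unfolding A_def B_def by blast
    qed
    thus "Pt -` range c = - (A \<union> B)" by blast
  qed
qed

end

lemma smooth_simple_loopE:
  assumes "smooth_simple_loop \<gamma>"
  obtains c where "smooth_loop c" "\<gamma> = range c"
  using assms by (auto simp: smooth_simple_loop_def smooth_loop_def)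

text \<open>Disjoint loops cannot both pass through infinity, so one of them is bounded in the
  plane, as \<open>separating_pair_limit\<close> demands of one of its sets.\<close>

lemma normalized_loop_mass_finite:
  assumes "smooth_simple_loop \<gamma>\<^sub>1" "smooth_simple_loop \<gamma>\<^sub>2" "\<gamma>\<^sub>1 \<inter> \<gamma>\<^sub>2 = {}"
  obtains L where "normalized_loop_mass \<gamma>\<^sub>1 \<gamma>\<^sub>2 = ereal L"
proof -
  let ?V = "Pt -` \<gamma>\<^sub>1" and ?W = "Pt -` \<gamma>\<^sub>2"
  obtain c where c: "smooth_loop c" "\<gamma>\<^sub>1 = range c" by (rule smooth_simple_loopE[OF assms(1)])
  obtain d where d: "smooth_loop d" "\<gamma>\<^sub>2 = range d" by (rule smooth_simple_loopE[OF assms(2)])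
  have sep: "separating ?V" "separating ?W" using c d smooth_loop.separating_range by auto
  have "Infty \<notin> \<gamma>\<^sub>1 \<or> Infty \<notin> \<gamma>\<^sub>2" using assms(3) by blast
  hence bd: "bounded ?V \<or> bounded ?W" using c d smooth_loop.bounded_range by metis
  have disj: "?V \<inter> ?W = {}" using assms(3) by auto
  obtain L where "((\<lambda>R. measure loop_meas (hit ?V \<inter> hit ?W \<inter> inside R) - ln (ln R)) \<longlongrightarrow> L) at_top"
    "\<And>R. emeasure loop_meas (hit ?V \<inter> hit ?W \<inter> inside R) < \<infinity>"
  proof (cases "bounded ?V")
    case True
    show ?thesis by (rule separating_pair_limit[OF sep disj True]) (rule that)
  next
    case False
    with bd have W: "bounded ?W" by simp
    have "?W \<inter> ?V = {}" using disj by blast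
    from separating_pair_limit[OF sep(2,1) this W] show ?thesis using that unfolding Int_commute[of "hit ?W" "hit ?V"] by blast
  qed
  thus ?thesis using normalized_loop_mass_eqI sep by (intro that) (auto simp: separating_closed)
qed

lemma has_vector_derivative_exp:
  "((\<lambda>t::real. A * exp (of_real t * w) :: complex) has_vector_derivative A * w * exp (of_real t * w)) (at t)"
proof -
  have "((\<lambda>z. A * exp (z * w)) has_field_derivative A * w * exp (of_real t * w)) (at (of_real t))"
    by (auto intro!: derivative_eq_intros)
  from has_vector_derivative_real_field[OF this] show ?thesis .
qed

text \<open>Derivatives stay in this family with another factor \<open>A\<close>, hence the
  induction over all \<open>A\<close>.\<close>

lemma smooth_on_exp: "smooth_on UNIV (\<lambda>t::real. A * exp (of_real t * w) :: complex)"
proof -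
  have "C_k_on k UNIV (\<lambda>t::real. A * exp (of_real t * w))" for k
  proof (induction k arbitrary: A)
    case 0
    show ?case by (auto intro!: continuous_intros)
  next
    case (Suc k)
    have D: "((\<lambda>t::real. A * exp (of_real t * w)) has_derivative (\<lambda>v. of_real v * A * w * exp (of_real t * w))) (at t)" for t
      using has_vector_derivative_exp[of A w t] by (simp add: has_vector_derivative_def scaleR_conv_of_real mult.assoc)
    have "frechet_derivative (\<lambda>t::real. A * exp (of_real t * w)) (at t) v = of_real v * A * w * exp (of_real t * w)" for t v
      using fun_cong[OF frechet_derivative_at[OF D[of t]], of v] by simp
    thus ?case using D Suc[of "of_real v * A * w" for v] by (auto simp: differentiable_def)
  qed
  thus ?thesis by (simp add: smooth_on_def)
qed

lemma smooth_simple_loop_circle: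
  assumes r: "0 < r" shows "smooth_simple_loop (circle r)"
proof -
  define w where "w = 2 * of_real pi * \<i>"
  define c where "c t = Pt (of_real r * exp (of_real t * w))" for t
  \<comment> \<open>In the chart at infinity the circle has the same form, with \<open>1 / r\<close>
    and \<open>- w\<close> in place of \<open>r\<close> and \<open>w\<close>, so
    \<open>smooth_on_exp\<close> serves both charts.\<close>
  have aff: "coord Affine \<circ> c = (\<lambda>t. of_real r * exp (of_real t * w))"
    and inf: "coord AtInfinity \<circ> c = (\<lambda>t. of_real (1 / r) * exp (of_real t * (- w)))"
    by (auto simp: c_def fun_eq_iff exp_minus field_simps)
  have dom: "c -` range (param k) = UNIV" for k
  proof -
    have "c t = param AtInfinity (1 / (of_real r * exp (of_real t * w)))" "c t = param Affine (of_real r * exp (of_real t * w))" for t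
      using r by (auto simp: c_def)
    hence "c t \<in> range (param k)" for t by (cases k) (metis rangeI)+
    thus ?thesis by blast
  qed
  have "smooth_immersed_curve c"
    unfolding smooth_immersed_curve_def Let_def dom
  proof (intro conjI allI ballI)
    have "continuous_on UNIV (\<lambda>t. of_real r * exp (of_real t * w))" by (intro continuous_intros)
    moreover have "open (Pt -` U)" if "open U" for U
    proof -
      have "param Affine = Pt" by (rule ext) simp
      thus ?thesis using that unfolding open_rsphere_def by metis
    qed
    moreover have "c -` U = (\<lambda>t. of_real r * exp (of_real t * w)) -` (Pt -` U)" for U by (auto simp: c_def)
    ultimately show "continuous_on UNIV c" by (simp add: continuous_on_open_vimage)
    fix k
    show "smooth_on UNIV (coord k \<circ> c)" by (cases k) (simp_all only: aff inf smooth_on_exp)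
    fix t
    show "vector_derivative (coord k \<circ> c) (at t) \<noteq> 0"
      using r by (cases k) (simp_all only: aff inf vector_derivative_at[OF has_vector_derivative_exp], auto simp: w_def)
  qed
  moreover have "c (t + 1) = c t" for t by (simp add: c_def w_def distrib_right exp_add)
  moreover have "inj_on c {0..<1}"
  proof (rule inj_onI)
    fix s t assume st: "s \<in> {0..<1}" "t \<in> {0..<1}" "c s = c t"
    hence "exp (of_real s * w) = exp (of_real t * w)" using r by (simp add: c_def)
    then obtain n :: int where "of_real s * w = of_real t * w + of_int (2 * n) * of_real pi * \<i>" by (auto simp: exp_eq)
    hence "(of_real s - of_real t - of_int n) * w = 0" by (simp add: w_def algebra_simps)
    hence "complex_of_real (s - t - of_int n) = 0" by (simp add: w_def)
    hence "s - t - of_int n = 0" by (simp only: of_real_eq_0_iff)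
    moreover from this have "n = 0" using st by auto
    ultimately show "s = t" by simp
  qed
  moreover have "circle r = range c"
  proof (intro subset_antisym subsetI)
    fix x assume "x \<in> circle r"
    then obtain z where z: "x = Pt z" "norm z = r" by (auto simp: circle_def)
    have "z = of_real (norm z) * exp (\<i> * of_real (Arg z))" using r z by (intro Arg_eq) auto
    also have "\<i> * of_real (Arg z) = of_real (Arg z / (2 * pi)) * w" by (simp add: w_def)
    finally have e: "z = of_real (norm z) * exp (of_real (Arg z / (2 * pi)) * w)" .
    have "x = c (Arg z / (2 * pi))"
      unfolding z(1) c_def z(2)[symmetric] by (rule arg_cong[of _ _ Pt]) (rule e)
    thus "x \<in> range c" by simp
  next
    fix x assume "x \<in> range c"
    thus "x \<in> circle r" using r by (auto simp: c_def circle_def norm_mult w_def)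
  qed
  ultimately show ?thesis unfolding smooth_simple_loop_def by blast
qed

section \<open>Scale invariance of the one-loop potential\<close>

text \<open>Derivatives at points of an open set are local, so equality on the set passes to all
  orders.\<close>

lemma C_k_on_cong:
  assumes "open S" "\<And>x. x \<in> S \<Longrightarrow> f x = g x" "C_k_on k S f"
  shows "C_k_on k S g"
  using assms(2,3)
proof (induction k arbitrary: f g)
  case 0
  thus ?case by (simp cong: continuous_on_cong)
next
  case (Suc k)
  have D: "(g has_derivative frechet_derivative f (at x)) (at x)" if x: "x \<in> S" for x
  proof -
    have "(f has_derivative frechet_derivative f (at x)) (at x)"
      using Suc.prems(2) x by (simp add: frechet_derivative_works)
    thus ?thesis by (rule has_derivative_transform_within_open[OF _ assms(1) x]) (rule Suc.prems(1))
  qed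
  have eq: "frechet_derivative f (at x) v = frechet_derivative g (at x) v" if "x \<in> S" for x v
    using frechet_derivative_at[OF D[OF that]] by simp
  have "C_k_on k S (\<lambda>x. frechet_derivative g (at x) v)" for v
    by (rule Suc.IH[OF eq]) (use Suc.prems(2) in auto)
  thus ?case using D by (auto simp: differentiable_def)
qed

lemma frechet_derivative_scale:
  fixes f :: "'a::real_normed_vector \<Rightarrow> 'b::real_normed_vector"
  assumes "f differentiable at (c *\<^sub>R x)"
  shows "(\<lambda>x. d *\<^sub>R f (c *\<^sub>R x)) differentiable at x"
    and "frechet_derivative (\<lambda>x. d *\<^sub>R f (c *\<^sub>R x)) (at x) v = (d * c) *\<^sub>R frechet_derivative f (at (c *\<^sub>R x)) v"
proof -
  let ?f' = "frechet_derivative f (at (c *\<^sub>R x))"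
  have f': "(f has_derivative ?f') (at (c *\<^sub>R x))" using assms by (simp add: frechet_derivative_works)
  have "((\<lambda>x. c *\<^sub>R x) has_derivative (\<lambda>v. c *\<^sub>R v)) (at x)" by (auto intro!: derivative_eq_intros)
  from has_derivative_compose[OF this f'] have "((\<lambda>x. f (c *\<^sub>R x)) has_derivative (\<lambda>v. ?f' (c *\<^sub>R v))) (at x)" .
  hence D: "((\<lambda>x. d *\<^sub>R f (c *\<^sub>R x)) has_derivative (\<lambda>v. d *\<^sub>R ?f' (c *\<^sub>R v))) (at x)"
    by (rule has_derivative_scaleR_right)
  thus "(\<lambda>x. d *\<^sub>R f (c *\<^sub>R x)) differentiable at x" by (auto simp: differentiable_def)
  have "?f' (c *\<^sub>R v) = c *\<^sub>R ?f' v"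
    using has_derivative_linear[OF f'] by (simp add: linear_cmul)
  thus "frechet_derivative (\<lambda>x. d *\<^sub>R f (c *\<^sub>R x)) (at x) v = (d * c) *\<^sub>R ?f' v"
    using fun_cong[OF frechet_derivative_at[OF D], of v] by simp
qed

lemma open_scale_vimage: "open S \<Longrightarrow> open ((*\<^sub>R) c -` S)" for S :: "'a::real_normed_vector set"
  by (intro open_vimage continuous_intros)

text \<open>The outer factor \<open>d\<close> is carried for the sake of the induction: each
  derivative brings out a factor \<open>c\<close>.\<close>

lemma C_k_on_scale:
  assumes "open S" "C_k_on k S f"
  shows "C_k_on k ((*\<^sub>R) c -` S) (\<lambda>x. d *\<^sub>R f (c *\<^sub>R x))"
  using assms(2)
proof (induction k arbitrary: f d)
  case 0
  hence "continuous_on ((*\<^sub>R) c ` ((*\<^sub>R) c -` S)) f" by (auto elim: continuous_on_subset)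
  moreover have "continuous_on ((*\<^sub>R) c -` S) (\<lambda>x. c *\<^sub>R x)" by (intro continuous_intros)
  ultimately have "continuous_on ((*\<^sub>R) c -` S) (\<lambda>x. f (c *\<^sub>R x))" by (rule continuous_on_compose2) simp
  thus ?case by (auto intro!: continuous_on_scaleR continuous_on_const)
next
  case (Suc k)
  have diff: "f differentiable at (c *\<^sub>R x)" if "x \<in> (*\<^sub>R) c -` S" for x using Suc.prems that by simp
  have "C_k_on k ((*\<^sub>R) c -` S) (\<lambda>x. frechet_derivative (\<lambda>x. d *\<^sub>R f (c *\<^sub>R x)) (at x) v)" for v
  proof (rule C_k_on_cong[OF open_scale_vimage[OF assms(1)]])
    show "C_k_on k ((*\<^sub>R) c -` S) (\<lambda>x. (d * c) *\<^sub>R frechet_derivative f (at (c *\<^sub>R x)) v)"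
      using Suc.prems by (intro Suc.IH) simp
    show "(d * c) *\<^sub>R frechet_derivative f (at (c *\<^sub>R x)) v = frechet_derivative (\<lambda>x. d *\<^sub>R f (c *\<^sub>R x)) (at x) v"
      if "x \<in> (*\<^sub>R) c -` S" for x using frechet_derivative_scale(2)[OF diff[OF that]] by simp
  qed
  thus ?case using frechet_derivative_scale(1)[OF diff] by simp
qed

lemma smooth_on_scale:
  "open S \<Longrightarrow> smooth_on S f \<Longrightarrow> smooth_on ((*\<^sub>R) c -` S) (\<lambda>x. d *\<^sub>R f (c *\<^sub>R x))"
  by (simp add: smooth_on_def C_k_on_scale)

lemma laplacian_scale:
  assumes S: "open S" "smooth_on S f" and z: "c *\<^sub>R z \<in> S"
  shows "laplacian (\<lambda>x. f (c *\<^sub>R x)) z = c\<^sup>2 * laplacian f (c *\<^sub>R z)"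
proof -
  have C2: "C_k_on (Suc (Suc 0)) S f" using S(2) by (simp only: smooth_on_def)
  have "frechet_derivative (\<lambda>x. frechet_derivative (\<lambda>x. f (c *\<^sub>R x)) (at x) b) (at z) b =
     c\<^sup>2 * frechet_derivative (\<lambda>x. frechet_derivative f (at x) b) (at (c *\<^sub>R z)) b" for b
  proof -
    let ?h = "\<lambda>y. frechet_derivative f (at y) b"
    have h: "?h differentiable at (c *\<^sub>R z)" using C2 z by simp
    have eq: "c *\<^sub>R ?h (c *\<^sub>R x) = frechet_derivative (\<lambda>x. f (c *\<^sub>R x)) (at x) b" if "x \<in> (*\<^sub>R) c -` S" for x
      using frechet_derivative_scale(2)[of f c x 1 b] C2 that by simp
    have "((\<lambda>x. c *\<^sub>R ?h (c *\<^sub>R x)) has_derivative frechet_derivative (\<lambda>x. c *\<^sub>R ?h (c *\<^sub>R x)) (at z)) (at z)"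
      using frechet_derivative_scale(1)[OF h] by (simp add: frechet_derivative_works)
    hence "((\<lambda>x. frechet_derivative (\<lambda>x. f (c *\<^sub>R x)) (at x) b) has_derivative frechet_derivative (\<lambda>x. c *\<^sub>R ?h (c *\<^sub>R x)) (at z)) (at z)"
      by (rule has_derivative_transform_within_open[OF _ open_scale_vimage[OF S(1)]]) (use z eq in auto)
    from frechet_derivative_at[OF this] show ?thesis
      using frechet_derivative_scale(2)[OF h, of c b] by (simp add: power2_eq_square)
  qed
  thus ?thesis by (simp add: laplacian_def sum_distrib_left)
qed

section \<open>Dilations acting on metrics and spectra\<close>

fun sphere_scale :: "real \<Rightarrow> rsphere \<Rightarrow> rsphere" where
  "sphere_scale a (Pt z) = Pt (a *\<^sub>R z)"
| "sphere_scale a Infty = Infty"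

text \<open>In the coordinate \<open>1 / z\<close> the dilation by \<open>a\<close> is the dilation
  by \<open>1 / a\<close>; with this factor both charts are treated alike.\<close>

fun chart_scale :: "real \<Rightarrow> chart \<Rightarrow> real" where
  "chart_scale a Affine = a"
| "chart_scale a AtInfinity = 1 / a"

text \<open>Pull-back of the metric under \<open>sphere_scale a\<close>: the length element
  contributes the squared factor.\<close>

definition pull_metric :: "real \<Rightarrow> density \<Rightarrow> density" where
  "pull_metric a \<rho> k z = (chart_scale a k)\<^sup>2 * \<rho> k (chart_scale a k *\<^sub>R z)"

lemma sphere_scale_param: "0 < a \<Longrightarrow> sphere_scale a (param k z) = param k (chart_scale a k *\<^sub>R z)"
  by (cases k) (auto simp: scaleR_conv_of_real)

lemma sphere_scale_inverse [simp]:
  "0 < a \<Longrightarrow> sphere_scale a (sphere_scale (1 / a) p) = p"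
  "0 < a \<Longrightarrow> sphere_scale (1 / a) (sphere_scale a p) = p"
  by (cases p; simp)+

lemma chart_scale_pos: "0 < a \<Longrightarrow> 0 < chart_scale a k"
  and chart_scale_inverse: "chart_scale (1 / a) k = 1 / chart_scale a k"
  by (cases k; simp)+

lemma param_vimage_scale:
  "0 < a \<Longrightarrow> param k -` (sphere_scale a -` U) = (*\<^sub>R) (chart_scale a k) -` (param k -` U)"
  by (auto simp: sphere_scale_param)

lemma continuous_sphere_scale: "0 < a \<Longrightarrow> continuous_on UNIV (sphere_scale a)"
  by (simp add: continuous_on_open_vimage open_rsphere_def param_vimage_scale open_scale_vimage)

lemma pull_metric_inverse:
  assumes "0 < a" shows "pull_metric a (pull_metric (1 / a) \<rho>) = \<rho>"
proof -
  have "chart_scale a k \<noteq> 0" for k using chart_scale_pos[OF assms, of k] by simp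
  thus ?thesis by (simp add: pull_metric_def fun_eq_iff chart_scale_inverse power_divide)
qed

lemma smooth_conformal_metric_pull:
  assumes a: "0 < a" and \<rho>: "smooth_conformal_metric \<rho>"
  shows "smooth_conformal_metric (pull_metric a \<rho>)"
  unfolding smooth_conformal_metric_def
proof (intro conjI allI impI)
  fix k
  show "smooth_on UNIV (pull_metric a \<rho> k)"
    using smooth_on_scale[of UNIV "\<rho> k" "chart_scale a k" "(chart_scale a k)\<^sup>2"] \<rho>
    by (simp add: pull_metric_def[abs_def] smooth_conformal_metric_def)
  show "0 < pull_metric a \<rho> k z" for z
    using \<rho> chart_scale_pos[OF a, of k] by (simp add: pull_metric_def smooth_conformal_metric_def)
next
  fix w :: complex assume w: "w \<noteq> 0"
  have "\<rho> AtInfinity v = \<rho> Affine (1 / v) / norm v ^ 4" if "v \<noteq> 0" for v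
    using \<rho> that by (simp add: smooth_conformal_metric_def)
  from this[of "(1 / a) *\<^sub>R w"]
  have "\<rho> AtInfinity ((1 / a) *\<^sub>R w) = \<rho> Affine (a *\<^sub>R (1 / w)) / norm ((1 / a) *\<^sub>R w) ^ 4"
    using a w by (simp add: scaleR_conv_of_real)
  thus "pull_metric a \<rho> AtInfinity w = pull_metric a \<rho> Affine (1 / w) / norm w ^ 4"
    using a w by (simp add: pull_metric_def power_mult_distrib power_divide field_simps eval_nat_numeral)
qed

lemma volume_pull:
  assumes a: "0 < a" and \<rho>: "smooth_conformal_metric \<rho>"
  shows "volume (pull_metric a \<rho>) = volume \<rho>"
proof -
  have "continuous_on UNIV (\<rho> Affine)" using \<rho> by (auto simp: smooth_conformal_metric_def intro: smooth_on_imp_continuous_on)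
  hence [measurable]: "\<rho> Affine \<in> borel_measurable borel" by (rule borel_measurable_continuous_onI)
  have "volume \<rho> = (\<integral>z. \<rho> Affine z \<partial>density (distr lborel borel (\<lambda>x::complex. 0 + a *\<^sub>R x)) (\<lambda>_. \<bar>a\<bar> ^ DIM(complex)))"
    unfolding volume_def using a by (subst lborel_affine[of a 0]) auto
  also have "\<dots> = (\<integral>z. \<bar>a\<bar> ^ DIM(complex) *\<^sub>R \<rho> Affine z \<partial>distr lborel borel (\<lambda>x::complex. 0 + a *\<^sub>R x))"
    by (rule integral_density) auto
  also have "\<dots> = (\<integral>z. \<bar>a\<bar> ^ DIM(complex) *\<^sub>R \<rho> Affine (0 + a *\<^sub>R z) \<partial>lborel)"
    by (rule integral_distr) auto
  also have "\<dots> = volume (pull_metric a \<rho>)" by (simp add: volume_def pull_metric_def)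
  finally show ?thesis by simp
qed

text \<open>In each chart the Laplacian and the density both acquire the square of
  \<open>chart_scale\<close>, which cancels in their quotient.\<close>

lemma eigenspace_pull_subset:
  assumes a: "0 < a" and \<Omega>: "open \<Omega>" and u: "u \<in> eigenspace \<rho> \<Omega> l"
  shows "u \<circ> sphere_scale a \<in> eigenspace (pull_metric a \<rho>) (sphere_scale a -` \<Omega>) l"
  unfolding eigenspace_def
proof (intro CollectI conjI allI impI ballI)
  have u': "continuous_on UNIV u" "\<And>p. p \<notin> \<Omega> \<Longrightarrow> u p = 0" "\<And>k. smooth_on (param k -` \<Omega>) (u \<circ> param k)"
    "\<And>k z. z \<in> param k -` \<Omega> \<Longrightarrow> - laplacian (u \<circ> param k) z / \<rho> k z = l * u (param k z)"
    using u by (auto simp: eigenspace_def)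
  show "continuous_on UNIV (u \<circ> sphere_scale a)"
    by (rule continuous_on_compose[OF continuous_sphere_scale[OF a] continuous_on_subset[OF u'(1)]]) auto
  show "(u \<circ> sphere_scale a) p = 0" if "p \<notin> sphere_scale a -` \<Omega>" for p using u'(2) that by auto
  fix k
  let ?c = "chart_scale a k"
  have op: "open (param k -` \<Omega>)" using \<Omega> by (simp add: open_rsphere_def)
  have eq: "u \<circ> sphere_scale a \<circ> param k = (\<lambda>z. (u \<circ> param k) (?c *\<^sub>R z))" using a by (auto simp: sphere_scale_param)
  show "smooth_on (param k -` (sphere_scale a -` \<Omega>)) (u \<circ> sphere_scale a \<circ> param k)"
    using smooth_on_scale[OF op u'(3), of ?c 1] a by (simp only: eq param_vimage_scale scaleR_one)
  fix z assume z: "z \<in> param k -` (sphere_scale a -` \<Omega>)"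
  have cz: "?c *\<^sub>R z \<in> param k -` \<Omega>" using z a by (simp only: param_vimage_scale vimage_eq)
  have "laplacian (u \<circ> sphere_scale a \<circ> param k) z = ?c\<^sup>2 * laplacian (u \<circ> param k) (?c *\<^sub>R z)"
    unfolding eq by (rule laplacian_scale[OF op u'(3) cz])
  moreover have "?c \<noteq> 0" using chart_scale_pos[OF a, of k] by simp
  ultimately have "- laplacian (u \<circ> sphere_scale a \<circ> param k) z / pull_metric a \<rho> k z = - laplacian (u \<circ> param k) (?c *\<^sub>R z) / \<rho> k (?c *\<^sub>R z)"
    by (simp add: pull_metric_def)
  also have "\<dots> = l * (u \<circ> sphere_scale a) (param k z)" using u'(4)[OF cz] a by (simp add: sphere_scale_param)
  finally show "- laplacian (u \<circ> sphere_scale a \<circ> param k) z / pull_metric a \<rho> k z = l * (u \<circ> sphere_scale a) (param k z)" .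
qed

text \<open>The remaining inclusion is \<open>eigenspace_pull_subset\<close> for the inverse
  dilation.\<close>

lemma eigenspace_pull:
  assumes a: "0 < a" and \<Omega>: "open \<Omega>"
  shows "eigenspace (pull_metric a \<rho>) (sphere_scale a -` \<Omega>) l = (\<lambda>u. u \<circ> sphere_scale a) ` eigenspace \<rho> \<Omega> l"
proof (intro subset_antisym subsetI)
  fix u assume u: "u \<in> eigenspace (pull_metric a \<rho>) (sphere_scale a -` \<Omega>) l"
  have o: "open (sphere_scale a -` \<Omega>)" using continuous_sphere_scale[OF a] \<Omega> by (simp add: continuous_on_open_vimage)
  have "sphere_scale (1 / a) -` (sphere_scale a -` \<Omega>) = \<Omega>" using a by auto
  moreover have "pull_metric (1 / a) (pull_metric a \<rho>) = \<rho>" using pull_metric_inverse[of "1 / a" \<rho>] a by simp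
  ultimately have "u \<circ> sphere_scale (1 / a) \<in> eigenspace \<rho> \<Omega> l"
    using eigenspace_pull_subset[OF _ o u, of "1 / a"] a by simp
  moreover have "u = u \<circ> sphere_scale (1 / a) \<circ> sphere_scale a" using a by auto
  ultimately show "u \<in> (\<lambda>u. u \<circ> sphere_scale a) ` eigenspace \<rho> \<Omega> l" by blast
qed (use eigenspace_pull_subset[OF a \<Omega>] in auto)

text \<open>Composition with the dilation is an injective linear map of function spaces, so it
  carries a basis to a basis of the same cardinality.\<close>

lemma multiplicity_pull:
  assumes a: "0 < a" and \<Omega>: "open \<Omega>"
  shows "multiplicity_of (pull_metric a \<rho>) (sphere_scale a -` \<Omega>) l = multiplicity_of \<rho> \<Omega> l"
proof -
  let ?s = "\<lambda>(c::real) (u::rsphere \<Rightarrow> real) p. c * u p"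
  let ?L = "\<lambda>u::rsphere \<Rightarrow> real. u \<circ> sphere_scale a"
  interpret V: vector_space ?s by (rule vector_space_real_functions)
  interpret L: Vector_Spaces.linear ?s ?s ?L
    by unfold_locales (auto simp: fun_eq_iff)
  have inj: "inj ?L"
  proof (rule injI)
    fix u v :: "rsphere \<Rightarrow> real" assume "?L u = ?L v"
    hence "u (sphere_scale a (sphere_scale (1 / a) p)) = v (sphere_scale a (sphere_scale (1 / a) p))" for p by (metis comp_apply)
    thus "u = v" using a by (simp add: fun_eq_iff)
  qed
  obtain B where B: "B \<subseteq> eigenspace \<rho> \<Omega> l" "V.independent B" "eigenspace \<rho> \<Omega> l \<subseteq> V.span B" "card B = V.dim (eigenspace \<rho> \<Omega> l)"
    by (rule V.basis_exists)
  have "card (?L ` B) = V.dim (?L ` eigenspace \<rho> \<Omega> l)"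
  proof (rule V.basis_card_eq_dim)
    show "?L ` B \<subseteq> ?L ` eigenspace \<rho> \<Omega> l" using B by auto
    show "?L ` eigenspace \<rho> \<Omega> l \<subseteq> V.span (?L ` B)" using B by (auto simp: L.span_image)
    show "V.independent (?L ` B)" using B inj by (intro L.independent_injective_image) (auto intro: inj_on_subset)
  qed
  moreover have "card (?L ` B) = card B" using inj by (intro card_image) (auto intro: inj_on_subset)
  ultimately show ?thesis unfolding multiplicity_of_def eigenspace_pull[OF a \<Omega>] using B by simp
qed

text \<open>Metric and domain enter the determinant only through the multiplicities.\<close>

lemma zeta_det_pull:
  assumes "0 < a" "open \<Omega>"
  shows "zeta_det (pull_metric a \<rho>) (sphere_scale a -` \<Omega>) = zeta_det \<rho> \<Omega>"
  by (simp add: zeta_det_def spectral_zeta_def multiplicity_pull[OF assms])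

section \<open>The two sides of a circle\<close>

definition circle_inside :: "real \<Rightarrow> rsphere set" where
  "circle_inside r = param Affine ` ball 0 r"

text \<open>Written as a disk in the chart at infinity, which makes its connectedness and openness
  those of a disk.\<close>

definition circle_outside :: "real \<Rightarrow> rsphere set" where
  "circle_outside r = param AtInfinity ` ball 0 (1 / r)"

lemma circle_inside_iff: "Pt z \<in> circle_inside r \<longleftrightarrow> norm z < r" "Infty \<notin> circle_inside r"
  by (auto simp: circle_inside_def)

lemma circle_outside_iff:
  assumes "0 < r" shows "Pt z \<in> circle_outside r \<longleftrightarrow> r < norm z" "Infty \<in> circle_outside r"
proof -
  show "Infty \<in> circle_outside r" using assms by (auto simp: circle_outside_def intro!: image_eqI[of _ _ 0])
  show "Pt z \<in> circle_outside r \<longleftrightarrow> r < norm z"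
  proof
    assume "Pt z \<in> circle_outside r"
    then obtain w where w: "norm w < 1 / r" "w \<noteq> 0" "z = 1 / w" by (auto simp: circle_outside_def split: if_splits)
    hence "r * norm w < 1" "0 < norm w" using assms by (simp_all add: field_simps)
    thus "r < norm z" using w(3) by (simp add: norm_divide pos_less_divide_eq)
  next
    assume z: "r < norm z"
    hence "z \<noteq> 0" using assms by auto
    hence "Pt z = param AtInfinity (1 / z)" by simp
    moreover have "norm (1 / z) < 1 / r" using z assms by (simp add: norm_divide frac_less2)
    ultimately show "Pt z \<in> circle_outside r" unfolding circle_outside_def by (intro image_eqI[of _ _ "1 / z"]) auto
  qed
qed

lemma continuous_param: "continuous_on S (param k)"
  by (rule continuous_on_subset[of UNIV]) (auto simp: continuous_on_open_vimage open_rsphere_def)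

lemma open_circle_sides:
  assumes "0 < r" shows "open (circle_inside r)" "open (circle_outside r)"
proof -
  have "param Affine -` circle_inside r = ball 0 r" "param Affine -` circle_outside r = - cball 0 r"
    using assms by (auto simp: circle_inside_iff circle_outside_iff)
  moreover have "param AtInfinity -` circle_outside r = ball 0 (1 / r)" "param AtInfinity -` circle_inside r = - cball 0 (1 / r)"
    using assms by (auto simp: circle_inside_iff circle_outside_iff norm_divide field_simps split: if_splits)
  ultimately show "open (circle_inside r)" "open (circle_outside r)"
    unfolding open_rsphere_def by (metis (full_types) chart.exhaust open_ball open_Compl closed_cball)+
qed

text \<open>The two sides are disjoint, open and connected, so every connected subset of the
  complement lies in one of them, and maximality identifies the components.\<close>

lemma components_circle:
  assumes r: "0 < r"
  shows "components (- circle r) = {circle_inside r, circle_outside r}" "circle_inside r \<noteq> circle_outside r"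
proof -
  have U: "- circle r = circle_inside r \<union> circle_outside r" and disj: "circle_inside r \<inter> circle_outside r = {}"
  proof -
    have "p \<in> - circle r \<longleftrightarrow> p \<in> circle_inside r \<union> circle_outside r" "p \<notin> circle_inside r \<inter> circle_outside r" for p
      using r by (cases p; auto simp: circle_def circle_inside_iff circle_outside_iff)+
    thus "- circle r = circle_inside r \<union> circle_outside r" "circle_inside r \<inter> circle_outside r = {}" by blast+
  qed
  have conn: "connected (circle_inside r)" "connected (circle_outside r)"
    unfolding circle_inside_def circle_outside_def by (intro connected_continuous_image continuous_param; simp)+
  have ne: "circle_inside r \<noteq> {}" "circle_outside r \<noteq> {}"
    using r circle_inside_iff(1)[of 0 r] circle_outside_iff(2)[of r] by auto
  show "circle_inside r \<noteq> circle_outside r" using disj ne by auto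
  have sub: "d \<subseteq> circle_inside r \<or> d \<subseteq> circle_outside r" if "connected d" "d \<subseteq> - circle r" for d
    using connectedD[OF that(1) open_circle_sides[OF r]] that(2) disj unfolding U by blast
  show "components (- circle r) = {circle_inside r, circle_outside r}"
  proof (intro subset_antisym subsetI)
    fix c assume c: "c \<in> components (- circle r)"
    have "c \<subseteq> - circle r" "connected c" using c in_components_subset in_components_connected by metis+
    have max: "d = c" if "d \<noteq> {}" "c \<subseteq> d" "d \<subseteq> - circle r" "connected d" for d
      using c that unfolding in_components_maximal by (elim conjE allE[of _ d]) simp
    have io: "circle_inside r \<subseteq> - circle r" "circle_outside r \<subseteq> - circle r" using U by simp_all
    from sub[OF \<open>connected c\<close> \<open>c \<subseteq> - circle r\<close>] show "c \<in> {circle_inside r, circle_outside r}"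
    proof
      assume "c \<subseteq> circle_inside r"
      from max[OF ne(1) this io(1) conn(1)] show ?thesis by simp
    next
      assume "c \<subseteq> circle_outside r"
      from max[OF ne(2) this io(2) conn(2)] show ?thesis by simp
    qed
  next
    have max: "d = c" if c: "c = circle_inside r \<or> c = circle_outside r" and d: "c \<subseteq> d" "d \<subseteq> - circle r" "connected d" for c d
    proof (rule subset_antisym[OF _ d(1)])
      have "\<not> circle_inside r \<subseteq> circle_outside r" "\<not> circle_outside r \<subseteq> circle_inside r" using disj ne by auto
      thus "d \<subseteq> c" using sub[OF d(3,2)] c d(1) by (metis order_trans)
    qed
    fix c assume "c \<in> {circle_inside r, circle_outside r}"
    hence c: "c = circle_inside r \<or> c = circle_outside r" by simp
    hence "c \<noteq> {}" "c \<subseteq> - circle r" "connected c" using ne conn by (auto simp: U)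
    thus "c \<in> components (- circle r)" using max[OF c] unfolding in_components_maximal by simp
  qed
qed

lemma loop_potential_wrt_pull:
  assumes r: "0 < r" and \<rho>: "smooth_conformal_metric \<rho>"
  shows "loop_potential_wrt (pull_metric r \<rho>) (circle 1) = loop_potential_wrt \<rho> (circle r)"
proof -
  have v: "sphere_scale r -` circle_inside r = circle_inside 1" "sphere_scale r -` circle_outside r = circle_outside 1"
  proof -
    have "sphere_scale r p \<in> circle_inside r \<longleftrightarrow> p \<in> circle_inside 1" "sphere_scale r p \<in> circle_outside r \<longleftrightarrow> p \<in> circle_outside 1" for p
      using r by (cases p; simp add: circle_inside_iff circle_outside_iff)+
    thus "sphere_scale r -` circle_inside r = circle_inside 1" "sphere_scale r -` circle_outside r = circle_outside 1" by blast+
  qed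
  have "zeta_det_sphere (pull_metric r \<rho>) = zeta_det_sphere \<rho>"
    using zeta_det_pull[OF r open_UNIV, of \<rho>] volume_pull[OF r \<rho>] by (simp add: zeta_det_sphere_def)
  moreover have "zeta_det (pull_metric r \<rho>) (circle_inside 1) = zeta_det \<rho> (circle_inside r)"
    "zeta_det (pull_metric r \<rho>) (circle_outside 1) = zeta_det \<rho> (circle_outside r)"
    using zeta_det_pull[OF r open_circle_sides(1)[OF r], of \<rho>] zeta_det_pull[OF r open_circle_sides(2)[OF r], of \<rho>] by (simp_all add: v)
  ultimately show ?thesis
    using components_circle[OF r] components_circle[of 1] by (simp add: loop_potential_wrt_def)
qed

text \<open>Pull-back is a bijection of the smooth conformal metrics, so the conditions under the
  two \<open>THE\<close> operators hold for the same values.\<close>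

lemma loop_potential_circle:
  assumes r: "0 < r" shows "loop_potential (circle r) = loop_potential (circle 1)"
proof -
  have "(\<forall>\<rho>. smooth_conformal_metric \<rho> \<longrightarrow> loop_potential_wrt \<rho> (circle r) = v) \<longleftrightarrow>
    (\<forall>\<rho>. smooth_conformal_metric \<rho> \<longrightarrow> loop_potential_wrt \<rho> (circle 1) = v)" for v
  proof (intro iffI allI impI)
    fix \<rho> assume *: "\<forall>\<rho>. smooth_conformal_metric \<rho> \<longrightarrow> loop_potential_wrt \<rho> (circle r) = v" and \<rho>: "smooth_conformal_metric \<rho>"
    have m: "smooth_conformal_metric (pull_metric (1 / r) \<rho>)" using smooth_conformal_metric_pull[OF _ \<rho>] r by simp
    thus "loop_potential_wrt \<rho> (circle 1) = v"
      using * loop_potential_wrt_pull[OF r m] pull_metric_inverse[OF r, of \<rho>] by simp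
  next
    fix \<rho> assume *: "\<forall>\<rho>. smooth_conformal_metric \<rho> \<longrightarrow> loop_potential_wrt \<rho> (circle 1) = v" and \<rho>: "smooth_conformal_metric \<rho>"
    show "loop_potential_wrt \<rho> (circle r) = v"
      using * loop_potential_wrt_pull[OF r \<rho>] smooth_conformal_metric_pull[OF r \<rho>] by simp
  qed
  thus ?thesis by (simp add: loop_potential_def)
qed

section \<open>The two-loop potential\<close>

lemma concentric_potential_eq:
  assumes "0 < \<tau>"
  shows "concentric_potential \<tau> = ereal (2 * loop_potential (circle 1) + circle_mass (exp (- 2 * pi * \<tau>)))"
proof -
  have "exp (- 2 * pi * \<tau>) < 1" using assms by simp
  thus ?thesis
    using normalized_loop_mass_circles[of "exp (- 2 * pi * \<tau>)"] loop_potential_circle[of "exp (- 2 * pi * \<tau>)"]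
    by (simp add: concentric_potential_def two_loop_potential_def)
qed

text \<open>Along concentric circles the one-loop terms are constant, so the first three claims are
  those about \<open>circle_mass\<close> at radius \<open>exp (- 2 * pi * \<tau>)\<close>, which
  runs from 1 down to 0.\<close>

theorem mainTheorem10:
  shows "strict_antimono_on {0<..} concentric_potential \<and>
    (concentric_potential \<longlongrightarrow> \<infinity>) (at_right 0) \<and>
    (concentric_potential \<longlongrightarrow> - \<infinity>) at_top \<and>
    (INF (\<gamma>\<^sub>1, \<gamma>\<^sub>2) \<in> disjoint_loop_pairs. two_loop_potential \<gamma>\<^sub>1 \<gamma>\<^sub>2) = - \<infinity> \<and>
    \<not> (\<exists>(\<gamma>\<^sub>1, \<gamma>\<^sub>2) \<in> disjoint_loop_pairs. two_loop_potential \<gamma>\<^sub>1 \<gamma>\<^sub>2 =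
          (INF (\<gamma>\<^sub>1', \<gamma>\<^sub>2') \<in> disjoint_loop_pairs. two_loop_potential \<gamma>\<^sub>1' \<gamma>\<^sub>2'))"
proof -
  define C where "C = 2 * loop_potential (circle 1)"
  have eq: "concentric_potential \<tau> = ereal (C + circle_mass (exp (- 2 * pi * \<tau>)))" if "0 < \<tau>" for \<tau>
    using concentric_potential_eq[OF that] by (simp add: C_def)
  have anti: "strict_antimono_on {0<..} concentric_potential"
    using circle_mass_strict by (intro monotone_onI) (simp add: eq)
  have "filterlim (\<lambda>\<tau>. exp (- 2 * pi * \<tau>)) (at_left 1) (at_right (0::real))" using pi_gt_zero by real_asymp
  from filterlim_compose[OF circle_mass_at_1 this]
  have "filterlim (\<lambda>\<tau>. C + circle_mass (exp (- 2 * pi * \<tau>))) at_top (at_right 0)"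
    by (intro filterlim_tendsto_add_at_top[OF tendsto_const])
  hence "((\<lambda>\<tau>. ereal (C + circle_mass (exp (- 2 * pi * \<tau>)))) \<longlongrightarrow> \<infinity>) (at_right 0)"
    by (simp only: tendsto_PInfty_eq_at_top)
  hence lim0: "(concentric_potential \<longlongrightarrow> \<infinity>) (at_right 0)"
    by (rule Lim_transform_eventually) (auto simp: eq eventually_at_right_field intro!: exI[of _ 1])
  have "filterlim (\<lambda>\<tau>. exp (- 2 * pi * \<tau>)) (at_right 0) (at_top :: real filter)" using pi_gt_zero by real_asymp
  from filterlim_compose[OF circle_mass_at_0 this]
  have "filterlim (\<lambda>\<tau>. - circle_mass (exp (- 2 * pi * \<tau>))) at_top at_top" by (simp only: filterlim_uminus_at_bot)
  hence "filterlim (\<lambda>\<tau>. - C + - circle_mass (exp (- 2 * pi * \<tau>))) at_top at_top"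
    by (intro filterlim_tendsto_add_at_top[OF tendsto_const])
  hence "filterlim (\<lambda>\<tau>. - (C + circle_mass (exp (- 2 * pi * \<tau>)))) at_top at_top" by simp
  hence "((\<lambda>\<tau>. - ereal (C + circle_mass (exp (- 2 * pi * \<tau>)))) \<longlongrightarrow> \<infinity>) at_top"
    by (simp only: tendsto_PInfty_eq_at_top uminus_ereal.simps)
  hence "((\<lambda>\<tau>. ereal (C + circle_mass (exp (- 2 * pi * \<tau>)))) \<longlongrightarrow> - \<infinity>) at_top"
    by (simp only: ereal_Lim_uminus[of _ "- \<infinity>"] ereal_uminus_uminus)
  hence lim1: "(concentric_potential \<longlongrightarrow> - \<infinity>) at_top"
    by (rule Lim_transform_eventually) (auto simp: eq intro!: eventually_mono[OF eventually_gt_at_top[of 0]])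
  let ?I = "INF (\<gamma>\<^sub>1, \<gamma>\<^sub>2) \<in> disjoint_loop_pairs. two_loop_potential \<gamma>\<^sub>1 \<gamma>\<^sub>2"
  have "?I \<le> concentric_potential \<tau>" if \<tau>: "0 < \<tau>" for \<tau>
  proof -
    have "exp (- 2 * pi * \<tau>) < 1" using \<tau> by simp
    hence "circle (exp (- 2 * pi * \<tau>)) \<inter> circle 1 = {}" by (auto simp: circle_def)
    hence "(circle (exp (- 2 * pi * \<tau>)), circle 1) \<in> disjoint_loop_pairs"
      by (simp add: disjoint_loop_pairs_def smooth_simple_loop_circle)
    from INF_lower[OF this, of "\<lambda>(\<gamma>\<^sub>1, \<gamma>\<^sub>2). two_loop_potential \<gamma>\<^sub>1 \<gamma>\<^sub>2"] show ?thesis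
      by (simp only: prod.case concentric_potential_def)
  qed
  \<comment> \<open>\<open>?I\<close> is a lower bound of a function that tends to minus
    infinity.\<close>
  hence "?I \<le> - \<infinity>"
    by (intro tendsto_lowerbound[OF lim1]) (auto intro!: eventually_mono[OF eventually_gt_at_top[of 0]])
  hence inf: "?I = - \<infinity>" by simp
  \<comment> \<open>All three summands are finite, by \<open>normalized_loop_mass_finite\<close>, so
    no pair takes the value of the infimum.\<close>
  have "two_loop_potential \<gamma>\<^sub>1 \<gamma>\<^sub>2 \<noteq> - \<infinity>" if "(\<gamma>\<^sub>1, \<gamma>\<^sub>2) \<in> disjoint_loop_pairs" for \<gamma>\<^sub>1 \<gamma>\<^sub>2
  proof -
    have "smooth_simple_loop \<gamma>\<^sub>1" "smooth_simple_loop \<gamma>\<^sub>2" "\<gamma>\<^sub>1 \<inter> \<gamma>\<^sub>2 = {}"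
      using that by (simp_all add: disjoint_loop_pairs_def)
    then obtain L where "normalized_loop_mass \<gamma>\<^sub>1 \<gamma>\<^sub>2 = ereal L" by (rule normalized_loop_mass_finite)
    thus ?thesis by (simp add: two_loop_potential_def)
  qed
  thus ?thesis using anti lim0 lim1 unfolding inf by auto
qed

end
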